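(* Let $k\ge2$ be an integer and $\varepsilon,\varphi\in(0,1)$ with $\frac{\varepsilon}{\varphi^2}\le\frac{1}{10^5}$. Let $G=(V,E)$ be a $d$-regular $(k,\varphi,\varepsilon)$-clusterable graph on $n$ vertices. Let $\frac{1}{n^5}<\xi<1$ and $1\le M_{\mathrm{init}},M_{\mathrm{query}}\le O\!\left(\frac{n^{1/2-20\varepsilon/\varphi^2}}{k}\right)$. Then, with probability at least $1-2n^{-100}$, $\textsc{InitOracle}(G,k,\xi,M_{\mathrm{init}})$ computes a matrix $\Psi$ of size $n^{O(\varepsilon/\varphi^2)}\cdot\log^2 n\cdot(k/\xi)^{O(1)}$ such that for every pair of vertices $x,y\in V$, $\textsc{QueryDot}(G,x,y,\xi,\Psi,M_{\mathrm{query}})$ outputs a value $\langle f_x,f_y\rangle_{\mathrm{apx}}$ satisfying, with probability at least $1-6n^{-100}$, $$\left|\langle f_x,f_y\rangle_{\mathrm{apx}}-\langle f_x,f_y\rangle\right|\le\frac{\xi}{n}.$$ Moreover, the space $S_{\mathrm{init}}$ (in bits) and time $T_{\mathrm{init}}$ of $\textsc{InitOracle}$ and the space $S_{\mathrm{query}}$ and time $T_{\mathrm{query}}$ of a single $\textsc{QueryDot}$ call satisfy $S_{\mathrm{init}}=(k/\xi)^{O(1)}n^{O(\varepsilon/\varphi^2)}M_{\mathrm{init}}\log^4 n$, $T_{\mathrm{init}}=(k/\xi)^{O(1)}n^{1+O(\varepsilon/\varphi^2)}\frac{\log^4 n}{M_{\mathrm{init}}}\cdot\frac{1}{\varphi^2}$,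 $S_{\mathrm{query}}=(k/\xi)^{O(1)}n^{O(\varepsilon/\varphi^2)}M_{\mathrm{query}}\log^3 n$, $T_{\mathrm{query}}=(k/\xi)^{O(1)}n^{1+O(\varepsilon/\varphi^2)}\frac{\log^3 n}{M_{\mathrm{query}}}\cdot\frac{1}{\varphi^2}$.
   Context: $G$ is $(k,\varphi,\varepsilon)$-clusterable if $V$ has a partition $C_1,\dots,C_k$ with inner conductance $\phi_{\mathrm{in}}(C_i)\ge\varphi$, outer conductance $\phi_{\mathrm{out}}(C_i,V)\le\varepsilon$, and $|C_i|/|C_j|\in O(1)$; here $\phi_{\mathrm{out}}(C,V)=|E(C,V\setminus C)|/\mathrm{vol}(C)$, $\mathrm{vol}(C)=\sum_{v\in C}d_v$, and $\phi_{\mathrm{in}}(C)=\min_{S\subseteq C,0<\mathrm{vol}(S)\le\mathrm{vol}(C)/2}\phi_{\mathrm{out}}(S,C)$. Let $A$ be the adjacency matrix, $L=I-A/d$ the normalized Laplacian with eigenvalues $0=\lambda_1\le\dots\le\lambda_n$ and orthonormal eigenvectors $u_1,\dots,u_n$; the spectral embedding of $x$ is $f_x=(u_1(x),\dots,u_k(x))^T\in\mathbb{R}^k$. $\mathbf M=\frac12(I+A/d)$ is the lazy random walk transition matrix; $\mathbb 1_x$ is the indicator vector of $x$. Algorithms. $\textsc{EstRWDot}(G,R,t,M,x,y)$: for each of $B=R/M$ batches, run $M$ independent lazy random walks of length $t$ from $x$ and $M$ from $y$, let $\hat p_x(i)$ (resp. $\hat p_y(i)$) be the fraction of walks from $x$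 (resp. $y$) ending at $i$, and set $Z_b=\langle\hat p_x,\hat p_y\rangle$; output $Z=\frac1B\sum_b Z_b$ (only the current batch's endpoints are stored). $\textsc{EstColliProb}(G,R,t,M,I_S)$, for a multiset $I_S=\{s_1,\dots,s_s\}$: for $l=1,\dots,O(\log n)$ set $\mathcal G_l(i,j)=\mathcal G_l(j,i)=\textsc{EstRWDot}(G,R,t,M,s_i,s_j)$ for $i\le j$; output the entrywise median $\mathcal G\in\mathbb R^{s\times s}$. $\textsc{InitOracle}(G,k,\xi,M_{\mathrm{init}})$: $t=\frac{20\log n}{\varphi^2}$, $R_{\mathrm{init}}=\Theta\!\left(\frac{n^{1+920\varepsilon/\varphi^2}}{M_{\mathrm{init}}}\frac{k^{14}}{\xi^2}\right)$, $s=O(n^{480\varepsilon/\varphi^2}\log n\,k^8/\xi^2)$; sample a multiset $I_S$ of $s$ vertices independently and uniformly at random; $\mathcal G=\textsc{EstColliProb}(G,R_{\mathrm{init}},t,M_{\mathrm{init}},I_S)$; take an eigendecomposition $\frac ns\mathcal G=\widehat W\widehat\Sigma\widehat W^T$; if $\widehat\Sigma^{-1}$ exists, output $\Psi=\frac ns\widehat W_{[k]}\widehat\Sigma_{[k]}^{-2}\widehat W_{[k]}^T$, where $_{[k]}$ denotes restriction to the first $k$ eigenvalues/columns. $\textsc{QueryDot}(G,x,y,\xi,\Psi,M_{\mathrm{query}})$: $t$ as before, $R_{\mathrm{query}}=\Theta\!\left(\frac{n^{1+440\varepsilon/\varphi^2}}{M_{\mathrm{query}}}\frac{k^6}{\xi^2}\right)$;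 for $l=1,\dots,O(\log n)$ and $i=1,\dots,s$ set $x_l(i)=\textsc{EstRWDot}(G,R_{\mathrm{query}},t,M_{\mathrm{query}},x,s_i)$, $y_l(i)=\textsc{EstRWDot}(G,R_{\mathrm{query}},t,M_{\mathrm{query}},y,s_i)$; let $\alpha_x,\alpha_y$ be entrywise medians; output $\langle f_x,f_y\rangle_{\mathrm{apx}}=\alpha_x^T\Psi\alpha_y$.
   Formalization: InitOracle's test "if Σ̂⁻¹ exists" is applied to Σ̂_[k], the only block that is inverted; with the full s×s Σ̂ the claim fails, e.g. for two disjoint cliques with constant ξ, where the medians make 𝒢 block-constant of rank 2 with high probability. *)

theory Defs
  imports
    "HOL-Probability.Probability"
    "Jordan_Normal_Form.Gauss_Jordan_Elimination"
begin

hide_const (open) Finite_Cartesian_Product.vec Finite_Cartesian_Product.mat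
hide_type (open) Finite_Cartesian_Product.vec
unbundle no vec_syntax
unbundle no inner_syntax

section \<open>Graphs, conductance, clusterability\<close>

text \<open>A graph on \<open>n\<close> vertices has vertex set \<open>{..<n}\<close> and is given by its adjacency relation.\<close>

type_synonym edges = "nat \<Rightarrow> nat \<Rightarrow> bool"

definition graph :: "nat \<Rightarrow> edges \<Rightarrow> bool" where
  "graph n E \<longleftrightarrow>
     (\<forall>u v. E u v \<longrightarrow> u < n \<and> v < n) \<and> (\<forall>u v. E u v \<longrightarrow> E v u) \<and> (\<forall>v. \<not> E v v)"

definition deg :: "edges \<Rightarrow> nat \<Rightarrow> nat" where
  "deg E v = card {u. E v u}"

definition regular_graph :: "nat \<Rightarrow> nat \<Rightarrow> edges \<Rightarrow> bool" where
  "regular_graph n d E \<longleftrightarrow> graph n E \<and> d \<ge> 1 \<and> (\<forall>v<n. deg E v = d)"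

definition vol :: "edges \<Rightarrow> nat set \<Rightarrow> nat" where
  "vol E C = (\<Sum>v\<in>C. deg E v)"

definition cut_edges :: "edges \<Rightarrow> nat set \<Rightarrow> nat set \<Rightarrow> (nat \<times> nat) set" where
  "cut_edges E S T = {(u, v). u \<in> S \<and> v \<in> T \<and> E u v}"

definition outer_conductance :: "edges \<Rightarrow> nat set \<Rightarrow> nat set \<Rightarrow> real" where
  "outer_conductance E S C = real (card (cut_edges E S (C - S))) / real (vol E S)"

text \<open>The minimum is an infimum over a finite set of reals, taken in \<^typ>\<open>ereal\<close> so that it is
  \<open>\<infinity>\<close> when no set \<open>S\<close> is admissible (e.g. for a singleton cluster).\<close>

definition inner_conductance :: "edges \<Rightarrow> nat set \<Rightarrow> ereal" where
  "inner_conductance E C =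
     (INF S \<in> {S. S \<subseteq> C \<and> 0 < vol E S \<and> real (vol E S) \<le> real (vol E C) / 2}.
        ereal (outer_conductance E S C))"

text \<open>\<open>\<beta>\<close> is the constant behind the requirement \<open>|C\<^sub>i| / |C\<^sub>j| \<in> O(1)\<close>.\<close>

definition clusterable :: "real \<Rightarrow> nat \<Rightarrow> real \<Rightarrow> real \<Rightarrow> nat \<Rightarrow> edges \<Rightarrow> bool" where
  "clusterable \<beta> k \<phi> \<epsilon> n E \<longleftrightarrow>
     (\<exists>C :: nat \<Rightarrow> nat set.
        (\<forall>i<k. C i \<noteq> {}) \<and> disjoint_family_on C {..<k} \<and> (\<Union>i<k. C i) = {..<n} \<and>
        (\<forall>i<k. inner_conductance E (C i) \<ge> ereal \<phi>) \<and>
        (\<forall>i<k. outer_conductance E (C i) {..<n} \<le> \<epsilon>) \<and>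
        (\<forall>i<k. \<forall>j<k. real (card (C i)) / real (card (C j)) \<le> \<beta>))"

section \<open>Spectral embedding\<close>

definition adjacency :: "nat \<Rightarrow> edges \<Rightarrow> real mat" where
  "adjacency n E = mat n n (\<lambda>(i, j). if E i j then 1 else 0)"

definition laplacian :: "nat \<Rightarrow> nat \<Rightarrow> edges \<Rightarrow> real mat" where
  "laplacian n d E = 1\<^sub>m n - (1 / real d) \<cdot>\<^sub>m adjacency n E"

definition ordered_eigenbasis :: "nat \<Rightarrow> real mat \<Rightarrow> (nat \<Rightarrow> real) \<Rightarrow> (nat \<Rightarrow> real vec) \<Rightarrow> bool" where
  "ordered_eigenbasis n A lam u \<longleftrightarrow>
     (\<forall>i<n. u i \<in> carrier_vec n \<and> A *\<^sub>v u i = lam i \<cdot>\<^sub>v u i) \<and>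
     (\<forall>i<n. \<forall>j<n. u i \<bullet> u j = (if i = j then 1 else 0)) \<and>
     (\<forall>i j. i \<le> j \<and> j < n \<longrightarrow> lam i \<le> lam j)"

definition spectral_embedding :: "nat \<Rightarrow> (nat \<Rightarrow> real vec) \<Rightarrow> nat \<Rightarrow> real vec" where
  "spectral_embedding k u x = vec k (\<lambda>i. u i $ x)"

section \<open>Randomized computations with time and space\<close>

text \<open>An outcome consists of a value, the number of elementary operations performed, and the peak
  number of bits of working memory. Memory follows a stack discipline: \<open>with_space b m\<close> keeps \<open>b\<close>
  bits reserved while \<open>m\<close> runs and releases them afterwards, so values that survive a call are paid
  for by the caller. The graph is accessed through neighbour queries and is not charged.\<close>

datatype 'a comp = Comp (run: "('a \<times> nat \<times> nat) pmf")

definition ret :: "'a \<Rightarrow> 'a comp" where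
  "ret a = Comp (return_pmf (a, 0, 0))"

definition bind_comp :: "'a comp \<Rightarrow> ('a \<Rightarrow> 'b comp) \<Rightarrow> 'b comp" where
  "bind_comp m f = Comp (bind_pmf (run m) (\<lambda>(a, T, S).
     map_pmf (\<lambda>(b, T', S'). (b, T + T', max S S')) (run (f a))))"

adhoc_overloading Monad_Syntax.bind \<rightleftharpoons> bind_comp

definition tick :: "nat \<Rightarrow> unit comp" where
  "tick T = Comp (return_pmf ((), T, 0))"

definition draw :: "'a pmf \<Rightarrow> 'a comp" where
  "draw p = Comp (map_pmf (\<lambda>a. (a, 1, 0)) p)"

definition with_space :: "nat \<Rightarrow> 'a comp \<Rightarrow> 'a comp" where
  "with_space b m = Comp (map_pmf (\<lambda>(a, T, S). (a, T, b + S)) (run m))"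

primrec for_each :: "('a \<Rightarrow> 'b comp) \<Rightarrow> 'a list \<Rightarrow> 'b list comp" where
  "for_each f [] = ret []"
| "for_each f (x # xs) = do { y \<leftarrow> f x; ys \<leftarrow> for_each f xs; ret (y # ys) }"

primrec accumulate :: "nat \<Rightarrow> real comp \<Rightarrow> real \<Rightarrow> real comp" where
  "accumulate 0 m acc = ret acc"
| "accumulate (Suc b) m acc = do { z \<leftarrow> m; tick 1; accumulate b m (acc + z) }"

definition result :: "'a comp \<Rightarrow> 'a pmf" where
  "result m = map_pmf fst (run m)"

text \<open>Vertices, counters and numbers each occupy one machine word of \<open>\<Theta>(log n)\<close> bits, with hidden
  constant \<open>cw\<close>.\<close>

definition word :: "nat \<Rightarrow> nat \<Rightarrow> nat" where
  "word cw n = cw * nat \<lceil>log 2 (real n)\<rceil>"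

definition sort_time :: "nat \<Rightarrow> nat" where
  "sort_time m = m * (nat \<lceil>log 2 (real m)\<rceil> + 1)"

section \<open>The algorithms\<close>

text \<open>One step has transition matrix \<open>(I + A/d)/2\<close> and costs one operation.\<close>

definition lazy_step :: "edges \<Rightarrow> nat \<Rightarrow> nat pmf" where
  "lazy_step E v =
     bind_pmf (bernoulli_pmf (1/2)) (\<lambda>stay. if stay then return_pmf v else pmf_of_set {u. E v u})"

primrec lazy_walk :: "edges \<Rightarrow> nat \<Rightarrow> nat \<Rightarrow> nat comp" where
  "lazy_walk E 0 v = ret v"
| "lazy_walk E (Suc t) v = do { u \<leftarrow> draw (lazy_step E v); lazy_walk E t u }"

definition empirical :: "nat list \<Rightarrow> nat \<Rightarrow> real" where
  "empirical xs i = real (count_list xs i) / real (length xs)"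

text \<open>The inner product of the two empirical distributions is charged as sorting both lists of
  endpoints followed by one merging pass.\<close>

definition rw_batch :: "nat \<Rightarrow> edges \<Rightarrow> nat \<Rightarrow> nat \<Rightarrow> nat \<Rightarrow> nat \<Rightarrow> real comp" where
  "rw_batch n E t M x y = do {
     xs \<leftarrow> for_each (\<lambda>_. lazy_walk E t x) [0..<M];
     ys \<leftarrow> for_each (\<lambda>_. lazy_walk E t y) [0..<M];
     tick (2 * sort_time M + 2 * M);
     ret (\<Sum>i<n. empirical xs i * empirical ys i)
   }"

text \<open>The reserved space holds the \<open>2 M\<close> endpoints of the current batch and a constant number of
  registers (loop counters, current vertex, accumulator).\<close>

definition est_rw_dot ::
    "nat \<Rightarrow> nat \<Rightarrow> edges \<Rightarrow> real \<Rightarrow> nat \<Rightarrow> nat \<Rightarrow> nat \<Rightarrow> nat \<Rightarrow> real comp" where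
  "est_rw_dot cw n E R t M x y =
     (let B = nat \<lceil>R / real M\<rceil> in
      with_space (word cw n * (2 * M + 8)) (do {
        z \<leftarrow> accumulate B (rw_batch n E t M x y) 0;
        tick 1;
        ret (z / real B)
      }))"

definition median :: "real list \<Rightarrow> real" where
  "median xs = sort xs ! (length xs div 2)"

text \<open>\<open>reps\<close> is the number of repetitions, \<open>O(log n)\<close>. The triangular array \<open>rows\<close> holds the
  estimates for \<open>i \<le> j\<close>, from which the symmetric matrix \<open>\<G>\<^sub>l\<close> is read off. The reserved space holds
  all matrices \<open>\<G>\<^sub>l\<close> and one array for computing medians.\<close>

definition est_colli_prob ::
    "nat \<Rightarrow> nat \<Rightarrow> edges \<Rightarrow> nat \<Rightarrow> real \<Rightarrow> nat \<Rightarrow> nat \<Rightarrow> nat list \<Rightarrow> real mat comp" where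
  "est_colli_prob cw n E reps R t M IS =
     (let s = length IS in
      with_space (word cw n * (reps * s\<^sup>2 + reps + 8)) (do {
        Gs \<leftarrow> for_each (\<lambda>l. do {
                rows \<leftarrow> for_each (\<lambda>i. for_each (\<lambda>j. est_rw_dot cw n E R t M (IS ! i) (IS ! j)) [i..<s])
                          [0..<s];
                ret (mat s s (\<lambda>(i, j). rows ! min i j ! (max i j - min i j)))
              }) [0..<reps];
        tick (s\<^sup>2 * sort_time reps);
        ret (mat s s (\<lambda>(i, j). median (map (\<lambda>G. G $$ (i, j)) Gs)))
      }))"

text \<open>Some eigendecomposition \<open>A = W \<Sigma> W\<^sup>T\<close> of every real symmetric matrix, with the eigenvalues in
  decreasing order.\<close>

definition eigensolver :: "(real mat \<Rightarrow> real mat \<times> real mat) \<Rightarrow> bool" where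
  "eigensolver eig \<longleftrightarrow>
     (\<forall>m A. A \<in> carrier_mat m m \<and> transpose_mat A = A \<longrightarrow>
        (case eig A of (W, D) \<Rightarrow>
           W \<in> carrier_mat m m \<and> D \<in> carrier_mat m m \<and>
           W * transpose_mat W = 1\<^sub>m m \<and> transpose_mat W * W = 1\<^sub>m m \<and>
           diagonal_mat D \<and> (\<forall>i j. i \<le> j \<and> j < m \<longrightarrow> D $$ (j, j) \<le> D $$ (i, i)) \<and>
           A = W * D * transpose_mat W))"

text \<open>The constants hidden in \<open>s\<close>, \<open>R\<^sub>i\<^sub>n\<^sub>i\<^sub>t\<close>, \<open>R\<^sub>q\<^sub>u\<^sub>e\<^sub>r\<^sub>y\<close> and in the number of repetitions.\<close>

record hidden =
  c_s :: real
  c_init :: real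
  c_query :: real
  c_reps :: real

definition positive_hidden :: "hidden \<Rightarrow> bool" where
  "positive_hidden H \<longleftrightarrow> c_s H > 0 \<and> c_init H > 0 \<and> c_query H > 0 \<and> c_reps H > 0"

definition walk_length :: "nat \<Rightarrow> real \<Rightarrow> nat" where
  "walk_length n \<phi> = nat \<lceil>20 * ln (real n) / \<phi>\<^sup>2\<rceil>"

definition repetitions :: "hidden \<Rightarrow> nat \<Rightarrow> nat" where
  "repetitions H n = nat \<lceil>c_reps H * ln (real n)\<rceil>"

definition sample_size :: "hidden \<Rightarrow> nat \<Rightarrow> nat \<Rightarrow> real \<Rightarrow> real \<Rightarrow> real \<Rightarrow> nat" where
  "sample_size H n k \<phi> \<epsilon> \<xi> =
     nat \<lceil>c_s H * (real n powr (480 * \<epsilon> / \<phi>\<^sup>2) * ln (real n) * real k ^ 8 / \<xi>\<^sup>2)\<rceil>"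

definition R_init :: "hidden \<Rightarrow> nat \<Rightarrow> nat \<Rightarrow> real \<Rightarrow> real \<Rightarrow> real \<Rightarrow> nat \<Rightarrow> real" where
  "R_init H n k \<phi> \<epsilon> \<xi> M =
     c_init H * (real n powr (1 + 920 * \<epsilon> / \<phi>\<^sup>2) / real M * (real k ^ 14 / \<xi>\<^sup>2))"

definition R_query :: "hidden \<Rightarrow> nat \<Rightarrow> nat \<Rightarrow> real \<Rightarrow> real \<Rightarrow> real \<Rightarrow> nat \<Rightarrow> real" where
  "R_query H n k \<phi> \<epsilon> \<xi> M =
     c_query H * (real n powr (1 + 440 * \<epsilon> / \<phi>\<^sup>2) / real M * (real k ^ 6 / \<xi>\<^sup>2))"

text \<open>The oracle consists of the sampled multiset, as a list, and of \<open>\<Psi>\<close>; no \<open>\<Psi>\<close> is output if the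
  diagonal matrix of the \<open>k\<close> largest eigenvalues is singular. The eigendecomposition of an
  \<open>s \<times> s\<close> matrix is charged \<open>ce s\<^sup>3\<close> operations and \<open>ce s\<^sup>2\<close> words. The reserved space holds the
  sample, \<open>\<G>\<close>, \<open>\<Psi>\<close>, the eigendecomposition, and an \<open>s \<times> k\<close> intermediate product.\<close>

definition init_oracle ::
    "hidden \<Rightarrow> nat \<Rightarrow> nat \<Rightarrow> (real mat \<Rightarrow> real mat \<times> real mat) \<Rightarrow> nat \<Rightarrow> edges \<Rightarrow>
     nat \<Rightarrow> real \<Rightarrow> real \<Rightarrow> real \<Rightarrow> nat \<Rightarrow> (nat list \<times> real mat option) comp" where
  "init_oracle H cw ce eig n E k \<phi> \<epsilon> \<xi> M =
     (let t = walk_length n \<phi>;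
          R = R_init H n k \<phi> \<epsilon> \<xi> M;
          s = sample_size H n k \<phi> \<epsilon> \<xi>
      in with_space (word cw n * (s + 2 * s\<^sup>2 + ce * s\<^sup>2 + s * k + 8)) (do {
        IS \<leftarrow> for_each (\<lambda>_. draw (pmf_of_set {..<n})) [0..<s];
        G \<leftarrow> est_colli_prob cw n E (repetitions H n) R t M IS;
        let (W, D) = eig ((real n / real s) \<cdot>\<^sub>m G);
        tick (s\<^sup>2 + ce * s ^ 3);
        let Wk = mat s k (\<lambda>(i, j). W $$ (i, j));
        let Dk = mat k k (\<lambda>(i, j). D $$ (i, j));
        tick (k + s * k + s\<^sup>2 * k + s\<^sup>2);
        ret (IS, case mat_inverse Dk of
                   None \<Rightarrow> None
                 | Some Di \<Rightarrow> Some ((real n / real s) \<cdot>\<^sub>m (Wk * (Di * Di) * transpose_mat Wk)))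
      }))"

text \<open>The reserved space includes the oracle itself (sample and \<open>\<Psi>\<close>), besides the arrays
  \<open>x\<^sub>l, y\<^sub>l\<close>, their medians, and one array for computing medians.\<close>

definition query_dot ::
    "hidden \<Rightarrow> nat \<Rightarrow> nat \<Rightarrow> edges \<Rightarrow> nat \<Rightarrow> real \<Rightarrow> real \<Rightarrow> real \<Rightarrow>
     nat list \<Rightarrow> real mat \<Rightarrow> nat \<Rightarrow> nat \<Rightarrow> nat \<Rightarrow> real comp" where
  "query_dot H cw n E k \<phi> \<epsilon> \<xi> IS \<Psi> M x y =
     (let t = walk_length n \<phi>;
          R = R_query H n k \<phi> \<epsilon> \<xi> M;
          reps = repetitions H n;
          s = length IS
      in with_space (word cw n * (s + s\<^sup>2 + 2 * reps * s + 2 * s + reps + 8)) (do {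
        rows \<leftarrow> for_each (\<lambda>l. for_each (\<lambda>i. do {
                  a \<leftarrow> est_rw_dot cw n E R t M x (IS ! i);
                  b \<leftarrow> est_rw_dot cw n E R t M y (IS ! i);
                  ret (a, b)
                }) [0..<s]) [0..<reps];
        tick (2 * s * sort_time reps);
        let \<alpha>x = vec s (\<lambda>i. median (map (\<lambda>r. fst (r ! i)) rows));
        let \<alpha>y = vec s (\<lambda>i. median (map (\<lambda>r. snd (r ! i)) rows));
        tick (2 * s\<^sup>2 + 2 * s);
        ret (\<alpha>x \<bullet> (\<Psi> *\<^sub>v \<alpha>y))
      }))"

end

theory Submission
  imports Defs "Jordan_Normal_Form.Determinant"
begin

text \<open>
  Write \<open>\<nu> = n powr (\<epsilon> / \<phi>\<^sup>2)\<close>. Testing the Laplacian on the cluster indicators gives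
  \<open>\<lambda>\<^sub>k \<le> 2 \<epsilon>\<close>, and Cheeger's inequality inside each cluster gives \<open>\<lambda>\<^sub>k\<^sub>+\<^sub>1 \<ge> \<phi>\<^sup>2 / 2\<close>. Hence after
  \<open>20 ln n / \<phi>\<^sup>2\<close> lazy steps the top part of the spectrum is damped by at most a power of \<open>\<nu>\<close>, and
  the rest by \<open>n\<^sup>-\<^sup>1\<^sup>0\<close>. Superlevel sets of an eigenvector with eigenvalue at most \<open>2 \<epsilon>\<close> grow by a
  factor \<open>1 + \<phi> / 2\<close> whenever the level drops by a factor \<open>1 - 8 \<epsilon> / \<phi>\<close>, so its entries are at
  most \<open>O(\<nu>\<^sup>3\<^sup>0 sqrt (k / n))\<close>. This sup-norm bound controls the variance of the collision estimates
  and the number of samples.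

  Let \<open>A\<close> be the \<open>s \<times> k\<close> matrix of the rescaled embedded sample points and \<open>D\<^sup>2\<close> the diagonal matrix of
  the top \<open>k\<close> eigenvalues of the \<open>2 t\<close>-step walk. By Hoeffding's inequality \<open>A\<^sup>T A\<close> is close to the
  identity. The rescaled estimated Gram matrix is \<open>G = A D\<^sup>2 A\<^sup>T + N\<close> and the rescaled query vector is
  \<open>b = A D\<^sup>2 f + e\<close> with \<open>N\<close> and \<open>e\<close> small. If \<open>A\<^sup>T A w = f\<close> and \<open>\<omega> = A w\<close> then
  \<open>b = G \<omega> + (e - N \<omega>)\<close>, so applying the truncated inverse of \<open>G\<close> to \<open>b\<close> recovers \<open>\<omega>\<close> up to a small
  error, and \<open>\<omega>\<^sub>x \<bullet> \<omega>\<^sub>y = w\<^sub>x \<bullet> f\<^sub>y\<close> is close to \<open>f\<^sub>x \<bullet> f\<^sub>y\<close>.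
\<close>

section \<open>Underdetermined linear systems\<close>

text \<open>The obstacle is that the eigenvectors of the noisy matrix \<open>G\<close> cannot be
  matched with those of its noiseless part: the first \<open>k\<close> eigenvalues may be
  arbitrarily close, so there is no eigengap to use. Since each query vector is, up to a small
  error, the image under \<open>G\<close> of some \<open>\<omega>\<close> in the range of
  \<open>A\<close>, it suffices to know that the first \<open>k\<close> eigenvalues of
  \<open>G\<close> are bounded below and that the others are tiny. The min-max principle behind
  these two facts, and behind the two bounds on the Laplacian spectrum, is replaced each time by a
  homogeneous system with more unknowns than equations, whose solution is a test vector in the
  intersection of two subspaces. Constants are disposed of as follows. Clusters have at least two
  vertices, so \<open>n\<close> is at least 4; with \<open>\<xi> > n^-5\<close> this keeps the
  discarded spectrum, of size \<open>n^-10\<close>, below a fraction of \<open>\<xi> / n\<close>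
  even after division by the smallest retained eigenvalue. In the costs \<open>k / \<xi>\<close> is
  at least 2, so a constant \<open>K \<ge> 1\<close> is at most
  \<open>(k / \<xi>) powr log 2 K\<close> and moves into the exponent.\<close>

lemma homogeneous_system_nontrivial:
  fixes a :: "'i \<Rightarrow> 'j \<Rightarrow> real"
  assumes "finite I" "finite J" "card I < card J"
  shows "\<exists>c. (\<exists>j\<in>J. c j \<noteq> 0) \<and> (\<forall>i\<in>I. (\<Sum>j\<in>J. a i j * c j) = 0)"
  using assms
proof (induction I arbitrary: J a rule: finite_induct)
  case empty
  then have "J \<noteq> {}" by auto
  then show ?case by (intro exI[of _ "\<lambda>_. 1"]) auto
next
  case (insert i0 I)
  show ?case
  proof (cases "\<forall>j\<in>J. a i0 j = 0")
    case True
    have "card I < card J" using insert by simp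
    then obtain c where "\<exists>j\<in>J. c j \<noteq> 0" "\<forall>i\<in>I. (\<Sum>j\<in>J. a i j * c j) = 0"
      using insert.IH[OF insert.prems(1)] by blast
    with True show ?thesis by (intro exI[of _ c]) auto
  next
    case False
    then obtain j0 where j0: "j0 \<in> J" "a i0 j0 \<noteq> 0" by blast
    \<comment> \<open>Gaussian elimination with pivot \<open>a i0 j0\<close>: the induction
      hypothesis solves the other equations after elimination of the unknown \<open>j0\<close>, and
      \<open>s\<close> below is the value that equation \<open>i0\<close> forces on it.\<close>
    define J' where "J' = J - {j0}"
    have J: "J = insert j0 J'" "j0 \<notin> J'" "finite J'" using j0 insert.prems by (auto simp: J'_def)
    have "card I < card J'" using insert J by simp
    then obtain c where c: "\<exists>j\<in>J'. c j \<noteq> 0"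
      "\<forall>i\<in>I. (\<Sum>j\<in>J'. (a i j - a i j0 * a i0 j / a i0 j0) * c j) = 0"
      using insert.IH[OF J(3), of "\<lambda>i j. a i j - a i j0 * a i0 j / a i0 j0"] by blast
    define s where "s = - (\<Sum>j\<in>J'. a i0 j * c j) / a i0 j0"
    define c' where "c' = c(j0 := s)"
    have split: "(\<Sum>j\<in>J. a i j * c' j) = a i j0 * s + (\<Sum>j\<in>J'. a i j * c j)" for i
    proof -
      have "(\<Sum>j\<in>J'. a i j * c' j) = (\<Sum>j\<in>J'. a i j * c j)"
        by (rule sum.cong) (use J in \<open>auto simp: c'_def\<close>)
      then show ?thesis using J by (simp add: c'_def)
    qed
    have 1: "(\<Sum>j\<in>J. a i0 j * c' j) = 0"
      unfolding split using j0 by (simp add: s_def)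
    have 2: "(\<Sum>j\<in>J. a i j * c' j) = 0" if "i \<in> I" for i
    proof -
      have "0 = (\<Sum>j\<in>J'. (a i j - a i j0 * a i0 j / a i0 j0) * c j)" using c that by simp
      also have "\<dots> = (\<Sum>j\<in>J'. a i j * c j - (a i j0 / a i0 j0) * (a i0 j * c j))"
        by (rule sum.cong) (auto simp: algebra_simps)
      also have "\<dots> = (\<Sum>j\<in>J'. a i j * c j) + a i j0 * s"
        by (simp add: sum_subtractf sum_distrib_left sum_divide_distrib s_def)
      finally show ?thesis unfolding split by simp
    qed
    have "\<exists>j\<in>J. c' j \<noteq> 0" using c(1) J by (auto simp: c'_def)
    then show ?thesis using 1 2 by blast
  qed
qed

section \<open>Cheeger's inequality\<close>

text \<open>A real-valued edge indicator, so that degrees, cut sizes and quadratic forms are all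
  double sums.\<close>

definition adj :: "edges \<Rightarrow> nat \<Rightarrow> nat \<Rightarrow> real" where
  "adj E x y = (if E x y then 1 else 0)"

lemma adj_nonneg [simp]: "0 \<le> adj E x y" by (simp add: adj_def)

text \<open>The witness is the least value of \<open>z\<close> whose sublevel set contains at least
  half of \<open>C\<close>. This leaves at most half strictly above it; if more than half were
  strictly below, the largest value below it would be a smaller candidate.\<close>

lemma median_value_exists:
  fixes z :: "'a \<Rightarrow> real"
  assumes "finite C" "C \<noteq> {}"
  shows "\<exists>m. 2 * card {x\<in>C. z x > m} \<le> card C \<and> 2 * card {x\<in>C. z x < m} \<le> card C"
proof -
  define P where "P = {z y | y. y \<in> C \<and> card C \<le> 2 * card {x\<in>C. z x \<le> z y}}"
  have fin: "finite P" using assms(1) unfolding P_def by simp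
  have "Max (z ` C) \<in> z ` C" using assms by (intro Max_in) auto
  then obtain y where y: "y \<in> C" "z y = Max (z ` C)" by force
  then have "{x\<in>C. z x \<le> z y} = C" using assms by auto
  then have "z y \<in> P" using y unfolding P_def by force
  then have ne: "P \<noteq> {}" by blast
  define m where "m = Min P"
  have "m \<in> P" unfolding m_def by (rule Min_in[OF fin ne])
  then have le: "card C \<le> 2 * card {x\<in>C. z x \<le> m}" by (auto simp: P_def)
  have "{x\<in>C. z x > m} = C - {x\<in>C. z x \<le> m}" by auto
  then have "card {x\<in>C. z x > m} = card C - card {x\<in>C. z x \<le> m}"
    using assms(1) by (simp add: card_Diff_subset)
  moreover have "2 * card {x\<in>C. z x < m} \<le> card C"
  proof (rule ccontr)
    assume H: "\<not> ?thesis"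
    define L where "L = {x\<in>C. z x < m}"
    have "L \<noteq> {}" "finite L" using H assms(1) by (auto simp: L_def) (metis (mono_tags, lifting) card.empty empty_Collect_eq le0 mult_0_right)
    then have "Max (z ` L) \<in> z ` L" by (intro Max_in) auto
    then obtain w where w: "w \<in> L" "z w = Max (z ` L)" by force
    have "{x\<in>C. z x \<le> z w} = L"
      using w \<open>finite L\<close> by (auto simp: L_def)
    then have "card C \<le> 2 * card {x\<in>C. z x \<le> z w}" using H by (simp add: L_def)
    moreover have "w \<in> C" using w by (simp add: L_def)
    ultimately have "z w \<in> P" unfolding P_def by blast
    then have "m \<le> z w" unfolding m_def using fin by (intro Min_le)
    then show False using w by (auto simp: L_def)
  qed
  ultimately show ?thesis using le by (intro exI[of _ m]) auto
qed

text \<open>The co-area formula, proved by peeling off the lowest positive level set.\<close>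

lemma coarea_inequality:
  fixes H :: "nat \<Rightarrow> real" and r :: real
  assumes fin: "finite C" and sym: "\<And>x y. E x y \<Longrightarrow> E y x" and r: "0 \<le> r"
    and iso: "\<And>S. S \<subseteq> C \<Longrightarrow> S \<noteq> {} \<Longrightarrow> 2 * card S \<le> card C \<Longrightarrow>
                r * card S \<le> (\<Sum>x\<in>S. \<Sum>y\<in>C-S. adj E x y)"
    and H: "\<And>x. x \<in> C \<Longrightarrow> 0 \<le> H x" and supp: "2 * card {x\<in>C. H x \<noteq> 0} \<le> card C"
  shows "2 * r * (\<Sum>x\<in>C. H x) \<le> (\<Sum>x\<in>C. \<Sum>y\<in>C. adj E x y * \<bar>H x - H y\<bar>)"
  using H supp
proof (induction "card {x\<in>C. H x \<noteq> 0}" arbitrary: H rule: less_induct)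
  case less
  define S where "S = {x\<in>C. H x \<noteq> 0}"
  have S: "S \<subseteq> C" "finite S" using fin by (auto simp: S_def)
  show ?case
  proof (cases "S = {}")
    case True
    then have "\<And>x. x \<in> C \<Longrightarrow> H x = 0" by (auto simp: S_def)
    then have "(\<Sum>x\<in>C. H x) = 0" by simp
    then show ?thesis by (simp add: sum_nonneg)
  next
    case False
    define m where "m = Min (H ` S)"
    have "m \<in> H ` S" unfolding m_def using False S by (intro Min_in) auto
    then obtain x0 where x0: "x0 \<in> S" "H x0 = m" by auto
    have m: "m > 0" using x0 less.prems(1)[of x0] by (auto simp: S_def)
    have mle: "m \<le> H x" if "x \<in> S" for x unfolding m_def using that S by simp
    define H' where "H' x = (if x \<in> S then H x - m else 0)" for x
    have sub: "{x\<in>C. H' x \<noteq> 0} \<subset> S"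
      using x0 by (auto simp: H'_def S_def)
    have lt: "card {x\<in>C. H' x \<noteq> 0} < card S" using psubset_card_mono[OF S(2) sub] .
    have IH: "2 * r * (\<Sum>x\<in>C. H' x) \<le> (\<Sum>x\<in>C. \<Sum>y\<in>C. adj E x y * \<bar>H' x - H' y\<bar>)"
      using lt less.prems(2) mle unfolding S_def[symmetric]
      by (intro less.hyps) (auto simp: H'_def S_def)
    define I where "I x = (if x \<in> S then 1 else 0::real)" for x
    \<comment> \<open>Lowering \<open>H\<close> by \<open>m\<close> on its support changes
      \<open>\<bar>H x - H y\<bar>\<close> by exactly \<open>m\<close> on pairs crossing the
      boundary of \<open>S\<close> and by nothing elsewhere, because \<open>H\<close> is at least
      \<open>m\<close> on \<open>S\<close>. Each crossing edge occurs in both orders, whence the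
      factor 2 in the claim.\<close>
    have dec: "\<bar>H x - H y\<bar> = \<bar>H' x - H' y\<bar> + m * (I x * (1 - I y) + I y * (1 - I x))"
      if "x \<in> C" "y \<in> C" for x y
      using that mle[of x] mle[of y] m by (auto simp: H'_def I_def S_def)
    have cut: "(\<Sum>x\<in>C. \<Sum>y\<in>C. adj E x y * (I x * (1 - I y))) = (\<Sum>x\<in>S. \<Sum>y\<in>C-S. adj E x y)"
    proof -
      have "(\<Sum>x\<in>C. \<Sum>y\<in>C. adj E x y * (I x * (1 - I y)))
          = (\<Sum>x\<in>S. \<Sum>y\<in>C. adj E x y * (I x * (1 - I y)))"
        by (rule sum.mono_neutral_right) (use S fin in \<open>auto simp: I_def\<close>)
      also have "\<dots> = (\<Sum>x\<in>S. \<Sum>y\<in>C-S. adj E x y * (I x * (1 - I y)))"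
        by (intro sum.cong refl sum.mono_neutral_right) (use S fin in \<open>auto simp: I_def\<close>)
      also have "\<dots> = (\<Sum>x\<in>S. \<Sum>y\<in>C-S. adj E x y)"
        by (intro sum.cong refl) (auto simp: I_def)
      finally show ?thesis .
    qed
    have cut': "(\<Sum>x\<in>C. \<Sum>y\<in>C. adj E x y * (I y * (1 - I x))) = (\<Sum>x\<in>S. \<Sum>y\<in>C-S. adj E x y)"
    proof -
      have symadj: "adj E x y = adj E y x" for x y using sym by (auto simp: adj_def)
      have "(\<Sum>x\<in>C. \<Sum>y\<in>C. adj E x y * (I y * (1 - I x)))
          = (\<Sum>y\<in>C. \<Sum>x\<in>C. adj E y x * (I y * (1 - I x)))"
        by (subst sum.swap) (simp add: symadj)
      then show ?thesis using cut by simp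
    qed
    have sumH: "(\<Sum>x\<in>C. H x) = (\<Sum>x\<in>C. H' x) + m * card S"
    proof -
      have "(\<Sum>x\<in>C. H x) = (\<Sum>x\<in>C. H' x + m * I x)"
        by (rule sum.cong) (auto simp: H'_def I_def S_def)
      also have "(\<Sum>x\<in>C. I x) = card S"
        unfolding I_def using S fin by (simp add: sum.If_cases Int_absorb1)
      ultimately show ?thesis by (simp add: sum.distrib sum_distrib_left[symmetric])
    qed
    have "r * card S \<le> (\<Sum>x\<in>S. \<Sum>y\<in>C-S. adj E x y)"
      using iso[OF S(1) False] less.prems(2) by (simp add: S_def)
    then have "2 * r * (m * card S) \<le> 2 * m * (\<Sum>x\<in>S. \<Sum>y\<in>C-S. adj E x y)"
      using m by (simp add: algebra_simps)
    then have "2 * r * (\<Sum>x\<in>C. H x) \<le> (\<Sum>x\<in>C. \<Sum>y\<in>C. adj E x y * \<bar>H' x - H' y\<bar>)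
        + 2 * m * (\<Sum>x\<in>S. \<Sum>y\<in>C-S. adj E x y)"
      using IH by (simp add: sumH algebra_simps)
    also have "\<dots> = (\<Sum>x\<in>C. \<Sum>y\<in>C. adj E x y * \<bar>H' x - H' y\<bar>)
        + m * ((\<Sum>x\<in>C. \<Sum>y\<in>C. adj E x y * (I x * (1 - I y)))
        + (\<Sum>x\<in>C. \<Sum>y\<in>C. adj E x y * (I y * (1 - I x))))"
      unfolding cut cut' by simp
    also have "\<dots> = (\<Sum>x\<in>C. \<Sum>y\<in>C. adj E x y * (\<bar>H' x - H' y\<bar>
        + m * (I x * (1 - I y) + I y * (1 - I x))))"
      by (simp add: sum.distrib[symmetric] sum_distrib_left distrib_left mult.left_commute)
    also have "\<dots> = (\<Sum>x\<in>C. \<Sum>y\<in>C. adj E x y * \<bar>H x - H y\<bar>)"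
      by (intro sum.cong refl) (simp add: dec)
    finally show ?thesis .
  qed
qed

text \<open>The square of \<open>h\<close> is inserted into the co-area inequality. The difference
  of squares factors, the edge weight is split as \<open>sqrt (adj E x y)\<close> over both factors,
  and Cauchy-Schwarz leaves the energy times a sum of \<open>(h x + h y)^2\<close>, which is at most
  \<open>4 * d\<close> times the squared norm. One factor of the squared norm then cancels.\<close>

lemma cheeger_small_support:
  fixes h :: "nat \<Rightarrow> real"
  assumes fin: "finite C" and sym: "\<And>x y. E x y \<Longrightarrow> E y x" and \<phi>: "0 \<le> \<phi>" and d: "0 < (d::real)"
    and deg: "\<And>x. x \<in> C \<Longrightarrow> (\<Sum>y\<in>C. adj E x y) \<le> d"
    and iso: "\<And>S. S \<subseteq> C \<Longrightarrow> S \<noteq> {} \<Longrightarrow> 2 * card S \<le> card C \<Longrightarrow>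
                \<phi> * d * card S \<le> (\<Sum>x\<in>S. \<Sum>y\<in>C-S. adj E x y)"
    and h: "\<And>x. x \<in> C \<Longrightarrow> 0 \<le> h x" and supp: "2 * card {x\<in>C. h x \<noteq> 0} \<le> card C"
  shows "\<phi>\<^sup>2 * d * (\<Sum>x\<in>C. (h x)\<^sup>2) \<le> (\<Sum>x\<in>C. \<Sum>y\<in>C. adj E x y * (h x - h y)\<^sup>2)"
proof -
  define s where "s = (\<Sum>x\<in>C. (h x)\<^sup>2)"
  define En where "En = (\<Sum>x\<in>C. \<Sum>y\<in>C. adj E x y * (h x - h y)\<^sup>2)"
  have s0: "s \<ge> 0" unfolding s_def by (simp add: sum_nonneg)
  have En0: "En \<ge> 0" unfolding En_def by (simp add: sum_nonneg)
  have symadj: "adj E x y = adj E y x" for x y using sym by (auto simp: adj_def)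
  have 1: "2 * (\<phi> * d) * s \<le> (\<Sum>x\<in>C. \<Sum>y\<in>C. adj E x y * \<bar>(h x)\<^sup>2 - (h y)\<^sup>2\<bar>)"
    unfolding s_def using \<phi> d supp
    by (intro coarea_inequality fin iso) (auto intro: sym)
  also have "\<dots> = (\<Sum>(x,y)\<in>C\<times>C. (sqrt (adj E x y) * \<bar>h x - h y\<bar>) * (sqrt (adj E x y) * (h x + h y)))"
    unfolding sum.cartesian_product
    by (intro sum.cong refl)
       (auto simp: power2_eq_square square_diff_square_factored abs_mult adj_def h abs_of_nonneg)
  finally have "(2 * (\<phi> * d) * s)\<^sup>2 \<le>
      (\<Sum>(x,y)\<in>C\<times>C. (sqrt (adj E x y) * \<bar>h x - h y\<bar>) * (sqrt (adj E x y) * (h x + h y)))\<^sup>2"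
    using s0 d \<phi> by (intro power_mono) auto
  also have "\<dots> \<le> (\<Sum>(x,y)\<in>C\<times>C. (sqrt (adj E x y) * \<bar>h x - h y\<bar>)\<^sup>2)
      * (\<Sum>(x,y)\<in>C\<times>C. (sqrt (adj E x y) * (h x + h y))\<^sup>2)"
    unfolding case_prod_unfold by (rule Cauchy_Schwarz_ineq_sum)
  also have "(\<Sum>(x,y)\<in>C\<times>C. (sqrt (adj E x y) * \<bar>h x - h y\<bar>)\<^sup>2) = En"
    unfolding En_def sum.cartesian_product by (intro sum.cong refl) (auto simp: power_mult_distrib)
  also have "(\<Sum>(x,y)\<in>C\<times>C. (sqrt (adj E x y) * (h x + h y))\<^sup>2) \<le> 4 * d * s"
  proof -
    have "(\<Sum>(x,y)\<in>C\<times>C. (sqrt (adj E x y) * (h x + h y))\<^sup>2)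
        = (\<Sum>x\<in>C. \<Sum>y\<in>C. adj E x y * (h x + h y)\<^sup>2)"
      unfolding sum.cartesian_product by (intro sum.cong refl) (auto simp: power_mult_distrib)
    also have "\<dots> \<le> (\<Sum>x\<in>C. \<Sum>y\<in>C. adj E x y * (2 * (h x)\<^sup>2 + 2 * (h y)\<^sup>2))"
    proof (intro sum_mono mult_left_mono)
      fix x y show "(h x + h y)\<^sup>2 \<le> 2 * (h x)\<^sup>2 + 2 * (h y)\<^sup>2"
        using sum_squares_bound[of "h x" "h y"] by (simp add: power2_sum)
    qed simp
    also have "\<dots> = 2 * (\<Sum>x\<in>C. \<Sum>y\<in>C. adj E x y * (h x)\<^sup>2) + 2 * (\<Sum>x\<in>C. \<Sum>y\<in>C. adj E x y * (h y)\<^sup>2)"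
      by (simp add: sum_distrib_left sum.distrib[symmetric] algebra_simps)
    also have "(\<Sum>x\<in>C. \<Sum>y\<in>C. adj E x y * (h y)\<^sup>2) = (\<Sum>x\<in>C. \<Sum>y\<in>C. adj E x y * (h x)\<^sup>2)"
      by (subst sum.swap) (simp add: symadj)
    also have "(\<Sum>x\<in>C. \<Sum>y\<in>C. adj E x y * (h x)\<^sup>2) \<le> d * s"
      unfolding s_def sum_distrib_left
      by (intro sum_mono) (auto simp: sum_distrib_right[symmetric] intro!: mult_right_mono deg)
    finally show ?thesis by simp
  qed
  finally have *: "(2 * (\<phi> * d) * s)\<^sup>2 \<le> En * (4 * d * s)" using En0 by (simp add: mult_left_mono)
  show ?thesis
  proof (cases "s = 0")
    case True then show ?thesis using En0 by (simp add: s_def En_def)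
  next
    case False
    then have sp: "4 * d * s > 0" using s0 d by auto
    have "(2 * (\<phi> * d) * s)\<^sup>2 = (\<phi>\<^sup>2 * d * s) * (4 * d * s)" by (simp add: power2_eq_square algebra_simps)
    then have "\<phi>\<^sup>2 * d * s \<le> En" using * sp by (simp add: mult_le_cancel_right)
    then show ?thesis by (simp add: s_def En_def)
  qed
qed

text \<open>After subtraction of a median, the positive and the negative part both live on at most
  half of \<open>C\<close>, where the previous bound applies. Their energies add up to at most that
  of \<open>z\<close>, since the cross term has the right sign, and the shift can only increase the
  norm because \<open>z\<close> has mean zero.\<close>

lemma cheeger_inequality:
  fixes z :: "nat \<Rightarrow> real"
  assumes fin: "finite C" and sym: "\<And>x y. E x y \<Longrightarrow> E y x" and \<phi>: "0 \<le> \<phi>" and d: "0 < (d::real)"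
    and deg: "\<And>x. x \<in> C \<Longrightarrow> (\<Sum>y\<in>C. adj E x y) \<le> d"
    and iso: "\<And>S. S \<subseteq> C \<Longrightarrow> S \<noteq> {} \<Longrightarrow> 2 * card S \<le> card C \<Longrightarrow>
                \<phi> * d * card S \<le> (\<Sum>x\<in>S. \<Sum>y\<in>C-S. adj E x y)"
    and z: "(\<Sum>x\<in>C. z x) = 0"
  shows "\<phi>\<^sup>2 * d * (\<Sum>x\<in>C. (z x)\<^sup>2) \<le> (\<Sum>x\<in>C. \<Sum>y\<in>C. adj E x y * (z x - z y)\<^sup>2)"
proof (cases "C = {}")
  case True then show ?thesis by simp
next
  case False
  obtain m where m: "2 * card {x\<in>C. z x > m} \<le> card C" "2 * card {x\<in>C. z x < m} \<le> card C"
    using median_value_exists[OF fin False] by blast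
  define p where "p x = max (z x - m) 0" for x
  define q where "q x = max (m - z x) 0" for x
  have "{x\<in>C. p x \<noteq> 0} = {x\<in>C. z x > m}" "{x\<in>C. q x \<noteq> 0} = {x\<in>C. z x < m}"
    by (auto simp: p_def q_def max_def split: if_splits)
  then have "\<phi>\<^sup>2 * d * (\<Sum>x\<in>C. (p x)\<^sup>2) \<le> (\<Sum>x\<in>C. \<Sum>y\<in>C. adj E x y * (p x - p y)\<^sup>2)"
    "\<phi>\<^sup>2 * d * (\<Sum>x\<in>C. (q x)\<^sup>2) \<le> (\<Sum>x\<in>C. \<Sum>y\<in>C. adj E x y * (q x - q y)\<^sup>2)"
    using m by (auto intro!: cheeger_small_support fin sym \<phi> d deg iso simp: p_def q_def)
  then have "\<phi>\<^sup>2 * d * (\<Sum>x\<in>C. (p x)\<^sup>2 + (q x)\<^sup>2) \<le>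
      (\<Sum>x\<in>C. \<Sum>y\<in>C. adj E x y * ((p x - p y)\<^sup>2 + (q x - q y)\<^sup>2))"
    by (simp add: sum.distrib algebra_simps)
  also have "\<dots> \<le> (\<Sum>x\<in>C. \<Sum>y\<in>C. adj E x y * (z x - z y)\<^sup>2)"
  proof (intro sum_mono mult_left_mono)
    fix x y
    have key: "(a + b)\<^sup>2 \<ge> a\<^sup>2 + b\<^sup>2" if "a \<ge> 0" "b \<ge> 0" for a b :: real
      using that by (simp add: power2_sum)
    consider "z x \<ge> m" "z y \<ge> m" | "z x \<le> m" "z y \<le> m" | "z x \<ge> m" "z y \<le> m" | "z x \<le> m" "z y \<ge> m" by linarith
    then show "(p x - p y)\<^sup>2 + (q x - q y)\<^sup>2 \<le> (z x - z y)\<^sup>2"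
    proof cases
      case 1 then show ?thesis by (simp add: p_def q_def max_def)
    next
      case 2
      then show ?thesis by (simp add: p_def q_def max_def power2_commute)
    next
      case 3 then show ?thesis using key[of "z x - m" "m - z y"] by (simp add: p_def q_def max_def power2_eq_square)
    next
      case 4 then show ?thesis using key[of "z y - m" "m - z x"] by (simp add: p_def q_def max_def power2_eq_square algebra_simps)
    qed
  qed simp
  finally have 1: "\<phi>\<^sup>2 * d * (\<Sum>x\<in>C. (p x)\<^sup>2 + (q x)\<^sup>2) \<le> (\<Sum>x\<in>C. \<Sum>y\<in>C. adj E x y * (z x - z y)\<^sup>2)" .
  have "(\<Sum>x\<in>C. (p x)\<^sup>2 + (q x)\<^sup>2) = (\<Sum>x\<in>C. (z x)\<^sup>2 - 2 * m * z x + m\<^sup>2)"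
    by (intro sum.cong refl) (auto simp: p_def q_def max_def power2_eq_square algebra_simps)
  also have "\<dots> = (\<Sum>x\<in>C. (z x)\<^sup>2) + card C * m\<^sup>2"
    using z by (simp add: sum.distrib sum_subtractf sum_distrib_left[symmetric])
  finally have "(\<Sum>x\<in>C. (z x)\<^sup>2) \<le> (\<Sum>x\<in>C. (p x)\<^sup>2 + (q x)\<^sup>2)" by simp
  then have "\<phi>\<^sup>2 * d * (\<Sum>x\<in>C. (z x)\<^sup>2) \<le> \<phi>\<^sup>2 * d * (\<Sum>x\<in>C. (p x)\<^sup>2 + (q x)\<^sup>2)"
    using d by (intro mult_left_mono) auto
  with 1 show ?thesis by linarith
qed

section \<open>Spectrum of a clusterable graph\<close>

text \<open>The eigenbasis is a family of real functions, and the eigenvalue equation is the one for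
  the adjacency matrix \<open>d * (I - L)\<close>. \<open>complete\<close> is the dual orthogonality
  relation of the same square matrix; expansions in the eigenbasis rest on it.\<close>

locale regular_spectral =
  fixes n d :: nat and E :: edges and lam :: "nat \<Rightarrow> real" and v :: "nat \<Rightarrow> nat \<Rightarrow> real"
  assumes reg: "regular_graph n d E"
    and eigen: "a < n \<Longrightarrow> x < n \<Longrightarrow> (\<Sum>y<n. adj E x y * v a y) = real d * (1 - lam a) * v a x"
    and orth: "a < n \<Longrightarrow> b < n \<Longrightarrow> (\<Sum>x<n. v a x * v b x) = (if a = b then 1 else 0)"
    and complete: "x < n \<Longrightarrow> y < n \<Longrightarrow> (\<Sum>a<n. v a x * v a y) = (if x = y then 1 else 0)"
    and lam_mono: "a \<le> b \<Longrightarrow> b < n \<Longrightarrow> lam a \<le> lam b"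
begin

lemma d_pos: "0 < real d"
  using reg by (simp add: regular_graph_def)

lemma E_sym: "E x y \<Longrightarrow> E y x"
  using reg by (simp add: regular_graph_def graph_def)

lemma adj_sym: "adj E x y = adj E y x"
  using E_sym by (auto simp: adj_def)

lemma E_bound: "E x y \<Longrightarrow> x < n \<and> y < n"
  using reg by (simp add: regular_graph_def graph_def)

lemma E_irrefl: "\<not> E x x"
  using reg by (simp add: regular_graph_def graph_def)

lemma neighbours: "{y. E x y} = {y\<in>{..<n}. E x y}"
  using E_bound by auto

lemma sum_adj: "(\<Sum>y<n. adj E x y * g y) = (\<Sum>y | E x y. g y)"
proof -
  have "(\<Sum>y<n. adj E x y * g y) = (\<Sum>y<n. if E x y then g y else 0)"
    by (rule sum.cong) (auto simp: adj_def)
  also have "\<dots> = (\<Sum>y\<in>{y\<in>{..<n}. E x y}. g y)"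
    by (rule sum.inter_filter[symmetric]) simp
  finally show ?thesis using neighbours by simp
qed

lemma degree_eq: "x < n \<Longrightarrow> card {y. E x y} = d"
  using reg by (simp add: regular_graph_def deg_def)

lemma adj_row_sum: "x < n \<Longrightarrow> (\<Sum>y<n. adj E x y) = real d"
  using sum_adj[of x "\<lambda>_. 1"] degree_eq[of x] by simp

lemma adj_column_sum: "y < n \<Longrightarrow> (\<Sum>x<n. adj E x y) = real d"
  using adj_row_sum[of y] by (simp add: adj_sym)

text \<open>Ordered pairs count every edge twice, so a unit eigenvector with eigenvalue
  \<open>l\<close> has energy \<open>2 * d * l\<close>; this is the factor 2 in the Rayleigh
  quotients below.\<close>

definition energy :: "(nat \<Rightarrow> real) \<Rightarrow> real" where
  "energy z = (\<Sum>x<n. \<Sum>y<n. adj E x y * (z x - z y)\<^sup>2)"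

lemma energy_nonneg: "0 \<le> energy z"
  unfolding energy_def by (simp add: sum_nonneg)

lemma sum_adj_square:
  fixes z :: "nat \<Rightarrow> real"
  shows "(\<Sum>x<n. \<Sum>y<n. adj E x y * (z x)\<^sup>2) = d * (\<Sum>x<n. (z x)\<^sup>2)"
  "(\<Sum>x<n. \<Sum>y<n. adj E x y * (z y)\<^sup>2) = d * (\<Sum>x<n. (z x)\<^sup>2)"
proof -
  show 1: "(\<Sum>x<n. \<Sum>y<n. adj E x y * (z x)\<^sup>2) = d * (\<Sum>x<n. (z x)\<^sup>2)"
    by (simp add: sum_distrib_left sum_distrib_right[symmetric] adj_row_sum)
  show "(\<Sum>x<n. \<Sum>y<n. adj E x y * (z y)\<^sup>2) = d * (\<Sum>x<n. (z x)\<^sup>2)"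
    using 1 by (subst sum.swap) (simp add: adj_sym)
qed

lemma energy_eq:
  fixes z :: "nat \<Rightarrow> real"
  shows "energy z = 2 * (\<Sum>x<n. z x * (d * z x - (\<Sum>y<n. adj E x y * z y)))"
proof -
  have "energy z = (\<Sum>x<n. \<Sum>y<n. adj E x y * (z x)\<^sup>2 + adj E x y * (z y)\<^sup>2 - 2 * (z x * (adj E x y * z y)))"
    unfolding energy_def by (intro sum.cong refl) (simp add: power2_eq_square algebra_simps)
  also have "\<dots> = 2 * (d * (\<Sum>x<n. (z x)\<^sup>2)) - 2 * (\<Sum>x<n. z x * (\<Sum>y<n. adj E x y * z y))"
    by (simp add: sum.distrib sum_subtractf sum_adj_square sum_distrib_left)
  also have "\<dots> = 2 * (\<Sum>x<n. z x * (d * z x - (\<Sum>y<n. adj E x y * z y)))"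
    by (simp add: right_diff_distrib sum_subtractf sum_distrib_left power2_eq_square mult.left_commute)
  finally show ?thesis .
qed

lemma energy_le: fixes z :: "nat \<Rightarrow> real" shows "energy z \<le> 4 * d * (\<Sum>x<n. (z x)\<^sup>2)"
proof -
  have "energy z \<le> (\<Sum>x<n. \<Sum>y<n. adj E x y * (2 * (z x)\<^sup>2 + 2 * (z y)\<^sup>2))"
    unfolding energy_def
  proof (intro sum_mono mult_left_mono)
    fix x y show "(z x - z y)\<^sup>2 \<le> 2 * (z x)\<^sup>2 + 2 * (z y)\<^sup>2"
      using sum_squares_bound[of "z x" "- z y"] by (simp add: power2_diff)
  qed simp
  also have "\<dots> = 2 * (\<Sum>x<n. \<Sum>y<n. adj E x y * (z x)\<^sup>2) + 2 * (\<Sum>x<n. \<Sum>y<n. adj E x y * (z y)\<^sup>2)"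
    by (simp add: sum_distrib_left sum.distrib[symmetric] algebra_simps)
  finally show ?thesis by (simp add: sum_adj_square)
qed

lemma inner_combination:
  assumes "J \<subseteq> {..<n}"
  shows "(\<Sum>x<n. (\<Sum>a\<in>J. c a * v a x) * (\<Sum>a\<in>J. e a * v a x)) = (\<Sum>a\<in>J. c a * e a)"
proof -
  have fin: "finite J" using assms finite_subset by blast
  have "(\<Sum>x<n. (\<Sum>a\<in>J. c a * v a x) * (\<Sum>a\<in>J. e a * v a x))
      = (\<Sum>x<n. \<Sum>a\<in>J. \<Sum>b\<in>J. c a * e b * (v a x * v b x))"
    by (simp add: sum_product algebra_simps)
  also have "\<dots> = (\<Sum>a\<in>J. \<Sum>b\<in>J. \<Sum>x<n. c a * e b * (v a x * v b x))"
    by (subst sum.swap, rule sum.cong[OF refl], subst sum.swap) simp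
  also have "\<dots> = (\<Sum>a\<in>J. \<Sum>b\<in>J. c a * e b * (if a = b then 1 else 0))"
    using assms by (intro sum.cong refl) (auto simp: sum_distrib_left[symmetric] orth subset_eq)
  also have "\<dots> = (\<Sum>a\<in>J. c a * e a)"
    using fin by (intro sum.cong refl) (simp add: if_distrib sum.delta cong: if_cong)
  finally show ?thesis .
qed

lemma norm_combination:
  assumes "J \<subseteq> {..<n}"
  shows "(\<Sum>x<n. (\<Sum>a\<in>J. c a * v a x)\<^sup>2) = (\<Sum>a\<in>J. (c a)\<^sup>2)"
  using inner_combination[OF assms, of c c] by (simp add: power2_eq_square)

lemma energy_combination:
  assumes J: "J \<subseteq> {..<n}"
  shows "energy (\<lambda>x. \<Sum>a\<in>J. c a * v a x) = 2 * d * (\<Sum>a\<in>J. lam a * (c a)\<^sup>2)"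
proof -
  define z where "z x = (\<Sum>a\<in>J. c a * v a x)" for x
  have "d * z x - (\<Sum>y<n. adj E x y * z y) = (\<Sum>a\<in>J. (d * lam a * c a) * v a x)" if "x < n" for x
  proof -
    have "(\<Sum>y<n. adj E x y * z y) = (\<Sum>a\<in>J. c a * (\<Sum>y<n. adj E x y * v a y))"
      unfolding z_def by (simp add: sum_distrib_left, subst sum.swap) (simp add: algebra_simps)
    also have "\<dots> = (\<Sum>a\<in>J. c a * (d * (1 - lam a) * v a x))"
      using that J by (intro sum.cong refl) (auto simp: eigen subset_eq)
    finally show ?thesis unfolding z_def
      by (simp add: sum_distrib_left sum_subtractf[symmetric] algebra_simps)
  qed
  then have "energy z = 2 * (\<Sum>x<n. z x * (\<Sum>a\<in>J. (d * lam a * c a) * v a x))"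
    by (simp add: energy_eq)
  also have "\<dots> = 2 * (\<Sum>a\<in>J. c a * (d * lam a * c a))"
    unfolding z_def by (simp only: inner_combination[OF J])
  finally show ?thesis unfolding z_def by (simp add: sum_distrib_left power2_eq_square algebra_simps)
qed

lemma expansion:
  assumes "x < n"
  shows "z x = (\<Sum>a<n. (\<Sum>y<n. z y * v a y) * v a x)"
proof -
  have "(\<Sum>a<n. (\<Sum>y<n. z y * v a y) * v a x) = (\<Sum>y<n. z y * (\<Sum>a<n. v a y * v a x))"
    by (simp add: sum_distrib_left sum_distrib_right, subst sum.swap) (simp add: algebra_simps)
  also have "\<dots> = (\<Sum>y<n. z y * (if y = x then 1 else 0))"
    using assms by (intro sum.cong refl) (auto simp: complete)
  also have "\<dots> = z x" using assms by (simp add: if_distrib sum.delta cong: if_cong)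
  finally show ?thesis by simp
qed

lemma energy_cong: "(\<And>x. x < n \<Longrightarrow> z x = z' x) \<Longrightarrow> energy z = energy z'"
  unfolding energy_def by (intro sum.cong refl) simp

lemma lam_nonneg: "0 \<le> lam a" and lam_le_2: "lam a \<le> 2" if "a < n"
proof -
  have e: "energy (\<lambda>x. \<Sum>b\<in>{a}. 1 * v b x) = 2 * d * lam a"
    using energy_combination[of "{a}" "\<lambda>_. 1"] that by simp
  have s: "(\<Sum>x<n. (\<Sum>b\<in>{a}. 1 * v b x)\<^sup>2) = 1"
    using norm_combination[of "{a}" "\<lambda>_. 1"] that by simp
  have "0 \<le> 2 * d * lam a" using energy_nonneg[of "\<lambda>x. \<Sum>b\<in>{a}. 1 * v b x"] unfolding e .
  then show "0 \<le> lam a" using d_pos by (simp add: zero_le_mult_iff)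
  show "lam a \<le> 2" using energy_le[of "\<lambda>x. \<Sum>b\<in>{a}. 1 * v b x"] d_pos unfolding e s by simp
qed

end

locale clustered_spectral = regular_spectral +
  fixes k :: nat and \<phi> \<epsilon> \<beta> :: real and C :: "nat \<Rightarrow> nat set"
  assumes k2: "2 \<le> k" and \<phi>: "0 < \<phi>" "\<phi> < 1" and \<epsilon>: "0 < \<epsilon>" "\<epsilon> < 1" and ratio: "\<epsilon> / \<phi>\<^sup>2 \<le> 1 / 10 ^ 5"
    and C_ne: "i < k \<Longrightarrow> C i \<noteq> {}"
    and C_disj: "disjoint_family_on C {..<k}"
    and C_un: "(\<Union>i<k. C i) = {..<n}"
    and C_in: "i < k \<Longrightarrow> inner_conductance E (C i) \<ge> ereal \<phi>"
    and C_out: "i < k \<Longrightarrow> outer_conductance E (C i) {..<n} \<le> \<epsilon>"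
    and C_ratio: "i < k \<Longrightarrow> j < k \<Longrightarrow> real (card (C i)) / real (card (C j)) \<le> \<beta>"
begin

lemma eps_small: "\<epsilon> \<le> \<phi>\<^sup>2 / 10 ^ 5" "\<epsilon> \<le> 1 / 10 ^ 5"
proof -
  show 1: "\<epsilon> \<le> \<phi>\<^sup>2 / 10 ^ 5" using ratio \<phi> by (simp add: divide_simps split: if_splits)
  have "\<phi>\<^sup>2 \<le> 1" using \<phi> by (simp add: power_le_one)
  then show "\<epsilon> \<le> 1 / 10 ^ 5" using 1 by simp
qed

lemma C_sub: "i < k \<Longrightarrow> C i \<subseteq> {..<n}" using C_un by blast

lemma C_fin: "i < k \<Longrightarrow> finite (C i)" using C_sub finite_subset by blast

lemma sum_clusters: "(\<Sum>x<n. g x) = (\<Sum>i<k. \<Sum>x\<in>C i. g x)" for g :: "nat \<Rightarrow> real"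
  unfolding C_un[symmetric] using C_disj C_fin
  by (intro sum.UNION_disjoint) (auto simp: disjoint_family_on_def)

lemma card_cut: 
  assumes "finite S" "finite T"
  shows "real (card (cut_edges E S T)) = (\<Sum>x\<in>S. \<Sum>y\<in>T. adj E x y)"
proof -
  have "cut_edges E S T = {p\<in>S\<times>T. E (fst p) (snd p)}" by (auto simp: cut_edges_def)
  moreover have "(\<Sum>x\<in>S. \<Sum>y\<in>T. adj E x y) = (\<Sum>p\<in>S\<times>T. if E (fst p) (snd p) then 1 else 0)"
    unfolding sum.cartesian_product by (intro sum.cong refl) (auto simp: adj_def)
  moreover have "\<dots> = (\<Sum>p\<in>{p\<in>S\<times>T. E (fst p) (snd p)}. 1)"
    by (rule sum.inter_filter[symmetric]) (use assms in simp)
  ultimately show ?thesis by simp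
qed

lemma vol_eq: "S \<subseteq> {..<n} \<Longrightarrow> vol E S = d * card S"
  unfolding vol_def using reg by (simp add: regular_graph_def subset_eq)

text \<open>In a regular graph the volume condition of \<open>inner_conductance\<close> is a
  condition on cardinalities. The infimum is unfolded here once; later only this edge count is
  used.\<close>

lemma cluster_expansion:
  assumes i: "i < k" and S: "S \<subseteq> C i" "S \<noteq> {}" "2 * card S \<le> card (C i)"
  shows "\<phi> * d * card S \<le> (\<Sum>x\<in>S. \<Sum>y\<in>C i - S. adj E x y)"
proof -
  have Sn: "S \<subseteq> {..<n}" using S C_sub[OF i] by blast
  have finS: "finite S" using finite_subset[OF Sn] by simp
  have pos: "0 < vol E S" using Sn finS S d_pos by (simp add: vol_eq card_gt_0_iff)
  have "real (2 * card S) \<le> real (card (C i))" using S by linarith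
  then have "d * (real (2 * card S)) \<le> d * real (card (C i))" using d_pos by (intro mult_left_mono) auto
  then have "real (vol E S) \<le> real (vol E (C i)) / 2"
    using C_sub[OF i] Sn by (simp add: vol_eq)
  then have "S \<in> {S. S \<subseteq> C i \<and> 0 < vol E S \<and> real (vol E S) \<le> real (vol E (C i)) / 2}"
    using S pos by blast
  then have "inner_conductance E (C i) \<le> ereal (outer_conductance E S (C i))"
    unfolding inner_conductance_def by (rule INF_lower)
  then have "\<phi> \<le> outer_conductance E S (C i)" using C_in[OF i] by (metis order_trans ereal_less_eq(3))
  then have "\<phi> \<le> (\<Sum>x\<in>S. \<Sum>y\<in>C i - S. adj E x y) / (d * card S)"
    unfolding outer_conductance_def using Sn finS C_fin[OF i] by (simp add: card_cut vol_eq)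
  moreover have "0 < real d * card S" using pos Sn by (simp add: vol_eq flip: of_nat_mult)
  ultimately show ?thesis by (simp add: pos_le_divide_eq mult.assoc)
qed

lemma cluster_cut:
  assumes i: "i < k"
  shows "(\<Sum>x\<in>C i. \<Sum>y\<in>{..<n} - C i. adj E x y) \<le> \<epsilon> * d * card (C i)"
proof -
  have "0 < real d * card (C i)" using C_ne[OF i] C_fin[OF i] d_pos by (simp add: card_gt_0_iff)
  then show ?thesis using C_out[OF i] C_fin[OF i] C_sub[OF i]
    unfolding outer_conductance_def by (simp add: card_cut vol_eq pos_divide_le_eq mult.assoc)
qed

text \<open>All edges at the vertex of a singleton cluster leave the cluster, so its outer
  conductance would be 1, more than \<open>\<epsilon>\<close>. This excludes clusters whose inner
  conductance is vacuously infinite and is the source of \<open>4 \<le> n\<close>.\<close>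

lemma card_C_ge_2: assumes i: "i < k" shows "2 \<le> card (C i)"
proof (rule ccontr)
  assume "\<not> ?thesis"
  moreover have "card (C i) \<noteq> 0" using C_ne[OF i] C_fin[OF i] by simp
  ultimately have "card (C i) = 1" by linarith
  then obtain x where x: "C i = {x}" by (auto simp: card_1_singleton_iff)
  then have xn: "x < n" using C_sub[OF i] by auto
  have "real d = (\<Sum>y\<in>{..<n} - {x}. adj E x y) + adj E x x"
    using adj_row_sum[OF xn] xn by (simp add: sum.remove)
  then have "real d = (\<Sum>y\<in>{..<n} - {x}. adj E x y)" using E_irrefl by (simp add: adj_def)
  then have "real d \<le> \<epsilon> * d" using cluster_cut[OF i] x by simp
  then show False using \<epsilon> d_pos by simp
qed

lemma n_eq: "n = (\<Sum>i<k. card (C i))"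
proof -
  have "card (\<Union>i<k. C i) = (\<Sum>i<k. card (C i))"
    using C_disj C_fin by (intro card_UN_disjoint) (auto simp: disjoint_family_on_def)
  then show ?thesis by (simp add: C_un)
qed

lemma two_k_le_n: "2 * k \<le> n"
proof -
  have "(\<Sum>i<k. 2) \<le> (\<Sum>i<k. card (C i))" using card_C_ge_2 by (intro sum_mono) auto
  then show ?thesis by (simp add: n_eq[symmetric])
qed

lemma n4: "4 \<le> n" using two_k_le_n k2 by linarith

lemma beta_ge_1: "1 \<le> \<beta>"
  using C_ratio[of 0 0] card_C_ge_2[of 0] k2 by simp

text \<open>No cluster exceeds \<open>\<beta>\<close> times the size of \<open>C i\<close>, and
  \<open>k\<close> clusters cover all \<open>n\<close> vertices.\<close>

lemma card_C_ge: assumes i: "i < k" shows "real n / (\<beta> * k) \<le> card (C i)"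
proof -
  have "card (C j) \<le> \<beta> * card (C i)" if "j < k" for j
    using C_ratio[OF that i] card_C_ge_2[OF i] by (simp add: pos_divide_le_eq)
  then have "(\<Sum>j<k. real (card (C j))) \<le> (\<Sum>j<k. \<beta> * card (C i))" by (intro sum_mono) auto
  moreover have "real n = (\<Sum>j<k. real (card (C j)))" by (subst n_eq) simp
  ultimately have "real n \<le> k * (\<beta> * card (C i))" by simp
  then show ?thesis using beta_ge_1 k2 by (simp add: pos_divide_le_eq algebra_simps)
qed

text \<open>A nonzero test vector constant on clusters and orthogonal to the first
  \<open>k - 1\<close> eigenvectors exists, as \<open>k\<close> values face \<open>k - 1\<close>
  equations. Its Rayleigh quotient is at least \<open>lam (k - 1)\<close>, the largest of the first
  \<open>k\<close> eigenvalues when indices start at 0. It varies only along edges between clusters,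
  of which cluster \<open>i\<close> sends out at most
  \<open>\<epsilon> * d * card (C i)\<close>.\<close>

lemma lam_top: assumes "a < k" shows "lam a \<le> 2 * \<epsilon>"
proof -
  have kn: "k \<le> n" "k - 1 < n" using two_k_le_n k2 by auto
  obtain c where c: "\<exists>i\<in>{..<k}. c i \<noteq> 0" "\<forall>b\<in>{..<k-1}. (\<Sum>i\<in>{..<k}. (\<Sum>x\<in>C i. v b x) * c i) = 0"
    using homogeneous_system_nontrivial[of "{..<k-1}" "{..<k}" "\<lambda>b i. \<Sum>x\<in>C i. v b x"] k2 by auto
  define z where "z x = c (THE i. i < k \<and> x \<in> C i)" for x
  have z: "z x = c i" if "i < k" "x \<in> C i" for x i
  proof -
    have "(THE i. i < k \<and> x \<in> C i) = i"
      using that C_disj by (intro the_equality) (auto simp: disjoint_family_on_def)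
    then show ?thesis by (simp add: z_def)
  qed
  define h where "h b = (\<Sum>y<n. z y * v b y)" for b
  have h0: "h b = 0" if "b < k - 1" for b
  proof -
    have "h b = (\<Sum>i<k. \<Sum>x\<in>C i. z x * v b x)" unfolding h_def by (rule sum_clusters)
    also have "\<dots> = (\<Sum>i<k. (\<Sum>x\<in>C i. v b x) * c i)"
      by (intro sum.cong refl) (auto simp: sum_distrib_left z mult.commute)
    finally show ?thesis using c that by auto
  qed
  have zx: "z x = (\<Sum>b\<in>{..<n}. h b * v b x)" if "x < n" for x
    using expansion[OF that, of z] by (simp add: h_def)
  have norm: "(\<Sum>x<n. (z x)\<^sup>2) = (\<Sum>b<n. (h b)\<^sup>2)"
    using norm_combination[of "{..<n}" h] zx by simp
  have "energy z = 2 * d * (\<Sum>b<n. lam b * (h b)\<^sup>2)"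
    using energy_combination[of "{..<n}" h] energy_cong[OF zx] by simp
  moreover have "(\<Sum>b<n. lam b * (h b)\<^sup>2) \<ge> (\<Sum>b<n. lam (k-1) * (h b)\<^sup>2)"
  proof (rule sum_mono)
    fix b assume b: "b \<in> {..<n}"
    show "lam (k-1) * (h b)\<^sup>2 \<le> lam b * (h b)\<^sup>2"
      using h0[of b] lam_mono[of "k-1" b] b by (cases "b < k - 1") (auto intro: mult_right_mono)
  qed
  ultimately have lower: "2 * d * lam (k-1) * (\<Sum>x<n. (z x)\<^sup>2) \<le> energy z"
    using d_pos by (simp add: norm sum_distrib_left[symmetric])
  have sqsum: "(\<Sum>x<n. (z x)\<^sup>2) = (\<Sum>i<k. (c i)\<^sup>2 * card (C i))"
    unfolding sum_clusters by (intro sum.cong refl) (simp add: z)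
  \<comment> \<open>Pairs with equal values contribute nothing; elsewhere
    \<open>(a - b)^2 \<le> 2 * a^2 + 2 * b^2\<close> separates the two endpoints, and by symmetry
    both halves equal the sum charged to \<open>x\<close>.\<close>
  have "energy z \<le> (\<Sum>x<n. \<Sum>y<n. adj E x y * ((if z x = z y then 0 else 1) * (2 * (z x)\<^sup>2 + 2 * (z y)\<^sup>2)))"
    unfolding energy_def
  proof (intro sum_mono mult_left_mono)
    fix x y show "(z x - z y)\<^sup>2 \<le> (if z x = z y then 0 else 1) * (2 * (z x)\<^sup>2 + 2 * (z y)\<^sup>2)"
      using sum_squares_bound[of "z x" "- z y"] by (cases "z x = z y") (simp_all add: power2_diff)
  qed simp
  also have "\<dots> = 2 * (\<Sum>x<n. \<Sum>y<n. adj E x y * ((if z x = z y then 0 else 1) * (z x)\<^sup>2))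
      + 2 * (\<Sum>x<n. \<Sum>y<n. adj E x y * ((if z x = z y then 0 else 1) * (z y)\<^sup>2))"
    by (simp add: sum_distrib_left sum.distrib[symmetric] algebra_simps)
  also have "(\<Sum>x<n. \<Sum>y<n. adj E x y * ((if z x = z y then 0 else 1) * (z y)\<^sup>2))
      = (\<Sum>x<n. \<Sum>y<n. adj E x y * ((if z x = z y then 0 else 1) * (z x)\<^sup>2))"
    by (subst sum.swap) (intro sum.cong refl, auto simp: adj_sym)
  also have "(\<Sum>x<n. \<Sum>y<n. adj E x y * ((if z x = z y then 0 else 1) * (z x)\<^sup>2))
      \<le> (\<Sum>i<k. \<Sum>x\<in>C i. \<Sum>y\<in>{..<n} - C i. adj E x y * (z x)\<^sup>2)"
    unfolding sum_clusters[of "\<lambda>x. \<Sum>y<n. _ x y"]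
  proof (intro sum_mono)
    fix i x assume i: "i \<in> {..<k}" and x: "x \<in> C i"
    have "(\<Sum>y<n. adj E x y * ((if z x = z y then 0 else 1) * (z x)\<^sup>2))
      = (\<Sum>y\<in>{..<n} - C i. adj E x y * ((if z x = z y then 0 else 1) * (z x)\<^sup>2))"
      using i x z by (intro sum.mono_neutral_right) auto
    also have "\<dots> \<le> (\<Sum>y\<in>{..<n} - C i. adj E x y * (z x)\<^sup>2)"
      by (intro sum_mono mult_left_mono) auto
    finally show "(\<Sum>y<n. adj E x y * ((if z x = z y then 0 else 1) * (z x)\<^sup>2))
      \<le> (\<Sum>y\<in>{..<n} - C i. adj E x y * (z x)\<^sup>2)" .
  qed
  also have "(\<Sum>i<k. \<Sum>x\<in>C i. \<Sum>y\<in>{..<n} - C i. adj E x y * (z x)\<^sup>2)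
      = (\<Sum>i<k. (c i)\<^sup>2 * (\<Sum>x\<in>C i. \<Sum>y\<in>{..<n} - C i. adj E x y))"
    by (intro sum.cong refl) (simp add: z sum_distrib_left mult.commute)
  also have "\<dots> \<le> (\<Sum>i<k. (c i)\<^sup>2 * (\<epsilon> * d * card (C i)))"
    using cluster_cut by (intro sum_mono mult_left_mono) auto
  also have "\<dots> = \<epsilon> * d * (\<Sum>x<n. (z x)\<^sup>2)"
    by (simp add: sqsum sum_distrib_left algebra_simps)
  finally have upper: "energy z \<le> 4 * \<epsilon> * d * (\<Sum>x<n. (z x)\<^sup>2)" by simp
  obtain i where i: "i < k" "c i \<noteq> 0" using c by auto
  have "0 < (c i)\<^sup>2 * card (C i)" using i card_C_ge_2[of i] by simp
  also have "\<dots> \<le> (\<Sum>x<n. (z x)\<^sup>2)" unfolding sqsum using i by (intro member_le_sum) auto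
  finally have pos: "0 < 2 * real d * (\<Sum>x<n. (z x)\<^sup>2)" using d_pos by simp
  have "lam (k-1) * (2 * real d * (\<Sum>x<n. (z x)\<^sup>2)) \<le> (2 * \<epsilon>) * (2 * real d * (\<Sum>x<n. (z x)\<^sup>2))"
    using lower upper by (simp add: algebra_simps)
  then have "lam (k-1) \<le> 2 * \<epsilon>" using pos mult_le_cancel_right_pos by blast
  moreover have "lam a \<le> lam (k-1)" using assms kn by (intro lam_mono) auto
  ultimately show ?thesis by linarith
qed

text \<open>The dual test vector is a nonzero combination of the first \<open>k + 1\<close>
  eigenvectors that sums to zero over each of the \<open>k\<close> clusters. Its energy is at most
  \<open>2 * d * lam k\<close> times its squared norm; Cheeger's inequality inside every cluster,
  after the edges between clusters are dropped, bounds the energy from below.\<close>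

lemma lam_gap: assumes "k \<le> a" "a < n" shows "\<phi>\<^sup>2 / 2 \<le> lam a"
proof -
  have kn: "k < n" using assms by linarith
  obtain c where c: "\<exists>b\<in>{..k}. c b \<noteq> 0" "\<forall>i\<in>{..<k}. (\<Sum>b\<in>{..k}. (\<Sum>x\<in>C i. v b x) * c b) = 0"
    using homogeneous_system_nontrivial[of "{..<k}" "{..k}" "\<lambda>i b. \<Sum>x\<in>C i. v b x"] by auto
  define z where "z x = (\<Sum>b\<in>{..k}. c b * v b x)" for x
  have J: "{..k} \<subseteq> {..<n}" using kn by auto
  have norm: "(\<Sum>x<n. (z x)\<^sup>2) = (\<Sum>b\<le>k. (c b)\<^sup>2)"
    unfolding z_def by (rule norm_combination[OF J])
  have z0: "(\<Sum>x\<in>C i. z x) = 0" if "i < k" for i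
  proof -
    have "(\<Sum>x\<in>C i. z x) = (\<Sum>b\<in>{..k}. (\<Sum>x\<in>C i. v b x) * c b)"
      unfolding z_def by (subst sum.swap) (simp add: sum_distrib_left mult.commute)
    then show ?thesis using c that by auto
  qed
  have "energy z = 2 * d * (\<Sum>b\<le>k. lam b * (c b)\<^sup>2)"
    unfolding z_def by (rule energy_combination[OF J])
  also have "\<dots> \<le> 2 * d * (\<Sum>b\<le>k. lam k * (c b)\<^sup>2)"
    using kn by (intro mult_left_mono sum_mono mult_right_mono lam_mono) auto
  finally have upper: "energy z \<le> 2 * d * lam k * (\<Sum>x<n. (z x)\<^sup>2)"
    by (simp add: norm sum_distrib_left[symmetric] mult.assoc)
  have "\<phi>\<^sup>2 * d * (\<Sum>x<n. (z x)\<^sup>2) = (\<Sum>i<k. \<phi>\<^sup>2 * d * (\<Sum>x\<in>C i. (z x)\<^sup>2))"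
    by (simp add: sum_clusters sum_distrib_left)
  also have "\<dots> \<le> (\<Sum>i<k. \<Sum>x\<in>C i. \<Sum>y\<in>C i. adj E x y * (z x - z y)\<^sup>2)"
  proof (intro sum_mono cheeger_inequality)
    fix i x assume i: "i \<in> {..<k}" and x: "x \<in> C i"
    have "(\<Sum>y\<in>C i. adj E x y) \<le> (\<Sum>y<n. adj E x y)"
      using i C_sub by (intro sum_mono2) auto
    then show "(\<Sum>y\<in>C i. adj E x y) \<le> d" using adj_row_sum[of x] x C_sub[of i] i by auto
  qed (use C_fin E_sym \<phi> d_pos z0 cluster_expansion in auto)
  also have "\<dots> \<le> (\<Sum>i<k. \<Sum>x\<in>C i. \<Sum>y<n. adj E x y * (z x - z y)\<^sup>2)"
    using C_sub by (intro sum_mono sum_mono2) auto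
  also have "\<dots> = energy z" unfolding energy_def by (rule sum_clusters[symmetric])
  finally have lower: "\<phi>\<^sup>2 * d * (\<Sum>x<n. (z x)\<^sup>2) \<le> energy z" .
  obtain b where b: "b \<le> k" "c b \<noteq> 0" using c by auto
  have "0 < (c b)\<^sup>2" using b by simp
  also have "\<dots> \<le> (\<Sum>x<n. (z x)\<^sup>2)" unfolding norm using b by (intro member_le_sum) auto
  finally have pos: "0 < 2 * real d * (\<Sum>x<n. (z x)\<^sup>2)" using d_pos by simp
  have "(\<phi>\<^sup>2 / 2) * (2 * real d * (\<Sum>x<n. (z x)\<^sup>2)) \<le> lam k * (2 * real d * (\<Sum>x<n. (z x)\<^sup>2))"
    using lower upper by (simp add: algebra_simps)
  then have "\<phi>\<^sup>2 / 2 \<le> lam k" using pos mult_le_cancel_right_pos by blast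
  then show ?thesis using lam_mono[OF assms] by linarith
qed

end

section \<open>Sup-norm bound on the low eigenvectors\<close>

context clustered_spectral
begin

text \<open>This is \<open>\<nu>\<close> to the power \<open>r\<close>. All losses in powers of
  \<open>\<nu>\<close> are tracked through the additive parameter \<open>r\<close>.\<close>

definition pw :: "real \<Rightarrow> real" where
  "pw r = real n powr (r * \<epsilon> / \<phi>\<^sup>2)"

lemma pw_pos: "0 < pw r" using n4 by (simp add: pw_def)

lemma pw_add: "pw (r + s) = pw r * pw s"
  by (simp add: pw_def powr_add[symmetric] add_divide_distrib distrib_right)

lemma pw_mono: "r \<le> s \<Longrightarrow> pw r \<le> pw s"
  unfolding pw_def using n4 \<epsilon> \<phi>
  by (intro powr_mono divide_right_mono mult_right_mono) auto

lemma pw_0 [simp]: "pw 0 = 1" using n4 by (simp add: pw_def)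

lemma pw_ge_1: "0 \<le> r \<Longrightarrow> 1 \<le> pw r" using pw_mono[of 0 r] by simp

lemma pw_exp: "pw r = exp (r * (\<epsilon> / \<phi>\<^sup>2) * ln n)"
  using n4 by (simp add: pw_def powr_def)

text \<open>Each piece \<open>S \<inter> C i\<close> is at most half of its cluster and hence
  expands inside it; the edges counted there leave \<open>S\<close> as well, because their other
  endpoint lies in the same cluster.\<close>

lemma vertex_expansion:
  assumes S: "S \<subseteq> {..<n}" and small: "\<And>i. i < k \<Longrightarrow> 2 * card S \<le> card (C i)"
  shows "\<phi> * d * card S \<le> (\<Sum>x\<in>S. \<Sum>y\<in>{..<n} - S. adj E x y)"
proof -
  have fS: "finite S" using finite_subset[OF S] by simp
  have split: "(\<Sum>x\<in>S. g x) = (\<Sum>i<k. \<Sum>x\<in>S \<inter> C i. g x)" for g :: "nat \<Rightarrow> real"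
  proof -
    have "(\<Sum>x\<in>S. g x) = (\<Sum>x<n. if x \<in> S then g x else 0)"
      using S by (simp add: sum.If_cases Int_absorb1)
    also have "\<dots> = (\<Sum>i<k. \<Sum>x\<in>C i. if x \<in> S then g x else 0)" by (rule sum_clusters)
    also have "\<dots> = (\<Sum>i<k. \<Sum>x\<in>S \<inter> C i. g x)"
      by (rule sum.cong[OF refl]) (simp add: sum.If_cases C_fin Int_commute)
    finally show ?thesis .
  qed
  have "\<phi> * d * card S = (\<Sum>i<k. \<phi> * d * card (S \<inter> C i))"
    using split[of "\<lambda>_. \<phi> * d"] by (simp add: mult.commute)
  also have "\<dots> \<le> (\<Sum>i<k. \<Sum>x\<in>S \<inter> C i. \<Sum>y\<in>{..<n} - S. adj E x y)"
  proof (rule sum_mono)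
    fix i assume "i \<in> {..<k}" then have i: "i < k" by simp
    show "\<phi> * d * card (S \<inter> C i) \<le> (\<Sum>x\<in>S \<inter> C i. \<Sum>y\<in>{..<n} - S. adj E x y)"
    proof (cases "S \<inter> C i = {}")
      case False
      have "card (S \<inter> C i) \<le> card S" using fS by (intro card_mono) auto
      then have "2 * card (S \<inter> C i) \<le> card (C i)" using small[OF i] by linarith
      then have "\<phi> * d * card (S \<inter> C i) \<le> (\<Sum>x\<in>S \<inter> C i. \<Sum>y\<in>C i - (S \<inter> C i). adj E x y)"
        using False by (intro cluster_expansion[OF i]) auto
      also have "\<dots> \<le> (\<Sum>x\<in>S \<inter> C i. \<Sum>y\<in>{..<n} - S. adj E x y)"
        using C_sub[OF i] by (intro sum_mono sum_mono2) auto
      finally show ?thesis .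
    qed simp
  qed
  also have "\<dots> = (\<Sum>x\<in>S. \<Sum>y\<in>{..<n} - S. adj E x y)" by (rule split[symmetric])
  finally show ?thesis .
qed

text \<open>Summing the eigenvalue equation over a superlevel set \<open>S\<close> bounds the total drop of the
  eigenvector along the edges leaving \<open>S\<close>, so that most of these edges lead into a slightly lower
  superlevel set.\<close>

lemma superlevel_growth:
  fixes w :: "nat \<Rightarrow> real"
  assumes ev: "\<And>x. x < n \<Longrightarrow> (\<Sum>y<n. adj E x y * w y) = real d * (1 - l) * w x"
    and l: "0 \<le> l" "l \<le> 2 * \<epsilon>" and \<theta>: "0 < \<theta>" and q: "q = 8 * \<epsilon> / \<phi>"
    and S: "S = {x\<in>{..<n}. \<theta> \<le> w x}" and S': "S' = {x\<in>{..<n}. \<theta> * (1 - q) \<le> w x}"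
    and avg: "(\<Sum>x\<in>S. w x) \<le> 2 * \<theta> * card S"
    and small: "\<And>i. i < k \<Longrightarrow> 2 * card S \<le> card (C i)"
  shows "(1 + \<phi> / 2) * card S \<le> card S'"
proof -
  have q0: "0 < q" using q \<epsilon> \<phi> by simp
  have sub: "S \<subseteq> S'" using S S' \<theta> q0 by (auto simp: right_diff_distrib intro: order_trans[rotated])
  have fin: "finite S" "finite S'" "S \<subseteq> {..<n}" "S' \<subseteq> {..<n}" using S S' by auto
  \<comment> \<open>Summed over \<open>S\<close>, the eigenvalue equation gives the total drop
    \<open>d * l\<close> times the sum of \<open>w\<close>; pairs inside \<open>S\<close> cancel by
    antisymmetry, so the whole drop occurs across the boundary. The hypothesis \<open>avg\<close>
    turns the sum into a multiple of \<open>\<theta> * card S\<close>.\<close>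
  have tot: "(\<Sum>x\<in>S. \<Sum>y\<in>{..<n} - S. adj E x y * (w x - w y)) \<le> 4 * \<epsilon> * d * \<theta> * card S"
  proof -
    have row: "(\<Sum>y<n. adj E x y * (w x - w y)) = d * l * w x" if "x < n" for x
    proof -
      have "(\<Sum>y<n. adj E x y * (w x - w y)) = (\<Sum>y<n. adj E x y) * w x - (\<Sum>y<n. adj E x y * w y)"
        by (simp add: right_diff_distrib sum_subtractf sum_distrib_right)
      then show ?thesis unfolding adj_row_sum[OF that] ev[OF that] by (simp add: algebra_simps)
    qed
    have "(\<Sum>x\<in>S. \<Sum>y\<in>S. adj E x y * (w x - w y)) = (\<Sum>x\<in>S. \<Sum>y\<in>S. adj E y x * (w y - w x))"
      by (rule sum.swap)
    also have "\<dots> = - (\<Sum>x\<in>S. \<Sum>y\<in>S. adj E x y * (w x - w y))"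
      by (simp add: sum_negf[symmetric] adj_sym algebra_simps)
    finally have anti: "(\<Sum>x\<in>S. \<Sum>y\<in>S. adj E x y * (w x - w y)) = 0" by simp
    have "(\<Sum>x\<in>S. \<Sum>y\<in>{..<n} - S. adj E x y * (w x - w y))
        = (\<Sum>x\<in>S. (\<Sum>y<n. adj E x y * (w x - w y)) - (\<Sum>y\<in>S. adj E x y * (w x - w y)))"
      using fin by (intro sum.cong refl) (simp add: sum_diff)
    also have "\<dots> = (\<Sum>x\<in>S. d * l * w x)"
      using row fin by (simp add: sum_subtractf anti subset_eq)
    also have "\<dots> = d * l * (\<Sum>x\<in>S. w x)" by (simp add: sum_distrib_left)
    also have "\<dots> \<le> d * l * (2 * \<theta> * card S)" using avg l by (intro mult_left_mono) auto
    also have "\<dots> \<le> d * (2 * \<epsilon>) * (2 * \<theta> * card S)"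
      using l \<theta> by (intro mult_right_mono mult_left_mono) auto
    finally show ?thesis by (simp add: algebra_simps)
  qed
  have "q * \<theta> * (\<Sum>x\<in>S. \<Sum>y\<in>{..<n} - S'. adj E x y)
      = (\<Sum>x\<in>S. \<Sum>y\<in>{..<n} - S'. adj E x y * (q * \<theta>))"
    by (simp add: sum_distrib_left mult.commute)
  also have "\<dots> \<le> (\<Sum>x\<in>S. \<Sum>y\<in>{..<n} - S'. adj E x y * (w x - w y))"
    using S S' by (intro sum_mono mult_left_mono) (auto simp: algebra_simps)
  also have "\<dots> \<le> (\<Sum>x\<in>S. \<Sum>y\<in>{..<n} - S. adj E x y * (w x - w y))"
    using sub S by (intro sum_mono sum_mono2) auto
  also note tot
  \<comment> \<open>The value \<open>q = 8 * \<epsilon> / \<phi>\<close> is chosen so that edges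
    ending below the lower level make up at most half of the expansion
    \<open>\<phi> * d * card S\<close>. The other half ends in \<open>S' - S\<close>, where a vertex
    receives at most \<open>d\<close> edges.\<close>
  finally have "(q * \<theta>) * (\<Sum>x\<in>S. \<Sum>y\<in>{..<n} - S'. adj E x y) \<le> (q * \<theta>) * (\<phi> / 2 * d * card S)"
    using \<phi> by (simp add: q field_simps)
  then have far: "(\<Sum>x\<in>S. \<Sum>y\<in>{..<n} - S'. adj E x y) \<le> \<phi> / 2 * d * card S"
    using mult_le_cancel_left_pos[of "q * \<theta>"] q0 \<theta> by simp
  have "{..<n} - S = (S' - S) \<union> ({..<n} - S')" "(S' - S) \<inter> ({..<n} - S') = {}" using sub fin by auto
  then have "(\<Sum>x\<in>S. \<Sum>y\<in>{..<n} - S. adj E x y)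
      = (\<Sum>x\<in>S. \<Sum>y\<in>S' - S. adj E x y) + (\<Sum>x\<in>S. \<Sum>y\<in>{..<n} - S'. adj E x y)"
    using fin by (simp add: sum.union_disjoint sum.distrib)
  then have "\<phi> / 2 * d * card S \<le> (\<Sum>x\<in>S. \<Sum>y\<in>S' - S. adj E x y)"
    using vertex_expansion[OF fin(3) small] far by simp
  also have "\<dots> = (\<Sum>y\<in>S' - S. \<Sum>x\<in>S. adj E x y)" by (rule sum.swap)
  also have "\<dots> \<le> (\<Sum>y\<in>S' - S. \<Sum>x<n. adj E x y)"
    using fin by (intro sum_mono sum_mono2) auto
  also have "\<dots> = d * card (S' - S)"
    using fin by (simp add: adj_column_sum subset_eq)
  finally have "d * (\<phi> / 2 * card S) \<le> d * real (card (S' - S))" by (simp add: algebra_simps)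
  then have "\<phi> / 2 * card S \<le> card (S' - S)" using mult_le_cancel_left_pos[OF d_pos] by blast
  moreover have "real (card S') = card S + card (S' - S)"
    using sub fin card_mono[OF fin(2) sub] by (simp add: card_Diff_subset)
  ultimately show ?thesis by (simp add: algebra_simps)
qed

text \<open>Growth by \<open>1 + \<phi> / 2\<close> can last only about
  \<open>3 * ln n / \<phi>\<close> levels before some \<open>S i\<close> exceeds half of a cluster.
  Then at least \<open>n / (2 * \<beta> * k)\<close> entries are \<open>\<theta> i\<close> or more,
  so the unit norm bounds \<open>\<theta> i\<close>, and the maximum \<open>m\<close> exceeds
  \<open>\<theta> i\<close> only by a power of \<open>\<nu>\<close> and a factor near 1.\<close>

lemma eigenvector_max_bound:
  fixes w :: "nat \<Rightarrow> real"
  assumes ev: "\<And>x. x < n \<Longrightarrow> (\<Sum>y<n. adj E x y * w y) = real d * (1 - l) * w x"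
    and l: "0 \<le> l" "l \<le> 2 * \<epsilon>" and norm: "(\<Sum>x<n. (w x)\<^sup>2) = 1"
    and x0: "x0 < n" "0 < w x0" and max: "\<And>x. x < n \<Longrightarrow> w x \<le> w x0"
  shows "(w x0)\<^sup>2 \<le> 3 * \<beta> * k * pw 60 / n"
proof -
  define m where "m = w x0"
  define q where "q = 8 * \<epsilon> / \<phi>"
  define \<theta> where "\<theta> i = m * (1 - q) ^ i" for i :: nat
  define S where "S i = {x\<in>{..<n}. \<theta> i \<le> w x}" for i
  define small where "small i \<longleftrightarrow> (\<forall>j<k. 2 * card (S i) \<le> card (C j))" for i
  have eps: "\<epsilon> / \<phi> \<le> \<phi> / 100000" using eps_small(1) \<phi> by (simp add: power2_eq_square pos_divide_le_eq)
  have q: "0 < q" "q \<le> 8 / 100000 * \<phi>" "q \<le> 1 / 1000"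
  proof -
    have "q = 8 * (\<epsilon> / \<phi>)" by (simp add: q_def)
    then show "q \<le> 8 / 100000 * \<phi>" using eps by linarith
    then show "q \<le> 1 / 1000" using \<phi> by simp
  qed (use \<epsilon> \<phi> in \<open>simp add: q_def\<close>)
  have \<theta>pos: "0 < \<theta> i" for i using x0 q by (simp add: \<theta>_def m_def)
  have cardS: "card (S i) \<le> n" for i
    using card_mono[of "{..<n}" "S i"] by (auto simp: S_def)
  have finS: "finite (S i)" for i by (simp add: S_def)
  \<comment> \<open>The second conjunct is the hypothesis \<open>avg\<close> of the growth step and
    must be carried along. New vertices have entries below \<open>\<theta> i\<close>, and it
    survives the drop of the level because growth gives
    \<open>card (S i) \<le> (1 - 2 * q) * card (S (Suc i))\<close>.\<close>
  have P: "(1 + \<phi> / 2) ^ i \<le> card (S i) \<and> (\<Sum>x\<in>S i. w x) \<le> 2 * \<theta> i * card (S i)"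
    if "\<forall>j<i. small j" for i
    using that
  proof (induction i)
    case 0
    have "x0 \<in> S 0" using x0 by (simp add: S_def \<theta>_def m_def)
    then have "1 \<le> card (S 0)" using finS[of 0] by (metis One_nat_def Suc_leI card_gt_0_iff empty_iff)
    moreover have "(\<Sum>x\<in>S 0. w x) \<le> (\<Sum>x\<in>S 0. m)"
      using max by (intro sum_mono) (auto simp: S_def m_def)
    moreover have "\<theta> 0 = m" by (simp add: \<theta>_def)
    moreover have "0 \<le> m * card (S 0)" using x0 by (simp add: m_def)
    ultimately show ?case by (simp add: mult.commute mult.left_commute)
  next
    case (Suc i)
    then have IH: "(1 + \<phi> / 2) ^ i \<le> card (S i)" "(\<Sum>x\<in>S i. w x) \<le> 2 * \<theta> i * card (S i)" by auto
    have \<theta>S: "\<theta> (Suc i) = \<theta> i * (1 - q)" by (simp add: \<theta>_def)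
    have sm: "\<And>j. j < k \<Longrightarrow> 2 * card (S i) \<le> card (C j)" using Suc.prems by (simp add: small_def)
    have grow: "(1 + \<phi> / 2) * card (S i) \<le> card (S (Suc i))"
      by (rule superlevel_growth[OF ev l \<theta>pos q_def _ _ IH(2) sm]) (simp_all only: S_def \<theta>S)
    have "(1 + \<phi> / 2) ^ Suc i \<le> (1 + \<phi> / 2) * card (S i)"
      using IH(1) \<phi> by (simp add: mult_left_mono)
    with grow have 1: "(1 + \<phi> / 2) ^ Suc i \<le> card (S (Suc i))" by linarith
    have "\<theta> (Suc i) \<le> \<theta> i" unfolding \<theta>S using \<theta>pos[of i] q by (simp add: mult_le_cancel_left1)
    then have sub: "S i \<subseteq> S (Suc i)" by (auto simp: S_def)
    have "(\<Sum>x\<in>S (Suc i). w x) = (\<Sum>x\<in>S (Suc i) - S i. w x) + (\<Sum>x\<in>S i. w x)"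
      by (rule sum.subset_diff[OF sub finS])
    also have "(\<Sum>x\<in>S (Suc i) - S i. w x) \<le> (\<Sum>x\<in>S (Suc i) - S i. \<theta> i)"
      by (rule sum_mono) (auto simp: S_def)
    also have "(\<Sum>x\<in>S (Suc i) - S i. \<theta> i) = \<theta> i * (real (card (S (Suc i))) - card (S i))"
      using sub finS card_mono[OF finS sub] by (simp add: card_Diff_subset)
    finally have "(\<Sum>x\<in>S (Suc i). w x) \<le> \<theta> i * (real (card (S (Suc i))) + card (S i))"
      using IH(2) by (simp add: algebra_simps)
    also have "\<dots> \<le> \<theta> i * (2 * (1 - q) * card (S (Suc i)))"
    proof (rule mult_left_mono)
      have "(1 + \<phi> / 2) * (1 - 2 * q) \<ge> 1"
      proof -
        have "(1 + \<phi> / 2) * (1 - 2 * q) = 1 + \<phi> / 2 - 2 * q - \<phi> * q" by (simp add: algebra_simps)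
        moreover have "\<phi> * q \<le> 1 * q" using \<phi> q by (intro mult_right_mono) auto
        ultimately show ?thesis using q \<phi> by linarith
      qed
      then have "card (S i) \<le> ((1 + \<phi> / 2) * (1 - 2 * q)) * card (S i)"
        by (simp add: mult_le_cancel_right1)
      also have "\<dots> = (1 - 2 * q) * ((1 + \<phi> / 2) * card (S i))" by simp
      also have "\<dots> \<le> (1 - 2 * q) * card (S (Suc i))" using grow q by (intro mult_left_mono) auto
      finally show "real (card (S (Suc i))) + card (S i) \<le> 2 * (1 - q) * card (S (Suc i))"
        by (simp add: algebra_simps)
    qed (use \<theta>pos[of i] in simp)
    finally show ?case using 1 by (simp add: \<theta>S algebra_simps)
  qed
  have "\<exists>i. \<not> small i"
  proof (rule ccontr)
    assume "\<not> ?thesis"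
    then have "(1 + \<phi> / 2) ^ i \<le> n" for i using P[of i] cardS[of i] by (meson of_nat_mono order_trans)
    moreover obtain i where "real n < (1 + \<phi> / 2) ^ i" using real_arch_pow[of "1 + \<phi> / 2" "real n"] \<phi> by auto
    ultimately show False by (meson not_le)
  qed
  define i where "i = (LEAST i. \<not> small i)"
  have i: "\<not> small i" unfolding i_def using \<open>\<exists>i. \<not> small i\<close> by (rule LeastI_ex)
  have before: "\<forall>j<i. small j" using not_less_Least i_def by blast
  have i_le: "real i \<le> 1 + 3 * ln n / \<phi>"
  proof (cases i)
    case 0 then show ?thesis using \<phi> n4 by simp
  next
    case (Suc j)
    have "\<forall>j'<j. small j'" using before Suc by auto
    then have "(1 + \<phi> / 2) ^ j \<le> n" using P[of j] cardS[of j] by (meson of_nat_mono order_trans)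
    then have "ln ((1 + \<phi> / 2) ^ j) \<le> ln n" using \<phi> n4 by (subst ln_le_cancel_iff) auto
    then have jl: "j * ln (1 + \<phi> / 2) \<le> ln n" using \<phi> by (simp add: ln_realpow)
    have "ln (1 / (1 + \<phi> / 2)) \<le> 1 / (1 + \<phi> / 2) - 1" using \<phi> by (intro ln_le_minus_one) simp
    then have "(\<phi> / 2) / (1 + \<phi> / 2) \<le> ln (1 + \<phi> / 2)" using \<phi> by (simp add: ln_div field_simps)
    moreover have "\<phi> / 3 \<le> (\<phi> / 2) / (1 + \<phi> / 2)" using \<phi> by (simp add: field_simps)
    ultimately have "\<phi> / 3 \<le> ln (1 + \<phi> / 2)" by linarith
    then have "j * (\<phi> / 3) \<le> j * ln (1 + \<phi> / 2)" by (intro mult_left_mono) auto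
    with jl have "j * (\<phi> / 3) \<le> ln n" by linarith
    then show ?thesis using Suc \<phi> by (simp add: field_simps)
  qed
  obtain j where j: "j < k" "card (C j) < 2 * card (S i)" using i by (auto simp: small_def)
  have "card (S i) * (\<theta> i)\<^sup>2 = (\<Sum>x\<in>S i. (\<theta> i)\<^sup>2)" by simp
  also have "\<dots> \<le> (\<Sum>x\<in>S i. (w x)\<^sup>2)"
    using \<theta>pos[of i] by (intro sum_mono power_mono) (auto simp: S_def)
  also have "\<dots> \<le> (\<Sum>x<n. (w x)\<^sup>2)" by (intro sum_mono2) (auto simp: S_def)
  finally have "card (S i) * (\<theta> i)\<^sup>2 \<le> 1" using norm by simp
  moreover have "n / (\<beta> * k) / 2 * (\<theta> i)\<^sup>2 \<le> card (S i) * (\<theta> i)\<^sup>2"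
    using card_C_ge[OF j(1)] j(2) by (intro mult_right_mono) auto
  ultimately have main: "n / (\<beta> * k) / 2 * (\<theta> i)\<^sup>2 \<le> 1" by linarith
  have lnq: "- (1.1 * q) \<le> ln (1 - q)"
  proof -
    have "- q - 2 * q\<^sup>2 \<le> ln (1 - q)" using q by (intro ln_one_minus_pos_lower_bound) auto
    moreover have "q\<^sup>2 \<le> 1 / 1000 * q" unfolding power2_eq_square using q by (intro mult_right_mono) auto
    ultimately show ?thesis using q by simp
  qed
  have "(\<theta> i)\<^sup>2 = m\<^sup>2 * exp (2 * i * ln (1 - q))"
  proof -
    have "(1 - q) ^ i = exp (i * ln (1 - q))" using q by (simp add: exp_of_nat_mult)
    then show ?thesis by (simp add: \<theta>_def power_mult_distrib exp_double[symmetric] mult.assoc)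
  qed
  \<comment> \<open>Origin of the exponent 60: \<open>2 * 1.1 * q\<close> times
    \<open>1 + 3 * ln n / \<phi>\<close> is \<open>17.6 * \<epsilon> / \<phi>\<close>, which is
    below 1/1000, plus \<open>52.8 * (\<epsilon> / \<phi>^2) * ln n\<close>.\<close>
  moreover have "exp (2 * i * ln (1 - q)) \<ge> exp (- (1 / 1000) - 60 * (\<epsilon> / \<phi>\<^sup>2) * ln n)"
  proof -
    have "2 * i * ln (1 - q) \<ge> 2 * i * (- (1.1 * q))" using lnq by (intro mult_left_mono) auto
    moreover have "(2.2 * q) * i \<le> (2.2 * q) * (1 + 3 * ln n / \<phi>)" using i_le q by (intro mult_left_mono) auto
    moreover have "(2.2 * q) * (1 + 3 * ln n / \<phi>) = 17.6 * (\<epsilon> / \<phi>) + 52.8 * ((\<epsilon> / \<phi>\<^sup>2) * ln n)"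
      using \<phi> by (simp add: q_def power2_eq_square field_simps)
    moreover have "\<epsilon> / \<phi> \<le> 1 / 100000" using eps \<phi> by linarith
    moreover have "0 \<le> (\<epsilon> / \<phi>\<^sup>2) * ln n" using \<epsilon> n4 by simp
    ultimately show ?thesis by (simp add: algebra_simps)
  qed
  ultimately have "m\<^sup>2 * exp (- (1 / 1000) - 60 * (\<epsilon> / \<phi>\<^sup>2) * ln n) \<le> (\<theta> i)\<^sup>2"
    by (simp add: mult_left_mono)
  then have "n / (\<beta> * k) / 2 * (m\<^sup>2 * exp (- (1 / 1000) - 60 * (\<epsilon> / \<phi>\<^sup>2) * ln n)) \<le> n / (\<beta> * k) / 2 * (\<theta> i)\<^sup>2"
    using beta_ge_1 by (intro mult_left_mono) auto
  with main have "n / (\<beta> * k) / 2 * (m\<^sup>2 * exp (- (1 / 1000) - 60 * (\<epsilon> / \<phi>\<^sup>2) * ln n)) \<le> 1" by linarith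
  also have "exp (- (1 / 1000) - 60 * (\<epsilon> / \<phi>\<^sup>2) * ln n) = exp (- (1 / 1000)) / pw 60"
    by (simp add: pw_exp exp_diff)
  finally have "n * m\<^sup>2 * exp (- (1 / 1000)) \<le> 2 * \<beta> * k * pw 60"
    using beta_ge_1 k2 pw_pos[of 60] by (simp add: field_simps)
  moreover have "999 / 1000 \<le> exp (- (1 / 1000) :: real)" using exp_ge_add_one_self[of "- (1 / 1000) :: real"] by simp
  then have "n * m\<^sup>2 * (999 / 1000) \<le> n * m\<^sup>2 * exp (- (1 / 1000))" by (intro mult_left_mono) auto
  ultimately have "n * m\<^sup>2 * (999 / 1000) \<le> 2 * \<beta> * k * pw 60" by linarith
  moreover have "0 \<le> \<beta> * k * pw 60" using beta_ge_1 pw_pos[of 60] by simp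
  ultimately have "n * m\<^sup>2 \<le> 3 * \<beta> * k * pw 60" by (simp add: algebra_simps)
  then show ?thesis using n4 by (simp add: m_def pos_le_divide_eq mult.commute)
qed

text \<open>A change of sign makes the entry of largest modulus positive and thereby the maximum of
  the eigenvector.\<close>

lemma eigenvector_sup_bound:
  assumes a: "a < k" and x: "x < n"
  shows "(v a x)\<^sup>2 \<le> 3 * \<beta> * k * pw 60 / n"
proof -
  have an: "a < n" using a two_k_le_n by linarith
  have ne: "{..<n} \<noteq> {}" using x by auto
  have "Max ((\<lambda>x. \<bar>v a x\<bar>) ` {..<n}) \<in> (\<lambda>x. \<bar>v a x\<bar>) ` {..<n}" using ne by (intro Max_in) auto
  then obtain x0 where x0: "x0 < n" "\<bar>v a x0\<bar> = Max ((\<lambda>x. \<bar>v a x\<bar>) ` {..<n})" by auto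
  have max: "\<bar>v a y\<bar> \<le> \<bar>v a x0\<bar>" if "y < n" for y unfolding x0(2) using that by (intro Max_ge) auto
  define s where "s = (if 0 \<le> v a x0 then 1 else - 1 :: real)"
  have s2: "s\<^sup>2 = 1" by (simp add: s_def)
  have norm: "(\<Sum>y<n. (s * v a y)\<^sup>2) = 1"
    using orth[OF an an] unfolding power_mult_distrib s2 by (simp add: power2_eq_square)
  have sx0: "s * v a x0 = \<bar>v a x0\<bar>" by (simp add: s_def)
  have "v a x0 \<noteq> 0"
  proof
    assume "v a x0 = 0"
    then have "\<And>y. y < n \<Longrightarrow> v a y = 0" using max by fastforce
    then show False using norm by simp
  qed
  then have "(s * v a x0)\<^sup>2 \<le> 3 * \<beta> * k * pw 60 / n"
  proof (intro eigenvector_max_bound[where w = "\<lambda>y. s * v a y" and l = "lam a"])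
    show "(\<Sum>y<n. adj E z y * (s * v a y)) = real d * (1 - lam a) * (s * v a z)" if "z < n" for z
      using eigen[OF an that] by (simp add: sum_distrib_left[symmetric] mult.left_commute[of _ s])
    show "s * v a z \<le> s * v a x0" if "z < n" for z
      unfolding sx0 using max[OF that] by (auto simp: s_def)
    show "0 < s * v a x0" unfolding sx0 using \<open>v a x0 \<noteq> 0\<close> by simp
  qed (use norm x0 lam_nonneg[OF an] lam_top[OF a] in auto)
  moreover have "(v a x)\<^sup>2 \<le> (v a x0)\<^sup>2" using max[OF x] by (simp add: abs_le_square_iff)
  moreover have "(s * v a x0)\<^sup>2 = (v a x0)\<^sup>2" by (simp add: sx0)
  ultimately show ?thesis by simp
qed

text \<open>Bound on the squared norm of an embedded vertex, the sup-norm bound summed over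
  \<open>k\<close> coordinates.\<close>

definition Fb :: real where "Fb = 3 * \<beta> * real k ^ 2 * pw 60 / n"

lemma embedding_norm_bound:
  assumes x: "x < n"
  shows "(\<Sum>a<k. (v a x)\<^sup>2) \<le> Fb" "(\<Sum>a<k. (v a x)\<^sup>2) \<le> 1"
proof -
  have "(\<Sum>a<k. (v a x)\<^sup>2) \<le> (\<Sum>a<k. 3 * \<beta> * k * pw 60 / n)"
    using x by (intro sum_mono eigenvector_sup_bound) auto
  then show "(\<Sum>a<k. (v a x)\<^sup>2) \<le> Fb" by (simp add: Fb_def power2_eq_square algebra_simps)
  have "(\<Sum>a<k. (v a x)\<^sup>2) \<le> (\<Sum>a<n. (v a x)\<^sup>2)"
    using two_k_le_n by (intro sum_mono2) auto
  also have "\<dots> = 1" using complete[OF x x] by (simp add: power2_eq_square)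
  finally show "(\<Sum>a<k. (v a x)\<^sup>2) \<le> 1" .
qed

end

section \<open>Perturbation of the truncated inverse square\<close>

text \<open>Vectors are functions of which only the values below \<open>m\<close> count, which keeps
  the perturbation argument free of carriers.\<close>

abbreviation nrm :: "nat \<Rightarrow> (nat \<Rightarrow> real) \<Rightarrow> real" where
  "nrm m x \<equiv> L2_set x {..<m}"

definition dot :: "nat \<Rightarrow> (nat \<Rightarrow> real) \<Rightarrow> (nat \<Rightarrow> real) \<Rightarrow> real" where
  "dot m x y = (\<Sum>i<m. x i * y i)"

lemma dot_self: "dot m x x = (nrm m x)\<^sup>2"
  by (simp add: dot_def L2_set_def power2_eq_square[symmetric] sum_nonneg)

lemma dot_le: "\<bar>dot m x y\<bar> \<le> nrm m x * nrm m y"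
proof -
  have "\<bar>dot m x y\<bar> \<le> (\<Sum>i<m. \<bar>x i\<bar> * \<bar>y i\<bar>)"
    unfolding dot_def by (rule order_trans[OF sum_abs]) (simp add: abs_mult)
  also have "\<dots> \<le> nrm m x * nrm m y" by (rule L2_set_mult_ineq)
  finally show ?thesis .
qed

lemma dot_add_left: "dot m (\<lambda>i. x i + y i) z = dot m x z + dot m y z"
  by (simp add: dot_def distrib_right sum.distrib)

lemma dot_add_right: "dot m z (\<lambda>i. x i + y i) = dot m z x + dot m z y"
  by (simp add: dot_def distrib_left sum.distrib)

lemma dot_commute: "dot m x y = dot m y x"
  by (simp add: dot_def mult.commute)

lemma nrm_nonneg: "0 \<le> nrm m x" by simp

lemma nrm_mono_abs: "(\<And>i. i < m \<Longrightarrow> \<bar>x i\<bar> \<le> \<bar>y i\<bar>) \<Longrightarrow> nrm m x \<le> nrm m y"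
  unfolding L2_set_def by (intro real_sqrt_le_mono sum_mono) (simp add: abs_le_square_iff)

lemma nrm_scale: "0 \<le> c \<Longrightarrow> nrm m (\<lambda>i. c * x i) = c * nrm m x"
  by (rule L2_set_right_distrib[symmetric])

lemma nrm_abs: "nrm m (\<lambda>i. \<bar>x i\<bar>) = nrm m x"
  by (simp add: L2_set_def)

lemma nrm_le_const:
  assumes "\<And>i. i < m \<Longrightarrow> \<bar>x i\<bar> \<le> c" "0 \<le> c"
  shows "nrm m x \<le> sqrt m * c"
proof -
  have "nrm m x \<le> nrm m (\<lambda>_. c)" using assms by (intro nrm_mono_abs) auto
  also have "\<dots> = sqrt m * c" using assms(2) by (simp add: L2_set_def real_sqrt_mult)
  finally show ?thesis .
qed

text \<open>Sampling yields entrywise bounds. By Cauchy-Schwarz in each row, entries of size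
  \<open>c / m\<close> make an operator of norm at most \<open>c\<close>; this fixes the scaling
  \<open>\<delta> / k\<close> and \<open>\<eta> / s\<close> below.\<close>

lemma nrm_matvec_le:
  assumes K: "\<And>i j. i < m \<Longrightarrow> j < m \<Longrightarrow> \<bar>K i j\<bar> \<le> c / m" and c: "0 \<le> c"
  shows "nrm m (\<lambda>i. \<Sum>j<m. K i j * y j) \<le> c * nrm m y"
proof (cases "m = 0")
  case True then show ?thesis by simp
next
  case False
  have "\<bar>\<Sum>j<m. K i j * y j\<bar> \<le> c / sqrt m * nrm m y" if "i < m" for i
  proof -
    have "\<bar>\<Sum>j<m. K i j * y j\<bar> \<le> nrm m (K i) * nrm m y" using dot_le[of m "K i" y] by (simp add: dot_def)
    also have "nrm m (K i) \<le> sqrt m * (c / m)" using K that c by (intro nrm_le_const) auto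
    also have "sqrt m * (c / m) = c / sqrt m" using False by (simp add: field_simps)
    finally show ?thesis by (simp add: mult_right_mono)
  qed
  then have "nrm m (\<lambda>i. \<Sum>j<m. K i j * y j) \<le> sqrt m * (c / sqrt m * nrm m y)"
    using c by (intro nrm_le_const) auto
  also have "\<dots> = c * nrm m y" using False by simp
  finally show ?thesis .
qed

text \<open>\<open>A\<close> is nearly an isometry, with error \<open>\<delta>\<close>;
  \<open>G\<close> is \<open>A D2 A^T\<close> plus noise of norm at most \<open>\<eta>\<close>;
  \<open>W\<close> and \<open>\<sigma>\<close> form an ordered spectral decomposition of
  \<open>G\<close>. The noise is at most a twentieth of \<open>\<mu>\<close>, the lower bound of the
  retained spectrum, so that the first \<open>k\<close> eigenvalues of \<open>G\<close> separate
  from the rest.\<close>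

locale perturbed_low_rank =
  fixes s k :: nat and A :: "nat \<Rightarrow> nat \<Rightarrow> real" and D2 :: "nat \<Rightarrow> real"
    and G W :: "nat \<Rightarrow> nat \<Rightarrow> real" and \<sigma> :: "nat \<Rightarrow> real" and \<delta> \<eta> \<mu> :: real
  assumes k1: "1 \<le> k" and ks: "k \<le> s"
    and gram: "\<And>a b. a < k \<Longrightarrow> b < k \<Longrightarrow> \<bar>(\<Sum>j<s. A j a * A j b) - (if a = b then 1 else 0)\<bar> \<le> \<delta> / k"
    and \<delta>: "0 \<le> \<delta>" "\<delta> \<le> 1 / 100"
    and D2: "\<And>a. a < k \<Longrightarrow> \<mu> \<le> D2 a" and \<mu>: "0 < \<mu>"
    and noise: "\<And>i j. i < s \<Longrightarrow> j < s \<Longrightarrow> \<bar>G i j - (\<Sum>a<k. A i a * D2 a * A j a)\<bar> \<le> \<eta> / s"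
    and \<eta>: "0 \<le> \<eta>" "\<eta> \<le> \<mu> / 20"
    and W_cols: "\<And>l l'. l < s \<Longrightarrow> l' < s \<Longrightarrow> (\<Sum>j<s. W j l * W j l') = (if l = l' then 1 else 0)"
    and W_rows: "\<And>i j. i < s \<Longrightarrow> j < s \<Longrightarrow> (\<Sum>l<s. W i l * W j l) = (if i = j then 1 else 0)"
    and G_eq: "\<And>i j. i < s \<Longrightarrow> j < s \<Longrightarrow> G i j = (\<Sum>l<s. W i l * \<sigma> l * W j l)"
    and \<sigma>_mono: "\<And>i j. i \<le> j \<Longrightarrow> j < s \<Longrightarrow> \<sigma> j \<le> \<sigma> i"
begin

definition mulA :: "(nat \<Rightarrow> real) \<Rightarrow> nat \<Rightarrow> real" where "mulA y i = (\<Sum>a<k. A i a * y a)"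
definition tA :: "(nat \<Rightarrow> real) \<Rightarrow> nat \<Rightarrow> real" where "tA x a = (\<Sum>i<s. A i a * x i)"
definition N :: "nat \<Rightarrow> nat \<Rightarrow> real" where "N i j = G i j - (\<Sum>a<k. A i a * D2 a * A j a)"
definition mulG :: "(nat \<Rightarrow> real) \<Rightarrow> nat \<Rightarrow> real" where "mulG x i = (\<Sum>j<s. G i j * x j)"
definition mulN :: "(nat \<Rightarrow> real) \<Rightarrow> nat \<Rightarrow> real" where "mulN x i = (\<Sum>j<s. N i j * x j)"
definition hat :: "(nat \<Rightarrow> real) \<Rightarrow> nat \<Rightarrow> real" where "hat x l = (\<Sum>i<s. W i l * x i)"

lemma mulA_adjoint: "dot s (mulA y) x = dot k y (tA x)"
  unfolding dot_def mulA_def tA_def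
  by (simp add: sum_distrib_left sum_distrib_right, subst sum.swap) (simp add: algebra_simps)

lemma mulG_split: "mulG x i = mulA (\<lambda>a. D2 a * tA x a) i + mulN x i"
proof -
  have "mulA (\<lambda>a. D2 a * tA x a) i = (\<Sum>a<k. \<Sum>j<s. A i a * D2 a * A j a * x j)"
    unfolding mulA_def tA_def by (simp add: sum_distrib_left algebra_simps)
  also have "\<dots> = (\<Sum>j<s. (\<Sum>a<k. A i a * D2 a * A j a) * x j)"
    by (subst sum.swap) (simp add: sum_distrib_right)
  finally show ?thesis unfolding mulG_def mulN_def N_def
    by (simp add: left_diff_distrib sum_subtractf)
qed

lemma mulN_bound: "nrm s (mulN x) \<le> \<eta> * nrm s x"
  unfolding mulN_def using noise \<eta> by (intro nrm_matvec_le) (auto simp: N_def)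

lemma gram_apply: "tA (mulA y) a = (\<Sum>b<k. (\<Sum>j<s. A j a * A j b) * y b)"
  unfolding tA_def mulA_def
  by (simp add: sum_distrib_left sum_distrib_right, subst sum.swap) (simp add: algebra_simps)

lemma gram_near_id: "nrm k (\<lambda>a. tA (mulA y) a - y a) \<le> \<delta> * nrm k y"
proof -
  have eq: "tA (mulA y) a - y a = (\<Sum>b<k. ((\<Sum>j<s. A j a * A j b) - (if a = b then 1 else 0)) * y b)"
    if "a < k" for a
    unfolding gram_apply left_diff_distrib sum_subtractf using that
    by (simp add: if_distribR if_distrib[of "\<lambda>t. t * (_::real)"] sum.delta cong: if_cong)
  have "nrm k (\<lambda>a. tA (mulA y) a - y a)
      = nrm k (\<lambda>a. \<Sum>b<k. ((\<Sum>j<s. A j a * A j b) - (if a = b then 1 else 0)) * y b)"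
    by (rule L2_set_cong) (auto simp: eq)
  also have "\<dots> \<le> \<delta> * nrm k y" using gram \<delta> by (intro nrm_matvec_le) auto
  finally show ?thesis .
qed

lemma norm_mulA_sq: "(nrm s (mulA y))\<^sup>2 = dot k y (tA (mulA y))"
  using mulA_adjoint[of y "mulA y"] by (simp add: dot_self)

lemma coercive: "(1 - \<delta>) * (nrm k y)\<^sup>2 \<le> (nrm s (mulA y))\<^sup>2"
proof -
  have "dot k y (tA (mulA y)) = dot k y y + dot k y (\<lambda>a. tA (mulA y) a - y a)"
    by (simp add: dot_add_right[symmetric])
  moreover have "\<bar>dot k y (\<lambda>a. tA (mulA y) a - y a)\<bar> \<le> nrm k y * (\<delta> * nrm k y)"
    by (rule order_trans[OF dot_le]) (intro mult_left_mono gram_near_id, simp)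
  ultimately show ?thesis unfolding norm_mulA_sq by (simp add: dot_self power2_eq_square algebra_simps)
qed

text \<open>A kernel vector of the \<open>k\<close> by \<open>k + 1\<close> matrix formed by
  \<open>A^T A\<close> and the extra column \<open>- f\<close> solves the system after division by
  its last entry. That entry is nonzero because \<open>coercive\<close> makes \<open>A^T A\<close>
  injective.\<close>

lemma gram_solve: "\<exists>w. \<forall>a<k. tA (mulA w) a = f a"
proof -
  define K where "K a b = (if b < k then (\<Sum>j<s. A j a * A j b) else - f a)" for a b
  obtain c where c: "\<exists>j\<in>{..k}. c j \<noteq> 0" "\<forall>i\<in>{..<k}. (\<Sum>j\<in>{..k}. K i j * c j) = 0"
    using homogeneous_system_nontrivial[of "{..<k}" "{..k}" K] by auto
  have eq: "tA (mulA c) a = f a * c k" if "a < k" for a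
  proof -
    have "(\<Sum>j\<in>{..k}. K a j * c j) = (\<Sum>j<k. K a j * c j) + K a k * c k"
      by (simp add: lessThan_Suc_atMost[symmetric])
    moreover have "(\<Sum>j<k. K a j * c j) = tA (mulA c) a"
      unfolding gram_apply by (rule sum.cong) (auto simp: K_def)
    ultimately show ?thesis using c(2) that by (auto simp: K_def)
  qed
  have "c k \<noteq> 0"
  proof
    assume ck: "c k = 0"
    have "dot k c (tA (mulA c)) = 0" unfolding dot_def using eq ck by simp
    then have "(1 - \<delta>) * (nrm k c)\<^sup>2 \<le> 0" using coercive[of c] norm_mulA_sq[of c] by simp
    then have "nrm k c = 0" using \<delta> by (simp add: mult_le_0_iff)
    then have "\<forall>a<k. c a = 0" by (simp add: L2_set_eq_0_iff)
    then show False using c(1) ck by (metis atMost_iff le_neq_implies_less)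
  qed
  have "tA (mulA (\<lambda>b. c b / c k)) a = tA (mulA c) a / c k" for a
    unfolding gram_apply by (simp add: sum_divide_distrib)
  then show ?thesis using eq \<open>c k \<noteq> 0\<close> by (intro exI[of _ "\<lambda>b. c b / c k"]) auto
qed

text \<open>Both bounds come from \<open>|A w|^2 = <w, f>\<close>. Coercivity gives
  \<open>|w| \<le> 100/99 * |f|\<close>, and the image \<open>A w\<close> needs only the square root
  of that factor.\<close>

lemma gram_solution_bounds:
  assumes w: "\<forall>a<k. tA (mulA w) a = f a"
  shows "nrm k w \<le> (51 / 50) * nrm k f" "nrm s (mulA w) \<le> (101 / 100) * nrm k f"
proof -
  have "(nrm s (mulA w))\<^sup>2 = dot k w f" unfolding norm_mulA_sq unfolding dot_def using w by simp
  then have sq: "(nrm s (mulA w))\<^sup>2 \<le> nrm k w * nrm k f" using dot_le[of k w f] by linarith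
  then have "(1 - \<delta>) * (nrm k w)\<^sup>2 \<le> nrm k w * nrm k f" using coercive[of w] by linarith
  moreover have "(99 / 100) * (nrm k w)\<^sup>2 \<le> (1 - \<delta>) * (nrm k w)\<^sup>2" using \<delta> by (intro mult_right_mono) auto
  ultimately have le: "(99 / 100) * nrm k w * nrm k w \<le> nrm k f * nrm k w"
    by (simp add: power2_eq_square algebra_simps)
  have 1: "(99 / 100) * nrm k w \<le> nrm k f"
  proof (cases "nrm k w = 0")
    case True then show ?thesis by simp
  next
    case False
    then have "0 < nrm k w" using nrm_nonneg[of w k] by linarith
    then show ?thesis using le mult_le_cancel_right_pos by blast
  qed
  then show "nrm k w \<le> (51 / 50) * nrm k f" using nrm_nonneg[of f k] by linarith
  have "(nrm s (mulA w))\<^sup>2 \<le> (100 / 99 * nrm k f) * nrm k f"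
    using sq 1 mult_right_mono[of "nrm k w" "100 / 99 * nrm k f" "nrm k f"] nrm_nonneg[of f k] by linarith
  also have "\<dots> \<le> ((101 / 100) * nrm k f)\<^sup>2" by (simp add: power2_eq_square mult_right_mono)
  finally show "nrm s (mulA w) \<le> (101 / 100) * nrm k f" by (rule power2_le_imp_le) simp
qed

section \<open>Spectrum of the noisy Gram matrix and the truncated inverse\<close>

lemma parseval: "dot s x y = dot s (hat x) (hat y)"
proof -
  have "dot s (hat x) (hat y) = (\<Sum>l<s. \<Sum>i<s. \<Sum>j<s. x i * y j * (W i l * W j l))"
    unfolding dot_def hat_def by (simp add: sum_product algebra_simps)
  also have "\<dots> = (\<Sum>i<s. \<Sum>j<s. x i * y j * (\<Sum>l<s. W i l * W j l))"
    by (subst sum.swap, rule sum.cong[OF refl], subst sum.swap) (simp add: sum_distrib_left)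
  also have "\<dots> = (\<Sum>i<s. \<Sum>j<s. x i * y j * (if i = j then 1 else 0))"
    by (intro sum.cong refl) (simp add: W_rows)
  also have "\<dots> = dot s x y"
    unfolding dot_def by (rule sum.cong) (auto simp: if_distrib sum.delta cong: if_cong)
  finally show ?thesis by simp
qed

lemma nrm_hat: "nrm s (hat x) = nrm s x"
proof -
  have "(nrm s (hat x))\<^sup>2 = (nrm s x)\<^sup>2" using parseval[of x x] by (simp add: dot_self)
  then show ?thesis by (simp add: power2_eq_iff_nonneg)
qed

lemma hat_mulG: assumes "l < s" shows "hat (mulG x) l = \<sigma> l * hat x l"
proof -
  have "hat (mulG x) l = (\<Sum>i<s. \<Sum>j<s. \<Sum>l'<s. W i l * (W i l' * \<sigma> l' * W j l') * x j)"
    unfolding hat_def mulG_def by (simp add: sum_distrib_left sum_distrib_right G_eq algebra_simps)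
  also have "\<dots> = (\<Sum>j<s. \<Sum>l'<s. \<Sum>i<s. W i l * (W i l' * \<sigma> l' * W j l') * x j)"
    by (subst sum.swap, rule sum.cong[OF refl], rule sum.swap)
  also have "\<dots> = (\<Sum>j<s. \<Sum>l'<s. (\<Sum>i<s. W i l * W i l') * (\<sigma> l' * W j l' * x j))"
    by (intro sum.cong refl) (simp add: sum_distrib_left sum_distrib_right mult_ac)
  also have "\<dots> = (\<Sum>j<s. \<Sum>l'<s. (if l = l' then 1 else 0) * (\<sigma> l' * W j l' * x j))"
    using assms by (intro sum.cong refl) (simp add: W_cols)
  also have "\<dots> = (\<Sum>j<s. \<sigma> l * W j l * x j)"
    using assms by (intro sum.cong refl) (simp add: if_distrib[of "\<lambda>t. t * (_::real)"] sum.delta cong: if_cong)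
  finally show ?thesis by (simp add: hat_def sum_distrib_left algebra_simps)
qed

lemma quadratic_form: "dot s x (mulG x) = (\<Sum>l<s. \<sigma> l * (hat x l)\<^sup>2)"
  unfolding parseval[of x] dot_def[of s "hat x"]
  by (rule sum.cong) (auto simp: hat_mulG power2_eq_square)

lemma quadratic_form_split:
  "dot s x (mulG x) = (\<Sum>a<k. D2 a * (tA x a)\<^sup>2) + dot s x (mulN x)"
proof -
  have "dot s x (mulG x) = dot s (mulA (\<lambda>a. D2 a * tA x a)) x + dot s x (mulN x)"
    by (simp add: mulG_split[abs_def] dot_add_right dot_commute[of s x])
  also have "dot s (mulA (\<lambda>a. D2 a * tA x a)) x = (\<Sum>a<k. D2 a * (tA x a)\<^sup>2)"
    unfolding mulA_adjoint unfolding dot_def by (simp add: power2_eq_square mult.assoc)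
  finally show ?thesis .
qed

lemma noise_form: "\<bar>dot s x (mulN x)\<bar> \<le> \<eta> * (nrm s x)\<^sup>2"
  by (rule order_trans[OF dot_le])
     (use mult_left_mono[OF mulN_bound[of x] nrm_nonneg[of x s]] in \<open>simp add: power2_eq_square algebra_simps\<close>)

text \<open>Within the \<open>k\<close>-dimensional range of \<open>A\<close> there is an
  \<open>x = A y\<close> orthogonal to the first \<open>k - 1\<close> eigenvectors of
  \<open>G\<close>, so its quadratic form is at most \<open>\<sigma> (k-1)\<close> times its squared
  norm. From below, the form is at least \<open>\<mu> * |A^T x|^2\<close> minus the noise.\<close>

lemma sigma_lower: assumes "l < k" shows "9 / 10 * \<mu> \<le> \<sigma> l"
proof -
  obtain y where y: "\<exists>a\<in>{..<k}. y a \<noteq> 0"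
    "\<forall>l\<in>{..<k-1}. (\<Sum>a\<in>{..<k}. (\<Sum>i<s. W i l * A i a) * y a) = 0"
    using homogeneous_system_nontrivial[of "{..<k-1}" "{..<k}" "\<lambda>l a. \<Sum>i<s. W i l * A i a"] k1 by auto
  define x where "x = mulA y"
  have hat0: "hat x l = 0" if "l < k - 1" for l
  proof -
    have "hat x l = (\<Sum>a<k. (\<Sum>i<s. W i l * A i a) * y a)"
      unfolding hat_def x_def mulA_def
      by (simp add: sum_distrib_left sum_distrib_right, subst sum.swap) (simp add: algebra_simps)
    then show ?thesis using y(2) that by simp
  qed
  have ypos: "0 < nrm k y"
  proof -
    have "nrm k y \<noteq> 0" using y(1) by (auto simp: L2_set_eq_0_iff)
    then show ?thesis using nrm_nonneg[of y k] by linarith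
  qed
  have "0 < (1 - \<delta>) * (nrm k y)\<^sup>2" using ypos \<delta> by simp
  then have xpos: "0 < (nrm s x)\<^sup>2" using coercive[of y] unfolding x_def by linarith
  have "dot s x (mulG x) \<le> (\<Sum>l<s. \<sigma> (k-1) * (hat x l)\<^sup>2)"
    unfolding quadratic_form
  proof (rule sum_mono)
    fix l assume l: "l \<in> {..<s}"
    show "\<sigma> l * (hat x l)\<^sup>2 \<le> \<sigma> (k-1) * (hat x l)\<^sup>2"
      using hat0[of l] \<sigma>_mono[of "k-1" l] l by (cases "l < k - 1") (auto intro: mult_right_mono)
  qed
  also have "\<dots> = \<sigma> (k-1) * (nrm s x)\<^sup>2"
    using dot_self[of s "hat x"] by (simp add: sum_distrib_left[symmetric] dot_def power2_eq_square nrm_hat)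
  finally have upper: "dot s x (mulG x) \<le> \<sigma> (k-1) * (nrm s x)\<^sup>2" .
  define g where "g = (nrm k (tA x))\<^sup>2"
  have "(\<Sum>a<k. \<mu> * (tA x a)\<^sup>2) \<le> (\<Sum>a<k. D2 a * (tA x a)\<^sup>2)"
    using D2 by (intro sum_mono mult_right_mono) auto
  then have "\<mu> * g \<le> (\<Sum>a<k. D2 a * (tA x a)\<^sup>2)"
    unfolding g_def dot_self[symmetric] dot_def by (simp add: sum_distrib_left power2_eq_square)
  then have lower: "\<mu> * g - \<eta> * (nrm s x)\<^sup>2 \<le> dot s x (mulG x)"
    unfolding quadratic_form_split using noise_form[of x] by linarith
  \<comment> \<open>On the range of \<open>A\<close> the adjoint also nearly preserves norms:
    \<open>|x|^2 = <y, A^T x>\<close>, and coercivity bounds \<open>|y|\<close> by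
    \<open>|x|\<close>.\<close>
  have "(1 - \<delta>) * (nrm s x)\<^sup>2 \<le> g"
  proof -
    have "(nrm s x)\<^sup>2 \<le> nrm k y * nrm k (tA x)"
      using norm_mulA_sq[of y] dot_le[of k y "tA x"] unfolding x_def by linarith
    then have "((nrm s x)\<^sup>2)\<^sup>2 \<le> (nrm k y * nrm k (tA x))\<^sup>2" by (intro power_mono) auto
    then have "(1 - \<delta>) * ((nrm s x)\<^sup>2)\<^sup>2 \<le> (1 - \<delta>) * (nrm k y * nrm k (tA x))\<^sup>2"
      using \<delta> by (intro mult_left_mono) auto
    also have "\<dots> = ((1 - \<delta>) * (nrm k y)\<^sup>2) * g" by (simp add: g_def power_mult_distrib)
    also have "\<dots> \<le> (nrm s x)\<^sup>2 * g" using coercive[of y] by (intro mult_right_mono) (auto simp: x_def g_def)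
    finally have "(nrm s x)\<^sup>2 * ((1 - \<delta>) * (nrm s x)\<^sup>2) \<le> (nrm s x)\<^sup>2 * g"
      by (simp add: power2_eq_square[of "(nrm s x)\<^sup>2"] algebra_simps)
    then show ?thesis using xpos mult_le_cancel_left_pos by blast
  qed
  then have "\<mu> * ((1 - \<delta>) * (nrm s x)\<^sup>2) \<le> \<mu> * g" using \<mu> by simp
  then have "(\<mu> * (1 - \<delta>) - \<eta>) * (nrm s x)\<^sup>2 \<le> \<sigma> (k-1) * (nrm s x)\<^sup>2"
    using lower upper by (simp add: algebra_simps)
  then have "\<mu> * (1 - \<delta>) - \<eta> \<le> \<sigma> (k-1)" using xpos mult_le_cancel_right_pos by blast
  moreover have "\<mu> * (99 / 100) \<le> \<mu> * (1 - \<delta>)" using \<mu> \<delta> by simp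
  ultimately have "9 / 10 * \<mu> \<le> \<sigma> (k-1)" using \<eta> \<mu> by linarith
  moreover have "\<sigma> (k-1) \<le> \<sigma> l" using assms ks k1 by (intro \<sigma>_mono) auto
  ultimately show ?thesis by linarith
qed

text \<open>From below, the eigenvector itself is tested, as \<open>A D2 A^T\<close> is positive
  semidefinite. From above, some nonzero combination of the first \<open>k + 1\<close> eigenvectors
  is annihilated by \<open>A^T\<close>, so only noise remains in its quadratic form, which is at
  least \<open>\<sigma> k\<close> times its squared norm.\<close>

lemma sigma_tail: assumes "k \<le> l" "l < s" shows "\<bar>\<sigma> l\<bar> \<le> \<eta>"
proof -
  have hatW: "hat (\<lambda>i. W i l) l' = (if l' = l then 1 else 0)" if "l < s" "l' < s" for l l'
    using W_cols[OF that(2,1)] by (simp add: hat_def)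
  have "- \<eta> \<le> \<sigma> l"
  proof -
    define x where "x i = W i l" for i
    have "dot s x (mulG x) = (\<Sum>l'<s. \<sigma> l' * (if l' = l then 1 else 0)\<^sup>2)"
      unfolding quadratic_form by (rule sum.cong) (use hatW[OF assms(2)] in \<open>auto simp: x_def[abs_def]\<close>)
    also have "\<dots> = (\<Sum>l'<s. if l' = l then \<sigma> l' else 0)" by (rule sum.cong) auto
    also have "\<dots> = \<sigma> l" using assms by simp
    finally have "dot s x (mulG x) = \<sigma> l" .
    moreover have "0 \<le> (\<Sum>a<k. D2 a * (tA x a)\<^sup>2)"
      using D2 \<mu> by (intro sum_nonneg mult_nonneg_nonneg) (auto intro: order_trans[OF less_imp_le])
    moreover have "(nrm s x)\<^sup>2 = 1"
      using W_cols[OF assms(2) assms(2)] by (simp add: dot_self[symmetric] dot_def x_def)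
    ultimately show ?thesis using quadratic_form_split[of x] noise_form[of x] by simp
  qed
  moreover have "\<sigma> l \<le> \<eta>"
  proof -
    have ks': "k < s" using assms by linarith
    obtain c where c: "\<exists>j\<in>{..k}. c j \<noteq> 0"
      "\<forall>a\<in>{..<k}. (\<Sum>j\<in>{..k}. (\<Sum>i<s. A i a * W i j) * c j) = 0"
      using homogeneous_system_nontrivial[of "{..<k}" "{..k}" "\<lambda>a j. \<Sum>i<s. A i a * W i j"] by auto
    define x where "x i = (\<Sum>j\<le>k. c j * W i j)" for i
    have t0: "tA x a = 0" if "a < k" for a
    proof -
      have "tA x a = (\<Sum>j\<le>k. (\<Sum>i<s. A i a * W i j) * c j)"
        unfolding tA_def x_def
        by (simp add: sum_distrib_left sum_distrib_right, subst sum.swap) (simp add: algebra_simps)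
      then show ?thesis using c(2) that by simp
    qed
    have hatx: "hat x l' = (if l' \<le> k then c l' else 0)" if "l' < s" for l'
    proof -
      have "hat x l' = (\<Sum>j\<le>k. c j * (\<Sum>i<s. W i l' * W i j))"
        unfolding hat_def x_def
        by (simp add: sum_distrib_left, subst sum.swap) (simp add: algebra_simps)
      also have "\<dots> = (\<Sum>j\<le>k. c j * (if l' = j then 1 else 0))"
        using that ks' by (intro sum.cong refl) (simp add: W_cols)
      also have "\<dots> = (if l' \<le> k then c l' else 0)" by (simp add: if_distrib sum.delta cong: if_cong)
      finally show ?thesis .
    qed
    have nsq: "(nrm s x)\<^sup>2 = (\<Sum>l'<s. (hat x l')\<^sup>2)"
      using dot_self[of s "hat x"] by (simp add: dot_def power2_eq_square nrm_hat)
    obtain j where j: "j \<le> k" "c j \<noteq> 0" using c(1) by auto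
    have "0 < (hat x j)\<^sup>2" using hatx[of j] j ks' by simp
    also have "\<dots> \<le> (nrm s x)\<^sup>2" unfolding nsq using j ks' by (intro member_le_sum) auto
    finally have xpos: "0 < (nrm s x)\<^sup>2" .
    have "\<sigma> k * (nrm s x)\<^sup>2 = (\<Sum>l'<s. \<sigma> k * (hat x l')\<^sup>2)" by (simp add: nsq sum_distrib_left)
    also have "\<dots> \<le> dot s x (mulG x)" unfolding quadratic_form
    proof (rule sum_mono)
      fix l' assume l': "l' \<in> {..<s}"
      show "\<sigma> k * (hat x l')\<^sup>2 \<le> \<sigma> l' * (hat x l')\<^sup>2"
        using hatx[of l'] \<sigma>_mono[of l' k] ks' l' by (cases "l' \<le> k") (auto intro: mult_right_mono)
    qed
    also have "\<dots> \<le> \<eta> * (nrm s x)\<^sup>2"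
      unfolding quadratic_form_split using t0 noise_form[of x] by simp
    finally have "\<sigma> k \<le> \<eta>" using xpos mult_le_cancel_right_pos by blast
    moreover have "\<sigma> l \<le> \<sigma> k" using assms by (intro \<sigma>_mono) auto
    ultimately show ?thesis by linarith
  qed
  ultimately show ?thesis by linarith
qed

text \<open>For \<open>l < k\<close> the identity \<open>b = G \<omega> + r\<close> with
  \<open>r = e - N \<omega>\<close> gives the coordinate of \<open>\<omega>\<close> up to
  \<open>hat r l / \<sigma> l\<close>. For \<open>l \<ge> k\<close> the coordinate of
  \<open>\<omega>\<close> is discarded, so it must itself be small: \<open>\<omega>\<close> is again
  an approximate image, \<open>\<omega> = G \<zeta> - N \<zeta>\<close>, and both terms are of order
  \<open>\<eta> * |\<zeta>|\<close> in these coordinates.\<close>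

lemma coordinates_bound:
  assumes b: "\<And>i. i < s \<Longrightarrow> b i = mulA (\<lambda>a. D2 a * f a) i + e i"
    and f: "nrm k f \<le> F" and e: "nrm s e \<le> \<gamma>"
    and w: "\<forall>a<k. tA (mulA w) a = f a"
  shows "nrm s (\<lambda>l. (if l < k then hat b l / \<sigma> l else 0) - hat (mulA w) l) \<le> (4 * \<eta> * F + (6 / 5) * \<gamma>) / \<mu>"
proof -
  define \<omega> where "\<omega> = mulA w"
  have \<omega>_norm: "nrm s \<omega> \<le> (101 / 100) * F" using gram_solution_bounds[OF w] f unfolding \<omega>_def by linarith
  have w_norm: "nrm k w \<le> (51 / 50) * F" using gram_solution_bounds[OF w] f by linarith
  have F0: "0 \<le> F" using f nrm_nonneg[of f k] by linarith
  define r where "r i = e i + (-1) * mulN \<omega> i" for i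
  have r_norm: "nrm s r \<le> \<gamma> + (101 / 100) * \<eta> * F"
  proof -
    have "nrm s r \<le> nrm s e + nrm s (\<lambda>i. (-1) * mulN \<omega> i)" unfolding r_def by (rule L2_set_triangle_ineq)
    also have "nrm s (\<lambda>i. (-1) * mulN \<omega> i) = nrm s (mulN \<omega>)" by (simp add: L2_set_def)
    also have "nrm s (mulN \<omega>) \<le> \<eta> * ((101 / 100) * F)"
      using mulN_bound[of \<omega>] mult_left_mono[OF \<omega>_norm \<eta>(1)] by linarith
    finally show ?thesis using e by simp
  qed
  have "mulA (\<lambda>a. D2 a * f a) i = mulA (\<lambda>a. D2 a * tA \<omega> a) i" for i
    unfolding mulA_def \<omega>_def[unfolded mulA_def[abs_def]] using w by (intro sum.cong) (auto simp: \<omega>_def mulA_def[abs_def])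
  then have "b i = mulG \<omega> i + r i" if "i < s" for i
    unfolding b[OF that] mulG_split r_def by simp
  then have "hat b l = (\<Sum>i<s. W i l * (mulG \<omega> i + r i))" for l
    unfolding hat_def by simp
  then have hb: "hat b l = \<sigma> l * hat \<omega> l + hat r l" if "l < s" for l
    using hat_mulG[OF that, of \<omega>] by (simp add: hat_def distrib_left sum.distrib)
  \<comment> \<open>The choice of \<open>u\<close> makes \<open>D2\<close> times
    \<open>A^T \<zeta>\<close> equal to \<open>w\<close>, so the noiseless part of \<open>G\<close>
    maps \<open>\<zeta>\<close> to \<open>A w = \<omega>\<close>. Division by \<open>D2\<close>
    costs the factor \<open>1 / \<mu>\<close>.\<close>
  obtain u where u: "\<forall>a<k. tA (mulA u) a = w a / D2 a" using gram_solve[of "\<lambda>a. w a / D2 a"] by blast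
  define \<zeta> where "\<zeta> = mulA u"
  have D2pos: "0 < D2 a" if "a < k" for a using D2[OF that] \<mu> by linarith
  have "nrm k (\<lambda>a. w a / D2 a) \<le> nrm k (\<lambda>a. (1 / \<mu>) * w a)"
  proof (rule nrm_mono_abs)
    fix a assume a: "a < k"
    have "\<bar>w a\<bar> / D2 a \<le> \<bar>w a\<bar> / \<mu>" using D2[OF a] \<mu> by (intro divide_left_mono) auto
    then show "\<bar>w a / D2 a\<bar> \<le> \<bar>1 / \<mu> * w a\<bar>" using D2pos[OF a] \<mu> by (simp add: abs_mult)
  qed
  also have "\<dots> = nrm k w / \<mu>" using \<mu> by (subst nrm_scale) auto
  also have "\<dots> \<le> (51 / 50) * F / \<mu>" using w_norm \<mu> by (intro divide_right_mono) auto
  finally have "nrm s \<zeta> \<le> (101 / 100) * ((51 / 50) * F / \<mu>)"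
    using gram_solution_bounds(2)[OF u] unfolding \<zeta>_def by linarith
  then have \<zeta>_norm: "nrm s \<zeta> \<le> (26 / 25) * F / \<mu>" using F0 \<mu> by (simp add: field_simps)
  have "mulA (\<lambda>a. D2 a * tA \<zeta> a) i = \<omega> i" for i
    unfolding mulA_def \<omega>_def \<zeta>_def using u D2pos
    by (intro sum.cong refl) (force simp: mulA_def[abs_def])
  then have "\<omega> i = mulG \<zeta> i - mulN \<zeta> i" for i by (simp add: mulG_split)
  then have "hat \<omega> l = hat (mulG \<zeta>) l - hat (mulN \<zeta>) l" for l
    by (simp add: hat_def right_diff_distrib sum_subtractf)
  then have h\<omega>: "hat \<omega> l = \<sigma> l * hat \<zeta> l - hat (mulN \<zeta>) l" if "l < s" for l
    using hat_mulG[OF that] by simp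
  have "nrm s (\<lambda>l. (if l < k then hat b l / \<sigma> l else 0) - hat \<omega> l)
      \<le> nrm s (\<lambda>l. (1 / (9 / 10 * \<mu>)) * \<bar>hat r l\<bar> + (\<eta> * \<bar>hat \<zeta> l\<bar> + \<bar>hat (mulN \<zeta>) l\<bar>))"
  proof (rule nrm_mono_abs)
    fix l assume l: "l < s"
    have nn: "0 \<le> (1 / (9 / 10 * \<mu>)) * \<bar>hat r l\<bar>" "0 \<le> \<eta> * \<bar>hat \<zeta> l\<bar> + \<bar>hat (mulN \<zeta>) l\<bar>"
      using \<mu> \<eta> by auto
    show "\<bar>(if l < k then hat b l / \<sigma> l else 0) - hat \<omega> l\<bar>
        \<le> \<bar>(1 / (9 / 10 * \<mu>)) * \<bar>hat r l\<bar> + (\<eta> * \<bar>hat \<zeta> l\<bar> + \<bar>hat (mulN \<zeta>) l\<bar>)\<bar>"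
    proof (cases "l < k")
      case True
      have \<sigma>: "9 / 10 * \<mu> \<le> \<sigma> l" "0 < \<sigma> l" using sigma_lower[OF True] \<mu> by auto
      have "hat b l / \<sigma> l - hat \<omega> l = hat r l / \<sigma> l" using hb[OF l] \<sigma> by (simp add: field_simps)
      moreover have "\<bar>hat r l / \<sigma> l\<bar> \<le> \<bar>hat r l\<bar> / (9 / 10 * \<mu>)"
        using \<sigma> \<mu> by (simp add: abs_divide del: times_divide_eq_left) (intro divide_left_mono, auto)
      ultimately show ?thesis using True nn by simp
    next
      case False
      have "\<bar>\<sigma> l * hat \<zeta> l\<bar> \<le> \<eta> * \<bar>hat \<zeta> l\<bar>"
        unfolding abs_mult using sigma_tail[of l] l False by (intro mult_right_mono) auto
      then show ?thesis using False nn h\<omega>[OF l] by simp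
    qed
  qed
  also have "\<dots> \<le> nrm s (\<lambda>l. (1 / (9 / 10 * \<mu>)) * \<bar>hat r l\<bar>)
      + (nrm s (\<lambda>l. \<eta> * \<bar>hat \<zeta> l\<bar>) + nrm s (\<lambda>l. \<bar>hat (mulN \<zeta>) l\<bar>))"
    by (rule order_trans[OF L2_set_triangle_ineq]) (intro add_left_mono L2_set_triangle_ineq)
  also have "nrm s (\<lambda>l. (1 / (9 / 10 * \<mu>)) * \<bar>hat r l\<bar>) = (1 / (9 / 10 * \<mu>)) * nrm s r"
    using \<mu> by (subst nrm_scale) (auto simp: nrm_abs nrm_hat)
  also have "nrm s (\<lambda>l. \<eta> * \<bar>hat \<zeta> l\<bar>) = \<eta> * nrm s \<zeta>"
    using \<eta> by (subst nrm_scale) (auto simp: nrm_abs nrm_hat)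
  also have "nrm s (\<lambda>l. \<bar>hat (mulN \<zeta>) l\<bar>) = nrm s (mulN \<zeta>)" by (simp add: nrm_abs nrm_hat)
  also have "1 / (9 / 10 * \<mu>) * nrm s r + (\<eta> * nrm s \<zeta> + nrm s (mulN \<zeta>))
      \<le> 1 / (9 / 10 * \<mu>) * (\<gamma> + (101 / 100) * \<eta> * F) + (\<eta> * ((26 / 25) * F / \<mu>) + \<eta> * ((26 / 25) * F / \<mu>))"
    using r_norm \<zeta>_norm order_trans[OF mulN_bound mult_left_mono[OF \<zeta>_norm \<eta>(1)]] \<mu> \<eta>
    by (intro add_mono mult_left_mono) auto
  also have "\<dots> \<le> (4 * \<eta> * F + (6 / 5) * \<gamma>) / \<mu>"
  proof -
    have "0 \<le> \<eta> * F" using \<eta> F0 by simp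
    moreover have "0 \<le> \<gamma>" using e nrm_nonneg[of e s] by linarith
    ultimately have "0 \<le> \<gamma> * (\<mu> * 400) + F * (\<eta> * (\<mu> * 3590))"
      using \<mu> \<eta> F0 by simp
    then show ?thesis using \<mu> by (simp add: field_simps)
  qed
  finally show ?thesis by (simp add: \<omega>_def)
qed

text \<open>The power -2 is shared evenly: each query vector takes one factor
  \<open>1 / \<sigma> l\<close> and becomes the coordinate vector of its own \<open>\<omega>\<close>
  up to an error \<open>\<tau>\<close>. Three cross terms carry \<open>\<tau>\<close>; the term with
  \<open>\<delta>\<close> comes from replacing \<open>wx\<close> by \<open>fx\<close>.\<close>

theorem truncated_inverse_square:
  assumes bx: "\<And>i. i < s \<Longrightarrow> bx i = mulA (\<lambda>a. D2 a * fx a) i + ex i"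
    and b_y: "\<And>i. i < s \<Longrightarrow> b_y i = mulA (\<lambda>a. D2 a * fy a) i + ey i"
    and f: "nrm k fx \<le> F" "nrm k fy \<le> F" and e: "nrm s ex \<le> \<gamma>" "nrm s ey \<le> \<gamma>"
    and \<tau>: "(4 * \<eta> * F + (6 / 5) * \<gamma>) / \<mu> \<le> \<tau>"
  shows "\<bar>(\<Sum>l<k. hat bx l * hat b_y l / (\<sigma> l)\<^sup>2) - dot k fx fy\<bar> \<le> (11 / 10) * \<delta> * F\<^sup>2 + (21 / 10) * F * \<tau> + \<tau>\<^sup>2"
proof -
  obtain wx where wx: "\<forall>a<k. tA (mulA wx) a = fx a" using gram_solve by blast
  obtain wy where wy: "\<forall>a<k. tA (mulA wy) a = fy a" using gram_solve by blast
  define px where "px l = (if l < k then hat bx l / \<sigma> l else 0)" for l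
  define py where "py l = (if l < k then hat b_y l / \<sigma> l else 0)" for l
  define ox where "ox = hat (mulA wx)"
  define oy where "oy = hat (mulA wy)"
  define tx where "tx l = px l - ox l" for l
  define ty where "ty l = py l - oy l" for l
  have F0: "0 \<le> F" using f nrm_nonneg[of fx k] by linarith
  have t: "nrm s tx \<le> \<tau>" "nrm s ty \<le> \<tau>"
    using coordinates_bound[OF bx f(1) e(1) wx] coordinates_bound[OF b_y f(2) e(2) wy] \<tau>
    unfolding tx_def ty_def px_def py_def ox_def oy_def by linarith+
  have o: "nrm s ox \<le> (101 / 100) * F" "nrm s oy \<le> (101 / 100) * F"
    using gram_solution_bounds(2)[OF wx] gram_solution_bounds(2)[OF wy] f
    unfolding ox_def oy_def nrm_hat by linarith+
  have \<tau>0: "0 \<le> \<tau>" using t nrm_nonneg[of tx s] by linarith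
  have "(\<Sum>l<k. hat bx l * hat b_y l / (\<sigma> l)\<^sup>2) = (\<Sum>l<k. px l * py l)"
    by (rule sum.cong) (auto simp: px_def py_def power2_eq_square)
  also have "\<dots> = dot s px py"
    unfolding dot_def using ks by (intro sum.mono_neutral_left) (auto simp: px_def)
  also have "\<dots> = dot s (\<lambda>l. ox l + tx l) (\<lambda>l. oy l + ty l)" by (simp add: tx_def ty_def)
  also have "\<dots> = dot s ox oy + (dot s ox ty + dot s tx oy + dot s tx ty)"
    by (simp add: dot_add_left dot_add_right)
  finally have out: "(\<Sum>l<k. hat bx l * hat b_y l / (\<sigma> l)\<^sup>2)
      = dot s ox oy + (dot s ox ty + dot s tx oy + dot s tx ty)" .
  have "\<bar>dot s ox ty\<bar> \<le> (101 / 100 * F) * \<tau>"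
    by (rule order_trans[OF dot_le mult_mono[OF o(1) t(2)]]) (use F0 in auto)
  moreover have "\<bar>dot s tx oy\<bar> \<le> \<tau> * (101 / 100 * F)"
    by (rule order_trans[OF dot_le mult_mono[OF t(1) o(2)]]) (use \<tau>0 in auto)
  moreover have "\<bar>dot s tx ty\<bar> \<le> \<tau> * \<tau>"
    by (rule order_trans[OF dot_le mult_mono[OF t(1) t(2)]]) (use \<tau>0 in auto)
  ultimately have cross: "\<bar>dot s ox ty + dot s tx oy + dot s tx ty\<bar> \<le> (21 / 10) * F * \<tau> + \<tau>\<^sup>2"
    using mult_nonneg_nonneg[OF F0 \<tau>0] by (simp add: power2_eq_square algebra_simps)
  have "dot s ox oy = dot k wx fy"
    unfolding ox_def oy_def parseval[symmetric] mulA_adjoint unfolding dot_def using wy by simp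
  moreover have "dot k fx fy = dot k wx fy + dot k (\<lambda>a. tA (mulA wx) a - wx a) fy"
    unfolding dot_add_left[symmetric] unfolding dot_def using wx by simp
  moreover have "\<bar>dot k (\<lambda>a. tA (mulA wx) a - wx a) fy\<bar> \<le> (\<delta> * ((51 / 50) * F)) * F"
  proof -
    have "nrm k (\<lambda>a. tA (mulA wx) a - wx a) \<le> \<delta> * ((51 / 50) * F)"
      using gram_near_id[of wx] mult_left_mono[of "nrm k wx" "(51 / 50) * F" \<delta>]
        gram_solution_bounds(1)[OF wx] f(1) \<delta> by linarith
    then show ?thesis using f \<delta> F0 by (intro order_trans[OF dot_le] mult_mono) auto
  qed
  moreover have "(\<delta> * ((51 / 50) * F)) * F \<le> (11 / 10) * \<delta> * F\<^sup>2"
    using \<delta> F0 by (simp add: power2_eq_square)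
  ultimately show ?thesis using out cross by linarith
qed

end

section \<open>Independent samples\<close>

abbreviation expect :: "'a pmf \<Rightarrow> ('a \<Rightarrow> real) \<Rightarrow> real" where
  "expect p f \<equiv> measure_pmf.expectation p f"

text \<open>All distributions involved have finite support, which settles integrability
  throughout.\<close>

lemma expect_bind:
  fixes h :: "'b \<Rightarrow> real"
  assumes "finite (set_pmf p)" "\<And>x. x \<in> set_pmf p \<Longrightarrow> finite (set_pmf (f x))"
  shows "expect (bind_pmf p f) h = expect p (\<lambda>x. expect (f x) h)"
proof -
  have "expect (bind_pmf p f) h = (\<Sum>x\<in>set_pmf p. pmf p x *\<^sub>R expect (f x) h)"
    using assms by (intro pmf_expectation_bind) auto
  also have "\<dots> = expect p (\<lambda>x. expect (f x) h)"
    using assms by (intro integral_measure_pmf[symmetric]) auto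
  finally show ?thesis .
qed

lemma expect_cong: "(\<And>x. x \<in> set_pmf p \<Longrightarrow> f x = g x) \<Longrightarrow> expect p f = expect p g"
  by (intro integral_cong_AE) (auto simp: AE_measure_pmf_iff)

lemma expect_mono:
  assumes "finite (set_pmf p)" "\<And>x. x \<in> set_pmf p \<Longrightarrow> f x \<le> g x"
  shows "expect p f \<le> expect p g"
  using assms by (intro integral_mono_AE integrable_measure_pmf_finite) (auto simp: AE_measure_pmf_iff)

lemma expect_add: "finite (set_pmf p) \<Longrightarrow> expect p (\<lambda>x. f x + g x) = expect p f + expect p g"
  by (intro Bochner_Integration.integral_add integrable_measure_pmf_finite)

lemma expect_sum: "finite (set_pmf p) \<Longrightarrow> expect p (\<lambda>x. \<Sum>i\<in>I. f i x) = (\<Sum>i\<in>I. expect p (f i))"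
  by (intro Bochner_Integration.integral_sum integrable_measure_pmf_finite)

lemma finite_replicate_pmf: "finite (set_pmf p) \<Longrightarrow> finite (set_pmf (replicate_pmf m p))"
  using finite_lists_length_eq[of "set_pmf p" m] by (simp add: set_replicate_pmf lists_eq_set Collect_conj_eq[symmetric])

lemma replicate_pmf_Suc: "replicate_pmf (Suc m) p = bind_pmf p (\<lambda>x. map_pmf ((#) x) (replicate_pmf m p))"
  by (simp add: map_pmf_def)

lemma expect_replicate_Suc:
  assumes "finite (set_pmf p)"
  shows "expect (replicate_pmf (Suc m) p) h = expect p (\<lambda>x. expect (replicate_pmf m p) (\<lambda>xs. h (x # xs)))"
  unfolding replicate_pmf_Suc using assms
  by (subst expect_bind) (auto simp: finite_replicate_pmf)

text \<open>The form in which independence enters the exponential moment bounds \<open>boost\<close>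
  and \<open>hoeffding_upper\<close>.\<close>

lemma expect_replicate_prod:
  assumes "finite (set_pmf p)"
  shows "expect (replicate_pmf m p) (\<lambda>xs. prod_list (map h xs)) = (expect p h) ^ m"
proof (induction m)
  case (Suc m)
  then show ?case by (subst expect_replicate_Suc[OF assms]) simp
qed simp

lemma expect_replicate_sum:
  assumes fin: "finite (set_pmf p)"
  shows "expect (replicate_pmf m p) (\<lambda>xs. sum_list (map g xs)) = m * expect p g"
proof (induction m)
  case (Suc m)
  then show ?case
    by (subst expect_replicate_Suc[OF fin]) (simp add: expect_add fin finite_replicate_pmf algebra_simps)
qed simp

lemma expect_replicate_variance:
  assumes fin: "finite (set_pmf p)" and \<mu>: "expect p g = \<mu>"
  shows "expect (replicate_pmf m p) (\<lambda>xs. (sum_list (map g xs) - m * \<mu>)\<^sup>2) = m * expect p (\<lambda>x. (g x - \<mu>)\<^sup>2)"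
proof (induction m)
  case (Suc m)
  let ?R = "replicate_pmf m p"
  note finR = finite_replicate_pmf[OF fin, of m]
  have zero: "expect ?R (\<lambda>xs. sum_list (map g xs) - m * \<mu>) = 0"
    using finR by (subst Bochner_Integration.integral_diff)
      (auto intro: integrable_measure_pmf_finite simp: expect_replicate_sum[OF fin] \<mu>)
  have "expect (replicate_pmf (Suc m) p) (\<lambda>xs. (sum_list (map g xs) - real (Suc m) * \<mu>)\<^sup>2)
      = expect p (\<lambda>x. expect ?R (\<lambda>xs. (g x + sum_list (map g xs) - real (Suc m) * \<mu>)\<^sup>2))"
    by (subst expect_replicate_Suc[OF fin]) simp
  also have "\<dots> = expect p (\<lambda>x. expect ?R (\<lambda>xs. (g x - \<mu>)\<^sup>2 + (2 * (g x - \<mu>) * (sum_list (map g xs) - m * \<mu>)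
      + (sum_list (map g xs) - m * \<mu>)\<^sup>2)))"
    by (simp add: power2_eq_square algebra_simps)
  also have "\<dots> = expect p (\<lambda>x. (g x - \<mu>)\<^sup>2 + m * expect p (\<lambda>x. (g x - \<mu>)\<^sup>2))"
    by (simp only: expect_add[OF finR] integral_mult_right_zero zero Suc.IH) simp
  also have "\<dots> = real (Suc m) * expect p (\<lambda>x. (g x - \<mu>)\<^sup>2)"
    by (simp add: expect_add[OF fin] algebra_simps)
  finally show ?case .
qed simp

section \<open>Tail bounds and amplification by medians\<close>

lemma markov_pmf:
  assumes fin: "finite (set_pmf p)" and h: "\<And>x. x \<in> set_pmf p \<Longrightarrow> 0 \<le> h x" and c: "0 < c"
  shows "measure_pmf.prob p {x. c \<le> h x} \<le> expect p h / c"
proof -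
  have "c * measure_pmf.prob p {x. c \<le> h x} = expect p (\<lambda>x. c * indicator {x. c \<le> h x} x)" by simp
  also have "\<dots> \<le> expect p h"
    using h by (intro expect_mono[OF fin]) (auto simp: indicator_def)
  finally show ?thesis using c by (simp add: field_simps)
qed

lemma prob_mono_pmf:
  "(\<And>x. x \<in> set_pmf p \<Longrightarrow> P x \<Longrightarrow> Q x) \<Longrightarrow> measure_pmf.prob p {x. P x} \<le> measure_pmf.prob p {x. Q x}"
  by (intro measure_pmf.finite_measure_mono_AE) (auto simp: AE_measure_pmf_iff)

lemma chebyshev_pmf:
  assumes fin: "finite (set_pmf p)" and c: "0 < c"
  shows "measure_pmf.prob p {x. \<not> \<bar>h x - \<mu>\<bar> \<le> c} \<le> expect p (\<lambda>x. (h x - \<mu>)\<^sup>2) / c\<^sup>2"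
proof -
  have "measure_pmf.prob p {x. \<not> \<bar>h x - \<mu>\<bar> \<le> c} \<le> measure_pmf.prob p {x. c\<^sup>2 \<le> (h x - \<mu>)\<^sup>2}"
  proof (intro prob_mono_pmf)
    fix x assume "\<not> \<bar>h x - \<mu>\<bar> \<le> c"
    then show "c\<^sup>2 \<le> (h x - \<mu>)\<^sup>2" using c by (simp add: abs_le_square_iff[symmetric])
  qed
  also have "\<dots> \<le> expect p (\<lambda>x. (h x - \<mu>)\<^sup>2) / c\<^sup>2" using c by (intro markov_pmf fin) auto
  finally show ?thesis .
qed

lemma prob_union_bound:
  assumes "finite I"
  shows "measure_pmf.prob p {x. \<exists>i\<in>I. B i x} \<le> (\<Sum>i\<in>I. measure_pmf.prob p {x. B i x})"
proof -
  have "{x. \<exists>i\<in>I. B i x} = (\<Union>i\<in>I. {x. B i x})" by auto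
  then show ?thesis using measure_pmf.finite_measure_subadditive_finite[OF assms, of "\<lambda>i. {x. B i x}" p] by simp
qed

lemma prob_compl_ge:
  assumes "measure_pmf.prob p {x. \<not> P x} \<le> c"
  shows "1 - c \<le> measure_pmf.prob p {x. P x}"
  using assms measure_pmf.prob_compl[of "{x. P x}" p] by (simp add: Collect_neg_eq Compl_eq_Diff_UNIV)

text \<open>Markov's inequality for a product of weights, 16 for a bad sample and 1 for a good one.
  A single weight has expectation at most \<open>1 + 15/16 < 2\<close>, while a bad half forces the
  product to be at least \<open>4 ^ m\<close>. This is why single estimates are required to fail
  with probability at most 1/16.\<close>

lemma boost:
  assumes fin: "finite (set_pmf p)" and bad: "measure_pmf.prob p {x. bad x} \<le> 1 / 16"
  shows "measure_pmf.prob (replicate_pmf m p) {xs. m \<le> 2 * length (filter bad xs)} \<le> (1 / 2) ^ m"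
proof -
  define h where "h x = (if bad x then 16 else 1 :: real)" for x
  have prod: "prod_list (map h xs) = 16 ^ length (filter bad xs)" for xs
    by (induction xs) (auto simp: h_def)
  have "expect p h = expect p (\<lambda>x. 1 + 15 * indicator {x. bad x} x)"
    by (rule expect_cong) (auto simp: h_def indicator_def)
  also have "\<dots> = 1 + 15 * measure_pmf.prob p {x. bad x}"
    by (subst expect_add[OF fin]) simp
  also have "\<dots> \<le> 2" using bad by simp
  finally have h2: "expect p h \<le> 2" .
  have h0: "0 \<le> expect p h" by (intro integral_nonneg_AE) (auto simp: h_def)
  have "measure_pmf.prob (replicate_pmf m p) {xs. m \<le> 2 * length (filter bad xs)}
      \<le> measure_pmf.prob (replicate_pmf m p) {xs. 4 ^ m \<le> prod_list (map h xs)}"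
  proof (rule prob_mono_pmf)
    fix xs assume "m \<le> 2 * length (filter bad xs)"
    then have "(4::real) ^ m \<le> 4 ^ (2 * length (filter bad xs))" by (intro power_increasing) auto
    then show "4 ^ m \<le> prod_list (map h xs)" by (simp add: prod power_mult)
  qed
  also have "\<dots> \<le> (expect p h) ^ m / 4 ^ m"
    unfolding expect_replicate_prod[OF fin, symmetric]
    by (rule markov_pmf[OF finite_replicate_pmf[OF fin]]) (simp_all add: prod)
  also have "\<dots> \<le> 2 ^ m / 4 ^ m" using h2 h0 by (intro divide_right_mono power_mono) auto
  also have "\<dots> = (1 / 2) ^ m" by (simp add: power_divide[symmetric])
  finally show ?thesis .
qed

lemma hoeffding_upper:
  assumes fin: "finite (set_pmf p)" and g: "\<And>x. x \<in> set_pmf p \<Longrightarrow> \<bar>g x\<bar> \<le> c" and c: "0 < c"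
    and \<mu>: "expect p g = \<mu>" and a: "0 < a" and m: "0 < m"
  shows "measure_pmf.prob (replicate_pmf m p) {xs. a \<le> sum_list (map g xs) - m * \<mu>} \<le> exp (- a\<^sup>2 / (2 * real m * c\<^sup>2))"
proof -
  \<comment> \<open>The minimiser of the final exponent
    \<open>m * l^2 * c^2 / 2 - l * a\<close>.\<close>
  define l where "l = a / (m * c\<^sup>2)"
  have l: "0 < l" using a c m by (simp add: l_def)
  interpret interval_bounded_random_variable "measure_pmf p" g "-c" c
    by unfold_locales (use g in \<open>auto simp: AE_measure_pmf_iff abs_le_iff minus_le_iff\<close>)
  define h where "h x = exp (l * (g x - \<mu>))" for x
  have "ennreal (expect p h) = (\<integral>\<^sup>+x. ennreal (h x) \<partial>measure_pmf p)"
    using fin by (intro nn_integral_eq_integral[symmetric] integrable_measure_pmf_finite) (auto simp: h_def)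
  also have "\<dots> \<le> ennreal (exp (l\<^sup>2 * (c - - c)\<^sup>2 / 8))"
    unfolding h_def \<mu>[symmetric] by (rule Hoeffdings_lemma_nn_integral[OF l])
  finally have h1: "expect p h \<le> exp (l\<^sup>2 * c\<^sup>2 / 2)" by (simp add: power2_eq_square algebra_simps)
  have h0: "0 \<le> expect p h" by (intro integral_nonneg_AE) (auto simp: h_def)
  have prod: "prod_list (map h xs) = exp (l * (sum_list (map g xs) - length xs * \<mu>))" for xs
    by (induction xs) (auto simp: h_def exp_add[symmetric] algebra_simps)
  have "measure_pmf.prob (replicate_pmf m p) {xs. a \<le> sum_list (map g xs) - m * \<mu>}
      \<le> measure_pmf.prob (replicate_pmf m p) {xs. exp (l * a) \<le> prod_list (map h xs)}"
    using l by (intro prob_mono_pmf) (auto simp: prod set_replicate_pmf)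
  also have "\<dots> \<le> (expect p h) ^ m / exp (l * a)"
    unfolding expect_replicate_prod[OF fin, symmetric]
    by (rule markov_pmf[OF finite_replicate_pmf[OF fin]]) (simp_all add: prod)
  also have "\<dots> \<le> exp (l\<^sup>2 * c\<^sup>2 / 2) ^ m / exp (l * a)"
    using h1 h0 by (intro divide_right_mono power_mono) auto
  also have "\<dots> = exp (m * (l\<^sup>2 * c\<^sup>2 / 2) - l * a)" by (simp add: exp_diff exp_of_nat_mult[symmetric])
  also have "m * (l\<^sup>2 * c\<^sup>2 / 2) - l * a = - a\<^sup>2 / (2 * real m * c\<^sup>2)"
    using c m by (simp add: l_def field_simps power2_eq_square)
  finally show ?thesis .
qed

lemma hoeffding_abs:
  assumes fin: "finite (set_pmf p)" and g: "\<And>x. x \<in> set_pmf p \<Longrightarrow> \<bar>g x\<bar> \<le> c" and c: "0 < c"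
    and \<mu>: "expect p g = \<mu>" and a: "0 < a" and m: "0 < m"
  shows "measure_pmf.prob (replicate_pmf m p) {xs. a \<le> \<bar>sum_list (map g xs) - m * \<mu>\<bar>}
    \<le> 2 * exp (- a\<^sup>2 / (2 * real m * c\<^sup>2))"
proof -
  have neg: "sum_list (map (\<lambda>x. - g x) xs) = - sum_list (map g xs)" for xs by (induction xs) auto
  have "measure_pmf.prob (replicate_pmf m p) {xs. a \<le> \<bar>sum_list (map g xs) - m * \<mu>\<bar>}
      \<le> measure_pmf.prob (replicate_pmf m p) ({xs. a \<le> sum_list (map g xs) - m * \<mu>}
          \<union> {xs. a \<le> sum_list (map (\<lambda>x. - g x) xs) - m * (- \<mu>)})"
    by (intro measure_pmf.finite_measure_mono) (auto simp: neg)
  also have "\<dots> \<le> measure_pmf.prob (replicate_pmf m p) {xs. a \<le> sum_list (map g xs) - m * \<mu>}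
      + measure_pmf.prob (replicate_pmf m p) {xs. a \<le> sum_list (map (\<lambda>x. - g x) xs) - m * (- \<mu>)}"
    by (rule measure_Un_le) auto
  also have "\<dots> \<le> exp (- a\<^sup>2 / (2 * real m * c\<^sup>2)) + exp (- a\<^sup>2 / (2 * real m * c\<^sup>2))"
    using hoeffding_upper[OF fin g c \<mu> a m] hoeffding_upper[of p "\<lambda>x. - g x" c "- \<mu>" a m] assms
    by (intro add_mono) auto
  finally show ?thesis by simp
qed

text \<open>If the sorted entry at index \<open>m div 2\<close> is too large, so are the
  \<open>m - m div 2\<close> entries from it upwards; if it is too small, so are the
  \<open>m div 2 + 1\<close> entries up to it. Either way this is at least half of the list.\<close>

lemma median_bad_count:
  assumes "length xs = m" "0 < m" "\<not> \<bar>median xs - c\<bar> \<le> r"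
  shows "m \<le> 2 * length (filter (\<lambda>x. \<not> \<bar>x - c\<bar> \<le> r) xs)"
proof -
  define ys where "ys = sort xs"
  define j where "j = m div 2"
  define bad where "bad x \<longleftrightarrow> \<not> \<bar>x - c\<bar> \<le> r" for x
  have len: "length ys = m" "sorted ys" using assms by (auto simp: ys_def)
  have jm: "j < m" using assms(2) by (simp add: j_def)
  have badj: "bad (ys ! j)" using assms by (simp add: bad_def ys_def j_def median_def)
  have "length (filter bad xs) = length (filter bad ys)"
    unfolding ys_def by (metis mset_filter mset_sort size_mset)
  also have "\<dots> = card {i. i < m \<and> bad (ys ! i)}" by (simp add: length_filter_conv_card len)
  finally have cnt: "length (filter bad xs) = card {i. i < m \<and> bad (ys ! i)}" .
  have fin: "finite {i. i < m \<and> bad (ys ! i)}" by simp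
  consider "c + r < ys ! j" | "ys ! j < c - r" using badj unfolding bad_def by linarith
  then have "m \<le> 2 * card {i. i < m \<and> bad (ys ! i)}"
  proof cases
    case 1
    have "{j..<m} \<subseteq> {i. i < m \<and> bad (ys ! i)}"
    proof
      fix i assume i: "i \<in> {j..<m}"
      then have "ys ! j \<le> ys ! i" using len by (intro sorted_nth_mono) auto
      then show "i \<in> {i. i < m \<and> bad (ys ! i)}" using 1 i by (auto simp: bad_def)
    qed
    then have "m - j \<le> card {i. i < m \<and> bad (ys ! i)}" using card_mono[OF fin] by (metis card_atLeastLessThan card_atMost Suc_eq_plus1)
    then show ?thesis by (simp add: j_def)
  next
    case 2
    have "{..j} \<subseteq> {i. i < m \<and> bad (ys ! i)}"
    proof
      fix i assume i: "i \<in> {..j}"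
      then have "ys ! i \<le> ys ! j" using len jm by (intro sorted_nth_mono) auto
      then show "i \<in> {i. i < m \<and> bad (ys ! i)}" using 2 i jm by (auto simp: bad_def)
    qed
    then have "j + 1 \<le> card {i. i < m \<and> bad (ys ! i)}" using card_mono[OF fin] by (metis card_atLeastLessThan card_atMost Suc_eq_plus1)
    then show ?thesis unfolding j_def by linarith
  qed
  then show ?thesis using cnt by (simp add: bad_def[abs_def])
qed

lemma median_boost:
  assumes fin: "finite (set_pmf p)" and m: "0 < m"
    and dev: "measure_pmf.prob p {x. \<not> \<bar>h x - c\<bar> \<le> r} \<le> 1 / 16"
  shows "measure_pmf.prob (replicate_pmf m p) {xs. \<not> \<bar>median (map h xs) - c\<bar> \<le> r} \<le> (1 / 2) ^ m"
proof -
  have "measure_pmf.prob (replicate_pmf m p) {xs. \<not> \<bar>median (map h xs) - c\<bar> \<le> r}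
    \<le> measure_pmf.prob (replicate_pmf m p) {xs. m \<le> 2 * length (filter (\<lambda>x. \<not> \<bar>h x - c\<bar> \<le> r) xs)}"
  proof (rule prob_mono_pmf)
    fix xs assume "xs \<in> set_pmf (replicate_pmf m p)" and H: "\<not> \<bar>median (map h xs) - c\<bar> \<le> r"
    then have "length (map h xs) = m" by (simp add: set_replicate_pmf)
    from median_bad_count[OF this m H] show "m \<le> 2 * length (filter (\<lambda>x. \<not> \<bar>h x - c\<bar> \<le> r) xs)"
      by (simp add: filter_map o_def)
  qed
  also have "\<dots> \<le> (1 / 2) ^ m" by (rule boost[OF fin dev])
  finally show ?thesis .
qed

text \<open>The variance of one sample is bounded by its second moment, the squared mean being
  dropped.\<close>

lemma iid_mean_second_moment:
  fixes p :: "nat pmf" and n M :: nat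
  assumes sub: "set_pmf p \<subseteq> {..<n}" and M: "0 < M"
  shows "expect (replicate_pmf M p) (\<lambda>xs. (sum_list (map w xs) / M - (\<Sum>i<n. pmf p i * w i))\<^sup>2)
    \<le> (\<Sum>i<n. pmf p i * (w i)\<^sup>2) / M"
proof -
  have fin: "finite (set_pmf p)" using finite_subset[OF sub] by simp
  have ex: "expect p f = (\<Sum>i<n. pmf p i * f i)" for f :: "nat \<Rightarrow> real"
    using sub by (subst integral_measure_pmf[of "{..<n}"]) auto
  define \<mu> where "\<mu> = (\<Sum>i<n. pmf p i * w i)"
  have \<mu>: "expect p w = \<mu>" by (simp add: ex \<mu>_def)
  have "expect (replicate_pmf M p) (\<lambda>xs. (sum_list (map w xs) / M - \<mu>)\<^sup>2)
      = expect (replicate_pmf M p) (\<lambda>xs. (sum_list (map w xs) - M * \<mu>)\<^sup>2 / (real M)\<^sup>2)"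
    using M by (intro expect_cong) (simp add: power2_eq_square field_simps)
  also have "\<dots> = M * expect p (\<lambda>x. (w x - \<mu>)\<^sup>2) / (real M)\<^sup>2"
    using expect_replicate_variance[OF fin \<mu>, of M] by simp
  also have "\<dots> = expect p (\<lambda>x. (w x - \<mu>)\<^sup>2) / M" using M by (simp add: power2_eq_square)
  also have "expect p (\<lambda>x. (w x - \<mu>)\<^sup>2) = expect p (\<lambda>x. (w x)\<^sup>2 + ((- 2 * \<mu>) * w x + \<mu>\<^sup>2))"
    by (rule expect_cong) (simp add: power2_eq_square algebra_simps)
  also have "\<dots> = expect p (\<lambda>x. (w x)\<^sup>2) - \<mu>\<^sup>2"
    by (simp only: expect_add[OF fin] integral_mult_right_zero \<mu>) (simp add: power2_eq_square)
  also have "\<dots> \<le> (\<Sum>i<n. pmf p i * (w i)\<^sup>2)" by (simp add: ex)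
  finally show ?thesis using M by (simp add: \<mu>_def divide_right_mono)
qed

lemma empirical_sum:
  fixes w :: "nat \<Rightarrow> real"
  assumes "set xs \<subseteq> {..<n}" "length xs = M"
  shows "(\<Sum>i<n. empirical xs i * w i) = sum_list (map w xs) / M"
proof -
  have "sum_list (map w xs) = (\<Sum>i<n. real (count_list xs i) * w i)"
    using assms(1)
  proof (induction xs)
    case (Cons x xs)
    have "(\<Sum>i<n. real (count_list (x # xs) i) * w i)
        = (\<Sum>i<n. real (count_list xs i) * w i + (if i = x then w i else 0))"
      by (intro sum.cong refl) (auto simp: algebra_simps)
    also have "\<dots> = (\<Sum>i<n. real (count_list xs i) * w i) + w x"
      using Cons.prems by (simp add: sum.distrib)
    finally show ?case using Cons by simp
  qed simp
  then show ?thesis using assms(2) by (simp add: empirical_def sum_divide_distrib)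
qed

section \<open>Distribution of the random computations\<close>

lemma result_ret [simp]: "result (ret a) = return_pmf a"
  by (simp add: result_def ret_def)

lemma result_bind [simp]: "result (bind_comp m f) = bind_pmf (result m) (\<lambda>a. result (f a))"
  by (simp add: result_def bind_comp_def map_bind_pmf bind_map_pmf pmf.map_comp o_def case_prod_unfold)

lemma result_tick [simp]: "result (tick T) = return_pmf ()"
  by (simp add: result_def tick_def)

lemma result_draw [simp]: "result (draw p) = p"
  by (simp add: result_def draw_def pmf.map_comp o_def)

lemma result_with_space [simp]: "result (with_space b m) = result m"
  by (simp add: result_def with_space_def pmf.map_comp o_def case_prod_unfold)

lemma result_for_each_const: "result (for_each (\<lambda>_. m) xs) = replicate_pmf (length xs) (result m)"
  by (induction xs) auto

lemma finite_result_for_each: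
  "(\<And>x. x \<in> set xs \<Longrightarrow> finite (set_pmf (result (f x)))) \<Longrightarrow> finite (set_pmf (result (for_each f xs)))"
  by (induction xs) auto

text \<open>Marginals suffice for the individual estimates, because failures of different entries
  are combined by a union bound; independence is used only between repetitions, batches and
  samples.\<close>

lemma result_for_each_nth:
  "i < length xs \<Longrightarrow> map_pmf (\<lambda>ys. ys ! i) (result (for_each f xs)) = result (f (xs ! i))"
proof (induction xs arbitrary: i)
  case (Cons x xs)
  show ?case
  proof (cases i)
    case 0
    then show ?thesis by (simp add: map_bind_pmf bind_return_pmf')
  next
    case (Suc j)
    then have "map_pmf (\<lambda>ys. ys ! j) (result (for_each f xs)) = result (f (xs ! j))"
      using Cons by simp
    then show ?thesis using Suc by (simp add: map_pmf_def bind_assoc_pmf bind_return_pmf)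
  qed
qed simp

lemma result_accumulate:
  "result (accumulate B m acc) = map_pmf (\<lambda>zs. acc + sum_list zs) (replicate_pmf B (result m))"
proof (induction B arbitrary: acc)
  case (Suc B)
  have "result (accumulate (Suc B) m acc)
      = bind_pmf (result m) (\<lambda>z. map_pmf (\<lambda>zs. acc + z + sum_list zs) (replicate_pmf B (result m)))"
    by (simp add: Suc.IH bind_return_pmf)
  then show ?case by (simp add: map_bind_pmf map_pmf_def bind_assoc_pmf bind_return_pmf add.assoc)
qed simp

section \<open>Mean and variance of the collision estimator\<close>

definition batch_pmf :: "nat \<Rightarrow> nat \<Rightarrow> nat pmf \<Rightarrow> nat pmf \<Rightarrow> real pmf" where
  "batch_pmf n M p q = bind_pmf (replicate_pmf M p) (\<lambda>xs. bind_pmf (replicate_pmf M q) (\<lambda>ys.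
     return_pmf (\<Sum>i<n. empirical xs i * empirical ys i)))"

lemma result_rw_batch:
  "result (rw_batch n E t M x y) = batch_pmf n M (result (lazy_walk E t x)) (result (lazy_walk E t y))"
  by (simp add: rw_batch_def batch_pmf_def result_for_each_const bind_return_pmf)

lemma result_est_rw_dot:
  "result (est_rw_dot cw n E R t M x y) = map_pmf (\<lambda>zs. sum_list zs / nat \<lceil>R / real M\<rceil>)
     (replicate_pmf (nat \<lceil>R / real M\<rceil>) (batch_pmf n M (result (lazy_walk E t x)) (result (lazy_walk E t y))))"
  by (simp add: est_rw_dot_def Let_def result_accumulate result_rw_batch bind_return_pmf map_pmf_def bind_assoc_pmf)

lemma finite_batch_pmf:
  "finite (set_pmf p) \<Longrightarrow> finite (set_pmf q) \<Longrightarrow> finite (set_pmf (batch_pmf n M p q))"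
  by (simp add: batch_pmf_def finite_replicate_pmf)

context
  fixes n M :: nat and p q :: "nat pmf"
  assumes p: "set_pmf p \<subseteq> {..<n}" and q: "set_pmf q \<subseteq> {..<n}" and M: "0 < M"
begin

lemma fin_p: "finite (set_pmf p)" and fin_q: "finite (set_pmf q)"
  using finite_subset[OF p] finite_subset[OF q] by auto

lemma expect_batch:
  "expect (batch_pmf n M p q) h
    = expect (replicate_pmf M p) (\<lambda>xs. expect (replicate_pmf M q) (\<lambda>ys. h (\<Sum>i<n. empirical xs i * empirical ys i)))"
  unfolding batch_pmf_def using fin_p fin_q by (simp add: expect_bind finite_replicate_pmf)

lemma batch_mean: "expect (batch_pmf n M p q) (\<lambda>z. z) = (\<Sum>i<n. pmf p i * pmf q i)"
proof -
  have ex: "expect r f = (\<Sum>i<n. pmf r i * f i)" if "set_pmf r \<subseteq> {..<n}" for r and f :: "nat \<Rightarrow> real"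
    using that by (subst integral_measure_pmf[of "{..<n}"]) auto
  have emp: "expect (replicate_pmf M r) (\<lambda>xs. \<Sum>i<n. empirical xs i * w i) = (\<Sum>i<n. pmf r i * w i)"
    if "set_pmf r \<subseteq> {..<n}" for r w
  proof -
    have fin: "finite (set_pmf r)" using finite_subset[OF that] by simp
    have "expect (replicate_pmf M r) (\<lambda>xs. \<Sum>i<n. empirical xs i * w i)
        = expect (replicate_pmf M r) (\<lambda>xs. sum_list (map w xs) / M)"
      using that by (intro expect_cong empirical_sum) (auto simp: set_replicate_pmf)
    also have "\<dots> = expect r w" using M by (simp add: expect_replicate_sum[OF fin])
    finally show ?thesis by (simp add: ex[OF that])
  qed
  have "expect (batch_pmf n M p q) (\<lambda>z. z)
      = expect (replicate_pmf M p) (\<lambda>xs. expect (replicate_pmf M q) (\<lambda>ys. \<Sum>i<n. empirical ys i * empirical xs i))"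
    by (simp add: expect_batch mult.commute)
  also have "\<dots> = expect (replicate_pmf M p) (\<lambda>xs. \<Sum>i<n. empirical xs i * pmf q i)"
    unfolding emp[OF q] by (simp add: mult.commute)
  also have "\<dots> = (\<Sum>i<n. pmf p i * pmf q i)" by (rule emp[OF p])
  finally show ?thesis .
qed

text \<open>The error \<open><p', q'> - <p, q>\<close> of the empirical distributions
  \<open>p'\<close>, \<open>q'\<close> is the sum of \<open><p' - p, q' - q>\<close>,
  \<open><p' - p, q>\<close> and \<open><p, q' - q>\<close>. The last two are deviations of sample
  means with fixed weights; the factor 3 comes from squaring a sum of three terms.\<close>

lemma batch_second_moment:
  "expect (batch_pmf n M p q) (\<lambda>z. (z - (\<Sum>i<n. pmf p i * pmf q i))\<^sup>2)
    \<le> 3 * ((\<Sum>i<n. pmf p i * pmf q i) / (real M)\<^sup>2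
         + ((\<Sum>i<n. pmf p i * (pmf q i)\<^sup>2) + (\<Sum>i<n. pmf q i * (pmf p i)\<^sup>2)) / M)"
proof -
  let ?P = "replicate_pmf M p" and ?Q = "replicate_pmf M q"
  define c where "c = (\<Sum>i<n. pmf p i * pmf q i)"
  define S where "S r xs w = sum_list (map w xs) / M - (\<Sum>i<n. pmf r i * w i)" for r :: "nat pmf" and xs w
  define W where "W ys i = empirical ys i - pmf q i" for ys i
  note finP = finite_replicate_pmf[OF fin_p, of M] and finQ = finite_replicate_pmf[OF fin_q, of M]
  have dec: "((\<Sum>i<n. empirical xs i * empirical ys i) - c)\<^sup>2
      \<le> 3 * ((S p xs (W ys))\<^sup>2 + ((S p xs (pmf q))\<^sup>2 + (S q ys (pmf p))\<^sup>2))"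
    if "xs \<in> set_pmf ?P" "ys \<in> set_pmf ?Q" for xs ys
  proof -
    have xs: "set xs \<subseteq> {..<n}" "length xs = M" and ys: "set ys \<subseteq> {..<n}" "length ys = M"
      using that p q by (auto simp: set_replicate_pmf)
    have 1: "S p xs w = (\<Sum>i<n. empirical xs i * w i) - (\<Sum>i<n. pmf p i * w i)" for w
      by (simp add: S_def empirical_sum[OF xs])
    have 2: "S q ys w = (\<Sum>i<n. empirical ys i * w i) - (\<Sum>i<n. pmf q i * w i)" for w
      by (simp add: S_def empirical_sum[OF ys])
    have "(\<Sum>i<n. empirical xs i * empirical ys i) - c = S p xs (W ys) + S p xs (pmf q) + S q ys (pmf p)"
      unfolding 1 2 W_def c_def by (simp add: sum_subtractf right_diff_distrib mult.commute)
    moreover have "(a + b + e)\<^sup>2 \<le> 3 * (a\<^sup>2 + (b\<^sup>2 + e\<^sup>2))" for a b e :: real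
      using zero_le_power2[of "a - b"] zero_le_power2[of "a - e"] zero_le_power2[of "b - e"]
      by (simp add: power2_eq_square algebra_simps)
    ultimately show ?thesis by simp
  qed
  have Sp: "expect ?P (\<lambda>xs. (S p xs w)\<^sup>2) \<le> (\<Sum>i<n. pmf p i * (w i)\<^sup>2) / M" for w
    unfolding S_def by (rule iid_mean_second_moment[OF p M])
  have Sq: "expect ?Q (\<lambda>ys. (S q ys w)\<^sup>2) \<le> (\<Sum>i<n. pmf q i * (w i)\<^sup>2) / M" for w
    unfolding S_def by (rule iid_mean_second_moment[OF q M])
  \<comment> \<open>For the bilinear part \<open>ys\<close> is fixed first, so that
    \<open>W ys\<close> acts as a weight for the samples of \<open>p\<close>. Averaging over
    \<open>ys\<close> then gives each squared weight expectation at most \<open>pmf q i / M\<close>,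
    hence the second factor \<open>1 / M\<close>.\<close>
  have "expect ?Q (\<lambda>ys. expect ?P (\<lambda>xs. (S p xs (W ys))\<^sup>2)) \<le> expect ?Q (\<lambda>ys. (\<Sum>i<n. pmf p i * (W ys i)\<^sup>2) / M)"
    by (intro expect_mono finQ Sp)
  also have "\<dots> = (\<Sum>i<n. pmf p i * expect ?Q (\<lambda>ys. (W ys i)\<^sup>2)) / M"
    by (simp add: expect_sum[OF finQ])
  also have "\<dots> \<le> (\<Sum>i<n. pmf p i * (pmf q i / M)) / M"
  proof (intro divide_right_mono sum_mono mult_left_mono)
    fix i assume i: "i \<in> {..<n}"
    define w where "w j = (if j = i then 1 else 0 :: real)" for j
    have "W ys i = S q ys w" if "ys \<in> set_pmf ?Q" for ys
    proof -
      have ys: "set ys \<subseteq> {..<n}" "length ys = M" using that q by (auto simp: set_replicate_pmf)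
      show ?thesis unfolding S_def W_def empirical_sum[OF ys, symmetric] using i
        by (simp add: w_def if_distrib sum.delta cong: if_cong)
    qed
    then have "expect ?Q (\<lambda>ys. (W ys i)\<^sup>2) = expect ?Q (\<lambda>ys. (S q ys w)\<^sup>2)" by (intro expect_cong) simp
    also have "\<dots> \<le> (\<Sum>j<n. pmf q j * (w j)\<^sup>2) / M" by (rule Sq)
    also have "(\<Sum>j<n. pmf q j * (w j)\<^sup>2) = (\<Sum>j<n. if j = i then pmf q j else 0)"
      by (rule sum.cong) (auto simp: w_def)
    also have "\<dots> = pmf q i" using i by simp
    finally show "expect ?Q (\<lambda>ys. (W ys i)\<^sup>2) \<le> pmf q i / M" .
  qed auto
  also have "\<dots> = c / (real M)\<^sup>2"
    by (simp add: c_def sum_divide_distrib power2_eq_square)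
  finally have first: "expect ?Q (\<lambda>ys. expect ?P (\<lambda>xs. (S p xs (W ys))\<^sup>2)) \<le> c / (real M)\<^sup>2" .
  have swap: "expect ?P (\<lambda>xs. expect ?Q (\<lambda>ys. f xs ys)) = expect ?Q (\<lambda>ys. expect ?P (\<lambda>xs. f xs ys))"
    for f :: "nat list \<Rightarrow> nat list \<Rightarrow> real"
    using finP finQ
    by (simp add: integral_measure_pmf[of "set_pmf ?P"] integral_measure_pmf[of "set_pmf ?Q"] sum_distrib_left mult.left_commute)
       (rule sum.swap)
  have "expect (batch_pmf n M p q) (\<lambda>z. (z - c)\<^sup>2)
      = expect ?P (\<lambda>xs. expect ?Q (\<lambda>ys. ((\<Sum>i<n. empirical xs i * empirical ys i) - c)\<^sup>2))"
    by (rule expect_batch)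
  also have "\<dots> \<le> expect ?P (\<lambda>xs. expect ?Q (\<lambda>ys. 3 * ((S p xs (W ys))\<^sup>2 + ((S p xs (pmf q))\<^sup>2 + (S q ys (pmf p))\<^sup>2))))"
    by (intro expect_mono finP finQ dec)
  also have "\<dots> = 3 * (expect ?P (\<lambda>xs. expect ?Q (\<lambda>ys. (S p xs (W ys))\<^sup>2))
      + (expect ?P (\<lambda>xs. (S p xs (pmf q))\<^sup>2) + expect ?Q (\<lambda>ys. (S q ys (pmf p))\<^sup>2)))"
    by (simp only: expect_add[OF finP] expect_add[OF finQ] integral_mult_right_zero) simp
  also have "\<dots> \<le> 3 * (c / (real M)\<^sup>2 + ((\<Sum>i<n. pmf p i * (pmf q i)\<^sup>2) / M + (\<Sum>i<n. pmf q i * (pmf p i)\<^sup>2) / M))"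
    unfolding swap using first Sp[of "pmf q"] Sq[of "pmf p"] by (intro mult_left_mono add_mono) auto
  finally show ?thesis by (simp add: c_def add_divide_distrib)
qed

text \<open>Only the squared norms of \<open>p\<close> and \<open>q\<close> matter: every single
  probability is at most \<open>sqrt \<Phi>\<close>, so the cubic sums are at most
  \<open>sqrt \<Phi> * \<Phi>\<close>. Chebyshev is applied to the mean of at least
  \<open>R / M\<close> batches; 48 is the factor 3 of the second moment times the 16 of the target
  probability.\<close>

lemma batch_mean_deviation:
  fixes R e \<Phi> :: real
  assumes \<Phi>: "(\<Sum>i<n. (pmf p i)\<^sup>2) \<le> \<Phi>" "(\<Sum>i<n. (pmf q i)\<^sup>2) \<le> \<Phi>" and R: "0 < R" and e: "0 < e"
    and big: "48 * (\<Phi> * (1 + 2 * (M * sqrt \<Phi>))) \<le> R * M * e\<^sup>2"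
  shows "measure_pmf.prob (map_pmf (\<lambda>zs. sum_list zs / nat \<lceil>R / M\<rceil>) (replicate_pmf (nat \<lceil>R / M\<rceil>) (batch_pmf n M p q)))
     {z. \<not> \<bar>z - (\<Sum>i<n. pmf p i * pmf q i)\<bar> \<le> e} \<le> 1 / 16"
proof -
  define B where "B = nat \<lceil>R / real M\<rceil>"
  define c where "c = (\<Sum>i<n. pmf p i * pmf q i)"
  define V where "V = expect (batch_pmf n M p q) (\<lambda>z. (z - c)\<^sup>2)"
  note finb = finite_batch_pmf[OF fin_p fin_q, of n M]
  have RM: "0 < R / M" using R M by simp
  have Bge: "R / M \<le> B" unfolding B_def by linarith
  then have Bpos: "0 < real B" using RM by linarith
  have \<Phi>0: "0 \<le> \<Phi>" using \<Phi>(1) sum_nonneg[of "{..<n}" "\<lambda>i. (pmf p i)\<^sup>2"] by simp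
  have le_sqrt: "pmf r i \<le> sqrt \<Phi>" if "i < n" "(\<Sum>i<n. (pmf r i)\<^sup>2) \<le> \<Phi>" for r i
  proof -
    have "(pmf r i)\<^sup>2 \<le> (\<Sum>i<n. (pmf r i)\<^sup>2)" using that by (intro member_le_sum) auto
    then show ?thesis using that by (intro real_le_rsqrt) simp
  qed
  have cub: "(\<Sum>i<n. pmf r i * (pmf r' i)\<^sup>2) \<le> sqrt \<Phi> * \<Phi>"
    if "(\<Sum>i<n. (pmf r i)\<^sup>2) \<le> \<Phi>" "(\<Sum>i<n. (pmf r' i)\<^sup>2) \<le> \<Phi>" for r r'
  proof -
    have "(\<Sum>i<n. pmf r i * (pmf r' i)\<^sup>2) \<le> (\<Sum>i<n. sqrt \<Phi> * (pmf r' i)\<^sup>2)"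
      using le_sqrt that by (intro sum_mono mult_right_mono) auto
    also have "\<dots> \<le> sqrt \<Phi> * \<Phi>" using that \<Phi>0 by (simp add: sum_distrib_left[symmetric] mult_left_mono)
    finally show ?thesis .
  qed
  have "c \<le> \<Phi>"
  proof -
    have "c \<le> (\<Sum>i<n. ((pmf p i)\<^sup>2 + (pmf q i)\<^sup>2) / 2)"
      unfolding c_def
    proof (rule sum_mono)
      fix i show "pmf p i * pmf q i \<le> ((pmf p i)\<^sup>2 + (pmf q i)\<^sup>2) / 2"
        using sum_squares_bound[of "pmf p i" "pmf q i"] by simp
    qed
    also have "\<dots> = ((\<Sum>i<n. (pmf p i)\<^sup>2) + (\<Sum>i<n. (pmf q i)\<^sup>2)) / 2"
      by (simp add: sum_divide_distrib[symmetric] sum.distrib)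
    finally show ?thesis using \<Phi> by simp
  qed
  then have "V \<le> 3 * (\<Phi> / (real M)\<^sup>2 + (sqrt \<Phi> * \<Phi> + sqrt \<Phi> * \<Phi>) / M)"
    using batch_second_moment cub[OF \<Phi>] cub[OF \<Phi>(2,1)] unfolding V_def c_def[symmetric]
    by (smt (verit) divide_right_mono of_nat_0_le_iff zero_le_power2)
  also have "\<dots> = 3 * (\<Phi> * (1 + 2 * (M * sqrt \<Phi>))) / (real M)\<^sup>2"
    using M by (simp add: field_simps power2_eq_square)
  also have "\<dots> \<le> R * M * e\<^sup>2 / 16 / (real M)\<^sup>2" using big by (intro divide_right_mono) auto
  also have "\<dots> = (R / M) * e\<^sup>2 / 16" using M by (simp add: power2_eq_square)
  also have "\<dots> \<le> B * e\<^sup>2 / 16" using Bge by (intro divide_right_mono mult_right_mono) auto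
  finally have V: "V \<le> B * e\<^sup>2 / 16" .
  have mean: "expect (batch_pmf n M p q) (\<lambda>z. z) = c" unfolding c_def by (rule batch_mean)
  have "expect (replicate_pmf B (batch_pmf n M p q)) (\<lambda>zs. (sum_list zs / B - c)\<^sup>2)
      = expect (replicate_pmf B (batch_pmf n M p q)) (\<lambda>zs. (sum_list (map (\<lambda>z. z) zs) - B * c)\<^sup>2 / (real B)\<^sup>2)"
    using Bpos by (intro expect_cong) (simp add: power2_eq_square field_simps)
  also have "\<dots> = B * V / (real B)\<^sup>2"
    using expect_replicate_variance[OF finb mean, of B] by (simp add: V_def)
  also have "\<dots> = V / B" using Bpos by (simp add: power2_eq_square)
  also have "\<dots> \<le> e\<^sup>2 / 16" using V Bpos by (simp add: field_simps)
  finally have "expect (replicate_pmf B (batch_pmf n M p q)) (\<lambda>zs. (sum_list zs / B - c)\<^sup>2) / e\<^sup>2 \<le> 1 / 16"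
    using e by (simp add: field_simps)
  moreover have "measure_pmf.prob (replicate_pmf B (batch_pmf n M p q)) {zs. \<not> \<bar>sum_list zs / B - c\<bar> \<le> e}
      \<le> expect (replicate_pmf B (batch_pmf n M p q)) (\<lambda>zs. (sum_list zs / B - c)\<^sup>2) / e\<^sup>2"
    by (rule chebyshev_pmf[OF finite_replicate_pmf[OF finb] e])
  ultimately have "measure_pmf.prob (replicate_pmf B (batch_pmf n M p q)) {zs. \<not> \<bar>sum_list zs / B - c\<bar> \<le> e} \<le> 1 / 16"
    by linarith
  then show ?thesis unfolding B_def[symmetric] c_def[symmetric]
    by (simp add: measure_map_pmf vimage_def)
qed

end

section \<open>Spectral expansion of the lazy random walk\<close>

context regular_spectral
begin

abbreviation walk :: "nat \<Rightarrow> nat \<Rightarrow> nat pmf" where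
  "walk t x \<equiv> result (lazy_walk E t x)"

lemma nbrs: assumes "x < n" shows "finite {y. E x y}" "{y. E x y} \<noteq> {}"
proof -
  show "finite {y. E x y}" using neighbours[of x] by simp
  then show "{y. E x y} \<noteq> {}" using degree_eq[OF assms] d_pos by (metis card.empty of_nat_0 less_irrefl)
qed

lemma set_lazy_step: "x < n \<Longrightarrow> set_pmf (lazy_step E x) \<subseteq> {..<n}"
  using set_pmf_of_set[OF nbrs(2,1), of x] E_bound by (auto simp: lazy_step_def split: if_splits)

lemma walk_support: "x < n \<Longrightarrow> set_pmf (walk t x) \<subseteq> {..<n}"
proof (induction t arbitrary: x)
  case (Suc t)
  then show ?case using set_lazy_step[OF Suc.prems] by auto
qed simp

text \<open>Conditioning on the first step: staying and moving to a uniform neighbour are averaged,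
  so one step multiplies the coefficient of \<open>v a\<close> by
  \<open>(1 + (1 - lam a)) / 2\<close>.\<close>

lemma walk_pmf:
  assumes "x < n" "i < n"
  shows "pmf (walk t x) i = (\<Sum>a<n. ((1 - lam a / 2) ^ t * v a x) * v a i)"
  using assms(1)
proof (induction t arbitrary: x)
  case 0
  then show ?case using complete[OF 0 assms(2)] by (simp add: pmf_return)
next
  case (Suc t)
  define P where "P y = pmf (walk t y) i" for y
  have fin: "finite (set_pmf (if b then return_pmf x else pmf_of_set {y. E x y}))" for b
    using nbrs[OF Suc.prems] by simp
  have "pmf (walk (Suc t) x) i = expect (lazy_step E x) P"
    by (simp add: pmf_bind P_def[abs_def])
  also have "\<dots> = expect (bernoulli_pmf (1 / 2)) (\<lambda>b. expect (if b then return_pmf x else pmf_of_set {y. E x y}) P)"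
    unfolding lazy_step_def by (rule expect_bind) (use fin in auto)
  also have "\<dots> = P x / 2 + (\<Sum>y | E x y. P y) / d / 2"
    using nbrs[OF Suc.prems] by (simp add: integral_pmf_of_set degree_eq[OF Suc.prems])
  also have "(\<Sum>y | E x y. P y) = (\<Sum>y | E x y. \<Sum>a<n. ((1 - lam a / 2) ^ t * v a y) * v a i)"
    using Suc.IH E_bound by (intro sum.cong refl) (auto simp: P_def)
  also have "\<dots> = (\<Sum>a<n. (1 - lam a / 2) ^ t * v a i * (\<Sum>y | E x y. v a y))"
    by (subst sum.swap) (simp add: sum_distrib_left sum_distrib_right mult.commute mult.left_commute)
  also have "\<dots> = (\<Sum>a<n. (1 - lam a / 2) ^ t * v a i * (d * (1 - lam a) * v a x))"
    using eigen Suc.prems by (intro sum.cong refl) (simp add: sum_adj)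
  also have "P x / 2 + (\<Sum>a<n. (1 - lam a / 2) ^ t * v a i * (d * (1 - lam a) * v a x)) / d / 2
      = (\<Sum>a<n. ((1 - lam a / 2) ^ t * v a x) * v a i / 2 + (1 - lam a / 2) ^ t * v a i * (d * (1 - lam a) * v a x) / d / 2)"
    unfolding P_def Suc.IH[OF Suc.prems] by (simp add: sum.distrib sum_divide_distrib)
  also have "\<dots> = (\<Sum>a<n. ((1 - lam a / 2) ^ Suc t * v a x) * v a i)"
    using d_pos by (intro sum.cong refl) (simp add: field_simps)
  finally show ?case .
qed

lemma walk_dot:
  assumes "x < n" "y < n"
  shows "(\<Sum>i<n. pmf (walk t x) i * pmf (walk t y) i) = (\<Sum>a<n. (1 - lam a / 2) ^ (2 * t) * v a x * v a y)"
proof -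
  have "(\<Sum>i<n. pmf (walk t x) i * pmf (walk t y) i)
      = (\<Sum>a<n. ((1 - lam a / 2) ^ t * v a x) * ((1 - lam a / 2) ^ t * v a y))"
    using inner_combination[of "{..<n}" "\<lambda>a. (1 - lam a / 2) ^ t * v a x" "\<lambda>a. (1 - lam a / 2) ^ t * v a y"]
    by (simp add: walk_pmf assms)
  also have "\<dots> = (\<Sum>a<n. (1 - lam a / 2) ^ (2 * t) * v a x * v a y)"
    unfolding mult_2 power_add by (simp add: algebra_simps)
  finally show ?thesis .
qed

end

section \<open>Accuracy of the oracle for accurate estimates\<close>

lemma mult_diagonal:
  fixes f :: "nat \<times> nat \<Rightarrow> real"
  shows "mat s k f * mat k k (\<lambda>(i, j). if i = j then b i else 0) = mat s k (\<lambda>(i, j). f (i, j) * b j)"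
proof (rule eq_matI)
  fix i j assume "i < dim_row (mat s k (\<lambda>(i, j). f (i, j) * b j))" "j < dim_col (mat s k (\<lambda>(i, j). f (i, j) * b j))"
  then have ij: "i < s" "j < k" by auto
  have "(mat s k f * mat k k (\<lambda>(i, j). if i = j then b i else 0)) $$ (i, j)
      = (\<Sum>l = 0..<k. f (i, l) * (if l = j then b l else 0))"
    using ij by (simp add: scalar_prod_def)
  also have "\<dots> = (\<Sum>l = 0..<k. if l = j then f (i, l) * b l else 0)" by (rule sum.cong) auto
  also have "\<dots> = f (i, j) * b j" using ij by simp
  finally show "(mat s k f * mat k k (\<lambda>(i, j). if i = j then b i else 0)) $$ (i, j)
      = mat s k (\<lambda>(i, j). f (i, j) * b j) $$ (i, j)" using ij by simp
qed auto

text \<open>The diagonal block has an explicit inverse, so it is a unit, \<open>mat_inverse\<close>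
  succeeds, and its result is that inverse by uniqueness. The bilinear form of \<open>\<Psi>\<close>
  then becomes the sum to which the perturbation bound applies.\<close>

lemma truncated_oracle_form:
  fixes W D :: "real mat" and s k :: nat
  assumes diag: "\<And>i j. i < k \<Longrightarrow> j < k \<Longrightarrow> i \<noteq> j \<Longrightarrow> D $$ (i, j) = 0"
    and pos: "\<And>i. i < k \<Longrightarrow> D $$ (i, i) \<noteq> 0"
  defines "Wk \<equiv> mat s k (\<lambda>(i, j). W $$ (i, j))"
  shows "\<exists>Di. mat_inverse (mat k k (\<lambda>(i, j). D $$ (i, j))) = Some Di \<and>
    (\<forall>c. \<forall>x\<in>carrier_vec s. \<forall>y\<in>carrier_vec s.
      x \<bullet> ((c \<cdot>\<^sub>m (Wk * (Di * Di) * transpose_mat Wk)) *\<^sub>v y)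
        = c * (\<Sum>l<k. (\<Sum>i<s. W $$ (i, l) * x $ i) * (\<Sum>i<s. W $$ (i, l) * y $ i) / (D $$ (l, l))\<^sup>2))"
proof -
  let ?Dk = "mat k k (\<lambda>(i, j). D $$ (i, j))"
  define Dv where "Dv = mat k k (\<lambda>(i, j). if i = j then 1 / D $$ (i, i) else 0)"
  define Dw where "Dw = mat k k (\<lambda>(i, j). if i = j then 1 / (D $$ (i, i))\<^sup>2 else 0)"
  have carr: "?Dk \<in> carrier_mat k k" "Dv \<in> carrier_mat k k" "Dw \<in> carrier_mat k k" "Wk \<in> carrier_mat s k"
    by (auto simp: Dv_def Dw_def Wk_def)
  have Dk_alt: "?Dk = mat k k (\<lambda>(i, j). if i = j then D $$ (i, i) else 0)"
    using diag by (intro eq_matI) auto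
  have 1: "?Dk * Dv = 1\<^sub>m k" unfolding Dk_alt Dv_def mult_diagonal using pos
    by (intro eq_matI) auto
  have 2: "Dv * ?Dk = 1\<^sub>m k" unfolding Dk_alt Dv_def mult_diagonal using pos
    by (intro eq_matI) auto
  have 3: "Dv * Dv = Dw" unfolding Dv_def Dw_def mult_diagonal
    by (intro eq_matI) (auto simp: power2_eq_square)
  have "?Dk \<in> Units (ring_mat TYPE(real) k ())"
    using 1 2 carr unfolding Units_def ring_mat_def by auto
  moreover have "mat_inverse ?Dk = None \<Longrightarrow> ?Dk \<notin> Units (ring_mat TYPE(real) k ())"
    by (rule mat_inverse(1)[OF carr(1)])
  ultimately have "mat_inverse ?Dk \<noteq> None" by blast
  then obtain Di where Di: "mat_inverse ?Dk = Some Di" by blast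
  have DiD: "Di * ?Dk = 1\<^sub>m k" "Di \<in> carrier_mat k k" using mat_inverse(2)[OF carr(1) Di] by auto
  have "Di = Di * (?Dk * Dv)" unfolding 1 using DiD(2) by simp
  also have "\<dots> = Dv" using DiD carr by (subst assoc_mult_mat[symmetric]) auto
  finally have DiDv: "Di = Dv" .
  have WD: "Wk * Dw = mat s k (\<lambda>(i, l). W $$ (i, l) / (D $$ (l, l))\<^sup>2)"
    unfolding Wk_def Dw_def mult_diagonal by (intro eq_matI) auto
  define Q where "Q = Wk * Dw * transpose_mat Wk"
  have Qc: "Q \<in> carrier_mat s s" using carr by (auto simp: Q_def)
  have Q: "Q $$ (i, j) = (\<Sum>l<k. W $$ (i, l) * W $$ (j, l) / (D $$ (l, l))\<^sup>2)" if "i < s" "j < s" for i j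
    using that unfolding Q_def WD unfolding Wk_def
    by (simp add: scalar_prod_def atLeast0LessThan mult.commute)
  have form: "x \<bullet> ((c \<cdot>\<^sub>m Q) *\<^sub>v y)
      = c * (\<Sum>l<k. (\<Sum>i<s. W $$ (i, l) * x $ i) * (\<Sum>i<s. W $$ (i, l) * y $ i) / (D $$ (l, l))\<^sup>2)"
    if x: "x \<in> carrier_vec s" and y: "y \<in> carrier_vec s" for c x y
  proof -
    have "x \<bullet> ((c \<cdot>\<^sub>m Q) *\<^sub>v y) = (\<Sum>i<s. x $ i * (\<Sum>j<s. c * Q $$ (i, j) * y $ j))"
      using x y Qc by (auto simp: scalar_prod_def atLeast0LessThan intro!: sum.cong)
    also have "\<dots> = (\<Sum>i<s. \<Sum>j<s. \<Sum>l<k. c * (W $$ (i, l) * x $ i) * (W $$ (j, l) * y $ j) / (D $$ (l, l))\<^sup>2)"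
      by (intro sum.cong refl) (simp add: Q sum_distrib_left sum_distrib_right mult_ac)
    also have "\<dots> = (\<Sum>l<k. \<Sum>i<s. \<Sum>j<s. c * (W $$ (i, l) * x $ i) * (W $$ (j, l) * y $ j) / (D $$ (l, l))\<^sup>2)"
      by (subst sum.swap[of _ "{..<k}" "{..<s}"]) (rule sum.swap)
    also have "\<dots> = c * (\<Sum>l<k. (\<Sum>i<s. W $$ (i, l) * x $ i) * (\<Sum>i<s. W $$ (i, l) * y $ i) / (D $$ (l, l))\<^sup>2)"
      unfolding sum_product unfolding sum_divide_distrib sum_distrib_left by (simp add: mult.assoc)
    finally show ?thesis .
  qed
  show ?thesis
  proof (intro exI[of _ Dv] conjI allI ballI)
    show "mat_inverse ?Dk = Some Dv" using Di DiDv by simp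
    show "x \<bullet> ((c \<cdot>\<^sub>m (Wk * (Dv * Dv) * transpose_mat Wk)) *\<^sub>v y)
        = c * (\<Sum>l<k. (\<Sum>i<s. W $$ (i, l) * x $ i) * (\<Sum>i<s. W $$ (i, l) * y $ i) / (D $$ (l, l))\<^sup>2)"
      if "x \<in> carrier_vec s" "y \<in> carrier_vec s" for c x y
      using form[OF that] unfolding 3 Q_def .
  qed
qed

context clustered_spectral
begin

definition t :: nat where "t = walk_length n \<phi>"

definition D2 :: "nat \<Rightarrow> real" where "D2 a = (1 - lam a / 2) ^ (2 * t)"

text \<open>Lower bound for the retained eigenvalues of the \<open>2 t\<close>-step walk:
  \<open>exp (- 2 * \<epsilon>)\<close> to the power \<open>2 * 20 * ln n / \<phi>^2\<close> is
  \<open>pw (- 80)\<close>, and 99/100 pays for rounding the walk length up.\<close>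

definition mu :: real where "mu = 99 / 100 * pw (- 80)"

definition p_dot :: "nat \<Rightarrow> nat \<Rightarrow> real" where
  "p_dot x y = (\<Sum>i<n. pmf (walk t x) i * pmf (walk t y) i)"

lemma ln_n: "1 \<le> ln n"
proof -
  have "exp 1 \<le> (4::real)" using exp_le by linarith
  also have "4 \<le> real n" using n4 by simp
  finally show ?thesis using n4 by (subst ln_ge_iff) auto
qed

lemma t_bounds: "20 * ln n / \<phi>\<^sup>2 \<le> t" "t \<le> 20 * ln n / \<phi>\<^sup>2 + 1"
proof -
  have "0 \<le> 20 * ln n / \<phi>\<^sup>2" using ln_n by simp
  then show "20 * ln n / \<phi>\<^sup>2 \<le> t" "t \<le> 20 * ln n / \<phi>\<^sup>2 + 1"
    unfolding t_def walk_length_def by linarith+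
qed

lemma mu_pos: "0 < mu" using pw_pos by (simp add: mu_def)

lemma D2_lower: assumes "a < k" shows "mu \<le> D2 a"
proof -
  have e1: "\<epsilon> \<le> 1 / 100000" using eps_small(2) by simp
  have "exp (- 2 * \<epsilon>) \<le> 1 - \<epsilon>"
  proof -
    have "- \<epsilon> - 2 * \<epsilon>\<^sup>2 \<le> ln (1 - \<epsilon>)" using e1 \<epsilon> by (intro ln_one_minus_pos_lower_bound) auto
    moreover have "\<epsilon>\<^sup>2 \<le> 1 / 100000 * \<epsilon>" unfolding power2_eq_square using e1 \<epsilon> by (intro mult_right_mono) auto
    ultimately have "- 2 * \<epsilon> \<le> ln (1 - \<epsilon>)" using \<epsilon> by linarith
    then show ?thesis using \<epsilon> ln_ge_iff[of "1 - \<epsilon>" "- 2 * \<epsilon>"] by simp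
  qed
  also have "\<dots> \<le> 1 - lam a / 2" using lam_top[OF assms] by simp
  finally have "exp (- 2 * \<epsilon>) ^ (2 * t) \<le> D2 a" unfolding D2_def by (intro power_mono) auto
  moreover have "exp (- 2 * \<epsilon>) ^ (2 * t) = exp (- 4 * \<epsilon> * t)"
    by (simp add: exp_of_nat_mult[symmetric] algebra_simps)
  moreover have "exp (- 4 * \<epsilon> - 80 * (\<epsilon> / \<phi>\<^sup>2) * ln n) \<le> exp (- 4 * \<epsilon> * t)"
  proof -
    have "4 * \<epsilon> * t \<le> 4 * \<epsilon> * (20 * ln n / \<phi>\<^sup>2 + 1)" using t_bounds(2) \<epsilon> by (intro mult_left_mono) auto
    also have "\<dots> = 4 * \<epsilon> + 80 * (\<epsilon> / \<phi>\<^sup>2) * ln n" by (simp add: algebra_simps)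
    finally show ?thesis by simp
  qed
  moreover have "exp (- 4 * \<epsilon> - 80 * (\<epsilon> / \<phi>\<^sup>2) * ln n) = exp (- 4 * \<epsilon>) * pw (- 80)"
    by (simp add: pw_exp exp_diff exp_minus field_simps)
  moreover have "99 / 100 * pw (- 80) \<le> exp (- 4 * \<epsilon>) * pw (- 80)"
  proof (rule mult_right_mono)
    show "99 / 100 \<le> exp (- 4 * \<epsilon>)" using exp_ge_add_one_self[of "- 4 * \<epsilon>"] e1 by linarith
  qed (use pw_pos in \<open>simp add: less_imp_le\<close>)
  ultimately show ?thesis unfolding mu_def by linarith
qed

text \<open>\<open>(1 - lam a / 2) ^ (2 * t)\<close> is at most \<open>exp (- lam a * t)\<close>,
  and \<open>lam a * t\<close> is at least \<open>10 * ln n\<close> by the spectral gap.\<close>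

lemma D2_tail: assumes "k \<le> a" "a < n" shows "0 \<le> D2 a" "D2 a \<le> 1 / real n ^ 10"
proof -
  have l: "0 \<le> 1 - lam a / 2" using lam_le_2[OF assms(2)] by simp
  then show "0 \<le> D2 a" by (simp add: D2_def)
  have "1 - lam a / 2 \<le> exp (- lam a / 2)" using exp_ge_add_one_self[of "- lam a / 2"] by simp
  then have "D2 a \<le> exp (- lam a / 2) ^ (2 * t)" unfolding D2_def using l by (intro power_mono) auto
  also have "\<dots> = exp (- (lam a * t))" by (simp add: exp_of_nat_mult[symmetric] algebra_simps)
  also have "\<dots> \<le> exp (- (10 * ln n))"
  proof -
    have "10 * ln n = \<phi>\<^sup>2 / 2 * (20 * ln n / \<phi>\<^sup>2)" using \<phi> by simp
    also have "\<dots> \<le> lam a * t"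
      using lam_gap[OF assms] t_bounds(1) ln_n lam_nonneg[OF assms(2)] by (intro mult_mono) auto
    finally show ?thesis by simp
  qed
  also have "\<dots> = 1 / real n ^ 10"
    using n4 by (simp add: exp_minus exp_of_nat_mult[of 10 "ln n", simplified] divide_inverse)
  finally show "D2 a \<le> 1 / real n ^ 10" .
qed

text \<open>For the discarded part, AM-GM passes to squares of entries, whose sum over the whole
  eigenbasis is 1 by completeness.\<close>

lemma p_dot_split:
  assumes x: "x < n" and y: "y < n"
  shows "\<bar>p_dot x y - (\<Sum>a<k. D2 a * v a x * v a y)\<bar> \<le> 1 / real n ^ 10"
proof -
  have kn: "k \<le> n" using two_k_le_n by linarith
  have "{..<n} = {..<k} \<union> {k..<n}" "{..<k} \<inter> {k..<n} = {}" using kn by auto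
  then have "p_dot x y = (\<Sum>a<k. D2 a * v a x * v a y) + (\<Sum>a\<in>{k..<n}. D2 a * v a x * v a y)"
    unfolding p_dot_def walk_dot[OF x y] D2_def[symmetric] by (simp add: sum.union_disjoint)
  moreover have "\<bar>\<Sum>a\<in>{k..<n}. D2 a * v a x * v a y\<bar> \<le> 1 / real n ^ 10"
  proof -
    have "\<bar>\<Sum>a\<in>{k..<n}. D2 a * v a x * v a y\<bar> \<le> (\<Sum>a\<in>{k..<n}. \<bar>D2 a * v a x * v a y\<bar>)" by (rule sum_abs)
    also have "\<dots> \<le> (\<Sum>a\<in>{k..<n}. 1 / real n ^ 10 * (((v a x)\<^sup>2 + (v a y)\<^sup>2) / 2))"
    proof (rule sum_mono)
      fix a assume a: "a \<in> {k..<n}"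
      have "\<bar>v a x\<bar> * \<bar>v a y\<bar> \<le> ((v a x)\<^sup>2 + (v a y)\<^sup>2) / 2"
        using sum_squares_bound[of "\<bar>v a x\<bar>" "\<bar>v a y\<bar>"] by simp
      moreover have "\<bar>D2 a * v a x * v a y\<bar> = D2 a * (\<bar>v a x\<bar> * \<bar>v a y\<bar>)"
        using D2_tail(1)[of a] a by (simp add: abs_mult)
      ultimately show "\<bar>D2 a * v a x * v a y\<bar> \<le> 1 / real n ^ 10 * (((v a x)\<^sup>2 + (v a y)\<^sup>2) / 2)"
        using mult_mono[of "D2 a" "1 / real n ^ 10" "\<bar>v a x\<bar> * \<bar>v a y\<bar>" "((v a x)\<^sup>2 + (v a y)\<^sup>2) / 2"]
          D2_tail[of a] a by auto
    qed
    also have "\<dots> \<le> (\<Sum>a<n. 1 / real n ^ 10 * (((v a x)\<^sup>2 + (v a y)\<^sup>2) / 2))"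
      by (intro sum_mono2) auto
    also have "\<dots> = 1 / real n ^ 10 * (((\<Sum>a<n. v a x * v a x) + (\<Sum>a<n. v a y * v a y)) / 2)"
      by (simp add: sum_distrib_left[symmetric] sum_divide_distrib[symmetric] sum.distrib power2_eq_square)
    also have "\<dots> = 1 / real n ^ 10" using complete[OF x x] complete[OF y y] by simp
    finally show ?thesis .
  qed
  ultimately show ?thesis by simp
qed

lemma Fb_lower: "12 / n \<le> Fb"
proof -
  have "1 * (4 * 1) \<le> \<beta> * ((real k)\<^sup>2 * pw 60)"
    using beta_ge_1 k2 pw_ge_1[of 60] power_mono[of 2 "real k" 2] by (intro mult_mono) auto
  then show ?thesis unfolding Fb_def using n4 by (intro divide_right_mono) auto
qed

lemma Fb_pos: "0 < Fb"
proof -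
  have "0 < 12 / real n" using n4 by simp
  then show ?thesis using Fb_lower by linarith
qed

text \<open>The diagonal case of the splitting, through which the sup-norm bound reaches the
  variance of the estimator. The factor 2 covers the discarded spectrum.\<close>

lemma walk_norm: assumes x: "x < n" shows "(\<Sum>i<n. (pmf (walk t x) i)\<^sup>2) \<le> 2 * Fb"
proof -
  have "D2 a * v a x * v a x \<le> (v a x)\<^sup>2" if "a < k" for a
  proof -
    have an: "a < n" using that two_k_le_n by linarith
    have "D2 a \<le> 1" unfolding D2_def using lam_nonneg[OF an] lam_le_2[OF an] by (intro power_le_one) auto
    then have "D2 a * (v a x)\<^sup>2 \<le> 1 * (v a x)\<^sup>2" by (intro mult_right_mono) auto
    then show ?thesis by (simp add: power2_eq_square algebra_simps)
  qed
  then have "(\<Sum>a<k. D2 a * v a x * v a x) \<le> (\<Sum>a<k. (v a x)\<^sup>2)" by (intro sum_mono) auto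
  moreover have "1 / real n ^ 10 \<le> 12 / n"
  proof -
    have "real n \<le> real n ^ 10" using n4 by (intro self_le_power) auto
    then have "1 / real n ^ 10 \<le> 1 / n" using n4 by (intro divide_left_mono) auto
    then show ?thesis using n4 by (smt (verit) divide_right_mono of_nat_0_le_iff)
  qed
  ultimately have "p_dot x x \<le> 2 * Fb"
    using p_dot_split[OF x x] embedding_norm_bound(1)[OF x] Fb_lower by linarith
  then show ?thesis by (simp add: p_dot_def power2_eq_square)
qed

text \<open>The error caused by the discarded part of the spectrum does not decrease with the number of
  samples, so it is estimated with explicit constants, which suffice because \<open>4 \<le> n\<close>.\<close>

definition \<delta>_err :: "real \<Rightarrow> real" where "\<delta>_err \<xi> = \<xi> / (10 * n * Fb)"
definition init_err :: "real \<Rightarrow> real" where "init_err \<xi> = \<xi> * mu / (100 * (real n)\<^sup>2 * Fb)"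
definition query_err :: "real \<Rightarrow> real" where "query_err \<xi> = \<xi> * mu / (100 * n * sqrt n * sqrt Fb)"

text \<open>With \<open>\<tau> = (4 * \<eta> * F + 6/5 * \<gamma>) / mu\<close>, the three terms are
  at most 0.11, 0.735 and 0.1225 times \<open>\<xi> / n\<close>. Taking the minimum in
  \<open>F\<close> serves two purposes: \<open>F^2 \<le> Fb\<close> cancels the powers of
  \<open>Fb\<close> in the error definitions, and \<open>F \<le> 1\<close> controls the discarded
  spectrum.\<close>

lemma error_budget:
  assumes \<xi>: "1 / real n ^ 5 < \<xi>" "\<xi> < 1"
  defines "\<eta> \<equiv> n * (init_err \<xi> + 1 / real n ^ 10)"
    and "\<gamma> \<equiv> sqrt n * (query_err \<xi> + 1 / real n ^ 10)"
    and "F \<equiv> sqrt (min 1 Fb)"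
  shows "\<delta>_err \<xi> \<le> 1 / 100" "\<eta> \<le> mu / 20"
    "11 / 10 * \<delta>_err \<xi> * F\<^sup>2 + 21 / 10 * F * ((4 * \<eta> * F + 6 / 5 * \<gamma>) / mu) + ((4 * \<eta> * F + 6 / 5 * \<gamma>) / mu)\<^sup>2 \<le> \<xi> / n"
proof -
  have np: "0 < real n" "4 \<le> real n" using n4 by auto
  have \<xi>0: "0 < \<xi>" using \<xi>(1) np by (smt (verit) divide_pos_pos zero_less_power)
  have pow10: "real n ^ 10 = n * real n ^ 9" and pow9: "real n ^ 9 = n * real n ^ 8"
    and pow8: "real n ^ 8 = (real n)\<^sup>2 * (real n ^ 5 * n)" by (simp_all add: eval_nat_numeral)
  have cancel: "n * (1 / (n * X)) = 1 / X" for X :: real using np by simp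
  have nFb: "12 \<le> n * Fb" using Fb_lower np by (simp add: field_simps)
  note Fb0 = Fb_pos and mu0 = mu_pos
  have F2: "F\<^sup>2 \<le> 1" "F\<^sup>2 \<le> Fb" "0 \<le> F" "F \<le> 1" "F \<le> sqrt Fb"
    using Fb0 by (auto simp: F_def min_def)
  have F2n: "1 / n \<le> F\<^sup>2"
  proof -
    have "1 / n \<le> 12 / n" using np by (intro divide_right_mono) auto
    then have "1 / n \<le> Fb" using Fb_lower by linarith
    moreover have "1 / n \<le> 1" using np by simp
    ultimately show ?thesis using Fb0 by (auto simp: F_def min_def)
  qed
  then have Fpos: "0 < F" using F2(3) np by (cases "F = 0") auto
  \<comment> \<open>Since \<open>\<epsilon> / \<phi>^2 \<le> 10^-5\<close>, even
    \<open>pw 100000\<close> is at most \<open>n\<close>, so \<open>mu\<close> loses at most one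
    power of \<open>n\<close>.\<close>
  have mu_low: "99 / 100 / n \<le> mu"
  proof -
    have "pw 80 \<le> pw 100000" by (rule pw_mono) simp
    also have "\<dots> \<le> real n powr 1"
    proof -
      have "100000 * \<epsilon> / \<phi>\<^sup>2 \<le> 1" using ratio by (simp add: mult.commute)
      then show ?thesis unfolding pw_def using np by (intro powr_mono) auto
    qed
    finally have "pw 80 \<le> n" using np by simp
    then have "1 / n \<le> 1 / pw 80" using np pw_pos[of 80] by (intro divide_left_mono) auto
    moreover have "pw (- 80) = 1 / pw 80" using pw_add[of 80 "-80"] pw_pos[of 80] by (simp add: field_simps)
    ultimately show ?thesis by (simp add: mu_def)
  qed
  show "\<delta>_err \<xi> \<le> 1 / 100"
  proof -
    have "\<xi> / (10 * (n * Fb)) \<le> 1 / (10 * 12)" using nFb \<xi> \<xi>0 by (intro frac_le) auto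
    then show ?thesis by (simp add: \<delta>_err_def mult.assoc)
  qed
  have n9: "1 / real n ^ 9 \<le> mu / 40"
  proof -
    have "65536 \<le> real n ^ 8" using power_mono[of 4 "real n" 8] np by simp
    then have "1 / real n ^ 8 \<le> 1 / 65536" using np by (intro divide_left_mono) auto
    then have "1 / real n ^ 8 / n \<le> 1 / 65536 / n" using np by (intro divide_right_mono) simp_all
    also have "1 / real n ^ 8 / n = 1 / real n ^ 9" unfolding pow9 by (simp only: divide_divide_eq_left mult.commute)
    also have "1 / 65536 / n \<le> 99 / 100 / n / 40" using np by (simp add: field_simps)
    also have "\<dots> \<le> mu / 40" using mu_low by (rule divide_right_mono) simp
    finally show ?thesis .
  qed
  have n10: "n * (1 / real n ^ 10) = 1 / real n ^ 9" unfolding pow10 by (rule cancel)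
  have i1: "n * init_err \<xi> = \<xi> * mu / (100 * (n * Fb))"
    using np Fb0 by (simp add: init_err_def power2_eq_square)
  have "n * init_err \<xi> \<le> mu / 40"
  proof -
    have "\<xi> * mu / (100 * (n * Fb)) \<le> 1 * mu / (100 * 12)" using nFb \<xi> \<xi>0 mu0 by (intro frac_le mult_right_mono) auto
    then show ?thesis unfolding i1 using mu0 by linarith
  qed
  then show "\<eta> \<le> mu / 20" unfolding \<eta>_def distrib_left n10 using n9 by linarith
  define \<tau> where "\<tau> = (4 * \<eta> * F + 6 / 5 * \<gamma>) / mu"
  \<comment> \<open>One power of \<open>n\<close> goes to \<open>1 / mu\<close>. Of the remaining
    \<open>n^-8\<close>, five powers are traded for \<open>\<xi>\<close>, one supplies the target
    \<open>1 / n\<close>, and two give the factor 1/16.\<close>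
  have tail: "1 / real n ^ 9 / mu \<le> 1 / 16 * (100 / 99) * (\<xi> / n)"
  proof -
    have "1 / real n ^ 9 / mu \<le> 1 / real n ^ 9 / (99 / 100 / n)"
      using mu_low mu0 np by (intro divide_left_mono) auto
    also have "\<dots> = (100 / 99) * (1 / real n ^ 8)"
    proof -
      have "1 / (n * X) / (99 / 100 / n) = 100 / 99 * (1 / X)" for X :: real using np by (simp add: field_simps)
      then show ?thesis unfolding pow9 .
    qed
    also have "1 / real n ^ 8 = 1 / (real n)\<^sup>2 * (1 / real n ^ 5 / n)"
      unfolding pow8 by (simp only: divide_divide_eq_left times_divide_times_eq mult_1)
    also have "\<dots> \<le> 1 / 16 * (\<xi> / n)"
    proof (rule mult_mono)
      have "4\<^sup>2 \<le> (real n)\<^sup>2" using np by (intro power_mono) auto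
      then show "1 / (real n)\<^sup>2 \<le> 1 / 16" using np by (intro divide_left_mono) auto
      show "1 / real n ^ 5 / n \<le> \<xi> / n" using \<xi> by (intro divide_right_mono) auto
    qed auto
    finally show ?thesis by simp
  qed
  have A: "4 * \<eta> * F\<^sup>2 / mu \<le> 4 / 100 * (\<xi> / n) + 4 * (1 / real n ^ 9 / mu)"
  proof -
    have "n * init_err \<xi> * F\<^sup>2 \<le> n * init_err \<xi> * Fb"
      using F2 \<xi>0 mu0 Fb0 by (intro mult_left_mono) (auto simp: init_err_def)
    also have "\<dots> = \<xi> / n * mu / 100" unfolding i1 using np Fb0 by simp
    finally have 1: "n * init_err \<xi> * F\<^sup>2 \<le> \<xi> / n * mu / 100" .
    have 2: "1 / real n ^ 9 * F\<^sup>2 \<le> 1 / real n ^ 9 * 1" using F2 by (intro mult_left_mono) auto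
    have "4 * \<eta> * F\<^sup>2 = 4 * (n * init_err \<xi> * F\<^sup>2) + 4 * (1 / real n ^ 9 * F\<^sup>2)"
      unfolding \<eta>_def distrib_left n10 by (simp add: algebra_simps)
    also have "\<dots> \<le> 4 * (\<xi> / n * mu / 100) + 4 * (1 / real n ^ 9)" using 1 2 by linarith
    finally have "4 * \<eta> * F\<^sup>2 / mu \<le> (4 * (\<xi> / n * mu / 100) + 4 * (1 / real n ^ 9)) / mu"
      using mu0 by (intro divide_right_mono) auto
    also have "\<dots> = 4 / 100 * (\<xi> / n) + 4 * (1 / real n ^ 9 / mu)" using mu0 by (simp add: add_divide_distrib)
    finally show ?thesis .
  qed
  have B: "6 / 5 * \<gamma> * F / mu \<le> 12 / 1000 * (\<xi> / n) + 6 / 10 * (1 / real n ^ 9 / mu)"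
  proof -
    have q1: "sqrt n * query_err \<xi> = \<xi> * mu / (100 * n * sqrt Fb)" using np Fb0 by (simp add: query_err_def)
    have "sqrt n * query_err \<xi> * F \<le> sqrt n * query_err \<xi> * sqrt Fb"
      using F2 \<xi>0 mu0 Fb0 by (intro mult_left_mono) (auto simp: query_err_def)
    also have "\<dots> = \<xi> / n * mu / 100" unfolding q1 using np Fb0 by simp
    finally have 1: "sqrt n * query_err \<xi> * F \<le> \<xi> / n * mu / 100" .
    have "sqrt n * 2 \<le> sqrt n * sqrt n" using np real_le_rsqrt[of 2 "real n"] by (intro mult_left_mono) auto
    then have "sqrt n \<le> n / 2" using np by simp
    then have "sqrt n * (1 / real n ^ 10) \<le> n / 2 * (1 / real n ^ 10)" by (intro mult_right_mono) auto
    then have s10: "sqrt n * (1 / real n ^ 10) \<le> 1 / 2 * (1 / real n ^ 9)" using n10 by simp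
    moreover have "sqrt n * (1 / real n ^ 10) * F \<le> sqrt n * (1 / real n ^ 10) * 1"
      using F2 by (intro mult_left_mono) auto
    ultimately have 2: "sqrt n * (1 / real n ^ 10) * F \<le> 1 / 2 * (1 / real n ^ 9)" by linarith
    have "6 / 5 * \<gamma> * F = 6 / 5 * (sqrt n * query_err \<xi> * F) + 6 / 5 * (sqrt n * (1 / real n ^ 10) * F)"
      unfolding \<gamma>_def by (simp add: algebra_simps)
    also have "\<dots> \<le> 6 / 5 * (\<xi> / n * mu / 100) + 6 / 10 * (1 / real n ^ 9)"
    proof -
      have "6 / 5 * a + 6 / 5 * c \<le> 6 / 5 * b + 6 / 10 * e" if "a \<le> b" "c \<le> 1 / 2 * e" for a b c e :: real
        using that by linarith
      from this[OF 1 2] show ?thesis .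
    qed
    finally have "6 / 5 * \<gamma> * F / mu \<le> (6 / 5 * (\<xi> / n * mu / 100) + 6 / 10 * (1 / real n ^ 9)) / mu"
      using mu0 by (intro divide_right_mono) auto
    also have "\<dots> = 12 / 1000 * (\<xi> / n) + 6 / 10 * (1 / real n ^ 9 / mu)" using mu0 by (simp add: add_divide_distrib)
    finally show ?thesis .
  qed
  have "F * \<tau> = 4 * \<eta> * F\<^sup>2 / mu + 6 / 5 * \<gamma> * F / mu"
    by (simp add: \<tau>_def power2_eq_square add_divide_distrib algebra_simps)
  also have "\<dots> \<le> 35 / 100 * (\<xi> / n)"
  proof -
    have "a + b \<le> 35 / 100 * z"
      if "a \<le> 4 / 100 * z + 4 * r" "b \<le> 12 / 1000 * z + 6 / 10 * r" "r \<le> 1 / 16 * (100 / 99) * z" "0 < z"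
      for a b r z :: real using that by linarith
    from this[OF A B tail divide_pos_pos[OF \<xi>0 np(1)]] show ?thesis .
  qed
  finally have F\<tau>: "F * \<tau> \<le> 35 / 100 * (\<xi> / n)" .
  have \<tau>0: "0 \<le> \<tau>"
    using \<xi>0 mu0 Fb0 F2 by (auto simp: \<tau>_def \<eta>_def \<gamma>_def init_err_def query_err_def intro!: divide_nonneg_nonneg add_nonneg_nonneg mult_nonneg_nonneg)
  \<comment> \<open>\<open>\<xi> / n \<le> 1 / n \<le> F^2\<close> turns the bound on
    \<open>F * \<tau>\<close> into one on \<open>\<tau>\<close>, which makes the quadratic term
    comparable to the linear one.\<close>
  have "\<tau> \<le> 35 / 100 * F"
  proof -
    have "\<xi> / n \<le> 1 / n" using \<xi> by (intro divide_right_mono) auto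
    then have "F * \<tau> \<le> F * (35 / 100 * F)" using F\<tau> F2n by (simp add: power2_eq_square)
    then show ?thesis using Fpos mult_le_cancel_left_pos by blast
  qed
  then have "\<tau> * \<tau> \<le> 35 / 100 * F * \<tau>" using \<tau>0 by (intro mult_right_mono) auto
  then have \<tau>2: "\<tau>\<^sup>2 \<le> 35 / 100 * (F * \<tau>)" by (simp add: power2_eq_square)
  have "\<delta>_err \<xi> * F\<^sup>2 \<le> \<delta>_err \<xi> * Fb" using F2 \<xi>0 Fb0 by (intro mult_left_mono) (auto simp: \<delta>_err_def)
  also have "\<dots> = 1 / 10 * (\<xi> / n)" using Fb0 by (simp add: \<delta>_err_def)
  finally have "\<delta>_err \<xi> * F\<^sup>2 \<le> 1 / 10 * (\<xi> / n)" .
  then have "11 / 10 * (\<delta>_err \<xi> * F\<^sup>2) + 21 / 10 * (F * \<tau>) + \<tau>\<^sup>2 \<le> \<xi> / n"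
    using F\<tau> \<tau>2 divide_pos_pos[OF \<xi>0 np(1)] by linarith
  then show "11 / 10 * \<delta>_err \<xi> * F\<^sup>2 + 21 / 10 * F * ((4 * \<eta> * F + 6 / 5 * \<gamma>) / mu) + ((4 * \<eta> * F + 6 / 5 * \<gamma>) / mu)\<^sup>2 \<le> \<xi> / n"
    unfolding \<tau>_def[symmetric] by (simp only: mult.assoc)
qed

end

context clustered_spectral
begin

text \<open>With \<open>A j a = sqrt (n / s) * v a (IS ! j)\<close> the sampled Gram matrix is near
  the identity. The query vectors are scaled by the same \<open>sqrt (n / s)\<close>, and the
  product of the two square roots is the prefactor of \<open>\<Psi>\<close>. The inverse is obtained
  before \<open>x\<close> and \<open>y\<close> are chosen, so one oracle serves all pairs.\<close>

lemma oracle_accurate: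
  fixes IS :: "nat list" and G W D :: "real mat"
  assumes \<xi>: "1 / real n ^ 5 < \<xi>" "\<xi> < 1"
    and len: "length IS = s" and ks: "k \<le> s" and IS: "\<And>j. j < s \<Longrightarrow> IS ! j < n"
    and sample: "\<And>a b. a < k \<Longrightarrow> b < k \<Longrightarrow>
        \<bar>real n / s * (\<Sum>j<s. v a (IS ! j) * v b (IS ! j)) - (if a = b then 1 else 0)\<bar> \<le> \<delta>_err \<xi> / k"
    and Gc: "G \<in> carrier_mat s s" and Gsym: "transpose_mat G = G"
    and G: "\<And>i j. i < s \<Longrightarrow> j < s \<Longrightarrow> \<bar>G $$ (i, j) - p_dot (IS ! i) (IS ! j)\<bar> \<le> init_err \<xi>"
    and eig: "eigensolver eig" "eig ((real n / real s) \<cdot>\<^sub>m G) = (W, D)"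
  defines "Wk \<equiv> mat s k (\<lambda>(i, j). W $$ (i, j))"
  shows "\<exists>Di. mat_inverse (mat k k (\<lambda>(i, j). D $$ (i, j))) = Some Di \<and>
    (\<forall>x y \<alpha>x \<alpha>y. x < n \<longrightarrow> y < n \<longrightarrow> \<alpha>x \<in> carrier_vec s \<longrightarrow> \<alpha>y \<in> carrier_vec s \<longrightarrow>
      (\<forall>i<s. \<bar>\<alpha>x $ i - p_dot x (IS ! i)\<bar> \<le> query_err \<xi>) \<longrightarrow>
      (\<forall>i<s. \<bar>\<alpha>y $ i - p_dot y (IS ! i)\<bar> \<le> query_err \<xi>) \<longrightarrow>
      \<bar>\<alpha>x \<bullet> (((real n / real s) \<cdot>\<^sub>m (Wk * (Di * Di) * transpose_mat Wk)) *\<^sub>v \<alpha>y) - (\<Sum>a<k. v a x * v a y)\<bar> \<le> \<xi> / n)"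
proof -
  define c where "c = real n / real s"
  have spos: "0 < real s" using ks k2 by simp
  have cpos: "0 < c" using spos n4 by (simp add: c_def)
  have cc: "sqrt c * sqrt c = c" using cpos by simp
  define A where "A j a = sqrt c * v a (IS ! j)" for j a
  define G' where "G' i j = c * G $$ (i, j)" for i j
  define W' where "W' i l = W $$ (i, l)" for i l
  define \<sigma> where "\<sigma> l = D $$ (l, l)" for l
  define \<eta> where "\<eta> = n * (init_err \<xi> + 1 / real n ^ 10)"
  define \<gamma> where "\<gamma> = sqrt n * (query_err \<xi> + 1 / real n ^ 10)"
  define F where "F = sqrt (min 1 Fb)"
  note budget = error_budget[OF \<xi>, folded \<eta>_def \<gamma>_def F_def]
  have \<xi>0: "0 < \<xi>" using order.strict_trans1[OF _ \<xi>(1), of 0] by simp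
  have Gs: "G $$ (i, j) = G $$ (j, i)" if "i < s" "j < s" for i j
    using index_transpose_mat(1)[of i G j] that Gc unfolding Gsym by simp
  have cG: "c \<cdot>\<^sub>m G \<in> carrier_mat s s" "transpose_mat (c \<cdot>\<^sub>m G) = c \<cdot>\<^sub>m G"
    using Gc Gs by (auto intro!: eq_matI)
  have "W \<in> carrier_mat s s \<and> D \<in> carrier_mat s s \<and>
      W * transpose_mat W = 1\<^sub>m s \<and> transpose_mat W * W = 1\<^sub>m s \<and>
      diagonal_mat D \<and> (\<forall>i j. i \<le> j \<and> j < s \<longrightarrow> D $$ (j, j) \<le> D $$ (i, i)) \<and>
      c \<cdot>\<^sub>m G = W * D * transpose_mat W"
    using mp[OF spec[OF spec[OF eig(1)[unfolded eigensolver_def], of s], of "c \<cdot>\<^sub>m G"] conjI[OF cG]]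
    unfolding eig(2)[folded c_def] prod.case .
  then have es: "W \<in> carrier_mat s s" "D \<in> carrier_mat s s" "W * transpose_mat W = 1\<^sub>m s"
    "transpose_mat W * W = 1\<^sub>m s" "diagonal_mat D" "\<And>i j. i \<le> j \<Longrightarrow> j < s \<Longrightarrow> D $$ (j, j) \<le> D $$ (i, i)"
    "c \<cdot>\<^sub>m G = W * D * transpose_mat W"
    by blast+
  have Ddiag: "D $$ (i, j) = 0" if "i < s" "j < s" "i \<noteq> j" for i j
    using es(5) that es(2) unfolding diagonal_mat_def by auto
  have Wrows: "(\<Sum>l<s. W' i l * W' j l) = (if i = j then 1 else 0)" if "i < s" "j < s" for i j
  proof -
    have "(W * transpose_mat W) $$ (i, j) = (\<Sum>l<s. W' i l * W' j l)"
      using that es(1) by (simp add: scalar_prod_def W'_def atLeast0LessThan)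
    then show ?thesis using es(3) that by simp
  qed
  have Wcols: "(\<Sum>j<s. W' j l * W' j l') = (if l = l' then 1 else 0)" if "l < s" "l' < s" for l l'
  proof -
    have "(transpose_mat W * W) $$ (l, l') = (\<Sum>j<s. W' j l * W' j l')"
      using that es(1) by (simp add: scalar_prod_def W'_def atLeast0LessThan)
    then show ?thesis using es(4) that by simp
  qed
  have Dmat: "D = mat s s (\<lambda>(i, j). if i = j then \<sigma> i else 0)"
    using Ddiag es(2) by (intro eq_matI) (auto simp: \<sigma>_def)
  have WD: "W * D = mat s s (\<lambda>(i, l). W $$ (i, l) * \<sigma> l)"
  proof -
    have Wm: "mat s s (\<lambda>p. W $$ p) = W" using es(1) by (intro eq_matI) auto
    show ?thesis using mult_diagonal[of s s "\<lambda>p. W $$ p" \<sigma>] unfolding Wm Dmat[symmetric] .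
  qed
  have Geq: "G' i j = (\<Sum>l<s. W' i l * \<sigma> l * W' j l)" if "i < s" "j < s" for i j
  proof -
    have "G' i j = (c \<cdot>\<^sub>m G) $$ (i, j)" using that Gc by (simp add: G'_def)
    also have "\<dots> = (\<Sum>l<s. W' i l * \<sigma> l * W' j l)"
      unfolding es(7) WD using that es(1) by (simp add: scalar_prod_def W'_def atLeast0LessThan)
    finally show ?thesis .
  qed
  have sc: "(sqrt c * p) * (sqrt c * r) = c * (p * r)" for p r
    using arg_cong[OF cc, of "\<lambda>z. z * (p * r)"] by (simp only: mult_ac)
  have sc': "(sqrt c * p) * d * (sqrt c * r) = c * (d * p * r)" for p r d
    using arg_cong[OF cc, of "\<lambda>z. z * (d * p * r)"] by (simp only: mult_ac)
  have gram: "\<bar>(\<Sum>j<s. A j a * A j b) - (if a = b then 1 else 0)\<bar> \<le> \<delta>_err \<xi> / k" if "a < k" "b < k" for a b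
  proof -
    have "(\<Sum>j<s. A j a * A j b) = c * (\<Sum>j<s. v a (IS ! j) * v b (IS ! j))"
      unfolding A_def sc sum_distrib_left ..
    then show ?thesis using sample[OF that] by (simp add: c_def)
  qed
  have AD: "(\<Sum>a<k. A i a * D2 a * A j a) = c * (\<Sum>a<k. D2 a * v a (IS ! i) * v a (IS ! j))" for i j
    unfolding A_def sc' sum_distrib_left ..
  have noise: "\<bar>G' i j - (\<Sum>a<k. A i a * D2 a * A j a)\<bar> \<le> \<eta> / s" if "i < s" "j < s" for i j
  proof -
    have "\<bar>G $$ (i, j) - (\<Sum>a<k. D2 a * v a (IS ! i) * v a (IS ! j))\<bar> \<le> init_err \<xi> + 1 / real n ^ 10"
      using G[OF that] p_dot_split[OF IS[OF that(1)] IS[OF that(2)]] by linarith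
    then have "c * \<bar>G $$ (i, j) - (\<Sum>a<k. D2 a * v a (IS ! i) * v a (IS ! j))\<bar> \<le> c * (init_err \<xi> + 1 / real n ^ 10)"
      using cpos by (intro mult_left_mono) auto
    moreover have "\<bar>G' i j - (\<Sum>a<k. A i a * D2 a * A j a)\<bar> = c * \<bar>G $$ (i, j) - (\<Sum>a<k. D2 a * v a (IS ! i) * v a (IS ! j))\<bar>"
      unfolding G'_def AD right_diff_distrib[symmetric] abs_mult using cpos by simp
    ultimately show ?thesis by (simp add: \<eta>_def c_def)
  qed
  have err0: "0 \<le> init_err \<xi>" "0 \<le> query_err \<xi>" "0 \<le> \<delta>_err \<xi>"
    using \<xi>0 mu_pos Fb_pos by (auto simp: init_err_def query_err_def \<delta>_err_def)
  interpret L: perturbed_low_rank s k A D2 G' W' \<sigma> "\<delta>_err \<xi>" \<eta> mu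
  proof
    show "1 \<le> k" using k2 by simp
    show "\<sigma> j \<le> \<sigma> i" if "i \<le> j" "j < s" for i j unfolding \<sigma>_def by (rule es(6)[OF that])
    show "0 \<le> \<eta>" using err0 by (simp add: \<eta>_def)
  qed (use ks gram err0 budget D2_lower mu_pos noise Wcols Wrows Geq in auto)
  have \<sigma>pos: "0 < \<sigma> l" if "l < k" for l using L.sigma_lower[OF that] mu_pos by linarith
  have "\<exists>Di. mat_inverse (mat k k (\<lambda>(i, j). D $$ (i, j))) = Some Di \<and>
    (\<forall>c. \<forall>x\<in>carrier_vec s. \<forall>y\<in>carrier_vec s. x \<bullet> ((c \<cdot>\<^sub>m (Wk * (Di * Di) * transpose_mat Wk)) *\<^sub>v y)
        = c * (\<Sum>l<k. (\<Sum>i<s. W $$ (i, l) * x $ i) * (\<Sum>i<s. W $$ (i, l) * y $ i) / (D $$ (l, l))\<^sup>2))"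
    unfolding Wk_def
  proof (rule truncated_oracle_form)
    show "D $$ (i, j) = 0" if "i < k" "j < k" "i \<noteq> j" for i j using Ddiag[of i j] that ks by simp
    show "D $$ (i, i) \<noteq> 0" if "i < k" for i using \<sigma>pos[OF that] by (simp add: \<sigma>_def)
  qed
  then obtain Di where Di: "mat_inverse (mat k k (\<lambda>(i, j). D $$ (i, j))) = Some Di"
    and form: "\<forall>c. \<forall>x\<in>carrier_vec s. \<forall>y\<in>carrier_vec s. x \<bullet> ((c \<cdot>\<^sub>m (Wk * (Di * Di) * transpose_mat Wk)) *\<^sub>v y)
        = c * (\<Sum>l<k. (\<Sum>i<s. W $$ (i, l) * x $ i) * (\<Sum>i<s. W $$ (i, l) * y $ i) / (D $$ (l, l))\<^sup>2)"
    by (elim exE conjE) (rule that)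
  have nrm_f: "nrm k (\<lambda>a. v a x) \<le> F" if "x < n" for x
    unfolding F_def L2_set_def using embedding_norm_bound[OF that] by (intro real_sqrt_le_mono) simp
  define e where "e \<alpha> x i = sqrt c * \<alpha> $ i - L.mulA (\<lambda>a. D2 a * v a x) i" for \<alpha> x i
  have nrm_e: "nrm s (e \<alpha> x) \<le> \<gamma>"
    if x: "x < n" and \<alpha>: "\<forall>i<s. \<bar>\<alpha> $ i - p_dot x (IS ! i)\<bar> \<le> query_err \<xi>" for \<alpha> x
  proof -
    have "\<bar>e \<alpha> x i\<bar> \<le> sqrt c * (query_err \<xi> + 1 / real n ^ 10)" if i: "i < s" for i
    proof -
      have "L.mulA (\<lambda>a. D2 a * v a x) i = sqrt c * (\<Sum>a<k. D2 a * v a x * v a (IS ! i))"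
        by (simp add: L.mulA_def A_def sum_distrib_left mult_ac)
      then have "e \<alpha> x i = sqrt c * (\<alpha> $ i - (\<Sum>a<k. D2 a * v a x * v a (IS ! i)))"
        by (simp add: e_def right_diff_distrib)
      moreover have "\<bar>\<alpha> $ i - (\<Sum>a<k. D2 a * v a x * v a (IS ! i))\<bar> \<le> query_err \<xi> + 1 / real n ^ 10"
        using \<alpha> i p_dot_split[OF x IS[OF i]] by (smt (verit))
      ultimately show ?thesis using cpos by (simp add: abs_mult mult_left_mono)
    qed
    then have "nrm s (e \<alpha> x) \<le> sqrt s * (sqrt c * (query_err \<xi> + 1 / real n ^ 10))"
      using err0 cpos by (intro nrm_le_const) auto
    also have "\<dots> = (sqrt s * sqrt c) * (query_err \<xi> + 1 / real n ^ 10)" by simp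
    also have "sqrt s * sqrt c = sqrt n" using spos by (simp add: c_def flip: real_sqrt_mult)
    finally show ?thesis by (simp add: \<gamma>_def)
  qed
  have main: "\<bar>\<alpha>x \<bullet> ((c \<cdot>\<^sub>m (Wk * (Di * Di) * transpose_mat Wk)) *\<^sub>v \<alpha>y) - (\<Sum>a<k. v a x * v a y)\<bar> \<le> \<xi> / n"
    if x: "x < n" and y: "y < n" and \<alpha>: "\<alpha>x \<in> carrier_vec s" "\<alpha>y \<in> carrier_vec s"
      and ex: "\<forall>i<s. \<bar>\<alpha>x $ i - p_dot x (IS ! i)\<bar> \<le> query_err \<xi>"
      and ey: "\<forall>i<s. \<bar>\<alpha>y $ i - p_dot y (IS ! i)\<bar> \<le> query_err \<xi>" for x y \<alpha>x \<alpha>y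
  proof -
    define bx where "bx i = sqrt c * \<alpha>x $ i" for i
    define b_y where "b_y i = sqrt c * \<alpha>y $ i" for i
    have hx: "L.hat bx l = sqrt c * (\<Sum>i<s. W $$ (i, l) * \<alpha>x $ i)" for l
      by (simp add: L.hat_def bx_def W'_def sum_distrib_left mult_ac)
    have hy: "L.hat b_y l = sqrt c * (\<Sum>i<s. W $$ (i, l) * \<alpha>y $ i)" for l
      by (simp add: L.hat_def b_y_def W'_def sum_distrib_left mult_ac)
    have "(\<Sum>l<k. L.hat bx l * L.hat b_y l / (\<sigma> l)\<^sup>2)
        = (\<Sum>l<k. c * ((\<Sum>i<s. W $$ (i, l) * \<alpha>x $ i) * (\<Sum>i<s. W $$ (i, l) * \<alpha>y $ i) / (D $$ (l, l))\<^sup>2))"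
      by (simp only: hx hy sc \<sigma>_def times_divide_eq_right)
    also have "\<dots> = \<alpha>x \<bullet> ((c \<cdot>\<^sub>m (Wk * (Di * Di) * transpose_mat Wk)) *\<^sub>v \<alpha>y)"
      unfolding bspec[OF bspec[OF spec[OF form, of c] \<alpha>(1)] \<alpha>(2)] by (rule sum_distrib_left[symmetric])
    finally have "(\<Sum>l<k. L.hat bx l * L.hat b_y l / (\<sigma> l)\<^sup>2)
        = \<alpha>x \<bullet> ((c \<cdot>\<^sub>m (Wk * (Di * Di) * transpose_mat Wk)) *\<^sub>v \<alpha>y)" .
    moreover have "\<bar>(\<Sum>l<k. L.hat bx l * L.hat b_y l / (\<sigma> l)\<^sup>2) - dot k (\<lambda>a. v a x) (\<lambda>a. v a y)\<bar>
        \<le> 11 / 10 * \<delta>_err \<xi> * F\<^sup>2 + 21 / 10 * F * ((4 * \<eta> * F + 6 / 5 * \<gamma>) / mu) + ((4 * \<eta> * F + 6 / 5 * \<gamma>) / mu)\<^sup>2"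
      by (rule L.truncated_inverse_square[where ex = "e \<alpha>x x" and ey = "e \<alpha>y y" and \<gamma> = \<gamma>])
         (use nrm_f[OF x] nrm_f[OF y] nrm_e[OF x ex] nrm_e[OF y ey] in \<open>auto simp: e_def bx_def b_y_def\<close>)
    ultimately show ?thesis using budget(3) by (simp add: dot_def)
  qed
  show ?thesis by (intro exI[of _ Di] conjI Di allI impI main[unfolded c_def]) simp_all
qed

end

text \<open>The numerical constants are those needed below: \<open>1668600 = 103 * 200 * 81\<close>
  for the sample, and for the numbers of walks \<open>960000 * 27\<close> and
  \<open>960000 * 9\<close>, divided by 0.98 and rounded up, with
  \<open>960000 = 48 * 2 * 10000\<close>. The integer \<open>q\<close> absorbs
  \<open>(c_s H + 1)^2\<close> into \<open>n ^ q\<close>; 140 is 100 for the failure probability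
  plus 40 for the \<open>s^2\<close> events.\<close>

locale oracle_setup = clustered_spectral +
  fixes H :: hidden and cM \<xi> :: real and q :: nat
  assumes \<xi>: "1 / real n ^ 5 < \<xi>" "\<xi> < 1"
    and cs: "1668600 * \<beta> ^ 4 \<le> c_s H"
    and ci: "30000000 * (1 + 2 * cM * sqrt (6 * \<beta>)) * \<beta> ^ 3 \<le> c_init H"
    and cq: "10000000 * (1 + 2 * cM * sqrt (6 * \<beta>)) * \<beta> ^ 2 \<le> c_query H"
    and cr: "(140 + q) / ln 2 \<le> c_reps H"
    and q: "(c_s H + 1)\<^sup>2 \<le> 4 ^ q"
begin

definition s :: nat where "s = sample_size H n k \<phi> \<epsilon> \<xi>"
definition reps :: nat where "reps = repetitions H n"

definition M_ok :: "nat \<Rightarrow> bool" where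
  "M_ok M \<longleftrightarrow> 1 \<le> M \<and> real M \<le> cM * (real n powr (1/2 - 20 * \<epsilon> / \<phi>\<^sup>2) / real k)"

lemma xi_pos: "0 < \<xi>" using order.strict_trans1[OF _ \<xi>(1), of 0] by simp

lemma M_bound: assumes "M_ok M" shows "real M * k \<le> cM * (sqrt n * pw (- 20))" "0 < cM"
proof -
  have "real n powr (1/2 - 20 * \<epsilon> / \<phi>\<^sup>2) = real n powr (1/2) * pw (- 20)"
    unfolding pw_def powr_add[symmetric] by simp
  then have e: "real n powr (1/2 - 20 * \<epsilon> / \<phi>\<^sup>2) = sqrt n * pw (- 20)"
    using n4 by (simp add: powr_half_sqrt)
  have kp: "0 < real k" using k2 by simp
  have "real M \<le> cM * (sqrt n * pw (- 20)) / k" using assms unfolding M_ok_def e by simp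
  then show b: "real M * k \<le> cM * (sqrt n * pw (- 20))" using kp by (simp add: pos_le_divide_eq)
  have "0 < real M * k" using assms kp by (simp add: M_ok_def)
  then have "0 < cM * (sqrt n * pw (- 20))" using b by linarith
  moreover have "0 < sqrt n * pw (- 20)" using pw_pos n4 by simp
  ultimately show "0 < cM" using zero_less_mult_pos2 by blast
qed

text \<open>\<open>sqrt Fb\<close> is of order \<open>k * pw 30 / sqrt n\<close>, and
  \<open>M\<close> is at most of order \<open>sqrt n * pw (- 20) / k\<close>: the batch size is
  capped so that only \<open>pw 10\<close> remains of their product.\<close>

lemma variance_factor:
  assumes "M_ok M"
  shows "1 + 2 * (M * sqrt (2 * Fb)) \<le> (1 + 2 * cM * sqrt (6 * \<beta>)) * pw 10"
proof -
  have kp: "0 < real k" using k2 by simp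
  have np: "0 < real n" using n4 by simp
  have "2 * Fb = 6 * \<beta> * (k * pw 30 / sqrt n)\<^sup>2"
    using pw_add[of 30 30] np by (simp add: Fb_def power2_eq_square)
  then have "sqrt (2 * Fb) = sqrt (6 * \<beta>) * (k * pw 30 / sqrt n)"
    using pw_pos[of 30] by (simp add: real_sqrt_mult)
  then have "M * sqrt (2 * Fb) = (M * k) * (sqrt (6 * \<beta>) * pw 30 / sqrt n)" by simp
  also have "\<dots> \<le> (cM * (sqrt n * pw (- 20))) * (sqrt (6 * \<beta>) * pw 30 / sqrt n)"
    using M_bound(1)[OF assms] pw_pos[of 30] beta_ge_1 by (intro mult_right_mono) auto
  also have "\<dots> = cM * sqrt (6 * \<beta>) * (pw (- 20) * pw 30)" using np by simp
  also have "pw (- 20) * pw 30 = pw 10" using pw_add[of "- 20" 30] by simp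
  finally have "M * sqrt (2 * Fb) \<le> cM * sqrt (6 * \<beta>) * pw 10" .
  moreover have "1 \<le> pw 10" by (rule pw_ge_1) simp
  ultimately show ?thesis by (simp add: distrib_right)
qed

lemma mu_sq: "98 / 100 * pw (- 160) \<le> mu\<^sup>2"
  using pw_add[of "- 80" "- 80"] pw_pos[of "- 160"] by (simp add: mu_def power2_eq_square)

lemma C0_pos: assumes "M_ok M" shows "1 \<le> 1 + 2 * cM * sqrt (6 * \<beta>)"
  using M_bound(2)[OF assms] beta_ge_1 by simp

text \<open>After the error is cleared, the requirement compares \<open>f ^ 3 * pw 10\<close>, of
  order \<open>k ^ 6 * pw 190\<close>, with \<open>k ^ 14 * pw 920 * mu^2\<close>, where
  \<open>mu^2\<close> costs \<open>pw 160\<close>.\<close>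

lemma R_init_sufficient:
  assumes M: "M_ok M"
  shows "0 < R_init H n k \<phi> \<epsilon> \<xi> M"
    "48 * (2 * Fb * (1 + 2 * (M * sqrt (2 * Fb)))) \<le> R_init H n k \<phi> \<epsilon> \<xi> M * M * (init_err \<xi>)\<^sup>2"
proof -
  define C0 where "C0 = 1 + 2 * cM * sqrt (6 * \<beta>)"
  define f where "f = 3 * \<beta> * (real k)\<^sup>2 * pw 60"
  have C0: "1 \<le> C0" unfolding C0_def by (rule C0_pos[OF M])
  have np: "0 < real n" and kp: "1 \<le> real k" and Mp: "0 < real M" using n4 k2 M by (auto simp: M_ok_def)
  have f: "0 < f" "Fb = f / n" using beta_ge_1 kp pw_pos by (auto simp: f_def Fb_def)
  have "0 < 30000000 * C0 * \<beta> ^ 3" using C0 beta_ge_1 by simp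
  then have cip: "0 < c_init H" "30000000 * C0 * \<beta> ^ 3 \<le> c_init H" using ci by (auto simp: C0_def)
  have Req: "R_init H n k \<phi> \<epsilon> \<xi> M * M = c_init H * (n * pw 920 * (real k ^ 14 / \<xi>\<^sup>2))"
    using Mp np by (simp add: R_init_def powr_add pw_def)
  show "0 < R_init H n k \<phi> \<epsilon> \<xi> M"
    using cip Mp np kp xi_pos by (simp add: R_init_def)
  have key: "960000 * f ^ 3 * (C0 * pw 10) \<le> c_init H * pw 920 * real k ^ 14 * mu\<^sup>2"
  proof -
    have p3: "pw 60 ^ 3 * pw 10 = pw 190" by (simp add: power3_eq_cube flip: pw_add)
    have "960000 * f ^ 3 * (C0 * pw 10) = 25920000 * C0 * \<beta> ^ 3 * real k ^ 6 * (pw 60 ^ 3 * pw 10)"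
      by (simp add: f_def power_mult_distrib flip: power_mult)
    also have "\<dots> \<le> (98 / 100 * (30000000 * C0 * \<beta> ^ 3)) * real k ^ 14 * pw 760"
    proof -
      have "0 \<le> C0 * \<beta> ^ 3" using C0 beta_ge_1 by simp
      then have "25920000 * C0 * \<beta> ^ 3 \<le> 98 / 100 * (30000000 * C0 * \<beta> ^ 3)" by simp
      then show ?thesis unfolding p3 using C0 beta_ge_1 kp pw_pos[of 190]
        by (intro mult_mono[OF mult_mono] pw_mono power_increasing) auto
    qed
    also have "\<dots> \<le> (98 / 100 * c_init H) * real k ^ 14 * pw 760"
      using cip pw_pos[of 760] by (intro mult_right_mono mult_left_mono) auto
    also have "\<dots> = c_init H * pw 920 * real k ^ 14 * (98 / 100 * pw (- 160))"
      using pw_add[of 920 "- 160"] by simp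
    also have "\<dots> \<le> c_init H * pw 920 * real k ^ 14 * mu\<^sup>2"
      using mu_sq cip pw_pos[of 920] by (intro mult_left_mono) auto
    finally show ?thesis .
  qed
  have "48 * (2 * Fb * (1 + 2 * (M * sqrt (2 * Fb)))) \<le> 48 * (2 * Fb * (C0 * pw 10))"
    unfolding C0_def using variance_factor[OF M] Fb_pos by (intro mult_left_mono) auto
  also have "\<dots> = 960000 * f ^ 3 * (C0 * pw 10) / (10000 * n * f\<^sup>2)"
    using f np by (simp add: power3_eq_cube power2_eq_square)
  also have "\<dots> \<le> c_init H * pw 920 * real k ^ 14 * mu\<^sup>2 / (10000 * n * f\<^sup>2)"
    using key by (intro divide_right_mono) auto
  also have "\<dots> = c_init H * (n * pw 920 * (real k ^ 14 / \<xi>\<^sup>2)) * (init_err \<xi>)\<^sup>2"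
    unfolding init_err_def f(2) using f np xi_pos by (simp add: field_simps power2_eq_square)
  finally show "48 * (2 * Fb * (1 + 2 * (M * sqrt (2 * Fb)))) \<le> R_init H n k \<phi> \<epsilon> \<xi> M * M * (init_err \<xi>)\<^sup>2"
    unfolding Req .
qed

text \<open>The query error contains only \<open>sqrt Fb\<close>, so one power of \<open>f\<close>
  fewer appears than for the oracle: \<open>k ^ 4 * pw 130\<close> against
  \<open>k ^ 6 * pw 440 * mu^2\<close>.\<close>

lemma R_query_sufficient:
  assumes M: "M_ok M"
  shows "0 < R_query H n k \<phi> \<epsilon> \<xi> M"
    "48 * (2 * Fb * (1 + 2 * (M * sqrt (2 * Fb)))) \<le> R_query H n k \<phi> \<epsilon> \<xi> M * M * (query_err \<xi>)\<^sup>2"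
proof -
  define C0 where "C0 = 1 + 2 * cM * sqrt (6 * \<beta>)"
  define f where "f = 3 * \<beta> * (real k)\<^sup>2 * pw 60"
  have C0: "1 \<le> C0" unfolding C0_def by (rule C0_pos[OF M])
  have np: "0 < real n" and kp: "1 \<le> real k" and Mp: "0 < real M" using n4 k2 M by (auto simp: M_ok_def)
  have f: "0 < f" "Fb = f / n" using beta_ge_1 kp pw_pos by (auto simp: f_def Fb_def)
  have "0 < 10000000 * C0 * \<beta> ^ 2" using C0 beta_ge_1 by simp
  then have cip: "0 < c_query H" "10000000 * C0 * \<beta> ^ 2 \<le> c_query H" using cq by (auto simp: C0_def)
  have Req: "R_query H n k \<phi> \<epsilon> \<xi> M * M = c_query H * (n * pw 440 * (real k ^ 6 / \<xi>\<^sup>2))"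
    using Mp np by (simp add: R_query_def powr_add pw_def)
  show "0 < R_query H n k \<phi> \<epsilon> \<xi> M"
    using cip Mp np kp xi_pos by (simp add: R_query_def)
  have key: "960000 * f ^ 2 * (C0 * pw 10) \<le> c_query H * pw 440 * real k ^ 6 * mu\<^sup>2"
  proof -
    have p3: "pw 60 ^ 2 * pw 10 = pw 130" by (simp add: power2_eq_square flip: pw_add)
    have "960000 * f ^ 2 * (C0 * pw 10) = 8640000 * C0 * \<beta> ^ 2 * real k ^ 4 * (pw 60 ^ 2 * pw 10)"
      by (simp add: f_def power_mult_distrib flip: power_mult)
    also have "\<dots> \<le> (98 / 100 * (10000000 * C0 * \<beta> ^ 2)) * real k ^ 6 * pw 280"
    proof -
      have "0 \<le> C0 * \<beta> ^ 2" using C0 beta_ge_1 by simp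
      then have "8640000 * C0 * \<beta> ^ 2 \<le> 98 / 100 * (10000000 * C0 * \<beta> ^ 2)" by simp
      then show ?thesis unfolding p3 using C0 beta_ge_1 kp pw_pos[of 130]
        by (intro mult_mono[OF mult_mono] pw_mono power_increasing) auto
    qed
    also have "\<dots> \<le> (98 / 100 * c_query H) * real k ^ 6 * pw 280"
      using cip pw_pos[of 280] by (intro mult_right_mono mult_left_mono) auto
    also have "\<dots> = c_query H * pw 440 * real k ^ 6 * (98 / 100 * pw (- 160))"
      using pw_add[of 440 "- 160"] by simp
    also have "\<dots> \<le> c_query H * pw 440 * real k ^ 6 * mu\<^sup>2"
      using mu_sq cip pw_pos[of 440] by (intro mult_left_mono) auto
    finally show ?thesis .
  qed
  have e2: "(query_err \<xi>)\<^sup>2 = \<xi>\<^sup>2 * mu\<^sup>2 / (10000 * (real n)\<^sup>2 * f)"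
    unfolding query_err_def f(2) using f np by (simp add: power_divide power_mult_distrib)
  have "48 * (2 * Fb * (1 + 2 * (M * sqrt (2 * Fb)))) \<le> 48 * (2 * Fb * (C0 * pw 10))"
    unfolding C0_def using variance_factor[OF M] Fb_pos by (intro mult_left_mono) auto
  also have "\<dots> = 960000 * f ^ 2 * (C0 * pw 10) / (10000 * n * f)"
    using f np by (simp add: power2_eq_square)
  also have "\<dots> \<le> c_query H * pw 440 * real k ^ 6 * mu\<^sup>2 / (10000 * n * f)"
    using key f by (intro divide_right_mono) auto
  also have "\<dots> = c_query H * (n * pw 440 * (real k ^ 6 / \<xi>\<^sup>2)) * (query_err \<xi>)\<^sup>2"
    unfolding e2 using f np xi_pos by (simp add: field_simps power2_eq_square)
  finally show "48 * (2 * Fb * (1 + 2 * (M * sqrt (2 * Fb)))) \<le> R_query H n k \<phi> \<epsilon> \<xi> M * M * (query_err \<xi>)\<^sup>2"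
    unfolding Req .
qed

lemma finite_est: "x < n \<Longrightarrow> y < n \<Longrightarrow> finite (set_pmf (result (est_rw_dot cw n E R t M x y)))"
  unfolding result_est_rw_dot using finite_subset[OF walk_support] 
  by (simp add: finite_replicate_pmf finite_batch_pmf)

lemma est_deviation:
  assumes x: "x < n" and y: "y < n" and M: "M_ok M" and R: "0 < R" and e: "0 < e"
    and big: "48 * (2 * Fb * (1 + 2 * (M * sqrt (2 * Fb)))) \<le> R * M * e\<^sup>2"
  shows "measure_pmf.prob (result (est_rw_dot cw n E R t M x y)) {z. \<not> \<bar>z - p_dot x y\<bar> \<le> e} \<le> 1 / 16"
  unfolding result_est_rw_dot p_dot_def
  using M by (intro batch_mean_deviation[OF walk_support[OF x] walk_support[OF y] _ walk_norm[OF x] walk_norm[OF y] R e big])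
    (simp add: M_ok_def)

lemma est_init_deviation:
  assumes "x < n" "y < n" "M_ok M"
  shows "measure_pmf.prob (result (est_rw_dot cw n E (R_init H n k \<phi> \<epsilon> \<xi> M) t M x y))
    {z. \<not> \<bar>z - p_dot x y\<bar> \<le> init_err \<xi>} \<le> 1 / 16"
  using xi_pos mu_pos Fb_pos n4
  by (intro est_deviation[OF assms R_init_sufficient(1)[OF assms(3)] _ R_init_sufficient(2)[OF assms(3)]])
     (simp add: init_err_def)

lemma est_query_deviation:
  assumes "x < n" "y < n" "M_ok M"
  shows "measure_pmf.prob (result (est_rw_dot cw n E (R_query H n k \<phi> \<epsilon> \<xi> M) t M x y))
    {z. \<not> \<bar>z - p_dot x y\<bar> \<le> query_err \<xi>} \<le> 1 / 16"
  using xi_pos mu_pos Fb_pos n4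
  by (intro est_deviation[OF assms R_query_sufficient(1)[OF assms(3)] _ R_query_sufficient(2)[OF assms(3)]])
     (simp add: query_err_def)

end

section \<open>Success probability\<close>

lemma prob_bind_le:
  assumes fin: "finite (set_pmf p)" "\<And>x. x \<in> set_pmf p \<Longrightarrow> finite (set_pmf (f x))"
    and p: "measure_pmf.prob p {x. \<not> P x} \<le> e1" and e2: "0 \<le> e2"
    and f: "\<And>x. x \<in> set_pmf p \<Longrightarrow> P x \<Longrightarrow> measure_pmf.prob (f x) B \<le> e2"
  shows "measure_pmf.prob (bind_pmf p f) B \<le> e1 + e2"
proof -
  have "measure_pmf.prob (bind_pmf p f) B = expect (bind_pmf p f) (indicator B)" by simp
  also have "\<dots> = expect p (\<lambda>x. expect (f x) (indicator B))" by (rule expect_bind[OF fin])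
  also have "\<dots> = expect p (\<lambda>x. measure_pmf.prob (f x) B)" by simp
  also have "\<dots> \<le> expect p (\<lambda>x. indicator {x. \<not> P x} x + e2)"
  proof (rule expect_mono[OF fin(1)])
    fix x assume x: "x \<in> set_pmf p"
    show "measure_pmf.prob (f x) B \<le> indicator {x. \<not> P x} x + e2"
      using f[OF x] e2 measure_pmf.prob_le_1[of "f x" B] by (cases "P x") (auto intro: order_trans)
  qed
  also have "\<dots> = measure_pmf.prob p {x. \<not> P x} + e2" by (subst expect_add[OF fin(1)]) simp
  finally show ?thesis using p by linarith
qed

lemma result_est_colli_prob:
  "result (est_colli_prob cw n E reps R t M IS) =
    map_pmf (\<lambda>Gs. mat (length IS) (length IS) (\<lambda>(i, j). median (map (\<lambda>G. G $$ (i, j)) Gs)))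
      (replicate_pmf reps (map_pmf (\<lambda>rows. mat (length IS) (length IS) (\<lambda>(i, j). rows ! min i j ! (max i j - min i j)))
        (result (for_each (\<lambda>i. for_each (\<lambda>j. est_rw_dot cw n E R t M (IS ! i) (IS ! j)) [i..<length IS]) [0..<length IS]))))"
  by (simp add: est_colli_prob_def Let_def result_for_each_const bind_return_pmf map_pmf_def)

lemma result_query_dot:
  "result (query_dot H cw n E k \<phi> \<epsilon> \<xi> IS \<Psi> M x y) =
    map_pmf (\<lambda>rows. vec (length IS) (\<lambda>i. median (map (\<lambda>r. fst (r ! i)) rows))
        \<bullet> (\<Psi> *\<^sub>v vec (length IS) (\<lambda>i. median (map (\<lambda>r. snd (r ! i)) rows))))
      (replicate_pmf (repetitions H n) (result (for_each (\<lambda>i. do {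
          a \<leftarrow> est_rw_dot cw n E (R_query H n k \<phi> \<epsilon> \<xi> M) (walk_length n \<phi>) M x (IS ! i);
          b \<leftarrow> est_rw_dot cw n E (R_query H n k \<phi> \<epsilon> \<xi> M) (walk_length n \<phi>) M y (IS ! i);
          ret (a, b) }) [0..<length IS])))"
  by (simp add: query_dot_def Let_def result_for_each_const bind_return_pmf map_pmf_def)

text \<open>The deterministic part of the oracle construction, separated so that the failure
  probability concerns only the sample and the Gram estimate.\<close>

definition oracle_output :: "(real mat \<Rightarrow> real mat \<times> real mat) \<Rightarrow> nat \<Rightarrow> nat \<Rightarrow> nat \<Rightarrow> real mat \<Rightarrow> real mat option" where
  "oracle_output eig n k s G = (let WD = eig ((real n / real s) \<cdot>\<^sub>m G);
     Wk = mat s k (\<lambda>(i, j). fst WD $$ (i, j)) in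
     case mat_inverse (mat k k (\<lambda>(i, j). snd WD $$ (i, j))) of
       None \<Rightarrow> None
     | Some Di \<Rightarrow> Some ((real n / real s) \<cdot>\<^sub>m (Wk * (Di * Di) * transpose_mat Wk)))"

lemma result_init_oracle:
  "result (init_oracle H cw ce eig n E k \<phi> \<epsilon> \<xi> M) =
    (let s = sample_size H n k \<phi> \<epsilon> \<xi> in
     bind_pmf (replicate_pmf s (pmf_of_set {..<n})) (\<lambda>IS.
       map_pmf (\<lambda>G. (IS, oracle_output eig n k s G))
         (result (est_colli_prob cw n E (repetitions H n) (R_init H n k \<phi> \<epsilon> \<xi> M) (walk_length n \<phi>) M IS))))"
  by (simp add: init_oracle_def Let_def oracle_output_def case_prod_unfold result_for_each_const bind_return_pmf map_pmf_def)

context oracle_setup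
begin

definition X :: real where "X = pw 480 * ln n * real k ^ 8 / \<xi>\<^sup>2"

lemma cs_ge_1: "1 \<le> c_s H"
proof -
  have "1 \<le> \<beta> ^ 4" using beta_ge_1 by simp
  then show ?thesis using cs by linarith
qed

lemma inv_xi: "1 \<le> 1 / \<xi>\<^sup>2" "1 / \<xi>\<^sup>2 \<le> real n ^ 10"
proof -
  have "\<xi>\<^sup>2 \<le> 1" using \<xi> xi_pos by (intro power_le_one) auto
  then show "1 \<le> 1 / \<xi>\<^sup>2" using xi_pos by simp
  have np: "0 < real n ^ 5" using n4 by simp
  have "1 / \<xi> \<le> real n ^ 5" using \<xi>(1) xi_pos np by (simp add: field_simps)
  then have "(1 / \<xi>)\<^sup>2 \<le> (real n ^ 5)\<^sup>2" using xi_pos by (intro power_mono) auto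
  then show "1 / \<xi>\<^sup>2 \<le> real n ^ 10" by (simp add: power_divide flip: power_mult)
qed

lemma X_bounds: "real k ^ 8 \<le> X" "X \<le> real n ^ 20"
proof -
  have Xe: "X = pw 480 * ln n * (real k ^ 8 * (1 / \<xi>\<^sup>2))" by (simp add: X_def)
  have "1 * 1 * (real k ^ 8 * 1) \<le> X"
    unfolding Xe using pw_ge_1[of 480] ln_n inv_xi by (intro mult_mono) auto
  then show "real k ^ 8 \<le> X" by simp
  have np: "1 \<le> real n" using n4 by simp
  have "pw 480 \<le> pw 100000" by (rule pw_mono) simp
  also have "\<dots> \<le> real n powr 1"
    unfolding pw_def using np ratio by (intro powr_mono) (simp_all add: mult.commute)
  finally have pw: "pw 480 \<le> n" using np by simp
  have ln: "ln n \<le> n" using ln_bound[of "real n"] np by simp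
  have kn: "real k \<le> n" using two_k_le_n by simp
  have "X \<le> real n * n * (real n ^ 8 * real n ^ 10)"
    unfolding Xe using pw ln inv_xi ln_n pw_pos[of 480] kn np by (intro mult_mono power_mono) auto
  also have "\<dots> = real n ^ 20" by (simp add: eval_nat_numeral)
  finally show "X \<le> real n ^ 20" .
qed

lemma X_pos: "1 \<le> X"
proof -
  have "1 \<le> real k ^ 8" using k2 by (intro one_le_power) simp
  then show ?thesis using X_bounds(1) by linarith
qed

lemma s_bounds: "c_s H * X \<le> s" "s \<le> c_s H * X + 1"
proof -
  have "0 \<le> c_s H * X" using cs_ge_1 X_pos by simp
  then show "c_s H * X \<le> s" "s \<le> c_s H * X + 1"
    unfolding s_def sample_size_def pw_def[symmetric] X_def[symmetric] by linarith+
qed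

lemma k_le_s: "k \<le> s"
proof -
  have "real k \<le> real k ^ 8" using k2 by (intro self_le_power) auto
  also have "\<dots> \<le> X" by (rule X_bounds)
  also have "\<dots> \<le> c_s H * X" using cs_ge_1 X_pos by simp
  finally show ?thesis using s_bounds by linarith
qed

lemma s_pos: "0 < s" using k_le_s k2 by linarith

text \<open>The number of entries in the union bound must be a power of \<open>n\<close>. The sample
  constant is at most \<open>4 ^ q\<close>, hence at most \<open>n ^ q\<close>, and
  \<open>reps\<close> is chosen with the same \<open>q\<close>.\<close>

lemma s_sq: "(real s)\<^sup>2 \<le> real n ^ (40 + q)"
proof -
  have np: "1 \<le> real n" "4 \<le> real n" using n4 by auto
  have "real s \<le> (c_s H + 1) * real n ^ 20"
  proof -
    have "real s \<le> c_s H * X + X" using s_bounds X_pos by linarith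
    also have "\<dots> = (c_s H + 1) * X" by (simp add: distrib_right)
    also have "\<dots> \<le> (c_s H + 1) * real n ^ 20" using X_bounds cs_ge_1 by (intro mult_left_mono) auto
    finally show ?thesis .
  qed
  then have "(real s)\<^sup>2 \<le> ((c_s H + 1) * real n ^ 20)\<^sup>2" by (intro power_mono) auto
  also have "\<dots> = (c_s H + 1)\<^sup>2 * real n ^ 40" by (simp add: power_mult_distrib flip: power_mult)
  also have "\<dots> \<le> 4 ^ q * real n ^ 40" using q by (intro mult_right_mono) auto
  also have "\<dots> \<le> real n ^ q * real n ^ 40" using np by (intro mult_right_mono power_mono) auto
  finally show ?thesis by (simp add: power_add mult.commute)
qed

lemma reps_pow: "(1 / 2) ^ reps \<le> 1 / real n ^ (140 + q)" "0 < reps"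
proof -
  have l2: "0 < ln (2::real)" by simp
  have "(140 + q) / ln 2 * ln n \<le> c_reps H * ln n" using cr ln_n by (intro mult_right_mono) auto
  moreover have "c_reps H * ln n \<le> reps" unfolding reps_def repetitions_def by linarith
  ultimately have r: "(140 + q) / ln 2 * ln n \<le> reps" by linarith
  then have "(140 + q) * ln n \<le> reps * ln 2" using l2 by (simp add: pos_divide_le_eq)
  then have "exp (- (reps * ln 2)) \<le> exp (- ((140 + q) * ln n))" by simp
  moreover have "exp (- (reps * ln 2)) = (1 / 2 :: real) ^ reps"
    unfolding exp_minus exp_of_nat_mult by (simp add: power_divide inverse_eq_divide)
  moreover have "exp (- ((140 + q) * ln n)) = 1 / real n ^ (140 + q)"
  proof -
    have "exp (real (140 + q) * ln n) = real n ^ (140 + q)" unfolding exp_of_nat_mult using n4 by simp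
    then show ?thesis by (simp add: exp_minus inverse_eq_divide)
  qed
  ultimately show "(1 / 2) ^ reps \<le> 1 / real n ^ (140 + q)" by simp
  have "0 < (140 + q) / ln 2 * ln n" using ln_n l2 by (intro mult_pos_pos divide_pos_pos) auto
  then show "0 < reps" using r by linarith
qed

lemma union_small: "(real s)\<^sup>2 * (1 / 2) ^ reps \<le> 1 / real n ^ 100"
proof -
  have np: "0 < real n" using n4 by simp
  have "(real s)\<^sup>2 * (1 / 2) ^ reps \<le> real n ^ (40 + q) * (1 / real n ^ (140 + q))"
    using s_sq reps_pow by (intro mult_mono) auto
  also have "real n ^ (140 + q) = real n ^ (40 + q) * real n ^ 100" by (simp flip: power_add)
  finally show ?thesis using np by simp
qed

section \<open>Failure probabilities of the sample, the Gram estimate and the queries\<close>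

definition good_sample :: "nat list \<Rightarrow> bool" where
  "good_sample IS \<longleftrightarrow> (\<forall>a<k. \<forall>b<k.
     \<bar>real n / s * (\<Sum>j<s. v a (IS ! j) * v b (IS ! j)) - (if a = b then 1 else 0)\<bar> \<le> \<delta>_err \<xi> / k)"

text \<open>Hoeffding's inequality for the products \<open>v a x * v b x\<close> at uniform
  \<open>x\<close>: by orthonormality their mean is \<open>1 / n\<close> or 0, and the sup-norm
  bound confines them to \<open>[-c, c]\<close>. The exponent 103 leaves room for the union over
  \<open>k^2\<close> pairs.\<close>

lemma pair_deviation:
  assumes a: "a < k" and b: "b < k"
  shows "measure_pmf.prob (replicate_pmf s (pmf_of_set {..<n}))
    {IS. \<not> \<bar>real n / s * (\<Sum>j<s. v a (IS ! j) * v b (IS ! j)) - (if a = b then 1 else 0)\<bar> \<le> \<delta>_err \<xi> / k}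
    \<le> 2 / real n ^ 103"
proof -
  define g where "g x = v a x * v b x" for x
  define f where "f = 3 * \<beta> * (real k)\<^sup>2 * pw 60"
  define c where "c = f / (k * n)"
  define I where "I = (if a = b then 1 else 0 :: real)"
  define r where "r = s * \<delta>_err \<xi> / (n * k)"
  have np: "0 < real n" and kp: "0 < real k" and sp: "0 < real s" using n4 k2 s_pos by auto
  have ne: "{..<n} \<noteq> {}" "finite {..<n}" using n4 by (auto simp: lessThan_empty_iff)
  have fin: "finite (set_pmf (pmf_of_set {..<n}))" using ne by simp
  have f0: "0 < f" using beta_ge_1 kp pw_pos by (simp add: f_def)
  have c0: "0 < c" using f0 np kp by (simp add: c_def)
  have nFb: "n * Fb = f" using np by (simp add: Fb_def f_def)
  have r0: "0 < r" using sp np kp xi_pos Fb_pos by (simp add: r_def \<delta>_err_def)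
  have an: "a < n" "b < n" using a b two_k_le_n by auto
  have ce: "c = 3 * \<beta> * k * pw 60 / n" using kp by (simp add: c_def f_def power2_eq_square)
  have gb: "\<bar>g x\<bar> \<le> c" if "x \<in> set_pmf (pmf_of_set {..<n})" for x
  proof -
    have x: "x < n" using that ne by simp
    have "\<bar>v a x\<bar> * \<bar>v b x\<bar> \<le> ((v a x)\<^sup>2 + (v b x)\<^sup>2) / 2"
      using sum_squares_bound[of "\<bar>v a x\<bar>" "\<bar>v b x\<bar>"] by simp
    also have "\<dots> \<le> c"
      using eigenvector_sup_bound[OF a x, folded ce] eigenvector_sup_bound[OF b x, folded ce] by simp
    finally show ?thesis by (simp add: g_def abs_mult)
  qed
  have mean: "expect (pmf_of_set {..<n}) g = I / n"
    using ne orth[OF an] by (simp add: integral_pmf_of_set g_def I_def)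
  have "measure_pmf.prob (replicate_pmf s (pmf_of_set {..<n}))
      {IS. \<not> \<bar>real n / s * (\<Sum>j<s. v a (IS ! j) * v b (IS ! j)) - I\<bar> \<le> \<delta>_err \<xi> / k}
      \<le> measure_pmf.prob (replicate_pmf s (pmf_of_set {..<n})) {IS. r \<le> \<bar>sum_list (map g IS) - s * (I / n)\<bar>}"
  proof (rule prob_mono_pmf)
    fix IS assume IS: "IS \<in> set_pmf (replicate_pmf s (pmf_of_set {..<n}))"
      and H: "\<not> \<bar>real n / s * (\<Sum>j<s. v a (IS ! j) * v b (IS ! j)) - I\<bar> \<le> \<delta>_err \<xi> / k"
    define S where "S = sum_list (map g IS)"
    have "length IS = s" using IS by (simp add: set_replicate_pmf)
    then have S: "(\<Sum>j<s. v a (IS ! j) * v b (IS ! j)) = S"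
      by (simp add: S_def sum_list_sum_nth g_def atLeast0LessThan)
    have "S - s * (I / n) = (s / n) * (real n / s * S - I)" using np sp by (simp add: field_simps)
    then have "\<bar>S - s * (I / n)\<bar> = (s / n) * \<bar>real n / s * S - I\<bar>" using np sp by (simp add: abs_mult)
    moreover have "(s / n) * (\<delta>_err \<xi> / k) \<le> (s / n) * \<bar>real n / s * S - I\<bar>"
      using H unfolding S by (intro mult_left_mono) auto
    ultimately show "r \<le> \<bar>sum_list (map g IS) - s * (I / n)\<bar>" by (simp add: r_def S_def)
  qed
  also have "\<dots> \<le> 2 * exp (- r\<^sup>2 / (2 * real s * c\<^sup>2))"
    by (rule hoeffding_abs[OF fin gb c0 mean r0 s_pos])
  also have "\<dots> \<le> 2 * (1 / real n ^ 103)"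
  proof -
    \<comment> \<open>Expressed through \<open>f = n * Fb\<close>, the Hoeffding exponent is free of
      \<open>n\<close> and equals \<open>s * \<xi>^2 / (200 * f ^ 4)\<close>.\<close>
    have "r / c = s * (\<xi> / (10 * f\<^sup>2))"
    proof -
      have "Fb = f / n" using nFb np by (simp add: field_simps)
      then show ?thesis unfolding r_def c_def \<delta>_err_def using np kp f0 by (simp add: power2_eq_square)
    qed
    then have rc: "r\<^sup>2 / c\<^sup>2 = (s * (\<xi> / (10 * f\<^sup>2)))\<^sup>2" by (simp add: power_divide[symmetric])
    have "r\<^sup>2 / (2 * real s * c\<^sup>2) = (r\<^sup>2 / c\<^sup>2) / (2 * s)" by simp
    also have "\<dots> = s * (\<xi>\<^sup>2 / (200 * f ^ 4))"
      unfolding rc using sp f0 by (simp add: field_simps power2_eq_square power4_eq_xxxx)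
    finally have ex: "r\<^sup>2 / (2 * real s * c\<^sup>2) = s * (\<xi>\<^sup>2 / (200 * f ^ 4))" .
    have f4: "f ^ 4 = 81 * \<beta> ^ 4 * real k ^ 8 * pw 240"
    proof -
      have "pw 60 ^ 4 = pw 240" by (simp add: power4_eq_xxxx flip: pw_add)
      then show ?thesis by (simp add: f_def power_mult_distrib flip: power_mult)
    qed
    \<comment> \<open>\<open>f ^ 4\<close> carries \<open>81 * \<beta> ^ 4 * k ^ 8 * pw 240\<close>,
      whereas the sample size carries \<open>pw 480\<close>; the surplus \<open>pw 240\<close> is at
      least 1.\<close>
    have "103 * ln n \<le> 103 * ln n * pw 240" using ln_n pw_ge_1[of 240] by (simp add: mult_le_cancel_left1)
    also have "\<dots> = (1668600 * \<beta> ^ 4 * X) * (\<xi>\<^sup>2 / (200 * f ^ 4))"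
    proof -
      have "pw 480 = pw 240 * pw 240" using pw_add[of 240 240] by simp
      moreover have "0 < \<beta>" "pw 240 \<noteq> 0" using beta_ge_1 pw_pos[of 240] by auto
      ultimately show ?thesis unfolding f4 X_def using xi_pos kp by (simp add: field_simps)
    qed
    also have "\<dots> \<le> s * (\<xi>\<^sup>2 / (200 * f ^ 4))"
    proof (rule mult_right_mono)
      have "1668600 * \<beta> ^ 4 * X \<le> c_s H * X" using cs X_pos by (intro mult_right_mono) auto
      then show "1668600 * \<beta> ^ 4 * X \<le> s" using s_bounds by linarith
    qed (use f0 in simp)
    finally have "exp (- (s * (\<xi>\<^sup>2 / (200 * f ^ 4)))) \<le> exp (- (real 103 * ln n))" by simp
    also have "\<dots> = 1 / real n ^ 103"
      unfolding exp_minus exp_of_nat_mult using np by (simp add: inverse_eq_divide)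
    finally show ?thesis using ex by simp
  qed
  finally show ?thesis by (simp add: I_def)
qed

lemma sample_failure:
  "measure_pmf.prob (replicate_pmf s (pmf_of_set {..<n})) {IS. \<not> good_sample IS} \<le> 1 / real n ^ 100"
proof -
  let ?P = "replicate_pmf s (pmf_of_set {..<n})"
  define B where "B p IS \<longleftrightarrow> \<not> \<bar>real n / s * (\<Sum>j<s. v (fst p) (IS ! j) * v (snd p) (IS ! j))
    - (if fst p = snd p then 1 else 0)\<bar> \<le> \<delta>_err \<xi> / k" for p IS
  have np: "4 \<le> real n" using n4 by simp
  have "{IS. \<not> good_sample IS} = {IS. \<exists>p\<in>{..<k} \<times> {..<k}. B p IS}"
    by (auto simp: good_sample_def B_def)
  also have "measure_pmf.prob ?P \<dots> \<le> (\<Sum>p\<in>{..<k} \<times> {..<k}. measure_pmf.prob ?P {IS. B p IS})"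
    by (rule prob_union_bound) simp
  also have "\<dots> \<le> (\<Sum>p\<in>{..<k} \<times> {..<k}. 2 / real n ^ 103)"
    unfolding B_def by (intro sum_mono pair_deviation) auto
  also have "\<dots> = 2 * (real k)\<^sup>2 / real n ^ 103" by (simp add: power2_eq_square)
  also have "\<dots> \<le> (real n)\<^sup>2 / real n ^ 103"
  proof (rule divide_right_mono)
    have "(2 * real k)\<^sup>2 \<le> (real n)\<^sup>2" using two_k_le_n by (intro power_mono) auto
    then have "4 * (real k)\<^sup>2 \<le> (real n)\<^sup>2" by (simp add: power_mult_distrib)
    moreover have "0 \<le> (real k)\<^sup>2" by simp
    ultimately show "2 * (real k)\<^sup>2 \<le> (real n)\<^sup>2" by linarith
  qed simp
  also have "\<dots> = 1 / (real n * real n ^ 100)"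
  proof -
    have "real n ^ 103 = (real n)\<^sup>2 * (real n ^ 1 * real n ^ 100)" by (simp only: power_add[symmetric]) simp
    then show ?thesis using np by simp
  qed
  also have "\<dots> \<le> 1 / real n ^ 100"
    using np by (intro divide_left_mono) (auto simp: mult_le_cancel_right1)
  finally show ?thesis .
qed

lemma p_dot_commute: "p_dot x y = p_dot y x"
  by (simp add: p_dot_def mult.commute)

text \<open>Symmetry is included because the specification of the eigensolver speaks about symmetric
  matrices only.\<close>

definition good_gram :: "nat list \<Rightarrow> real mat \<Rightarrow> bool" where
  "good_gram IS G \<longleftrightarrow> G \<in> carrier_mat s s \<and> transpose_mat G = G \<and>
     (\<forall>i<s. \<forall>j<s. \<bar>G $$ (i, j) - p_dot (IS ! i) (IS ! j)\<bar> \<le> init_err \<xi>)"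

context
  fixes IS :: "nat list" and M :: nat
  assumes len: "length IS = s" and IS: "\<And>j. j < s \<Longrightarrow> IS ! j < n" and M: "M_ok M"
begin

lemma finite_rows:
  "finite (set_pmf (result (for_each (\<lambda>i. for_each (\<lambda>j. est_rw_dot cw n E R t M (IS ! i) (IS ! j)) [i..<s]) [0..<s])))"
  using IS by (intro finite_result_for_each finite_est) auto

lemma finite_colli: "finite (set_pmf (result (est_colli_prob cw n E reps R t M IS)))"
  unfolding result_est_colli_prob len using finite_rows by (simp add: finite_replicate_pmf)

lemma colli_failure:
  "measure_pmf.prob (result (est_colli_prob cw n E reps (R_init H n k \<phi> \<epsilon> \<xi> M) t M IS)) {G. \<not> good_gram IS G}
    \<le> 1 / real n ^ 100"
proof -
  define rows where "rows = result (for_each (\<lambda>i. for_each (\<lambda>j. est_rw_dot cw n E (R_init H n k \<phi> \<epsilon> \<xi> M) t M (IS ! i) (IS ! j)) [i..<s]) [0..<s])"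
  define Q where "Q = map_pmf (\<lambda>rows. mat s s (\<lambda>(i, j). rows ! min i j ! (max i j - min i j))) rows"
  define B where "B p Gs \<longleftrightarrow> \<not> \<bar>median (map (\<lambda>G. G $$ p) Gs) - p_dot (IS ! fst p) (IS ! snd p)\<bar> \<le> init_err \<xi>" for p Gs
  have finQ: "finite (set_pmf Q)" unfolding Q_def rows_def using finite_rows by simp
  have dev: "measure_pmf.prob Q {G. \<not> \<bar>G $$ (i, j) - p_dot (IS ! i) (IS ! j)\<bar> \<le> init_err \<xi>} \<le> 1 / 16"
    if i: "i < s" and j: "j < s" for i j
  proof -
    define a where "a = min i j"
    define b where "b = max i j"
    have ab: "a < s" "b < s" "a \<le> b" using i j by (auto simp: a_def b_def)
    have "map_pmf (\<lambda>rows. rows ! a ! (b - a)) rows = map_pmf (\<lambda>r. r ! (b - a)) (map_pmf (\<lambda>rows. rows ! a) rows)"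
      by (simp add: pmf.map_comp o_def)
    also have "\<dots> = map_pmf (\<lambda>r. r ! (b - a)) (result (for_each (\<lambda>j. est_rw_dot cw n E (R_init H n k \<phi> \<epsilon> \<xi> M) t M (IS ! a) (IS ! j)) [a..<s]))"
      unfolding rows_def using ab by (subst result_for_each_nth) auto
    also have "\<dots> = result (est_rw_dot cw n E (R_init H n k \<phi> \<epsilon> \<xi> M) t M (IS ! a) (IS ! b))"
      using ab by (subst result_for_each_nth) auto
    finally have marg: "map_pmf (\<lambda>rows. rows ! a ! (b - a)) rows
        = result (est_rw_dot cw n E (R_init H n k \<phi> \<epsilon> \<xi> M) t M (IS ! a) (IS ! b))" .
    have pd: "p_dot (IS ! i) (IS ! j) = p_dot (IS ! a) (IS ! b)"
      using p_dot_commute by (cases "i \<le> j") (auto simp: a_def b_def min_def max_def)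
    have "measure_pmf.prob Q {G. \<not> \<bar>G $$ (i, j) - p_dot (IS ! i) (IS ! j)\<bar> \<le> init_err \<xi>}
        = measure_pmf.prob (map_pmf (\<lambda>rows. rows ! a ! (b - a)) rows) {z. \<not> \<bar>z - p_dot (IS ! a) (IS ! b)\<bar> \<le> init_err \<xi>}"
      unfolding Q_def pd using i j by (simp add: measure_map_pmf vimage_def a_def b_def)
    also have "\<dots> \<le> 1 / 16" unfolding marg by (intro est_init_deviation IS ab M)
    finally show ?thesis .
  qed
  have "measure_pmf.prob (result (est_colli_prob cw n E reps (R_init H n k \<phi> \<epsilon> \<xi> M) t M IS)) {G. \<not> good_gram IS G}
      = measure_pmf.prob (replicate_pmf reps Q)
          {Gs. \<not> good_gram IS (mat s s (\<lambda>(i, j). median (map (\<lambda>G. G $$ (i, j)) Gs)))}"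
    unfolding result_est_colli_prob len Q_def rows_def by (simp add: measure_map_pmf vimage_def)
  also have "\<dots> \<le> measure_pmf.prob (replicate_pmf reps Q) {Gs. \<exists>p\<in>{..<s} \<times> {..<s}. B p Gs}"
  proof (rule prob_mono_pmf)
    fix Gs assume Gs: "Gs \<in> set_pmf (replicate_pmf reps Q)"
      and bad: "\<not> good_gram IS (mat s s (\<lambda>(i, j). median (map (\<lambda>G. G $$ (i, j)) Gs)))"
    \<comment> \<open>Symmetry never fails, as both entries are read from the same cell of the
      triangular array; only the deviations enter the union bound.\<close>
    have sym: "G $$ (i, j) = G $$ (j, i)" if "G \<in> set Gs" "i < s" "j < s" for G i j
    proof -
      have "G \<in> set_pmf Q" using Gs that by (auto simp: set_replicate_pmf)
      then show ?thesis using that by (auto simp: Q_def min.commute max.commute)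
    qed
    have "median (map (\<lambda>G. G $$ (i, j)) Gs) = median (map (\<lambda>G. G $$ (j, i)) Gs)" if "i < s" "j < s" for i j
      using sym that by (intro arg_cong[where f = median] map_cong) auto
    then have "transpose_mat (mat s s (\<lambda>(i, j). median (map (\<lambda>G. G $$ (i, j)) Gs)))
        = mat s s (\<lambda>(i, j). median (map (\<lambda>G. G $$ (i, j)) Gs))"
      by (intro eq_matI) auto
    then obtain i j where ij: "i < s" "j < s"
      and "\<not> \<bar>median (map (\<lambda>G. G $$ (i, j)) Gs) - p_dot (IS ! i) (IS ! j)\<bar> \<le> init_err \<xi>"
      using bad unfolding good_gram_def by auto
    then have "B (i, j) Gs" by (simp add: B_def)
    then show "\<exists>p\<in>{..<s} \<times> {..<s}. B p Gs" using ij by blast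
  qed
  also have "\<dots> \<le> (\<Sum>p\<in>{..<s} \<times> {..<s}. measure_pmf.prob (replicate_pmf reps Q) {Gs. B p Gs})"
    by (rule prob_union_bound) simp
  also have "\<dots> \<le> (\<Sum>p\<in>{..<s} \<times> {..<s}. (1 / 2) ^ reps)"
  proof (rule sum_mono)
    fix p assume "p \<in> {..<s} \<times> {..<s}"
    then show "measure_pmf.prob (replicate_pmf reps Q) {Gs. B p Gs} \<le> (1 / 2) ^ reps"
      unfolding B_def using dev[of "fst p" "snd p"] by (intro median_boost finQ reps_pow) auto
  qed
  also have "\<dots> = (real s)\<^sup>2 * (1 / 2) ^ reps" by (simp add: power2_eq_square)
  also have "\<dots> \<le> 1 / real n ^ 100" by (rule union_small)
  finally show ?thesis .
qed

text \<open>The hypothesis \<open>acc\<close> is deterministic, so only the \<open>2 * s\<close>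
  medians can fail. The union bound gives \<open>2 / n ^ 100\<close>, within the allowed 6.\<close>

lemma query_success:
  assumes x: "x < n" and y: "y < n"
    and acc: "\<And>\<alpha>x \<alpha>y. \<alpha>x \<in> carrier_vec s \<Longrightarrow> \<alpha>y \<in> carrier_vec s \<Longrightarrow>
      (\<And>i. i < s \<Longrightarrow> \<bar>\<alpha>x $ i - p_dot x (IS ! i)\<bar> \<le> query_err \<xi>) \<Longrightarrow>
      (\<And>i. i < s \<Longrightarrow> \<bar>\<alpha>y $ i - p_dot y (IS ! i)\<bar> \<le> query_err \<xi>) \<Longrightarrow>
      \<bar>\<alpha>x \<bullet> (\<Psi> *\<^sub>v \<alpha>y) - val\<bar> \<le> \<xi> / n"
  shows "1 - 6 / real n ^ 100 \<le> measure_pmf.prob (result (query_dot H cw n E k \<phi> \<epsilon> \<xi> IS \<Psi> M x y)) {z. \<bar>z - val\<bar> \<le> \<xi> / n}"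
proof (rule prob_compl_ge)
  let ?est = "\<lambda>x i. est_rw_dot cw n E (R_query H n k \<phi> \<epsilon> \<xi> M) t M x (IS ! i)"
  define Q where "Q = result (for_each (\<lambda>i. do { a \<leftarrow> ?est x i; b \<leftarrow> ?est y i; ret (a, b) }) [0..<s])"
  \<comment> \<open>A boolean selects the side of \<open>x\<close> or of \<open>y\<close>, so that
    one argument treats both coordinates.\<close>
  define prj where "prj c = (if c then fst else snd :: real \<times> real \<Rightarrow> real)" for c
  define pt where "pt c = (if c then x else y)" for c
  define B where "B p rows \<longleftrightarrow> \<not> \<bar>median (map (\<lambda>r. prj (snd p) (r ! fst p)) rows) - p_dot (pt (snd p)) (IS ! fst p)\<bar> \<le> query_err \<xi>"
    for p and rows :: "(real \<times> real) list list"
  have finQ: "finite (set_pmf Q)"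
    unfolding Q_def using IS x y by (intro finite_result_for_each) (auto simp: finite_est)
  have marg: "map_pmf (\<lambda>r. prj c (r ! i)) Q = result (?est (pt c) i)" if i: "i < s" for c i
  proof -
    have "map_pmf (\<lambda>r. prj c (r ! i)) Q = map_pmf (prj c) (map_pmf (\<lambda>r. r ! i) Q)"
      by (simp add: pmf.map_comp o_def)
    also have "\<dots> = map_pmf (prj c) (bind_pmf (result (?est x i)) (\<lambda>a. bind_pmf (result (?est y i)) (\<lambda>b. return_pmf (a, b))))"
      unfolding Q_def using i by (subst result_for_each_nth) auto
    also have "\<dots> = result (?est (pt c) i)"
      by (cases c) (simp_all add: map_bind_pmf prj_def pt_def bind_return_pmf')
    finally show ?thesis .
  qed
  have dev: "measure_pmf.prob Q {r. \<not> \<bar>prj c (r ! i) - p_dot (pt c) (IS ! i)\<bar> \<le> query_err \<xi>} \<le> 1 / 16"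
    if i: "i < s" for c i
  proof -
    have "measure_pmf.prob Q {r. \<not> \<bar>prj c (r ! i) - p_dot (pt c) (IS ! i)\<bar> \<le> query_err \<xi>}
        = measure_pmf.prob (map_pmf (\<lambda>r. prj c (r ! i)) Q) {z. \<not> \<bar>z - p_dot (pt c) (IS ! i)\<bar> \<le> query_err \<xi>}"
      by (simp add: measure_map_pmf vimage_def)
    also have "\<dots> \<le> 1 / 16" unfolding marg[OF i] using x y by (intro est_query_deviation IS i M) (simp add: pt_def)
    finally show ?thesis .
  qed
  have "measure_pmf.prob (result (query_dot H cw n E k \<phi> \<epsilon> \<xi> IS \<Psi> M x y)) {z. \<not> \<bar>z - val\<bar> \<le> \<xi> / n}
      = measure_pmf.prob (replicate_pmf reps Q) {rows. \<not> \<bar>vec s (\<lambda>i. median (map (\<lambda>r. fst (r ! i)) rows))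
          \<bullet> (\<Psi> *\<^sub>v vec s (\<lambda>i. median (map (\<lambda>r. snd (r ! i)) rows))) - val\<bar> \<le> \<xi> / n}"
    unfolding result_query_dot len Q_def reps_def t_def by (simp add: measure_map_pmf vimage_def)
  also have "\<dots> \<le> measure_pmf.prob (replicate_pmf reps Q) {rows. \<exists>p\<in>{..<s} \<times> UNIV. B p rows}"
  proof (rule prob_mono_pmf, rule ccontr)
    fix rows assume bad: "\<not> \<bar>vec s (\<lambda>i. median (map (\<lambda>r. fst (r ! i)) rows))
          \<bullet> (\<Psi> *\<^sub>v vec s (\<lambda>i. median (map (\<lambda>r. snd (r ! i)) rows))) - val\<bar> \<le> \<xi> / n"
      and "\<not> (\<exists>p\<in>{..<s} \<times> UNIV. B p rows)"
    then have nB: "\<not> B (i, c) rows" if "i < s" for i c using that by blast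
    show False using bad
    proof (rule notE, intro acc)
      show "\<bar>vec s (\<lambda>i. median (map (\<lambda>r. fst (r ! i)) rows)) $ i - p_dot x (IS ! i)\<bar> \<le> query_err \<xi>" if "i < s" for i
        using nB[OF that, of True] that by (simp add: B_def prj_def pt_def)
      show "\<bar>vec s (\<lambda>i. median (map (\<lambda>r. snd (r ! i)) rows)) $ i - p_dot y (IS ! i)\<bar> \<le> query_err \<xi>" if "i < s" for i
        using nB[OF that, of False] that by (simp add: B_def prj_def pt_def)
    qed auto
  qed
  also have "\<dots> \<le> (\<Sum>p\<in>{..<s} \<times> UNIV. measure_pmf.prob (replicate_pmf reps Q) {rows. B p rows})"
    by (rule prob_union_bound) simp
  also have "\<dots> \<le> (\<Sum>p\<in>{..<s} \<times> (UNIV :: bool set). (1 / 2) ^ reps)"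
  proof (rule sum_mono)
    fix p :: "nat \<times> bool" assume "p \<in> {..<s} \<times> UNIV"
    then show "measure_pmf.prob (replicate_pmf reps Q) {rows. B p rows} \<le> (1 / 2) ^ reps"
      unfolding B_def using dev[of "fst p" "snd p"] by (intro median_boost finQ reps_pow) auto
  qed
  also have "\<dots> = 2 * (real s * (1 / 2) ^ reps)" by (simp add: UNIV_bool)
  also have "\<dots> \<le> 2 * ((real s)\<^sup>2 * (1 / 2) ^ reps)"
    using s_pos by (intro mult_left_mono mult_right_mono self_le_power) auto
  also have "\<dots> \<le> 2 * (1 / real n ^ 100)" using union_small by simp
  also have "\<dots> \<le> 6 / real n ^ 100" by (simp add: divide_right_mono)
  finally show "measure_pmf.prob (result (query_dot H cw n E k \<phi> \<epsilon> \<xi> IS \<Psi> M x y)) {z. \<not> \<bar>z - val\<bar> \<le> \<xi> / n}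
      \<le> 6 / real n ^ 100" .
qed

end

text \<open>The two failures counted are an unrepresentative sample and an inaccurate Gram estimate,
  each of probability at most \<open>n ^ -100\<close>. Outside both, \<open>oracle_accurate\<close>
  holds for all pairs at once, and the remaining randomness is that of a single query.\<close>

lemma init_success:
  assumes Mi: "M_ok Mi" and Mq: "M_ok Mq" and eig: "eigensolver eig"
  shows "1 - 2 / real n ^ 100 \<le> measure_pmf.prob (result (init_oracle H cw ce eig n E k \<phi> \<epsilon> \<xi> Mi))
    {r. \<exists>\<Psi>. snd r = Some \<Psi> \<and> dim_row \<Psi> = s \<and> dim_col \<Psi> = s \<and>
      (\<forall>x<n. \<forall>y<n. 1 - 6 / real n ^ 100 \<le>
        measure_pmf.prob (result (query_dot H cw n E k \<phi> \<epsilon> \<xi> (fst r) \<Psi> Mq x y)) {z. \<bar>z - (\<Sum>a<k. v a x * v a y)\<bar> \<le> \<xi> / n})}"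
proof (rule prob_compl_ge)
  define good where "good r \<longleftrightarrow> (\<exists>\<Psi>. snd r = Some \<Psi> \<and> dim_row \<Psi> = s \<and> dim_col \<Psi> = s \<and>
      (\<forall>x<n. \<forall>y<n. 1 - 6 / real n ^ 100 \<le>
        measure_pmf.prob (result (query_dot H cw n E k \<phi> \<epsilon> \<xi> (fst r) \<Psi> Mq x y)) {z. \<bar>z - (\<Sum>a<k. v a x * v a y)\<bar> \<le> \<xi> / n}))"
    for r :: "nat list \<times> real mat option"
  let ?U = "replicate_pmf s (pmf_of_set {..<n})"
  let ?C = "\<lambda>IS. result (est_colli_prob cw n E reps (R_init H n k \<phi> \<epsilon> \<xi> Mi) t Mi IS)"
  have ne: "{..<n} \<noteq> {}" "finite {..<n}" using n4 by (auto simp: lessThan_empty_iff)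
  have supp: "length IS = s" "\<And>j. j < s \<Longrightarrow> IS ! j < n" if "IS \<in> set_pmf ?U" for IS
    using that ne by (auto simp: set_replicate_pmf in_lists_conv_set)
  have "measure_pmf.prob (bind_pmf ?U (\<lambda>IS. map_pmf (\<lambda>G. (IS, oracle_output eig n k s G)) (?C IS))) {r. \<not> good r}
      \<le> 1 / real n ^ 100 + 1 / real n ^ 100"
  proof (rule prob_bind_le[where P = good_sample])
    show "finite (set_pmf ?U)" using ne by (simp add: finite_replicate_pmf)
    show "finite (set_pmf (map_pmf (\<lambda>G. (IS, oracle_output eig n k s G)) (?C IS)))" if "IS \<in> set_pmf ?U" for IS
      using finite_colli[OF supp[OF that] Mi] by simp
    show "measure_pmf.prob ?U {IS. \<not> good_sample IS} \<le> 1 / real n ^ 100" by (rule sample_failure)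
    fix IS assume IS: "IS \<in> set_pmf ?U" and gs: "good_sample IS"
    note supp = supp[OF IS]
    have good: "good (IS, oracle_output eig n k s G)" if G: "good_gram IS G" for G
    proof -
      obtain W D where WD: "eig ((real n / real s) \<cdot>\<^sub>m G) = (W, D)" by fastforce
      let ?Wk = "mat s k (\<lambda>(i, j). W $$ (i, j))"
      have Gc: "G \<in> carrier_mat s s" "transpose_mat G = G"
        "\<And>i j. i < s \<Longrightarrow> j < s \<Longrightarrow> \<bar>G $$ (i, j) - p_dot (IS ! i) (IS ! j)\<bar> \<le> init_err \<xi>"
        using G unfolding good_gram_def by auto
      have sample: "\<bar>real n / s * (\<Sum>j<s. v a (IS ! j) * v b (IS ! j)) - (if a = b then 1 else 0)\<bar> \<le> \<delta>_err \<xi> / k"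
        if "a < k" "b < k" for a b
        using gs that unfolding good_sample_def by blast
      have "\<exists>Di. mat_inverse (mat k k (\<lambda>(i, j). D $$ (i, j))) = Some Di \<and> (\<forall>x y \<alpha>x \<alpha>y. x < n \<longrightarrow> y < n \<longrightarrow> \<alpha>x \<in> carrier_vec s \<longrightarrow> \<alpha>y \<in> carrier_vec s \<longrightarrow>
          (\<forall>i<s. \<bar>\<alpha>x $ i - p_dot x (IS ! i)\<bar> \<le> query_err \<xi>) \<longrightarrow>
          (\<forall>i<s. \<bar>\<alpha>y $ i - p_dot y (IS ! i)\<bar> \<le> query_err \<xi>) \<longrightarrow>
          \<bar>\<alpha>x \<bullet> (((real n / real s) \<cdot>\<^sub>m (?Wk * (Di * Di) * transpose_mat ?Wk)) *\<^sub>v \<alpha>y) - (\<Sum>a<k. v a x * v a y)\<bar> \<le> \<xi> / n)"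
        by (rule oracle_accurate[OF \<xi> supp(1) k_le_s _ _ Gc(1,2) _ eig WD]) (use supp(2) sample Gc(3) in auto)
      then obtain Di where Di: "mat_inverse (mat k k (\<lambda>(i, j). D $$ (i, j))) = Some Di"
        and acc: "\<forall>x y \<alpha>x \<alpha>y. x < n \<longrightarrow> y < n \<longrightarrow> \<alpha>x \<in> carrier_vec s \<longrightarrow> \<alpha>y \<in> carrier_vec s \<longrightarrow>
          (\<forall>i<s. \<bar>\<alpha>x $ i - p_dot x (IS ! i)\<bar> \<le> query_err \<xi>) \<longrightarrow>
          (\<forall>i<s. \<bar>\<alpha>y $ i - p_dot y (IS ! i)\<bar> \<le> query_err \<xi>) \<longrightarrow>
          \<bar>\<alpha>x \<bullet> (((real n / real s) \<cdot>\<^sub>m (?Wk * (Di * Di) * transpose_mat ?Wk)) *\<^sub>v \<alpha>y) - (\<Sum>a<k. v a x * v a y)\<bar> \<le> \<xi> / n"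
        by (elim exE conjE) (rule that)
      define \<Psi> where "\<Psi> = (real n / real s) \<cdot>\<^sub>m (?Wk * (Di * Di) * transpose_mat ?Wk)"
      have out: "oracle_output eig n k s G = Some \<Psi>"
        unfolding oracle_output_def Let_def WD fst_conv snd_conv Di option.case \<Psi>_def ..
      have "1 - 6 / real n ^ 100 \<le> measure_pmf.prob (result (query_dot H cw n E k \<phi> \<epsilon> \<xi> IS \<Psi> Mq x y))
          {z. \<bar>z - (\<Sum>a<k. v a x * v a y)\<bar> \<le> \<xi> / n}" if xy: "x < n" "y < n" for x y
        by (rule query_success[OF supp Mq xy]) (use acc xy in \<open>auto simp: \<Psi>_def\<close>)
      moreover have "dim_row \<Psi> = s" "dim_col \<Psi> = s" by (simp_all add: \<Psi>_def)
      ultimately show ?thesis unfolding good_def out by simp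
    qed
    have "measure_pmf.prob (map_pmf (\<lambda>G. (IS, oracle_output eig n k s G)) (?C IS)) {r. \<not> good r}
        = measure_pmf.prob (?C IS) {G. \<not> good (IS, oracle_output eig n k s G)}"
      by (simp add: measure_map_pmf vimage_def)
    also have "\<dots> \<le> measure_pmf.prob (?C IS) {G. \<not> good_gram IS G}"
      using good by (intro prob_mono_pmf) blast
    also have "\<dots> \<le> 1 / real n ^ 100" by (rule colli_failure[OF supp Mi])
    finally show "measure_pmf.prob (map_pmf (\<lambda>G. (IS, oracle_output eig n k s G)) (?C IS)) {r. \<not> good r} \<le> 1 / real n ^ 100" .
  qed simp
  then show "measure_pmf.prob (result (init_oracle H cw ce eig n E k \<phi> \<epsilon> \<xi> Mi))
    {r. \<not> (\<exists>\<Psi>. snd r = Some \<Psi> \<and> dim_row \<Psi> = s \<and> dim_col \<Psi> = s \<and>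
      (\<forall>x<n. \<forall>y<n. 1 - 6 / real n ^ 100 \<le>
        measure_pmf.prob (result (query_dot H cw n E k \<phi> \<epsilon> \<xi> (fst r) \<Psi> Mq x y)) {z. \<bar>z - (\<Sum>a<k. v a x * v a y)\<bar> \<le> \<xi> / n}))}
      \<le> 2 / real n ^ 100"
    unfolding result_init_oracle Let_def good_def s_def reps_def t_def by simp
qed

end

section \<open>Time and space\<close>

text \<open>A bound over the whole support: the cost claims hold for every run, including those with
  an inaccurate result. The postcondition \<open>P\<close> hands the length of the sample on to the
  later steps.\<close>

definition costs :: "'a comp \<Rightarrow> ('a \<Rightarrow> bool) \<Rightarrow> nat \<Rightarrow> nat \<Rightarrow> bool" where
  "costs m P T S \<longleftrightarrow> (\<forall>r\<in>set_pmf (run m). P (fst r) \<and> fst (snd r) \<le> T \<and> snd (snd r) \<le> S)"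

lemma costs_ret: "P a \<Longrightarrow> costs (ret a) P T S"
  by (simp add: costs_def ret_def)

lemma costs_tick: "T \<le> T' \<Longrightarrow> costs (tick T) (\<lambda>_. True) T' S"
  by (simp add: costs_def tick_def)

lemma costs_draw: "costs (draw p) (\<lambda>_. True) 1 S"
  by (auto simp: costs_def draw_def)

lemma costs_bind:
  assumes "costs m P T1 S" "\<And>a. P a \<Longrightarrow> costs (f a) Q T2 S"
  shows "costs (bind_comp m f) Q (T1 + T2) S"
  unfolding costs_def
proof
  fix r assume "r \<in> set_pmf (run (bind_comp m f))"
  then obtain x y where x: "x \<in> set_pmf (run m)" and y: "y \<in> set_pmf (run (f (fst x)))"
    and r: "r = (fst y, fst (snd x) + fst (snd y), max (snd (snd x)) (snd (snd y)))"
    by (auto simp: bind_comp_def case_prod_unfold)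
  have "P (fst x) \<and> fst (snd x) \<le> T1 \<and> snd (snd x) \<le> S" using assms(1) x by (simp add: costs_def)
  moreover from this have "Q (fst y) \<and> fst (snd y) \<le> T2 \<and> snd (snd y) \<le> S"
    using assms(2)[of "fst x"] y unfolding costs_def by blast
  ultimately show "Q (fst r) \<and> fst (snd r) \<le> T1 + T2 \<and> snd (snd r) \<le> S" by (simp add: r)
qed

lemma costs_with_space: "costs m P T S \<Longrightarrow> costs (with_space b m) P T (b + S)"
  by (auto simp: costs_def with_space_def case_prod_unfold)

lemma costs_mono: "costs m P T S \<Longrightarrow> T \<le> T' \<Longrightarrow> S \<le> S' \<Longrightarrow> (\<And>a. P a \<Longrightarrow> Q a) \<Longrightarrow> costs m Q T' S'"
  unfolding costs_def by (meson order_trans)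

lemma costs_for_each:
  assumes "\<And>x. x \<in> set xs \<Longrightarrow> costs (f x) (\<lambda>_. True) T S"
  shows "costs (for_each f xs) (\<lambda>ys. length ys = length xs) (length xs * T) S"
  using assms
proof (induction xs)
  case (Cons x xs)
  have "costs (for_each f (x # xs)) (\<lambda>ys. length ys = length (x # xs)) (T + (length xs * T + 0)) S"
    unfolding for_each.simps
    by (rule costs_bind[where P = "\<lambda>_. True"], (use Cons in auto)[1], rule costs_bind[OF Cons.IH])
       (use Cons in \<open>auto intro: costs_ret\<close>)
  then show ?case by simp
qed (simp add: costs_ret)

lemma costs_accumulate:
  assumes "costs m (\<lambda>_. True) T S"
  shows "costs (accumulate B m acc) (\<lambda>_. True) (B * (T + 1)) S"
proof (induction B arbitrary: acc)
  case (Suc B)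
  have "costs (accumulate (Suc B) m acc) (\<lambda>_. True) (T + (1 + B * (T + 1))) S"
    unfolding accumulate.simps
    by (rule costs_bind[OF assms], rule costs_bind[OF costs_tick[OF order.refl] Suc])
  then show ?case by (rule costs_mono) simp_all
qed (simp add: costs_ret)

section \<open>Worst-case costs of the procedures\<close>

lemma costs_lazy_walk: "costs (lazy_walk E t x) (\<lambda>_. True) t 0"
proof (induction t arbitrary: x)
  case (Suc t)
  have "costs (lazy_walk E (Suc t) x) (\<lambda>_. True) (1 + t) 0"
    unfolding lazy_walk.simps by (rule costs_bind[OF costs_draw Suc])
  then show ?case by simp
qed (simp add: costs_ret)

definition batch_time :: "nat \<Rightarrow> nat \<Rightarrow> nat" where
  "batch_time t M = 2 * M * t + 2 * sort_time M + 2 * M"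

definition est_time :: "real \<Rightarrow> nat \<Rightarrow> nat \<Rightarrow> nat" where
  "est_time R t M = nat \<lceil>R / real M\<rceil> * (batch_time t M + 1) + 1"

lemma costs_rw_batch: "costs (rw_batch n E t M x y) (\<lambda>_. True) (batch_time t M) 0"
proof -
  have walks: "costs (for_each (\<lambda>_. lazy_walk E t z) [0..<M]) (\<lambda>_. True) (M * t) 0" for z
    by (rule costs_mono[OF costs_for_each[where T = t]]) (auto intro: costs_lazy_walk)
  have "costs (rw_batch n E t M x y) (\<lambda>_. True) (M * t + (M * t + (2 * sort_time M + 2 * M + 0))) 0"
    unfolding rw_batch_def
    by (rule costs_bind[OF walks], rule costs_bind[OF walks], rule costs_bind[OF costs_tick[OF order.refl]])
       (rule costs_ret, simp)
  then show ?thesis by (rule costs_mono) (simp_all add: batch_time_def)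
qed

lemma costs_est_rw_dot:
  "costs (est_rw_dot cw n E R t M x y) (\<lambda>_. True) (est_time R t M) (word cw n * (2 * M + 8))"
proof -
  have "costs (est_rw_dot cw n E R t M x y) (\<lambda>_. True) (nat \<lceil>R / real M\<rceil> * (batch_time t M + 1) + (1 + 0)) (word cw n * (2 * M + 8) + 0)"
    unfolding est_rw_dot_def Let_def
    by (rule costs_with_space, rule costs_bind[OF costs_accumulate[OF costs_rw_batch]],
        rule costs_bind[OF costs_tick[OF order.refl]]) (rule costs_ret, simp)
  then show ?thesis by (rule costs_mono) (simp_all add: est_time_def)
qed

lemma costs_est_colli_prob:
  "costs (est_colli_prob cw n E reps R t M IS) (\<lambda>_. True)
     (reps * (length IS * (length IS * est_time R t M)) + (length IS)\<^sup>2 * sort_time reps)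
     (word cw n * (reps * (length IS)\<^sup>2 + reps + 8) + word cw n * (2 * M + 8))"
proof -
  let ?s = "length IS" and ?S = "word cw n * (2 * M + 8)"
  have row: "costs (for_each (\<lambda>j. est_rw_dot cw n E R t M (IS ! i) (IS ! j)) [i..<?s]) (\<lambda>_. True) (?s * est_time R t M) ?S" for i
    by (rule costs_mono[OF costs_for_each[OF costs_est_rw_dot]]) auto
  have rows: "costs (for_each (\<lambda>i. for_each (\<lambda>j. est_rw_dot cw n E R t M (IS ! i) (IS ! j)) [i..<?s]) [0..<?s]) (\<lambda>_. True)
      (?s * (?s * est_time R t M)) ?S"
    by (rule costs_mono[OF costs_for_each[OF row]]) auto
  have one: "costs (do { rows \<leftarrow> for_each (\<lambda>i. for_each (\<lambda>j. est_rw_dot cw n E R t M (IS ! i) (IS ! j)) [i..<?s]) [0..<?s];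
        ret (mat ?s ?s (\<lambda>(i, j). rows ! min i j ! (max i j - min i j))) }) (\<lambda>_. True) (?s * (?s * est_time R t M) + 0) ?S"
    by (rule costs_bind[OF rows]) (rule costs_ret, simp)
  have all: "costs (for_each (\<lambda>l. do { rows \<leftarrow> for_each (\<lambda>i. for_each (\<lambda>j. est_rw_dot cw n E R t M (IS ! i) (IS ! j)) [i..<?s]) [0..<?s];
        ret (mat ?s ?s (\<lambda>(i, j). rows ! min i j ! (max i j - min i j))) }) [0..<reps]) (\<lambda>_. True) (reps * (?s * (?s * est_time R t M))) ?S"
    by (rule costs_mono[OF costs_for_each[OF one]]) auto
  have "costs (est_colli_prob cw n E reps R t M IS) (\<lambda>_. True)
     (reps * (?s * (?s * est_time R t M)) + (?s\<^sup>2 * sort_time reps + 0)) (word cw n * (reps * ?s\<^sup>2 + reps + 8) + ?S)"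
    unfolding est_colli_prob_def Let_def
    by (rule costs_with_space, rule costs_bind[OF all], rule costs_bind[OF costs_tick[OF order.refl]])
       (rule costs_ret, simp)
  then show ?thesis by simp
qed

lemma costs_init_oracle:
  fixes H n k \<phi> \<epsilon> \<xi> M cw ce
  defines "s \<equiv> sample_size H n k \<phi> \<epsilon> \<xi>" and "r \<equiv> repetitions H n"
    and "T \<equiv> est_time (R_init H n k \<phi> \<epsilon> \<xi> M) (walk_length n \<phi>) M"
  shows "costs (init_oracle H cw ce eig n E k \<phi> \<epsilon> \<xi> M) (\<lambda>(IS, out). length IS = s)
     (s + (r * (s * (s * T)) + s\<^sup>2 * sort_time r) + (s\<^sup>2 + ce * s ^ 3) + (k + s * k + s\<^sup>2 * k + s\<^sup>2))
     (word cw n * (s + 2 * s\<^sup>2 + ce * s\<^sup>2 + s * k + 8) + (word cw n * (r * s\<^sup>2 + r + 8) + word cw n * (2 * M + 8)))"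
proof -
  let ?S = "word cw n * (r * s\<^sup>2 + r + 8) + word cw n * (2 * M + 8)"
  have sample: "costs (for_each (\<lambda>_. draw (pmf_of_set {..<n})) [0..<s]) (\<lambda>IS. length IS = s) s ?S"
    by (rule costs_mono[OF costs_for_each[OF costs_draw]]) auto
  have colli: "costs (est_colli_prob cw n E r (R_init H n k \<phi> \<epsilon> \<xi> M) (walk_length n \<phi>) M IS) (\<lambda>_. True)
      (r * (s * (s * T)) + s\<^sup>2 * sort_time r) ?S" if "length IS = s" for IS :: "nat list"
    using costs_est_colli_prob[of cw n E r "R_init H n k \<phi> \<epsilon> \<xi> M" "walk_length n \<phi>" M IS] unfolding that T_def .
  have "costs (init_oracle H cw ce eig n E k \<phi> \<epsilon> \<xi> M) (\<lambda>(IS, out). length IS = s)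
     (s + ((r * (s * (s * T)) + s\<^sup>2 * sort_time r) + ((s\<^sup>2 + ce * s ^ 3) + ((k + s * k + s\<^sup>2 * k + s\<^sup>2) + 0))))
     (word cw n * (s + 2 * s\<^sup>2 + ce * s\<^sup>2 + s * k + 8) + ?S)"
    unfolding init_oracle_def Let_def case_prod_unfold s_def[symmetric] r_def[symmetric]
    by (rule costs_with_space, rule costs_bind[OF sample], rule costs_bind[OF colli], assumption,
        rule costs_bind[OF costs_tick[OF order.refl]], rule costs_bind[OF costs_tick[OF order.refl]])
       (rule costs_ret, simp)
  then show ?thesis by (rule costs_mono) simp_all
qed

lemma costs_query_dot:
  fixes H n k \<phi> \<epsilon> \<xi> M cw
  assumes "length IS = s"
  defines "r \<equiv> repetitions H n" and "T \<equiv> est_time (R_query H n k \<phi> \<epsilon> \<xi> M) (walk_length n \<phi>) M"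
  shows "costs (query_dot H cw n E k \<phi> \<epsilon> \<xi> IS \<Psi> M x y) (\<lambda>_. True)
     (r * (s * (2 * T)) + 2 * s * sort_time r + (2 * s\<^sup>2 + 2 * s))
     (word cw n * (s + s\<^sup>2 + 2 * r * s + 2 * s + r + 8) + word cw n * (2 * M + 8))"
proof -
  let ?S = "word cw n * (2 * M + 8)"
  let ?est = "\<lambda>x i. est_rw_dot cw n E (R_query H n k \<phi> \<epsilon> \<xi> M) (walk_length n \<phi>) M x (IS ! i)"
  have one: "costs (do { a \<leftarrow> ?est x i; b \<leftarrow> ?est y i; ret (a, b) }) (\<lambda>_. True) (T + (T + 0)) ?S" for i
    unfolding T_def
    by (rule costs_bind[OF costs_est_rw_dot], rule costs_bind[OF costs_est_rw_dot]) (rule costs_ret, simp)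
  have row: "costs (for_each (\<lambda>i. do { a \<leftarrow> ?est x i; b \<leftarrow> ?est y i; ret (a, b) }) [0..<s]) (\<lambda>_. True) (s * (2 * T)) ?S"
    by (rule costs_mono[OF costs_for_each[OF one]]) auto
  have all: "costs (for_each (\<lambda>l. for_each (\<lambda>i. do { a \<leftarrow> ?est x i; b \<leftarrow> ?est y i; ret (a, b) }) [0..<s]) [0..<r])
      (\<lambda>_. True) (r * (s * (2 * T))) ?S"
    by (rule costs_mono[OF costs_for_each[OF row]]) auto
  have "costs (query_dot H cw n E k \<phi> \<epsilon> \<xi> IS \<Psi> M x y) (\<lambda>_. True)
     (r * (s * (2 * T)) + (2 * s * sort_time r + ((2 * s\<^sup>2 + 2 * s) + 0)))
     (word cw n * (s + s\<^sup>2 + 2 * r * s + 2 * s + r + 8) + ?S)"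
    unfolding query_dot_def Let_def assms(1) r_def[symmetric]
    by (rule costs_with_space, rule costs_bind[OF all], rule costs_bind[OF costs_tick[OF order.refl]],
        rule costs_bind[OF costs_tick[OF order.refl]]) (rule costs_ret, simp)
  then show ?thesis by (rule costs_mono) simp_all
qed

lemma sort_time_le: assumes "1 \<le> m" shows "real (sort_time m) \<le> m * (2 * ln m + 2)"
proof -
  have l2: "1 / 2 \<le> ln (2::real)" using exp_half_le2 by (subst ln_ge_iff) auto
  have lm: "0 \<le> ln (real m)" using assms by simp
  have "ln m / ln 2 \<le> ln m / (1 / 2)" using l2 lm by (intro divide_left_mono) auto
  then have lg: "log 2 m \<le> 2 * ln m" by (simp add: log_def)
  have "0 \<le> log 2 m" using assms by simp
  then have "real (nat \<lceil>log 2 m\<rceil>) \<le> log 2 m + 1" by linarith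
  then have "real (nat \<lceil>log 2 m\<rceil> + 1) \<le> 2 * ln m + 2" using lg by simp
  then show ?thesis unfolding sort_time_def of_nat_mult by (intro mult_left_mono) auto
qed

text \<open>The sum of the constants of the two time bounds, the two space bounds and the size
  bound, plus 1, so that it dominates each of them and has a nonnegative logarithm.\<close>

definition cost_constant :: "hidden \<Rightarrow> real \<Rightarrow> nat \<Rightarrow> nat \<Rightarrow> real" where
  "cost_constant H cM cw ce =
    (let s = c_s H + 1; r = c_reps H + 1; w = r * (2 * r + 2);
         i = (c_init H + cM\<^sup>2) * (53 + 4 * cM) + cM; q = (c_query H + cM\<^sup>2) * (53 + 4 * cM) + cM
     in 1 + (r * s\<^sup>2 * i + s\<^sup>2 * w * cM + (6 + real ce) * s ^ 3 * cM) + (32 + real ce) * 3 * real cw * r * s\<^sup>2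
        + (2 * r * s * q + 2 * s * w * cM + 4 * s\<^sup>2 * cM) + 3 * real cw * (12 * s\<^sup>2 + 3 * r * s + 10) + s\<^sup>2)"

context oracle_setup
begin

text \<open>Scales for the cost bounds: \<open>P\<close> bounds the sample size up to a constant and
  \<open>ln n\<close>, \<open>P2\<close> the number of walks, and \<open>Y = P * P * P2\<close>
  every product that occurs. Hence \<open>30 = 8 + 8 + 14\<close> and
  \<open>1880 = 480 + 480 + 920\<close>.\<close>

definition X0 :: real where "X0 = real k / \<xi>"
definition P where "P = X0 ^ 8 * pw 480"
definition P2 where "P2 = X0 ^ 14 * pw 920"
definition Y where "Y = X0 ^ 30 * pw 1880"

abbreviation l where "l \<equiv> ln (real n)"
abbreviation cs' where "cs' \<equiv> c_s H + 1"
abbreviation cr' where "cr' \<equiv> c_reps H + 1"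
abbreviation co where "co \<equiv> cr' * (2 * cr' + 2)"

lemma X0_ge: "2 \<le> X0"
proof -
  have "2 / 1 \<le> real k / \<xi>" using k2 \<xi> xi_pos by (intro frac_le) auto
  then show ?thesis by (simp add: X0_def)
qed

lemma X0_pow: "i \<le> j \<Longrightarrow> X0 ^ i \<le> X0 ^ j" "1 \<le> X0 ^ i"
  using X0_ge by (auto intro: power_increasing)

lemma P_ge: "1 \<le> P" "1 \<le> P2"
  unfolding P_def P2_def using mult_mono[OF X0_pow(2)[of 8] pw_ge_1[of 480]] mult_mono[OF X0_pow(2)[of 14] pw_ge_1[of 920]]
  using X0_ge by auto

lemma Y_eq: "Y = P * P * P2"
proof -
  have "pw 1880 = pw 480 * pw 480 * pw 920" by (simp flip: pw_add)
  moreover have "X0 ^ 30 = X0 ^ 8 * X0 ^ 8 * X0 ^ 14" by (simp flip: power_add)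
  ultimately show ?thesis by (simp add: Y_def P_def P2_def)
qed

lemma P_le_P2: "P \<le> P2"
  unfolding P_def P2_def using X0_ge pw_pos[of 480] by (intro mult_mono X0_pow pw_mono) auto

lemma P_pows: "P * P \<le> Y" "P * P * P \<le> Y" "P * P2 \<le> Y" "P \<le> Y"
proof -
  have "P * P * 1 \<le> P * P * P2" using P_ge by (intro mult_left_mono) auto
  then show a: "P * P \<le> Y" by (simp add: Y_eq)
  have "P * P * P \<le> P * P * P2" using P_ge P_le_P2 by (intro mult_left_mono) auto
  then show "P * P * P \<le> Y" by (simp add: Y_eq)
  have "1 * (P * P2) \<le> P * (P * P2)" using P_ge by (intro mult_right_mono) auto
  then show "P * P2 \<le> Y" by (simp add: Y_eq mult.assoc)
  have "P * 1 \<le> P * P" using P_ge by (intro mult_left_mono) auto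
  then show "P \<le> Y" using a by simp
qed

text \<open>Since \<open>\<xi> < 1\<close>, raising it to a higher power in the denominator only
  enlarges the quotient; this turns mixed powers of \<open>k\<close> and \<open>\<xi>\<close> into
  powers of \<open>k / \<xi>\<close>.\<close>

lemma k_xi_le: "i \<ge> 2 \<Longrightarrow> real k ^ i / \<xi>\<^sup>2 \<le> X0 ^ i"
proof -
  assume i: "i \<ge> 2"
  have "\<xi> ^ i \<le> \<xi>\<^sup>2" using i \<xi> xi_pos by (intro power_decreasing) auto
  then have "real k ^ i / \<xi>\<^sup>2 \<le> real k ^ i / \<xi> ^ i" using xi_pos by (intro divide_left_mono) auto
  then show ?thesis by (simp add: X0_def power_divide)
qed

lemma cr_pos: "0 < c_reps H"
proof -
  have "0 < real (140 + q) / ln 2" by (intro divide_pos_pos) auto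
  then show ?thesis using cr by linarith
qed

lemma s_real: "real s \<le> cs' * P * l"
proof -
  have "X = (pw 480 * l) * (real k ^ 8 / \<xi>\<^sup>2)" by (simp add: X_def)
  also have "\<dots> \<le> (pw 480 * l) * X0 ^ 8" using k_xi_le[of 8] pw_pos[of 480] ln_n by (intro mult_left_mono) auto
  finally have "X \<le> P * l" by (simp add: P_def mult_ac)
  then have "cs' * X \<le> cs' * (P * l)" using cs_ge_1 by (intro mult_left_mono) auto
  moreover have "real s \<le> cs' * X" using s_bounds(2) X_pos by (simp add: distrib_right)
  ultimately show ?thesis by simp
qed

lemma reps_real: "real reps \<le> cr' * l"
proof -
  have "0 \<le> c_reps H * l" using cr_pos ln_n by simp
  then have "real reps \<le> c_reps H * l + 1" unfolding reps_def repetitions_def by linarith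
  then show ?thesis using ln_n by (simp add: distrib_right)
qed

lemma t_real: "real t \<le> 21 * (l * (1 / \<phi>\<^sup>2))" "l \<le> l * (1 / \<phi>\<^sup>2)" "1 \<le> 1 / \<phi>\<^sup>2"
proof -
  have "\<phi>\<^sup>2 \<le> 1" using \<phi> by (simp add: power_le_one)
  then show p: "1 \<le> 1 / \<phi>\<^sup>2" using \<phi> by simp
  have "l * 1 \<le> l * (1 / \<phi>\<^sup>2)" using p ln_n by (intro mult_left_mono) auto
  then show lp: "l \<le> l * (1 / \<phi>\<^sup>2)" by simp
  have "real t \<le> 20 * (l * (1 / \<phi>\<^sup>2)) + 1" using t_bounds(2) by simp
  then show "real t \<le> 21 * (l * (1 / \<phi>\<^sup>2))" using lp ln_n by linarith
qed

lemma word_real: "real (word cw n) \<le> 3 * real cw * l"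
proof -
  have l2: "1 / 2 \<le> ln (2::real)" using exp_half_le2 by (subst ln_ge_iff) auto
  have "l / ln 2 \<le> l / (1 / 2)" using l2 ln_n by (intro divide_left_mono) auto
  then have lg: "log 2 n \<le> 2 * l" by (simp add: log_def)
  have "0 \<le> log 2 n" using n4 by simp
  then have "real (nat \<lceil>log 2 n\<rceil>) \<le> log 2 n + 1" by linarith
  then have "real (nat \<lceil>log 2 n\<rceil>) \<le> 3 * l" using lg ln_n by linarith
  then have "real cw * real (nat \<lceil>log 2 n\<rceil>) \<le> real cw * (3 * l)" by (intro mult_left_mono) auto
  then show ?thesis by (simp add: word_def mult_ac)
qed

lemma sort_reps_real: "real (sort_time reps) \<le> co * l\<^sup>2"
proof -
  have r: "1 \<le> reps" using reps_pow(2) by simp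
  have c0: "0 \<le> cr'" using cr_pos by simp
  have "ln reps \<le> reps" using ln_bound[of "real reps"] r by simp
  then have "2 * ln reps + 2 \<le> 2 * (cr' * l) + 2 * l" using reps_real ln_n by linarith
  then have "reps * (2 * ln reps + 2) \<le> (cr' * l) * (2 * (cr' * l) + 2 * l)"
    using reps_real r c0 ln_n by (intro mult_mono) auto
  then show ?thesis using sort_time_le[OF r] by (simp add: power2_eq_square algebra_simps)
qed

context
  fixes M :: nat
  assumes M: "M_ok M"
begin

text \<open>The fact \<open>1 \<le> cM * (n / M)\<close> allows costs without random walks to be
  charged to a bound containing \<open>n / M\<close>.\<close>

lemma M_facts: "1 \<le> real M" "real M \<le> cM * sqrt n" "real M \<le> cM * n" "(real M)\<^sup>2 \<le> cM\<^sup>2 * n" "1 \<le> cM * (n / M)" "0 < cM"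
proof -
  show M1: "1 \<le> real M" using M by (simp add: M_ok_def)
  show cM: "0 < cM" by (rule M_bound(2)[OF M])
  have np: "1 \<le> real n" using n4 by simp
  have "real M * 1 \<le> real M * k" using k2 by (intro mult_left_mono) auto
  also have "\<dots> \<le> cM * (sqrt n * pw (- 20))" by (rule M_bound(1)[OF M])
  also have "\<dots> \<le> cM * (sqrt n * 1)" using cM pw_mono[of "- 20" 0] by (intro mult_left_mono) auto
  finally show a: "real M \<le> cM * sqrt n" by simp
  have "sqrt n \<le> n" using np by (simp add: real_sqrt_le_iff' real_le_lsqrt self_le_power)
  then have "cM * sqrt n \<le> cM * n" using cM by (intro mult_left_mono) auto
  with a show b: "real M \<le> cM * n" by linarith
  have "(real M)\<^sup>2 \<le> (cM * sqrt n)\<^sup>2" using a by (intro power_mono) auto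
  then show "(real M)\<^sup>2 \<le> cM\<^sup>2 * n" by (simp add: power_mult_distrib)
  show "1 \<le> cM * (n / M)" using b M1 by simp
qed

text \<open>There are about \<open>R / M = R * M / M^2\<close> batches, each of cost of order
  \<open>M * ln n / \<phi>^2\<close>, so one power of \<open>M\<close> remains in the denominator.
  In \<open>53 + 4 * cM\<close>, walks give 42, sorting gives \<open>8 + 4 * cM\<close>, and merging
  and the accumulator give 3. The term \<open>cM^2\<close> pays for rounding up the number of
  batches.\<close>

lemma est_real:
  fixes R c :: real
  assumes R: "0 < R" and RM: "R * M \<le> c * (n * P2)" and c: "0 \<le> c"
  shows "real (est_time R t M) \<le> ((c + cM\<^sup>2) * (53 + 4 * cM) + cM) * ((n / M) * P2 * l * (1 / \<phi>\<^sup>2))"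
proof -
  define L where "L = l * (1 / \<phi>\<^sup>2)"
  note Mf = M_facts
  have L1: "1 \<le> L" "l \<le> L" using t_real ln_n unfolding L_def by linarith+
  have np: "0 < real n" using n4 by simp
  have "ln M \<le> ln (cM * n)" using Mf by (subst ln_le_cancel_iff) auto
  also have "\<dots> = ln cM + l" using Mf np by (simp add: ln_mult)
  also have "\<dots> \<le> cM + l" using ln_bound[of cM] Mf by simp
  finally have lnM: "2 * ln M + 2 \<le> (2 * cM + 4) * L"
  proof -
    assume "ln M \<le> cM + l"
    moreover have "cM * 1 \<le> cM * L" using L1 Mf by (intro mult_left_mono) auto
    ultimately show ?thesis using L1 by (simp add: distrib_right)
  qed
  have "real (sort_time M) \<le> M * (2 * ln M + 2)" using M by (intro sort_time_le) (simp add: M_ok_def)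
  also have "\<dots> \<le> M * ((2 * cM + 4) * L)" using lnM by (intro mult_left_mono) auto
  finally have so: "real (sort_time M) \<le> M * ((2 * cM + 4) * L)" .
  have t: "real M * real t \<le> M * (21 * L)" using t_real(1) by (intro mult_left_mono) (auto simp: L_def)
  have MleL: "real M * 1 \<le> M * L" using L1 by (intro mult_left_mono) auto
  have "real (batch_time t M + 1) \<le> (53 + 4 * cM) * (M * L)"
  proof -
    have "real (batch_time t M + 1) = 2 * (real M * real t) + 2 * real (sort_time M) + 2 * real M + 1"
      by (simp add: batch_time_def)
    also have "\<dots> \<le> 2 * (M * (21 * L)) + 2 * (M * ((2 * cM + 4) * L)) + 2 * (M * L) + M * L"
      using so t MleL Mf(1) by linarith
    also have "\<dots> = (53 + 4 * cM) * (M * L)" by (simp add: algebra_simps)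
    finally show ?thesis .
  qed
  moreover have "real (nat \<lceil>R / real M\<rceil>) \<le> (c + cM\<^sup>2) * (n * P2) / (real M)\<^sup>2"
  proof -
    have "0 \<le> R / M" using R by simp
    then have 1: "real (nat \<lceil>R / real M\<rceil>) \<le> R / M + 1" by linarith
    have "R / M = R * M / (real M)\<^sup>2" using Mf(1) by (simp add: power2_eq_square)
    also have "\<dots> \<le> c * (n * P2) / (real M)\<^sup>2" using RM by (intro divide_right_mono) auto
    finally have 2: "R / M \<le> c * (n * P2) / (real M)\<^sup>2" .
    have "cM\<^sup>2 * n * 1 \<le> cM\<^sup>2 * n * P2" using P_ge by (intro mult_left_mono) auto
    then have "(real M)\<^sup>2 \<le> cM\<^sup>2 * (n * P2)" using Mf(4) by (simp add: mult.assoc)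
    then have 3: "1 \<le> cM\<^sup>2 * (n * P2) / (real M)\<^sup>2" using Mf(1) by simp
    show ?thesis using add_mono[OF 2 3] 1 by (simp add: add_divide_distrib distrib_right)
  qed
  ultimately have "real (nat \<lceil>R / real M\<rceil>) * real (batch_time t M + 1)
      \<le> ((c + cM\<^sup>2) * (n * P2) / (real M)\<^sup>2) * ((53 + 4 * cM) * (M * L))"
    using c P_ge by (intro mult_mono) auto
  also have "\<dots> = (c + cM\<^sup>2) * (53 + 4 * cM) * ((n / M) * P2 * L)"
    using Mf(1) by (simp add: power2_eq_square)
  finally have "real (est_time R t M) \<le> (c + cM\<^sup>2) * (53 + 4 * cM) * ((n / M) * P2 * L) + 1"
    unfolding est_time_def of_nat_add[of "_ * _"] of_nat_mult by simp
  moreover have "1 \<le> cM * ((n / M) * P2 * L)"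
  proof -
    have "1 * 1 \<le> (cM * (n / M)) * (P2 * L)"
      using Mf(5) mult_mono[OF P_ge(2) L1(1)] P_ge L1 by (intro mult_mono) auto
    then show ?thesis by (simp add: mult_ac)
  qed
  ultimately have "real (est_time R t M) \<le> ((c + cM\<^sup>2) * (53 + 4 * cM) + cM) * ((n / M) * P2 * L)"
    unfolding distrib_right[of "(c + cM\<^sup>2) * (53 + 4 * cM)" cM] by linarith
  then show ?thesis by (simp only: L_def mult.assoc)
qed

lemma est_init_real:
  "real (est_time (R_init H n k \<phi> \<epsilon> \<xi> M) t M) \<le>
    ((c_init H + cM\<^sup>2) * (53 + 4 * cM) + cM) * ((n / M) * P2 * l * (1 / \<phi>\<^sup>2))" (is ?A)
  and c_init_nonneg: "0 \<le> c_init H"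
proof -
  have Mp: "0 < real M" and np: "0 < real n" using M_facts(1) n4 by auto
  show c: "0 \<le> c_init H"
    using ci C0_pos[OF M] beta_ge_1 by (intro order_trans[OF _ ci] mult_nonneg_nonneg) auto
  show ?A
  proof (rule est_real[OF R_init_sufficient(1)[OF M] _ c])
    have "R_init H n k \<phi> \<epsilon> \<xi> M * M = c_init H * (n * (pw 920 * (real k ^ 14 / \<xi>\<^sup>2)))"
      using Mp np by (simp add: R_init_def powr_add pw_def)
    also have "\<dots> \<le> c_init H * (n * (pw 920 * X0 ^ 14))"
      using c k_xi_le[of 14] pw_pos[of 920] by (intro mult_left_mono) auto
    finally show "R_init H n k \<phi> \<epsilon> \<xi> M * M \<le> c_init H * (n * P2)" by (simp add: P2_def mult_ac)
  qed
qed

lemma est_query_real: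
  "real (est_time (R_query H n k \<phi> \<epsilon> \<xi> M) t M) \<le>
    ((c_query H + cM\<^sup>2) * (53 + 4 * cM) + cM) * ((n / M) * P2 * l * (1 / \<phi>\<^sup>2))" (is ?A)
  and c_query_nonneg: "0 \<le> c_query H"
proof -
  have Mp: "0 < real M" and np: "0 < real n" using M_facts(1) n4 by auto
  show c: "0 \<le> c_query H"
    using cq C0_pos[OF M] beta_ge_1 by (intro order_trans[OF _ cq] mult_nonneg_nonneg) auto
  show ?A
  proof (rule est_real[OF R_query_sufficient(1)[OF M] _ c])
    have "R_query H n k \<phi> \<epsilon> \<xi> M * M = c_query H * (n * (pw 440 * (real k ^ 6 / \<xi>\<^sup>2)))"
      using Mp np by (simp add: R_query_def powr_add pw_def)
    also have "\<dots> \<le> c_query H * (n * (pw 920 * X0 ^ 14))"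
      using c order_trans[OF k_xi_le[of 6] X0_pow(1)[of 6 14]] pw_pos[of 920] xi_pos
      by (intro mult_left_mono mult_mono pw_mono) auto
    finally show "R_query H n k \<phi> \<epsilon> \<xi> M * M \<le> c_query H * (n * P2)" by (simp add: P2_def mult_ac)
  qed
qed

text \<open>Sorting and linear algebra do not involve \<open>n / M\<close> or
  \<open>1 / \<phi>^2\<close>; both factors are inserted at the price of \<open>cM\<close>.\<close>

lemma absorb:
  "P * P * l ^ 4 \<le> cM * (Y * (n / M) * l ^ 4 * (1 / \<phi>\<^sup>2))"
  "P * P * P * l ^ 3 \<le> cM * (Y * (n / M) * l ^ 4 * (1 / \<phi>\<^sup>2))"
  "P * l ^ 3 \<le> cM * (Y * (n / M) * l ^ 3 * (1 / \<phi>\<^sup>2))"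
  "P * P * l ^ 2 \<le> cM * (Y * (n / M) * l ^ 3 * (1 / \<phi>\<^sup>2))"
proof -
  have gen: "A * B \<le> cM * (Y * (n / M) * B' * (1 / \<phi>\<^sup>2))" if "0 \<le> A" "A \<le> Y" "0 \<le> B" "B \<le> B'" for A B B'
  proof -
    have "(A * B) * (1 * 1) \<le> (Y * B') * ((cM * (n / M)) * (1 / \<phi>\<^sup>2))"
      using that M_facts(5) t_real(3) by (intro mult_mono) auto
    then show ?thesis by (simp add: mult_ac)
  qed
  have P0: "0 \<le> P" using P_ge by simp
  have "l ^ 3 \<le> l ^ 4" "l ^ 2 \<le> l ^ 3" using ln_n by (auto intro: power_increasing)
  then show "P * P * l ^ 4 \<le> cM * (Y * (n / M) * l ^ 4 * (1 / \<phi>\<^sup>2))"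
    "P * P * P * l ^ 3 \<le> cM * (Y * (n / M) * l ^ 4 * (1 / \<phi>\<^sup>2))"
    "P * l ^ 3 \<le> cM * (Y * (n / M) * l ^ 3 * (1 / \<phi>\<^sup>2))"
    "P * P * l ^ 2 \<le> cM * (Y * (n / M) * l ^ 3 * (1 / \<phi>\<^sup>2))"
    using P0 P_pows ln_n by (intro gen; simp)+
qed

abbreviation ci' where "ci' \<equiv> (c_init H + cM\<^sup>2) * (53 + 4 * cM) + cM"
abbreviation cq' where "cq' \<equiv> (c_query H + cM\<^sup>2) * (53 + 4 * cM) + cM"

lemma consts_nonneg: "0 \<le> cs'" "0 \<le> cr'" "0 \<le> co" "0 \<le> ci'" "0 \<le> cq'"
  using cs_ge_1 cr_pos c_init_nonneg c_query_nonneg M_facts(6) by auto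

lemma base_nonneg: "0 \<le> P" "0 \<le> P2" "0 \<le> l" "0 \<le> Y" "0 \<le> n / M" "0 \<le> 1 / \<phi>\<^sup>2"
  using P_ge ln_n P_pows(4) by auto

text \<open>The four logarithms in the leading term: one from the repetitions, two from the pairs of
  samples, one from the walk length.\<close>

lemma init_time_real:
  assumes "T = est_time (R_init H n k \<phi> \<epsilon> \<xi> M) t M"
  shows "real (s + (reps * (s * (s * T)) + s\<^sup>2 * sort_time reps) + (s\<^sup>2 + ce * s ^ 3) + (k + s * k + s\<^sup>2 * k + s\<^sup>2))
    \<le> (cr' * cs'\<^sup>2 * ci' + cs'\<^sup>2 * co * cM + (6 + real ce) * cs' ^ 3 * cM) * (Y * (n / M) * l ^ 4 * (1 / \<phi>\<^sup>2))"
proof -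
  define Z where "Z = Y * (n / M) * l ^ 4 * (1 / \<phi>\<^sup>2)"
  note c0 = consts_nonneg and b0 = base_nonneg
  have low: "s + (s\<^sup>2 + ce * s ^ 3) + (k + s * k + s\<^sup>2 * k + s\<^sup>2) \<le> (6 + ce) * s ^ 3"
  proof -
    have s1: "1 \<le> s" and ks: "k \<le> s" using s_pos k_le_s by auto
    have s2: "s\<^sup>2 \<le> s ^ 3" and s0: "s \<le> s ^ 3" using s1 by (auto intro: power_increasing self_le_power)
    have "s * k \<le> s * s" "s\<^sup>2 * k \<le> s\<^sup>2 * s" using ks by auto
    then have "s * k \<le> s\<^sup>2" "s\<^sup>2 * k \<le> s ^ 3" by (simp_all add: power2_eq_square power3_eq_cube)
    then show ?thesis using s2 s0 ks by (simp add: distrib_right)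
  qed
  have "real reps * (real s * (real s * real T))
      \<le> (cr' * l) * ((cs' * P * l) * ((cs' * P * l) * (ci' * ((n / M) * P2 * l * (1 / \<phi>\<^sup>2)))))"
    unfolding assms using s_real reps_real est_init_real c0 b0
    by (intro mult_mono mult_nonneg_nonneg) auto
  also have "\<dots> = cr' * cs'\<^sup>2 * ci' * Z"
    unfolding Z_def Y_eq power2_eq_square[of cs'] power4_eq_xxxx by (simp only: mult_ac)
  finally have 1: "real reps * (real s * (real s * real T)) \<le> cr' * cs'\<^sup>2 * ci' * Z" .
  have ss: "(real s)\<^sup>2 \<le> (cs' * P * l)\<^sup>2" "(real s) ^ 3 \<le> (cs' * P * l) ^ 3"
    using s_real by (auto intro: power_mono)
  have "(real s)\<^sup>2 * real (sort_time reps) \<le> (cs' * P * l)\<^sup>2 * (co * l\<^sup>2)"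
    using ss sort_reps_real by (intro mult_mono) auto
  also have "\<dots> = cs'\<^sup>2 * co * (P * P * l ^ 4)"
    unfolding power2_eq_square power4_eq_xxxx by (simp only: mult_ac)
  also have "\<dots> \<le> cs'\<^sup>2 * co * (cM * Z)" unfolding Z_def using absorb(1) c0 by (intro mult_left_mono) auto
  finally have 2: "(real s)\<^sup>2 * real (sort_time reps) \<le> cs'\<^sup>2 * co * (cM * Z)" .
  have "(6 + real ce) * real s ^ 3 \<le> (6 + real ce) * (cs' * P * l) ^ 3" using ss by (intro mult_left_mono) auto
  also have "\<dots> = (6 + real ce) * cs' ^ 3 * (P * P * P * l ^ 3)"
    unfolding power3_eq_cube by (simp only: mult_ac)
  also have "\<dots> \<le> (6 + real ce) * cs' ^ 3 * (cM * Z)" unfolding Z_def using absorb(2) c0 by (intro mult_left_mono) auto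
  finally have 3: "(6 + real ce) * real s ^ 3 \<le> (6 + real ce) * cs' ^ 3 * (cM * Z)" .
  have "real (s + (reps * (s * (s * T)) + s\<^sup>2 * sort_time reps) + (s\<^sup>2 + ce * s ^ 3) + (k + s * k + s\<^sup>2 * k + s\<^sup>2))
      = real (reps * (s * (s * T))) + real (s\<^sup>2 * sort_time reps) + real (s + (s\<^sup>2 + ce * s ^ 3) + (k + s * k + s\<^sup>2 * k + s\<^sup>2))"
    by simp
  also have "\<dots> \<le> real (reps * (s * (s * T))) + real (s\<^sup>2 * sort_time reps) + real ((6 + ce) * s ^ 3)"
    using low of_nat_mono by (intro add_mono) blast+
  also have "\<dots> = real reps * (real s * (real s * real T)) + (real s)\<^sup>2 * real (sort_time reps) + (6 + real ce) * real s ^ 3"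
    by simp
  also have "\<dots> \<le> cr' * cs'\<^sup>2 * ci' * Z + cs'\<^sup>2 * co * (cM * Z) + (6 + real ce) * cs' ^ 3 * (cM * Z)"
    using 1 2 3 by (intro add_mono)
  also have "\<dots> = (cr' * cs'\<^sup>2 * ci' + cs'\<^sup>2 * co * cM + (6 + real ce) * cs' ^ 3 * cM) * Z"
    by (simp only: distrib_right mult.assoc)
  finally show ?thesis unfolding Z_def .
qed

text \<open>Here the four logarithms are the word length, the repetitions and twice the sample
  size.\<close>

lemma init_space_real:
  "real (word cw n * (s + 2 * s\<^sup>2 + ce * s\<^sup>2 + s * k + 8) + (word cw n * (reps * s\<^sup>2 + reps + 8) + word cw n * (2 * M + 8)))
    \<le> (32 + real ce) * 3 * real cw * cr' * cs'\<^sup>2 * (Y * M * l ^ 4)"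
proof -
  note c0 = consts_nonneg and b0 = base_nonneg
  have s1: "1 \<le> s" and ks: "k \<le> s" and r1: "1 \<le> reps" and M1: "1 \<le> M"
    using s_pos k_le_s reps_pow(2) M by (auto simp: M_ok_def)
  define A where "A = reps * s\<^sup>2 * M"
  have sq: "1 \<le> s\<^sup>2" using s1 by simp
  have "s * 1 \<le> s * s" "s * k \<le> s * s" using s1 ks by auto
  then have ssq: "s \<le> s\<^sup>2" "s * k \<le> s\<^sup>2" by (simp_all add: power2_eq_square)
  have "1 * s\<^sup>2 \<le> (reps * M) * s\<^sup>2" "reps * s\<^sup>2 * 1 \<le> reps * s\<^sup>2 * M" "1 * M \<le> (reps * s\<^sup>2) * M"
    "reps * 1 \<le> reps * (s\<^sup>2 * M)" "1 * 1 \<le> reps * (s\<^sup>2 * M)"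
    using r1 M1 sq by (auto intro!: mult_le_mono)
  then have A: "s\<^sup>2 \<le> A" "reps * s\<^sup>2 \<le> A" "M \<le> A" "reps \<le> A" "1 \<le> A" by (simp_all add: A_def mult_ac)
  have "ce * s\<^sup>2 \<le> ce * A" using A by simp
  then have "(s + 2 * s\<^sup>2 + ce * s\<^sup>2 + s * k + 8) + ((reps * s\<^sup>2 + reps + 8) + (2 * M + 8)) \<le> (32 + ce) * A"
    unfolding distrib_right using A ssq by linarith
  then have "word cw n * ((s + 2 * s\<^sup>2 + ce * s\<^sup>2 + s * k + 8) + ((reps * s\<^sup>2 + reps + 8) + (2 * M + 8))) \<le> word cw n * ((32 + ce) * A)"
    by (rule mult_le_mono2)
  then have "real (word cw n * (s + 2 * s\<^sup>2 + ce * s\<^sup>2 + s * k + 8) + (word cw n * (reps * s\<^sup>2 + reps + 8) + word cw n * (2 * M + 8)))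
      \<le> real (word cw n * ((32 + ce) * A))"
    unfolding distrib_left[symmetric] using of_nat_mono by blast
  also have "\<dots> = (32 + real ce) * (real (word cw n) * (real reps * (real s)\<^sup>2)) * M" by (simp add: A_def)
  also have "\<dots> \<le> (32 + real ce) * ((3 * real cw * l) * ((cr' * l) * (cs' * P * l)\<^sup>2)) * M"
    using word_real[of cw] reps_real s_real c0 b0
    by (intro mult_right_mono mult_left_mono mult_mono power_mono) auto
  also have "\<dots> = (32 + real ce) * 3 * real cw * cr' * cs'\<^sup>2 * ((P * P) * M * l ^ 4)"
    unfolding power2_eq_square power4_eq_xxxx by (simp only: mult_ac)
  also have "\<dots> \<le> (32 + real ce) * 3 * real cw * cr' * cs'\<^sup>2 * (Y * M * l ^ 4)"
    using P_pows(1) c0 b0 by (intro mult_left_mono mult_right_mono) auto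
  finally show ?thesis .
qed

text \<open>Compared with the oracle, walks run only between a query vertex and the samples, so the
  leading term has one factor \<open>s\<close>, and with it one logarithm, less.\<close>

lemma query_time_real:
  assumes "T = est_time (R_query H n k \<phi> \<epsilon> \<xi> M) t M"
  shows "real (reps * (s * (2 * T)) + 2 * s * sort_time reps + (2 * s\<^sup>2 + 2 * s))
    \<le> (2 * cr' * cs' * cq' + 2 * cs' * co * cM + 4 * cs'\<^sup>2 * cM) * (Y * (n / M) * l ^ 3 * (1 / \<phi>\<^sup>2))"
proof -
  define Z where "Z = Y * (n / M) * l ^ 3 * (1 / \<phi>\<^sup>2)"
  note c0 = consts_nonneg and b0 = base_nonneg
  have "real reps * (real s * (2 * real T))
      \<le> (cr' * l) * ((cs' * P * l) * (2 * (cq' * ((n / M) * P2 * l * (1 / \<phi>\<^sup>2)))))"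
    unfolding assms using s_real reps_real est_query_real c0 b0
    by (intro mult_mono mult_nonneg_nonneg) auto
  also have "\<dots> = 2 * cr' * cs' * cq' * ((P * P2) * (n / M) * l ^ 3 * (1 / \<phi>\<^sup>2))"
    unfolding power3_eq_cube by (simp only: mult_ac)
  also have "\<dots> \<le> 2 * cr' * cs' * cq' * Z"
    unfolding Z_def using P_pows(3) c0 b0 by (intro mult_left_mono mult_right_mono) auto
  finally have 1: "real reps * (real s * (2 * real T)) \<le> 2 * cr' * cs' * cq' * Z" .
  have "2 * real s * real (sort_time reps) \<le> 2 * (cs' * P * l) * (co * l\<^sup>2)"
    using s_real sort_reps_real c0 b0 by (intro mult_mono) auto
  also have "\<dots> = 2 * cs' * co * (P * l ^ 3)"
    unfolding power2_eq_square power3_eq_cube by (simp only: mult_ac)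
  also have "\<dots> \<le> 2 * cs' * co * (cM * Z)" unfolding Z_def using absorb(3) c0 by (intro mult_left_mono) auto
  finally have 2: "2 * real s * real (sort_time reps) \<le> 2 * cs' * co * (cM * Z)" .
  have "real s \<le> (real s)\<^sup>2" using s_pos by (intro self_le_power) auto
  then have "2 * (real s)\<^sup>2 + 2 * real s \<le> 4 * (real s)\<^sup>2" by linarith
  also have "\<dots> \<le> 4 * (cs' * P * l)\<^sup>2" using s_real by (intro mult_left_mono power_mono) auto
  also have "\<dots> = 4 * cs'\<^sup>2 * (P * P * l ^ 2)"
    unfolding power2_eq_square by (simp only: mult_ac)
  also have "\<dots> \<le> 4 * cs'\<^sup>2 * (cM * Z)" unfolding Z_def using absorb(4) c0 by (intro mult_left_mono) auto
  finally have 3: "2 * (real s)\<^sup>2 + 2 * real s \<le> 4 * cs'\<^sup>2 * (cM * Z)" .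
  have "real (reps * (s * (2 * T)) + 2 * s * sort_time reps + (2 * s\<^sup>2 + 2 * s))
      = real reps * (real s * (2 * real T)) + 2 * real s * real (sort_time reps) + (2 * (real s)\<^sup>2 + 2 * real s)"
    by simp
  also have "\<dots> \<le> 2 * cr' * cs' * cq' * Z + 2 * cs' * co * (cM * Z) + 4 * cs'\<^sup>2 * (cM * Z)"
    using 1 2 3 by (intro add_mono)
  also have "\<dots> = (2 * cr' * cs' * cq' + 2 * cs' * co * cM + 4 * cs'\<^sup>2 * cM) * Z"
    by (simp only: distrib_right mult.assoc)
  finally show ?thesis unfolding Z_def .
qed

text \<open>Besides the word length, two logarithms occur, from storing the oracle with
  \<open>s^2\<close> entries or from \<open>reps * s\<close> estimates.\<close>

lemma query_space_real:
  "real (word cw n * (s + s\<^sup>2 + 2 * reps * s + 2 * s + reps + 8) + word cw n * (2 * M + 8))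
    \<le> 3 * real cw * (12 * cs'\<^sup>2 + 3 * cr' * cs' + 10) * (Y * M * l ^ 3)"
proof -
  note c0 = consts_nonneg and b0 = base_nonneg
  have s1: "1 \<le> s" and r1: "1 \<le> reps" and M1: "1 \<le> M"
    using s_pos reps_pow(2) M by (auto simp: M_ok_def)
  have "s * 1 \<le> s * s" "reps * 1 \<le> reps * s" using s1 by auto
  then have "s \<le> s\<^sup>2" "reps \<le> reps * s" "1 \<le> s\<^sup>2" using s1 by (simp_all add: power2_eq_square)
  then have "s + s\<^sup>2 + 2 * reps * s + 2 * s + reps + 8 \<le> 12 * s\<^sup>2 + 3 * (reps * s)"
    unfolding mult.assoc by linarith
  also have "\<dots> \<le> (12 * s\<^sup>2 + 3 * (reps * s)) * M" using M1 by simp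
  finally have "(s + s\<^sup>2 + 2 * reps * s + 2 * s + reps + 8) + (2 * M + 8) \<le> (12 * s\<^sup>2 + 3 * (reps * s) + 10) * M"
    using M1 by (simp add: distrib_right)
  then have "word cw n * ((s + s\<^sup>2 + 2 * reps * s + 2 * s + reps + 8) + (2 * M + 8)) \<le> word cw n * ((12 * s\<^sup>2 + 3 * (reps * s) + 10) * M)"
    by (rule mult_le_mono2)
  then have "real (word cw n * (s + s\<^sup>2 + 2 * reps * s + 2 * s + reps + 8) + word cw n * (2 * M + 8))
      \<le> real (word cw n * ((12 * s\<^sup>2 + 3 * (reps * s) + 10) * M))"
    unfolding distrib_left[symmetric] using of_nat_mono by blast
  also have "\<dots> = real (word cw n) * (12 * (real s)\<^sup>2 + 3 * (real reps * real s) + 10) * M" by simp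
  also have "\<dots> \<le> (3 * real cw * l) * ((12 * cs'\<^sup>2 + 3 * cr' * cs' + 10) * (Y * l\<^sup>2)) * M"
  proof -
    have Yl: "1 * 1 \<le> Y * l\<^sup>2" using P_pows(4) P_ge ln_n by (intro mult_mono) auto
    have "(real s)\<^sup>2 \<le> (cs' * P * l)\<^sup>2" using s_real by (intro power_mono) auto
    also have "\<dots> = cs'\<^sup>2 * ((P * P) * l\<^sup>2)" unfolding power2_eq_square by (simp only: mult_ac)
    also have "\<dots> \<le> cs'\<^sup>2 * (Y * l\<^sup>2)" using P_pows(1) by (intro mult_left_mono mult_right_mono) auto
    finally have 1: "(real s)\<^sup>2 \<le> cs'\<^sup>2 * (Y * l\<^sup>2)" .
    have "real reps * real s \<le> (cr' * l) * (cs' * P * l)" using reps_real s_real c0 b0 by (intro mult_mono) auto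
    also have "\<dots> = cr' * cs' * (P * l\<^sup>2)" unfolding power2_eq_square by (simp only: mult_ac)
    also have "\<dots> \<le> cr' * cs' * (Y * l\<^sup>2)" using P_pows(4) c0 by (intro mult_left_mono mult_right_mono) auto
    finally have 2: "real reps * real s \<le> cr' * cs' * (Y * l\<^sup>2)" .
    have "12 * (real s)\<^sup>2 + 3 * (real reps * real s) + 10 \<le> 12 * (cs'\<^sup>2 * (Y * l\<^sup>2)) + 3 * (cr' * cs' * (Y * l\<^sup>2)) + 10 * (Y * l\<^sup>2)"
      using 1 2 Yl by linarith
    also have "\<dots> = (12 * cs'\<^sup>2 + 3 * cr' * cs' + 10) * (Y * l\<^sup>2)" by (simp only: distrib_right mult.assoc)
    finally show ?thesis using word_real[of cw] b0 by (intro mult_right_mono mult_mono) auto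
  qed
  also have "\<dots> = 3 * real cw * (12 * cs'\<^sup>2 + 3 * cr' * cs' + 10) * (Y * M * l ^ 3)"
    unfolding power2_eq_square[of l] power3_eq_cube by (simp only: mult_ac)
  finally show ?thesis .
qed

lemma cost_constant_ge:
  "1 \<le> cost_constant H cM cw ce"
  "cr' * cs'\<^sup>2 * ci' + cs'\<^sup>2 * co * cM + (6 + real ce) * cs' ^ 3 * cM \<le> cost_constant H cM cw ce"
  "(32 + real ce) * 3 * real cw * cr' * cs'\<^sup>2 \<le> cost_constant H cM cw ce"
  "2 * cr' * cs' * cq' + 2 * cs' * co * cM + 4 * cs'\<^sup>2 * cM \<le> cost_constant H cM cw ce"
  "3 * real cw * (12 * cs'\<^sup>2 + 3 * cr' * cs' + 10) \<le> cost_constant H cM cw ce"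
  "cs'\<^sup>2 \<le> cost_constant H cM cw ce"
proof -
  note c0 = consts_nonneg and cM0 = M_facts(6)
  have n: "0 \<le> cr' * cs'\<^sup>2 * ci' + cs'\<^sup>2 * co * cM + (6 + real ce) * cs' ^ 3 * cM"
    "0 \<le> (32 + real ce) * 3 * real cw * cr' * cs'\<^sup>2"
    "0 \<le> 2 * cr' * cs' * cq' + 2 * cs' * co * cM + 4 * cs'\<^sup>2 * cM"
    "0 \<le> 3 * real cw * (12 * cs'\<^sup>2 + 3 * cr' * cs' + 10)" "0 \<le> cs'\<^sup>2"
    using c0 cM0 cs_ge_1 cr_pos by (auto intro!: add_nonneg_nonneg mult_nonneg_nonneg simp del: add_nonneg_nonneg)
  have e: "cost_constant H cM cw ce = 1 + (cr' * cs'\<^sup>2 * ci' + cs'\<^sup>2 * co * cM + (6 + real ce) * cs' ^ 3 * cM)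
     + (32 + real ce) * 3 * real cw * cr' * cs'\<^sup>2 + (2 * cr' * cs' * cq' + 2 * cs' * co * cM + 4 * cs'\<^sup>2 * cM)
     + 3 * real cw * (12 * cs'\<^sup>2 + 3 * cr' * cs' + 10) + cs'\<^sup>2"
    unfolding cost_constant_def Let_def ..
  have "1 \<le> 1 + a + b + c + d + e \<and> a \<le> 1 + a + b + c + d + e \<and> b \<le> 1 + a + b + c + d + e \<and>
      c \<le> 1 + a + b + c + d + e \<and> d \<le> 1 + a + b + c + d + e \<and> e \<le> 1 + a + b + c + d + e"
    if "0 \<le> a" "0 \<le> b" "0 \<le> c" "0 \<le> d" "0 \<le> e" for a b c d e :: real
    using that by simp
  from this[OF n] show "1 \<le> cost_constant H cM cw ce"
    "cr' * cs'\<^sup>2 * ci' + cs'\<^sup>2 * co * cM + (6 + real ce) * cs' ^ 3 * cM \<le> cost_constant H cM cw ce"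
    "(32 + real ce) * 3 * real cw * cr' * cs'\<^sup>2 \<le> cost_constant H cM cw ce"
    "2 * cr' * cs' * cq' + 2 * cs' * co * cM + 4 * cs'\<^sup>2 * cM \<le> cost_constant H cM cw ce"
    "3 * real cw * (12 * cs'\<^sup>2 + 3 * cr' * cs' + 10) \<le> cost_constant H cM cw ce"
    "cs'\<^sup>2 \<le> cost_constant H cM cw ce"
    unfolding e by blast+
qed

text \<open>A constant \<open>K \<ge> 1\<close> equals \<open>2 powr log 2 K\<close> and is at most
  \<open>X0 powr log 2 K\<close> because \<open>X0 \<ge> 2\<close>. The single exponent
  \<open>a\<close> covers both \<open>k / \<xi>\<close> and \<open>\<nu>\<close>.\<close>

lemma poly_small:
  assumes a: "a = 1880 + log 2 (cost_constant H cM cw ce)" and c: "c \<le> cost_constant H cM cw ce"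
    and U: "0 \<le> U"
  shows "c * (Y * U) \<le> (X0 powr a * pw a) * U"
proof -
  define K where "K = cost_constant H cM cw ce"
  have K1: "1 \<le> K" unfolding K_def by (rule cost_constant_ge)
  then have lK: "0 \<le> log 2 K" by simp
  have "X0 ^ 30 * K \<le> X0 powr 30 * X0 powr log 2 K"
  proof (rule mult_mono)
    show "X0 ^ 30 \<le> X0 powr 30" using X0_ge powr_realpow[of X0 30] by simp
    have "K = 2 powr log 2 K" using K1 by simp
    also have "\<dots> \<le> X0 powr log 2 K" using X0_ge lK by (intro powr_mono2) auto
    finally show "K \<le> X0 powr log 2 K" .
  qed (use K1 in auto)
  also have "\<dots> = X0 powr (30 + log 2 K)" by (rule powr_add[symmetric])
  also have "\<dots> \<le> X0 powr a" using X0_ge unfolding a K_def by (intro powr_mono) auto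
  finally have 1: "X0 ^ 30 * K \<le> X0 powr a" .
  have 2: "pw 1880 \<le> pw a" using lK unfolding a K_def by (intro pw_mono) auto
  have "c * (Y * U) \<le> K * (Y * U)" using c U base_nonneg(4) unfolding K_def by (intro mult_right_mono) auto
  also have "\<dots> = ((X0 ^ 30 * K) * pw 1880) * U" by (simp add: Y_def mult_ac)
  also have "\<dots> \<le> (X0 powr a * pw a) * U"
    using 1 2 U pw_pos[of 1880] by (intro mult_right_mono mult_mono) auto
  finally show ?thesis .
qed

lemma init_costs:
  assumes a: "a = 1880 + log 2 (cost_constant H cM cw ce)"
    and r: "((IS, out), T, S) \<in> set_pmf (run (init_oracle H cw ce eig n E k \<phi> \<epsilon> \<xi> M))"
  shows "length IS = s"
    "real S \<le> (real k / \<xi>) powr a * real n powr (a * \<epsilon> / \<phi>\<^sup>2) * real M * ln (real n) ^ 4"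
    "real T \<le> (real k / \<xi>) powr a * (real n * real n powr (a * \<epsilon> / \<phi>\<^sup>2)) * (ln (real n) ^ 4 / real M) * (1 / \<phi>\<^sup>2)"
proof -
  note c = bspec[OF costs_init_oracle[of H cw ce eig n E k \<phi> \<epsilon> \<xi> M, unfolded costs_def, folded s_def reps_def t_def] r]
  show "length IS = s" using c by simp
  have "real S \<le> (32 + real ce) * 3 * real cw * cr' * cs'\<^sup>2 * (Y * M * l ^ 4)"
    using c by (intro order_trans[OF _ init_space_real]) (simp only: of_nat_le_iff fst_conv snd_conv)
  also have "\<dots> = (32 + real ce) * 3 * real cw * cr' * cs'\<^sup>2 * (Y * (M * l ^ 4))" by simp
  also have "\<dots> \<le> (X0 powr a * pw a) * (M * l ^ 4)"
    by (rule poly_small[OF a cost_constant_ge(3)]) (use ln_n in auto)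
  finally show "real S \<le> (real k / \<xi>) powr a * real n powr (a * \<epsilon> / \<phi>\<^sup>2) * real M * ln (real n) ^ 4"
    by (simp add: X0_def pw_def mult.assoc)
  have "real T \<le> (cr' * cs'\<^sup>2 * ci' + cs'\<^sup>2 * co * cM + (6 + real ce) * cs' ^ 3 * cM) * (Y * (n / M) * l ^ 4 * (1 / \<phi>\<^sup>2))"
    using c by (intro order_trans[OF _ init_time_real[OF refl]]) (simp only: of_nat_le_iff fst_conv snd_conv)
  also have "\<dots> = (cr' * cs'\<^sup>2 * ci' + cs'\<^sup>2 * co * cM + (6 + real ce) * cs' ^ 3 * cM) * (Y * ((n / M) * l ^ 4 * (1 / \<phi>\<^sup>2)))"
    by (simp only: mult.assoc)
  also have "\<dots> \<le> (X0 powr a * pw a) * ((n / M) * l ^ 4 * (1 / \<phi>\<^sup>2))"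
    by (rule poly_small[OF a cost_constant_ge(2)]) (use ln_n in auto)
  finally show "real T \<le> (real k / \<xi>) powr a * (real n * real n powr (a * \<epsilon> / \<phi>\<^sup>2)) * (ln (real n) ^ 4 / real M) * (1 / \<phi>\<^sup>2)"
    by (simp add: X0_def pw_def mult_ac)
qed

lemma query_costs:
  assumes a: "a = 1880 + log 2 (cost_constant H cM cw ce)" and len: "length IS = s"
    and r: "(z, T, S) \<in> set_pmf (run (query_dot H cw n E k \<phi> \<epsilon> \<xi> IS \<Psi> M x y))"
  shows "real S \<le> (real k / \<xi>) powr a * real n powr (a * \<epsilon> / \<phi>\<^sup>2) * real M * ln (real n) ^ 3"
    "real T \<le> (real k / \<xi>) powr a * (real n * real n powr (a * \<epsilon> / \<phi>\<^sup>2)) * (ln (real n) ^ 3 / real M) * (1 / \<phi>\<^sup>2)"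
proof -
  note c = bspec[OF costs_query_dot[OF len, of H cw n E k \<phi> \<epsilon> \<xi> \<Psi> M x y, unfolded costs_def, folded reps_def t_def] r]
  have "real S \<le> 3 * real cw * (12 * cs'\<^sup>2 + 3 * cr' * cs' + 10) * (Y * M * l ^ 3)"
    using c by (intro order_trans[OF _ query_space_real]) (simp only: of_nat_le_iff fst_conv snd_conv)
  also have "\<dots> = 3 * real cw * (12 * cs'\<^sup>2 + 3 * cr' * cs' + 10) * (Y * (M * l ^ 3))" by (simp only: mult.assoc)
  also have "\<dots> \<le> (X0 powr a * pw a) * (M * l ^ 3)"
    by (rule poly_small[OF a cost_constant_ge(5)]) (use ln_n in auto)
  finally show "real S \<le> (real k / \<xi>) powr a * real n powr (a * \<epsilon> / \<phi>\<^sup>2) * real M * ln (real n) ^ 3"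
    by (simp add: X0_def pw_def mult.assoc)
  have "real T \<le> (2 * cr' * cs' * cq' + 2 * cs' * co * cM + 4 * cs'\<^sup>2 * cM) * (Y * (n / M) * l ^ 3 * (1 / \<phi>\<^sup>2))"
    using c by (intro order_trans[OF _ query_time_real[OF refl]]) (simp only: of_nat_le_iff fst_conv snd_conv)
  also have "\<dots> = (2 * cr' * cs' * cq' + 2 * cs' * co * cM + 4 * cs'\<^sup>2 * cM) * (Y * ((n / M) * l ^ 3 * (1 / \<phi>\<^sup>2)))"
    by (simp only: mult.assoc)
  also have "\<dots> \<le> (X0 powr a * pw a) * ((n / M) * l ^ 3 * (1 / \<phi>\<^sup>2))"
    by (rule poly_small[OF a cost_constant_ge(4)]) (use ln_n in auto)
  finally show "real T \<le> (real k / \<xi>) powr a * (real n * real n powr (a * \<epsilon> / \<phi>\<^sup>2)) * (ln (real n) ^ 3 / real M) * (1 / \<phi>\<^sup>2)"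
    by (simp add: X0_def pw_def mult_ac)
qed

lemma oracle_size:
  assumes a: "a = 1880 + log 2 (cost_constant H cM cw ce)"
  shows "real (s * s) \<le> real n powr (a * \<epsilon> / \<phi>\<^sup>2) * ln (real n) ^ 2 * (real k / \<xi>) powr a"
proof -
  have "real (s * s) \<le> (cs' * P * l)\<^sup>2" using power_mono[OF s_real, of 2] by (simp add: power2_eq_square)
  also have "\<dots> = cs'\<^sup>2 * ((P * P) * l\<^sup>2)" unfolding power2_eq_square by (simp only: mult_ac)
  also have "\<dots> \<le> cs'\<^sup>2 * (Y * l\<^sup>2)" using P_pows(1) by (intro mult_left_mono mult_right_mono) auto
  also have "\<dots> \<le> (X0 powr a * pw a) * l\<^sup>2"
    by (rule poly_small[OF a cost_constant_ge(6)]) simp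
  finally show ?thesis by (simp add: X0_def pw_def mult_ac)
qed

end

end

text \<open>For completeness: the matrix with the eigenvectors as rows has its transpose as right
  inverse, and for square matrices this is also a left inverse.\<close>

lemma regular_spectral_of_eigenbasis:
  assumes reg: "regular_graph n d E" and eb: "ordered_eigenbasis n (laplacian n d E) lam u"
  shows "regular_spectral n d E lam (\<lambda>a x. u a $ x)"
proof
  have d: "0 < real d" using reg by (simp add: regular_graph_def)
  have uc: "u a \<in> carrier_vec n" and ev: "laplacian n d E *\<^sub>v u a = lam a \<cdot>\<^sub>v u a" if "a < n" for a
    using eb that by (auto simp: ordered_eigenbasis_def)
  have dotu: "(\<Sum>x<n. u a $ x * u b $ x) = (if a = b then 1 else 0)" if "a < n" "b < n" for a b
  proof -
    have "u a \<bullet> u b = (\<Sum>x<n. u a $ x * u b $ x)"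
      using uc[OF that(2)] by (simp add: scalar_prod_def atLeast0LessThan)
    then show ?thesis using eb that by (simp add: ordered_eigenbasis_def)
  qed
  show "regular_graph n d E" by (rule reg)
  show "(\<Sum>y<n. adj E x y * u a $ y) = real d * (1 - lam a) * u a $ x" if "a < n" "x < n" for a x
  proof -
    have "(laplacian n d E *\<^sub>v u a) $ x = (\<Sum>y<n. ((if x = y then 1 else 0) - 1 / real d * adj E x y) * u a $ y)"
      using that uc[OF that(1)]
      by (simp add: laplacian_def adjacency_def scalar_prod_def atLeast0LessThan adj_def)
    also have "\<dots> = (\<Sum>y<n. if x = y then u a $ y else 0) - 1 / real d * (\<Sum>y<n. adj E x y * u a $ y)"
      unfolding sum_distrib_left sum_subtractf[symmetric] by (intro sum.cong refl) (simp add: left_diff_distrib)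
    also have "\<dots> = u a $ x - (\<Sum>y<n. adj E x y * u a $ y) / real d" using that by simp
    finally have "lam a * u a $ x = u a $ x - (\<Sum>y<n. adj E x y * u a $ y) / real d"
      using that uc[OF that(1)] unfolding ev[OF that(1)] by simp
    then show ?thesis using d by (simp add: field_simps)
  qed
  show "(\<Sum>x<n. u a $ x * u b $ x) = (if a = b then 1 else 0)" if "a < n" "b < n" for a b
    by (rule dotu[OF that])
  show "(\<Sum>a<n. u a $ x * u a $ y) = (if x = y then 1 else 0)" if "x < n" "y < n" for x y
  proof -
    define U where "U = mat n n (\<lambda>(a, x). u a $ x)"
    have U: "U \<in> carrier_mat n n" "transpose_mat U \<in> carrier_mat n n" by (auto simp: U_def)
    have "U * transpose_mat U = 1\<^sub>m n"
      using dotu by (intro eq_matI) (auto simp: U_def scalar_prod_def atLeast0LessThan)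
    then have "transpose_mat U * U = 1\<^sub>m n" by (rule mat_mult_left_right_inverse[OF U])
    then have "(transpose_mat U * U) $$ (x, y) = 1\<^sub>m n $$ (x, y)" by simp
    then show ?thesis using that by (simp add: U_def scalar_prod_def atLeast0LessThan)
  qed
  show "lam a \<le> lam b" if "a \<le> b" "b < n" for a b
    using eb that by (simp add: ordered_eigenbasis_def)
qed

text \<open>The order of quantifiers expresses the hidden constants: \<open>H\<close> may depend on
  \<open>\<beta>\<close> and \<open>cM\<close> only, the exponent \<open>a\<close> also on the cost
  parameters \<open>cw\<close> and \<open>ce\<close>, and neither on the graph, the accuracy or the
  batch sizes.\<close>

theorem theorem4:
  fixes \<beta> cM :: real
  shows "\<exists>H. positive_hidden H \<and> (\<forall>cw ce :: nat. \<exists>a::real. \<forall>(k::nat) (n::nat) (d::nat) (E::edges)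
      (\<phi>::real) (\<epsilon>::real) (\<xi>::real) (Mi::nat) (Mq::nat) lam u eig.
    k \<ge> 2 \<longrightarrow> 0 < \<epsilon> \<longrightarrow> \<epsilon> < 1 \<longrightarrow> 0 < \<phi> \<longrightarrow> \<phi> < 1 \<longrightarrow> \<epsilon> / \<phi>\<^sup>2 \<le> 1 / 10 ^ 5 \<longrightarrow>
    regular_graph n d E \<longrightarrow> clusterable \<beta> k \<phi> \<epsilon> n E \<longrightarrow>
    1 / real n ^ 5 < \<xi> \<longrightarrow> \<xi> < 1 \<longrightarrow>
    1 \<le> Mi \<longrightarrow> real Mi \<le> cM * (real n powr (1/2 - 20 * \<epsilon> / \<phi>\<^sup>2) / real k) \<longrightarrow>
    1 \<le> Mq \<longrightarrow> real Mq \<le> cM * (real n powr (1/2 - 20 * \<epsilon> / \<phi>\<^sup>2) / real k) \<longrightarrow>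
    ordered_eigenbasis n (laplacian n d E) lam u \<longrightarrow> eigensolver eig \<longrightarrow>
    (let f = spectral_embedding k u;
         init = init_oracle H cw ce eig n E k \<phi> \<epsilon> \<xi> Mi;
         query = (\<lambda>IS \<Psi> x y. query_dot H cw n E k \<phi> \<epsilon> \<xi> IS \<Psi> Mq x y);
         poly = (real k / \<xi>) powr a;
         small = real n powr (a * \<epsilon> / \<phi>\<^sup>2)
     in
       measure_pmf.prob (result init)
         {(IS, out). \<exists>\<Psi>. out = Some \<Psi> \<and>
            real (dim_row \<Psi> * dim_col \<Psi>) \<le> small * ln (real n) ^ 2 * poly \<and>
            (\<forall>x<n. \<forall>y<n.
               measure_pmf.prob (result (query IS \<Psi> x y))
                 {z. \<bar>z - f x \<bullet> f y\<bar> \<le> \<xi> / real n} \<ge> 1 - 6 / real n ^ 100)}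
         \<ge> 1 - 2 / real n ^ 100 \<and>
       (\<forall>((IS, out), T_init, S_init) \<in> set_pmf (run init).
          real S_init \<le> poly * small * real Mi * ln (real n) ^ 4 \<and>
          real T_init \<le> poly * (real n * small) * (ln (real n) ^ 4 / real Mi) * (1 / \<phi>\<^sup>2) \<and>
          (\<forall>\<Psi> x y. out = Some \<Psi> \<longrightarrow> x < n \<longrightarrow> y < n \<longrightarrow>
            (\<forall>(z, T_query, S_query) \<in> set_pmf (run (query IS \<Psi> x y)).
               real S_query \<le> poly * small * real Mq * ln (real n) ^ 3 \<and>
               real T_query \<le> poly * (real n * small) * (ln (real n) ^ 3 / real Mq) * (1 / \<phi>\<^sup>2))))))"
proof -
  \<comment> \<open>\<open>H\<close> is fixed before \<open>1 \<le> \<beta>\<close> and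
    \<open>0 < cM\<close> are known. Both follow later, from comparing a cluster with itself and
    from \<open>1 \<le> Mi\<close>; the maxima then disappear.\<close>
  define B where "B = max 1 \<beta>"
  define C0 where "C0 = 1 + 2 * max 0 cM * sqrt (6 * B)"
  have B1: "1 \<le> B" by (simp add: B_def)
  have C01: "1 \<le> C0" using B1 by (simp add: C0_def)
  \<comment> \<open>This \<open>q\<close> is chosen together with \<open>H\<close>, since the number
    of repetitions must beat the square of the sample constant for every
    \<open>n \<ge> 4\<close>.\<close>
  obtain q :: nat where q: "(1668600 * B ^ 4 + 1)\<^sup>2 < 4 ^ q"
    using real_arch_pow[of 4 "(1668600 * B ^ 4 + 1)\<^sup>2"] by auto
  define H where "H = \<lparr>c_s = 1668600 * B ^ 4, c_init = 30000000 * C0 * B ^ 3,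
    c_query = 10000000 * C0 * B ^ 2, c_reps = (140 + real q) / ln 2\<rparr>"
  have H: "positive_hidden H" using B1 C01 by (simp add: positive_hidden_def H_def)
  show ?thesis
  proof (rule exI[of _ H], rule conjI[OF H], intro allI, goal_cases)
    case (1 cw ce)
    define a where "a = 1880 + log 2 (cost_constant H cM cw ce)"
    show ?case
    proof (rule exI[of _ a], intro allI impI, goal_cases)
      case (1 k n d E \<phi> \<epsilon> \<xi> Mi Mq lam u eig)
      note asm = 1
      interpret R: regular_spectral n d E lam "\<lambda>a x. u a $ x"
        by (rule regular_spectral_of_eigenbasis) (use asm in auto)
      obtain C where C: "\<forall>i<k. C i \<noteq> {}" "disjoint_family_on C {..<k}" "(\<Union>i<k. C i) = {..<n}"
        "\<forall>i<k. inner_conductance E (C i) \<ge> ereal \<phi>" "\<forall>i<k. outer_conductance E (C i) {..<n} \<le> \<epsilon>"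
        "\<forall>i<k. \<forall>j<k. real (card (C i)) / real (card (C j)) \<le> \<beta>"
        using asm(8) unfolding clusterable_def by (elim exE conjE) (rule that)
      interpret S: clustered_spectral n d E lam "\<lambda>a x. u a $ x" k \<phi> \<epsilon> \<beta> C
        by unfold_locales (use asm C in auto)
      have Beq: "B = \<beta>" using S.beta_ge_1 by (simp add: B_def)
      have "0 < real n powr (1/2 - 20 * \<epsilon> / \<phi>\<^sup>2) / real k" using S.n4 asm(1) by simp
      moreover have "0 < cM * (real n powr (1/2 - 20 * \<epsilon> / \<phi>\<^sup>2) / real k)"
        using asm(11,12) by (simp add: order.strict_trans2[of 0 "real Mi"])
      ultimately have "0 < cM" by (rule zero_less_mult_pos2[rotated])
      then have Ceq: "C0 = 1 + 2 * cM * sqrt (6 * \<beta>)" by (simp add: C0_def Beq)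
      interpret O: oracle_setup n d E lam "\<lambda>a x. u a $ x" k \<phi> \<epsilon> \<beta> C H cM \<xi> q
        by unfold_locales (use asm q in \<open>simp_all add: H_def Beq Ceq\<close>)
      have Mi: "O.M_ok Mi" and Mq: "O.M_ok Mq" unfolding O.M_ok_def using asm by auto
      have f: "spectral_embedding k u x \<bullet> spectral_embedding k u y = (\<Sum>a<k. u a $ x * u a $ y)" for x y
        by (simp add: spectral_embedding_def scalar_prod_def atLeast0LessThan)
      show ?case unfolding Let_def f
      proof (intro conjI)
        show "1 - 2 / real n ^ 100 \<le> measure_pmf.prob (result (init_oracle H cw ce eig n E k \<phi> \<epsilon> \<xi> Mi))
         {(IS, out). \<exists>\<Psi>. out = Some \<Psi> \<and>
            real (dim_row \<Psi> * dim_col \<Psi>) \<le> real n powr (a * \<epsilon> / \<phi>\<^sup>2) * ln (real n) ^ 2 * (real k / \<xi>) powr a \<and>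
            (\<forall>x<n. \<forall>y<n. 1 - 6 / real n ^ 100 \<le>
               measure_pmf.prob (result (query_dot H cw n E k \<phi> \<epsilon> \<xi> IS \<Psi> Mq x y))
                 {z. \<bar>z - (\<Sum>a<k. u a $ x * u a $ y)\<bar> \<le> \<xi> / real n})}"
          by (rule order_trans[OF O.init_success[OF Mi Mq asm(16)]], rule measure_pmf.finite_measure_mono)
             (use O.oracle_size[OF Mi a_def] in auto)
        show "\<forall>((IS, out), T_init, S_init) \<in> set_pmf (run (init_oracle H cw ce eig n E k \<phi> \<epsilon> \<xi> Mi)).
          real S_init \<le> (real k / \<xi>) powr a * real n powr (a * \<epsilon> / \<phi>\<^sup>2) * real Mi * ln (real n) ^ 4 \<and>
          real T_init \<le> (real k / \<xi>) powr a * (real n * real n powr (a * \<epsilon> / \<phi>\<^sup>2)) * (ln (real n) ^ 4 / real Mi) * (1 / \<phi>\<^sup>2) \<and>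
          (\<forall>\<Psi> x y. out = Some \<Psi> \<longrightarrow> x < n \<longrightarrow> y < n \<longrightarrow>
            (\<forall>(z, T_query, S_query) \<in> set_pmf (run (query_dot H cw n E k \<phi> \<epsilon> \<xi> IS \<Psi> Mq x y)).
               real S_query \<le> (real k / \<xi>) powr a * real n powr (a * \<epsilon> / \<phi>\<^sup>2) * real Mq * ln (real n) ^ 3 \<and>
               real T_query \<le> (real k / \<xi>) powr a * (real n * real n powr (a * \<epsilon> / \<phi>\<^sup>2)) * (ln (real n) ^ 3 / real Mq) * (1 / \<phi>\<^sup>2)))"
        proof (clarify, intro conjI allI impI, goal_cases)
          case (1 IS out T S)
          then show ?case by (rule O.init_costs(2)[OF Mi a_def])
        next
          case (2 IS out T S)
          then show ?case by (rule O.init_costs(3)[OF Mi a_def])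
        next
          case (3 IS out T S \<Psi> x y)
          have len: "length IS = O.s" using 3(1) by (rule O.init_costs(1)[OF Mi a_def])
          show ?case using O.query_costs[OF Mq a_def len] by blast
        qed
      qed
    qed
  qed
qed

end
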